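(* Assume that for some constants $\gamma\ge 0$ and $\omega'\in[0,\hat\omega)$ one has $$\hat M b e^{\hat\omega\tau}\int_0^t|\alpha(s+\tau)|\,ds\le \gamma+\omega' t\qquad\text{for all } t>0,$$ and that $\int_{t-\tau}^t|\alpha(s)|\,ds\le\sigma$ for all $t\ge 0$, for some $\sigma>0$. There exists $\rho>0$ such that, if the initial datum $\hat\Phi=(f_0,g_0,\eta^0)\in C([-\tau,0];\hat{\mathcal H})$, with $u_0:=f_0(0)$, $u_1:=g_0(0)$, satisfies $$\|u_1\|^2+(1-\tilde k)\|\sqrt A u_0\|^2+\int_{-\tau}^0\|\nabla\psi_2(f_0(s))\|^2ds+\int_0^{+\infty}k(s)\|\sqrt A\eta^0(s)\|^2ds+\int_{-\tau}^0|\alpha(s+\tau)|\,\|B^*g_0(s)\|^2ds<\rho^2$$ and $$\max_{s\in[-\tau,0]}\|\hat\Phi(s)\|_{\hat{\mathcal H}}<\rho,$$ then the problem $$u_{tt}(t)+Au(t)-\int_0^{+\infty}k(s)Au(t-s)ds+\alpha(t)BB^*u_t(t-\tau)=\nabla\psi_1(u(t))+\nabla\psi_2(u(t-\tau)),\quad t>0,$$ with $u=f_0$ on $(-\infty,0]$ and $u_t=g_0$ on $[-\tau,0]$, has a unique global solution, and it satisfies $$\hat E(t)\le\tilde Ce^{-(\hat\omega-\omega')t}\qquad\text{for all }t\ge0,$$ where $\tilde C$ is a suitable constant depending on the initial data and $$\hat E(t)=\tfrac12\|u_t(t)\|^2+\tfrac{1-\tilde k}2\|\sqrt A u(t)\|^2-\psi_1(u(t))+\tfrac12\int_{t-\tau}^t\|\nabla\psi_2(u(s))\|^2ds+\tfrac12\int_{t-\tau}^t|\alpha(s+\tau)|\,\|B^*u_t(s)\|^2ds+\tfrac12\int_0^{+\infty}k(s)\|\sqrt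 A\eta^t(s)\|^2ds .$$
   Context: Setting. $H$ is a real Hilbert space with inner product $\langle\cdot,\cdot\rangle$ and norm $\|\cdot\|$; $A:D(A)\to H$ is a positive self-adjoint linear operator with dense domain $D(A)\subset H$; $\tau>0$ is a delay; $B:H\to H$ is a bounded linear operator with adjoint $B^*$; $\alpha\in L^1_{loc}([0,+\infty))$ satisfies $\int_{t-\tau}^t|\alpha(s)|ds\le\sigma$ for all $t\ge0$ and some $\sigma>0$ ($\alpha$ being understood as $0$ on negative times). The memory kernel $k:[0,+\infty)\to[0,+\infty)$ satisfies $k\in C^1(\mathbb R_+)\cap L^1(\mathbb R_+)$, $k(0)=k_0>0$, $\int_0^\infty k(t)dt=:\tilde k<1$, and $k'(t)\le-\zeta k(t)$ for some $\zeta>0$. Nonlinearities. $\psi_1,\psi_2:D(\sqrt A)\to\mathbb R$ are functionals with Gateaux derivatives $D\psi_i(u)$, such that: - for every $u\in D(\sqrt A)$ there is $c(u)>0$ with $|D\psi_i(u)(v)|\le c(u)\|v\|$ for all $v\in D(\sqrt A)$, $i=1,2$; then $D\psi_i(u)$ extends to $H$ and $\nabla\psi_i(u)\in H$ denotes its Riesz representative, $\langle\nabla\psi_i(u),v\rangle=D\psi_i(u)(v)$; - for all $R>0$ there is $L(R)>0$ with $\|\nabla\psi_i(u)-\nabla\psi_i(v)\|\le L(R)\|\sqrt A(u-v)\|$ whenever $u,v\in D(\sqrt A)$, $\|\sqrt A u\|\le R$, $\|\sqrt A v\|\le R$, $i=1,2$, and $L(R)\to0$ as $R\to0$; - $\psi_i(0)=0$,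 $\nabla\psi_i(0)=0$ for $i=1,2$, and there is a strictly increasing continuous function $h_1:[0,\infty)\to\mathbb R$ with $|\langle\nabla\psi_1(u),u\rangle|\le h_1(\|\sqrt A u\|)\|\sqrt A u\|^2$ for all $u\in D(\sqrt A)$. History variable. $\eta^t(s):=u(t)-u(t-s)$ for $s,t>0$; the equation becomes $u_{tt}+(1-\tilde k)Au+\int_0^{+\infty}k(s)A\eta^t(s)ds+\alpha(t)BB^*u_t(t-\tau)=\nabla\psi_1(u(t))+\nabla\psi_2(u(t-\tau))$, $\eta^t_t(s)=-\eta^t_s(s)+u_t(t)$, $\eta^0(s)=u_0-f_0(-s)$. Abstract form. $L^2_k((0,\infty);D(\sqrt A))$ is the Hilbert space of $D(\sqrt A)$-valued functions on $(0,\infty)$ with inner product $\int_0^\infty k(s)\langle\sqrt A\varphi_1(s),\sqrt A\varphi_2(s)\rangle ds$. $\hat{\mathcal H}=D(\sqrt A)\times H\times L^2_k((0,\infty);D(\sqrt A))$ has inner product $\langle(u,v,w),(\tilde u,\tilde v,\tilde w)\rangle_{\hat{\mathcal H}}=(1-\tilde k)\langle\sqrt A u,\sqrt A\tilde u\rangle+\langle v,\tilde v\rangle+\int_0^\infty k(s)\langle\sqrt A w(s),\sqrt A\tilde w(s)\rangle ds$. For $U=(u,v,w)$: $\hat{\mathscr A}U=(v,\,-(1-\tilde k)Au-\int_0^\infty k(s)Aw(s)ds,\,-w_s+v)$ with domain consisting of $(u,v,w)\in D(\sqrt A)\times D(\sqrt A)\times L^2_k((0,\infty);D(\sqrt A))$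 with $(1-\tilde k)u+\int_0^\infty k(s)w(s)ds\in D(A)$, $w_s\in L^2_k((0,\infty);D(\sqrt A))$ and $w(0)=0$; $\hat{\mathscr B}U=(0,-BB^*v,0)$; $\hat F(U(t),U(t-\tau))=(0,\nabla\psi_1(u(t))+\nabla\psi_2(u(t-\tau)),0)$; $b=\|\hat{\mathscr B}\|=\|BB^*\|$; $\hat\Phi(s)=(f_0(s),g_0(s),\eta^0)$ for $s\in[-\tau,0]$. The operator $\hat{\mathscr A}$ generates an exponentially stable $C_0$-semigroup $(\hat S(t))_{t\ge0}$ on $\hat{\mathcal H}$; $\hat M,\hat\omega>0$ are fixed constants with $\|\hat S(t)\|\le\hat Me^{-\hat\omega t}$ for all $t\ge0$. A solution $u$ of the second-order problem means that $U(t)=(u(t),u_t(t),\eta^t)$ is a continuous $\hat{\mathcal H}$-valued function with $U=\hat\Phi$ on $[-\tau,0]$ and $U(t)=\hat S(t)U_0+\int_0^t\hat S(t-s)[\alpha(s)\hat{\mathscr B}U(s-\tau)+\hat F(U(s),U(s-\tau))]ds$ for $t\ge0$, $U_0=U(0)=\hat\Phi(0)$. *)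

theory Defs
  imports "HOL-Analysis.Analysis" "HOL-Library.Function_Algebras"
begin

text \<open>
  Histories are functions on the half line; the pointwise vector space structure lets the
  library's simple functions be used with values in the (product) energy space.
\<close>

instantiation "fun" :: (type, real_vector) real_vector
begin

definition scaleR_fun :: "real \<Rightarrow> ('a \<Rightarrow> 'b) \<Rightarrow> 'a \<Rightarrow> 'b" where
  "scaleR_fun c f = (\<lambda>x. c *\<^sub>R f x)"

instance
  by standard (auto simp: scaleR_fun_def fun_eq_iff scaleR_add_right scaleR_add_left)

end


section \<open>Calculus in a seminormed space\<close>

text \<open>
  A pair \<open>X\<close>, \<open>p\<close> stands for the space of all \<open>x \<in> X\<close> with (semi)norm \<open>p\<close>; elements \<open>x\<close>, \<open>y\<close> with
  \<open>p (x - y) = 0\<close> are regarded as equal.  This is needed since the elements of \<open>L\<^sup>2\<close>-type spaces are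
  represented by functions, and since \<open>D(sqrt A)\<close> is normed by \<open>\<parallel>sqrt A u\<parallel>\<close> and not by the norm of
  the ambient space.  The Bochner integral is the one of the library, without
  the restriction to separable spaces.
\<close>

definition strongly_measurable_in ::
    "'v::real_vector set \<Rightarrow> ('v \<Rightarrow> real) \<Rightarrow> 'a measure \<Rightarrow> ('a \<Rightarrow> 'v) \<Rightarrow> bool" where
  "strongly_measurable_in X p M f \<longleftrightarrow>
     (AE x in M. f x \<in> X) \<and>
     (\<exists>g :: nat \<Rightarrow> 'a \<Rightarrow> 'v.
        (\<forall>n. simple_function M (g n) \<and> g n ` space M \<subseteq> X) \<and>
        (AE x in M. (\<lambda>n. p (f x - g n x)) \<longlonglongrightarrow> 0))"

definition has_bochner_integral_in ::
    "'v::real_vector set \<Rightarrow> ('v \<Rightarrow> real) \<Rightarrow> 'a measure \<Rightarrow> ('a \<Rightarrow> 'v) \<Rightarrow> 'v \<Rightarrow> bool" where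
  "has_bochner_integral_in X p M f I \<longleftrightarrow>
     I \<in> X \<and> strongly_measurable_in X p M f \<and>
     (\<exists>g :: nat \<Rightarrow> 'a \<Rightarrow> 'v.
        (\<forall>n. Bochner_Integration.simple_bochner_integrable M (g n) \<and> g n ` space M \<subseteq> X) \<and>
        (\<lambda>n. \<integral>\<^sup>+x. ennreal (p (f x - g n x)) \<partial>M) \<longlonglongrightarrow> 0 \<and>
        (\<lambda>n. p (Bochner_Integration.simple_bochner_integral M (g n) - I)) \<longlonglongrightarrow> 0)"

definition continuous_on_in ::
    "'v::real_vector set \<Rightarrow> ('v \<Rightarrow> real) \<Rightarrow> real set \<Rightarrow> (real \<Rightarrow> 'v) \<Rightarrow> bool" where
  "continuous_on_in X p T U \<longleftrightarrow>
     (\<forall>t\<in>T. U t \<in> X) \<and> (\<forall>t\<in>T. ((\<lambda>s. p (U s - U t)) \<longlongrightarrow> 0) (at t within T))"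

definition C0_semigroup_in ::
    "'v::real_vector set \<Rightarrow> ('v \<Rightarrow> real) \<Rightarrow> (real \<Rightarrow> 'v \<Rightarrow> 'v) \<Rightarrow> bool" where
  "C0_semigroup_in X p S \<longleftrightarrow>
     (\<forall>t\<ge>0. \<forall>U\<in>X. S t U \<in> X) \<and>
     (\<forall>t\<ge>0. \<forall>U\<in>X. \<forall>V\<in>X. \<forall>a b. p (S t (a *\<^sub>R U + b *\<^sub>R V) - (a *\<^sub>R S t U + b *\<^sub>R S t V)) = 0) \<and>
     (\<forall>t\<ge>0. \<exists>K. \<forall>U\<in>X. p (S t U) \<le> K * p U) \<and>
     (\<forall>U\<in>X. p (S 0 U - U) = 0) \<and>
     (\<forall>s\<ge>0. \<forall>t\<ge>0. \<forall>U\<in>X. p (S (s + t) U - S s (S t U)) = 0) \<and>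
     (\<forall>U\<in>X. ((\<lambda>t. p (S t U - U)) \<longlongrightarrow> 0) (at_right 0))"

text \<open>An operator in the space \<open>X\<close>, \<open>p\<close> is given by its graph \<open>G\<close>: \<open>G U V\<close> says that \<open>U\<close> is in the
  domain and that its image is \<open>V\<close>.\<close>

definition generates_in ::
    "'v::real_vector set \<Rightarrow> ('v \<Rightarrow> real) \<Rightarrow> ('v \<Rightarrow> 'v \<Rightarrow> bool) \<Rightarrow> (real \<Rightarrow> 'v \<Rightarrow> 'v) \<Rightarrow> bool" where
  "generates_in X p G S \<longleftrightarrow>
     C0_semigroup_in X p S \<and>
     (\<forall>U\<in>X. \<forall>V\<in>X. G U V \<longleftrightarrow> ((\<lambda>h. p ((1 / h) *\<^sub>R (S h U - U) - V)) \<longlongrightarrow> 0) (at_right 0))"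


section \<open>Positive self-adjoint operators\<close>

definition linear_op_on :: "'h::real_vector set \<Rightarrow> ('h \<Rightarrow> 'h) \<Rightarrow> bool" where
  "linear_op_on D T \<longleftrightarrow> subspace D \<and>
     (\<forall>x\<in>D. \<forall>y\<in>D. T (x + y) = T x + T y) \<and> (\<forall>c. \<forall>x\<in>D. T (c *\<^sub>R x) = c *\<^sub>R T x)"

text \<open>The set in the third conjunct is the domain of the adjoint.\<close>

definition self_adjoint_on :: "'h::real_inner set \<Rightarrow> ('h \<Rightarrow> 'h) \<Rightarrow> bool" where
  "self_adjoint_on D T \<longleftrightarrow> linear_op_on D T \<and> closure D = UNIV \<and>
     {y. \<exists>z. \<forall>x\<in>D. T x \<bullet> y = x \<bullet> z} = D \<and>
     (\<forall>x\<in>D. \<forall>y\<in>D. T x \<bullet> y = x \<bullet> T y)"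

definition positive_self_adjoint_on :: "'h::real_inner set \<Rightarrow> ('h \<Rightarrow> 'h) \<Rightarrow> bool" where
  "positive_self_adjoint_on D T \<longleftrightarrow> self_adjoint_on D T \<and> (\<forall>x\<in>D. 0 \<le> T x \<bullet> x)"

text \<open>\<open>(DR, R)\<close> is the square root of \<open>(DA, A)\<close>: the unique positive self-adjoint operator with
  \<open>R\<^sup>2 = A\<close>, domains included.\<close>

definition is_sqrt_op ::
    "'h::real_inner set \<Rightarrow> ('h \<Rightarrow> 'h) \<Rightarrow> 'h set \<Rightarrow> ('h \<Rightarrow> 'h) \<Rightarrow> bool" where
  "is_sqrt_op DA A DR R \<longleftrightarrow> positive_self_adjoint_on DR R \<and>
     DA = {x \<in> DR. R x \<in> DR} \<and> (\<forall>x\<in>DA. A x = R (R x))"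


section \<open>Nonlinearities\<close>

definition gateaux_derivative_on ::
    "'h::real_vector set \<Rightarrow> ('h \<Rightarrow> real) \<Rightarrow> ('h \<Rightarrow> 'h \<Rightarrow> real) \<Rightarrow> bool" where
  "gateaux_derivative_on D \<psi> D\<psi> \<longleftrightarrow>
     (\<forall>u\<in>D.
        (\<forall>v\<in>D. \<forall>w\<in>D. \<forall>a b. D\<psi> u (a *\<^sub>R v + b *\<^sub>R w) = a * D\<psi> u v + b * D\<psi> u w) \<and>
        (\<forall>v\<in>D. ((\<lambda>h. (\<psi> (u + h *\<^sub>R v) - \<psi> u) / h) \<longlongrightarrow> D\<psi> u v) (at 0)))"

text \<open>\<open>G u\<close> is the Riesz representative of the extension of \<open>D\<psi> u\<close> to the whole space; it is
  determined by its values on the dense set \<open>D\<close>.\<close>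

definition gradient_on ::
    "'h::real_inner set \<Rightarrow> ('h \<Rightarrow> real) \<Rightarrow> ('h \<Rightarrow> 'h \<Rightarrow> real) \<Rightarrow> ('h \<Rightarrow> 'h) \<Rightarrow> bool" where
  "gradient_on D \<psi> D\<psi> G \<longleftrightarrow>
     gateaux_derivative_on D \<psi> D\<psi> \<and>
     (\<forall>u\<in>D. \<exists>c>0. \<forall>v\<in>D. \<bar>D\<psi> u v\<bar> \<le> c * norm v) \<and>
     (\<forall>u\<in>D. \<forall>v\<in>D. G u \<bullet> v = D\<psi> u v)"


section \<open>The energy space and the wave operator with memory\<close>

text \<open>Throughout, \<open>R\<close> with domain \<open>DR\<close> is the square root of the operator \<open>A\<close> with domain \<open>DA\<close>.\<close>

type_synonym 'h state = "'h \<times> 'h \<times> (real \<Rightarrow> 'h)"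

definition kernel_mass :: "(real \<Rightarrow> real) \<Rightarrow> real" where
  "kernel_mass k = (LINT s:{0<..}|lebesgue. k s)"

definition sqrt_norm :: "('h::real_normed_vector \<Rightarrow> 'h) \<Rightarrow> 'h \<Rightarrow> real" where
  "sqrt_norm R u = norm (R u)"

definition L2_kernel ::
    "'h::real_normed_vector set \<Rightarrow> ('h \<Rightarrow> 'h) \<Rightarrow> (real \<Rightarrow> real) \<Rightarrow> (real \<Rightarrow> 'h) set" where
  "L2_kernel DR R k =
     {w. strongly_measurable_in DR (sqrt_norm R) (lebesgue_on {0<..}) w \<and>
         set_integrable lebesgue {0<..} (\<lambda>s. k s * (norm (R (w s)))\<^sup>2)}"

definition energy_space ::
    "'h::real_normed_vector set \<Rightarrow> ('h \<Rightarrow> 'h) \<Rightarrow> (real \<Rightarrow> real) \<Rightarrow> 'h state set" where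
  "energy_space DR R k = {(u, v, w). u \<in> DR \<and> w \<in> L2_kernel DR R k}"

definition energy_inner ::
    "('h::real_inner \<Rightarrow> 'h) \<Rightarrow> (real \<Rightarrow> real) \<Rightarrow> 'h state \<Rightarrow> 'h state \<Rightarrow> real" where
  "energy_inner R k = (\<lambda>(u, v, w) (u', v', w').
     (1 - kernel_mass k) * (R u \<bullet> R u') + v \<bullet> v' +
     (LINT s:{0<..}|lebesgue. k s * (R (w s) \<bullet> R (w' s))))"

definition energy_norm :: "('h::real_inner \<Rightarrow> 'h) \<Rightarrow> (real \<Rightarrow> real) \<Rightarrow> 'h state \<Rightarrow> real" where
  "energy_norm R k U = sqrt (energy_inner R k U U)"

text \<open>
  \<open>z\<close> is the (weak) derivative of \<open>w\<close>, and \<open>w 0 = 0\<close>: \<open>w\<close> has the locally absolutely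
  continuous representative \<open>\<integral>\<^sub>0\<^sup>s z\<close>, the integral being taken in \<open>D(sqrt A)\<close>.  Points with \<open>k s = 0\<close>
  do not count in the weighted space.
\<close>

definition weak_derivative_zero_at_0 ::
    "'h::real_normed_vector set \<Rightarrow> ('h \<Rightarrow> 'h) \<Rightarrow> (real \<Rightarrow> real) \<Rightarrow> (real \<Rightarrow> 'h) \<Rightarrow> (real \<Rightarrow> 'h) \<Rightarrow> bool"
  where
  "weak_derivative_zero_at_0 DR R k w z \<longleftrightarrow>
     (AE s in lebesgue_on {0<..}. 0 < k s \<longrightarrow>
        has_bochner_integral_in DR (sqrt_norm R) (lebesgue_on {0<..s}) z (w s))"

text \<open>
  Graph of \<open>(u, v, w) \<mapsto> (v, - A ((1 - k~) u + \<integral> k(s) w(s) ds), - w\<^sub>s + v)\<close>.  The second component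
  is what \<open>- (1 - k~) A u - \<integral> k(s) A w(s) ds\<close> means on the domain, where only the sum
  \<open>(1 - k~) u + \<integral> k(s) w(s) ds\<close> is required to be in \<open>D(A)\<close>.
\<close>

definition wave_memory_op ::
    "'h::real_inner set \<Rightarrow> ('h \<Rightarrow> 'h) \<Rightarrow> 'h set \<Rightarrow> ('h \<Rightarrow> 'h) \<Rightarrow> (real \<Rightarrow> real) \<Rightarrow>
     'h state \<Rightarrow> 'h state \<Rightarrow> bool" where
  "wave_memory_op DA A DR R k = (\<lambda>(u, v, w) V.
     u \<in> DR \<and> v \<in> DR \<and> w \<in> L2_kernel DR R k \<and> V \<in> energy_space DR R k \<and>
     (\<exists>y z.
        has_bochner_integral_in DR (sqrt_norm R) (lebesgue_on {0<..}) (\<lambda>s. k s *\<^sub>R w s) y \<and>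
        (1 - kernel_mass k) *\<^sub>R u + y \<in> DA \<and>
        z \<in> L2_kernel DR R k \<and> weak_derivative_zero_at_0 DR R k w z \<and>
        energy_norm R k
          (V - (v, - A ((1 - kernel_mass k) *\<^sub>R u + y), \<lambda>s. - z s + v)) = 0))"


section \<open>The delayed problem\<close>

definition delay_op :: "('h::real_inner \<Rightarrow> 'h) \<Rightarrow> 'h state \<Rightarrow> 'h state" where
  "delay_op B = (\<lambda>(u, v, w). (0, - B (adjoint B v), 0))"

text \<open>The arguments are the present and the delayed state.\<close>

definition source_term ::
    "('h::real_vector \<Rightarrow> 'h) \<Rightarrow> ('h \<Rightarrow> 'h) \<Rightarrow> 'h state \<Rightarrow> 'h state \<Rightarrow> 'h state" where
  "source_term G1 G2 U V = (0, G1 (fst U) + G2 (fst V), 0)"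

definition history :: "(real \<Rightarrow> 'h::real_vector) \<Rightarrow> real \<Rightarrow> real \<Rightarrow> 'h" where
  "history u t = (\<lambda>s. u t - u (t - s))"

text \<open>The history component of the initial datum is constant in time, equal to
  \<open>\<eta>\<^sup>0(s) = f0(0) - f0(-s)\<close>.\<close>

definition initial_state ::
    "(real \<Rightarrow> 'h::real_vector) \<Rightarrow> (real \<Rightarrow> 'h) \<Rightarrow> real \<Rightarrow> 'h state" where
  "initial_state f0 g0 s = (f0 s, g0 s, history f0 0)"

text \<open>On \<open>[-\<tau>, 0]\<close> the velocity is the datum \<open>g0\<close> (no relation between \<open>f0\<close> and \<open>g0\<close> is assumed).\<close>

definition velocity ::
    "(real \<Rightarrow> 'h::real_normed_vector) \<Rightarrow> (real \<Rightarrow> 'h) \<Rightarrow> real \<Rightarrow> 'h" where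
  "velocity g0 u t = (if t \<le> 0 then g0 t else vector_derivative u (at t))"

definition state_of ::
    "(real \<Rightarrow> 'h::real_normed_vector) \<Rightarrow> (real \<Rightarrow> 'h) \<Rightarrow> (real \<Rightarrow> 'h) \<Rightarrow> real \<Rightarrow> 'h state" where
  "state_of f0 g0 u t =
     (if t \<le> 0 then initial_state f0 g0 t else (u t, velocity g0 u t, history u t))"

definition is_global_solution ::
    "'h::real_inner set \<Rightarrow> ('h \<Rightarrow> 'h) \<Rightarrow> (real \<Rightarrow> real) \<Rightarrow> (real \<Rightarrow> 'h state \<Rightarrow> 'h state) \<Rightarrow>
     real \<Rightarrow> (real \<Rightarrow> real) \<Rightarrow> ('h \<Rightarrow> 'h) \<Rightarrow> ('h \<Rightarrow> 'h) \<Rightarrow> ('h \<Rightarrow> 'h) \<Rightarrow>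
     (real \<Rightarrow> 'h) \<Rightarrow> (real \<Rightarrow> 'h) \<Rightarrow> (real \<Rightarrow> 'h) \<Rightarrow> bool" where
  "is_global_solution DR R k S \<tau> \<alpha> B G1 G2 f0 g0 u \<longleftrightarrow>
     (\<forall>t\<le>0. u t = f0 t) \<and>
     (\<forall>t>0. u differentiable (at t)) \<and>
     (let X = energy_space DR R k; p = energy_norm R k; U = state_of f0 g0 u in
        continuous_on_in X p {-\<tau>..} U \<and>
        (\<forall>t\<ge>0. has_bochner_integral_in X p (lebesgue_on {0..t})
           (\<lambda>s. S (t - s) (\<alpha> s *\<^sub>R delay_op B (U (s - \<tau>)) + source_term G1 G2 (U s) (U (s - \<tau>))))
           (U t - S t (U 0))))"

definition wave_energy ::
    "('h::real_inner \<Rightarrow> 'h) \<Rightarrow> (real \<Rightarrow> real) \<Rightarrow> real \<Rightarrow> (real \<Rightarrow> real) \<Rightarrow> ('h \<Rightarrow> 'h) \<Rightarrow>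
     ('h \<Rightarrow> real) \<Rightarrow> ('h \<Rightarrow> 'h) \<Rightarrow> (real \<Rightarrow> 'h) \<Rightarrow> (real \<Rightarrow> 'h) \<Rightarrow> real \<Rightarrow> real" where
  "wave_energy R k \<tau> \<alpha> B \<psi>1 G2 g0 u t =
     1/2 * (norm (velocity g0 u t))\<^sup>2 +
     (1 - kernel_mass k) / 2 * (norm (R (u t)))\<^sup>2 -
     \<psi>1 (u t) +
     1/2 * (LINT s:{t-\<tau>..t}|lebesgue. (norm (G2 (u s)))\<^sup>2) +
     1/2 * (LINT s:{t-\<tau>..t}|lebesgue. \<bar>\<alpha> (s + \<tau>)\<bar> * (norm (adjoint B (velocity g0 u s)))\<^sup>2) +
     1/2 * (LINT s:{0<..}|lebesgue. k s * (norm (R (history u t s)))\<^sup>2)"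

end

theory Submission
 imports Defs
begin

text \<open>
The difficulty is not the decay but the meaning of the abstract equation: the given semigroup acts on
triples \<open>(u, v, w)\<close>, and a solution of the second-order problem is a triple of the form
\<open>(u, u', history of u)\<close>. The proof solves the abstract problem, shows that its solutions have this
form, and reads off the decay.

\<^emph>\<open>Abstract problem.\<close> The nonlinearities are Lipschitz on balls only. Composing them with the radial
retraction of \<open>D(R)\<close>, \<open>R = sqrt A\<close>, onto the ball \<open>\<parallel>R u\<parallel> \<le> r\<close> makes them globally Lipschitz with the
constant \<open>2 * L r\<close>, and \<open>mild_solution_exists\<close> gives a global mild solution by Picard iteration in an
exponentially weighted norm.

\<^emph>\<open>Structure.\<close> The generator is known only through its graph, so the equation is tested with bounded
functionals \<open>l\<close> for which \<open>l\<close> composed with the generator is again a bounded functional \<open>l'\<close>: then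
\<open>l (U t) = l (U 0) + \<integral> l' (U r) dr\<close> for every mild solution (\<open>functional_mild\<close>). With
\<open>l U = R u \<bullet> e\<close> this gives \<open>u' = v\<close>. With \<open>l U\<close> the double primitive of \<open>R w \<bullet> e\<close> it says that the
difference between \<open>w\<close> and the history of \<open>u\<close> solves the transport equation \<open>Z\<^sub>t = - Z\<^sub>s\<close> with zero
data, so that it vanishes along characteristics (\<open>mild_solution_structure\<close>).

\<^emph>\<open>Decay.\<close> Variation of constants and Gronwall's inequality for \<open>exp (\<omega> * t) * \<parallel>U t\<parallel>\<close> turn the growth
condition on \<open>\<alpha>\<close> into the loss \<open>\<omega>'\<close>, and the truncated nonlinearity costs a multiple of \<open>L r\<close>
(\<open>mild_decay\<close>). Since \<open>L r\<close> tends to \<open>0\<close>, a small \<open>r\<close> keeps this cost below half of the gap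
\<open>\<omega> - \<omega>'\<close>. The norm then decays at least with the rate \<open>(\<omega> - \<omega>') / 2\<close>; for small data the state never
leaves the ball where the truncation is the identity (\<open>small_solution\<close>). The energy is bounded by
squares of norms over \<open>[t - \<tau>, t]\<close>, which doubles the rate (\<open>wave_energy_decay\<close>). Uniqueness is
Gronwall's inequality again, after truncation at a radius that contains both solutions.

\<open>R\<close> is only assumed to be positive, but exponential stability forces \<open>\<parallel>u\<parallel> \<le> c * \<parallel>R u\<parallel>\<close> on \<open>D(R)\<close>
(\<open>R_bounded_below\<close>). The completeness of the energy space and the uniqueness of \<open>u\<close>, and not just of
\<open>R u\<close>, rest on this.
\<close>

section \<open>Spaces with a semidefinite inner product\<close>

lemmas hk_integral_combine = Henstock_Kurzweil_Integration.integral_combine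
 and hk_integral_diff = Henstock_Kurzweil_Integration.integral_diff
 and hk_integral_nonneg = Henstock_Kurzweil_Integration.integral_nonneg
 and hk_integral_add = Henstock_Kurzweil_Integration.integral_add
 and hk_integrable_reflect_real = Henstock_Kurzweil_Integration.integrable_reflect_real

lemma complete_measure_lebesgue_on:
 assumes "A \<in> sets lebesgue"
 shows "complete_measure (lebesgue_on A)"
proof
 fix C B :: "'a set" assume "B \<subseteq> C" "C \<in> null_sets (lebesgue_on A)"
 then have "C \<in> null_sets lebesgue" "C \<subseteq> A"
  using assms by (auto simp: null_sets_restrict_space)
 with \<open>B \<subseteq> C\<close> have "B \<in> null_sets lebesgue"
  by (metis negligible_iff_null_sets negligible_subset)
 with \<open>B \<subseteq> C\<close> \<open>C \<subseteq> A\<close> show "B \<in> sets (lebesgue_on A)"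
  using assms by (auto simp: sets_restrict_space_iff)
qed

text \<open>
Whatever values \<open>f\<close> takes on the exceptional null set, completeness makes it measurable.
\<close>

lemma (in complete_measure) borel_measurable_AE_LIMSEQ:
 fixes f :: "'a \<Rightarrow> real"
 assumes g: "\<And>n. g n \<in> borel_measurable M" and lim: "AE x in M. (\<lambda>n. g n x) \<longlonglongrightarrow> f x"
 shows "f \<in> borel_measurable M"
proof (rule measurableI)
 define h where "h x = lim (\<lambda>n. g n x)" for x
 have h: "h \<in> borel_measurable M"
  unfolding h_def using g by measurable
 have eq: "AE x in M. h x = f x"
  using lim by eventually_elim (simp add: h_def limI)
 fix A :: "real set" assume A: "A \<in> sets borel"
 show "f -` A \<inter> space M \<in> sets M"
 proof (rule in_sets_AE)
  show "AE x in M. x \<in> h -` A \<inter> space M \<longleftrightarrow> x \<in> f -` A \<inter> space M"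
   using eq by eventually_elim auto
  show "h -` A \<inter> space M \<in> sets M" using h A by (rule measurable_sets)
 qed auto
qed auto

text \<open>
The elements of the history space are functions, and only their classes modulo null functions form
a Hilbert space. Working with a carrier and a semidefinite form avoids the quotient, as the
semigroup laws also hold only up to null vectors.
\<close>

locale semi_hilbert =
 fixes X :: "'v::real_vector set" and ip :: "'v \<Rightarrow> 'v \<Rightarrow> real" and p :: "'v \<Rightarrow> real"
 assumes subspace_X: "subspace X"
  and ip_commute: "\<lbrakk>x \<in> X; y \<in> X\<rbrakk> \<Longrightarrow> ip x y = ip y x"
  and ip_add_left: "\<lbrakk>x \<in> X; y \<in> X; z \<in> X\<rbrakk> \<Longrightarrow> ip (x + y) z = ip x z + ip y z"
  and ip_scaleR_left: "\<lbrakk>x \<in> X; y \<in> X\<rbrakk> \<Longrightarrow> ip (a *\<^sub>R x) y = a * ip x y"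
  and ip_nonneg: "x \<in> X \<Longrightarrow> 0 \<le> ip x x"
  and p_eq: "x \<in> X \<Longrightarrow> p x = sqrt (ip x x)"
begin

lemma X_zero [simp, intro]: "0 \<in> X"
 and X_add [simp, intro]: "\<lbrakk>x \<in> X; y \<in> X\<rbrakk> \<Longrightarrow> x + y \<in> X"
 and X_diff [simp, intro]: "\<lbrakk>x \<in> X; y \<in> X\<rbrakk> \<Longrightarrow> x - y \<in> X"
 and X_scaleR [simp, intro]: "x \<in> X \<Longrightarrow> a *\<^sub>R x \<in> X"
 using subspace_X by (auto simp: subspace_def subspace_diff)

lemma X_sum [intro]: "(\<And>i. i \<in> J \<Longrightarrow> f i \<in> X) \<Longrightarrow> sum f J \<in> X"
 using subspace_X by (rule subspace_sum)

lemma p_nonneg [simp]: "x \<in> X \<Longrightarrow> 0 \<le> p x"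
 by (simp add: p_eq ip_nonneg)

lemma p_square: "x \<in> X \<Longrightarrow> (p x)\<^sup>2 = ip x x"
 by (simp add: p_eq ip_nonneg)

lemma ip_add_right: "\<lbrakk>x \<in> X; y \<in> X; z \<in> X\<rbrakk> \<Longrightarrow> ip x (y + z) = ip x y + ip x z"
 by (metis X_add ip_add_left ip_commute)

lemma ip_scaleR_right: "\<lbrakk>x \<in> X; y \<in> X\<rbrakk> \<Longrightarrow> ip x (a *\<^sub>R y) = a * ip x y"
 by (metis X_scaleR ip_commute ip_scaleR_left)

lemma p_scaleR: "x \<in> X \<Longrightarrow> p (a *\<^sub>R x) = \<bar>a\<bar> * p x"
 by (simp add: p_eq ip_scaleR_left ip_scaleR_right real_sqrt_mult flip: mult.assoc)

lemma p_zero [simp]: "p 0 = 0"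
 using p_scaleR[of 0 0] by simp

text \<open>
The discriminant argument for the Cauchy-Schwarz inequality; for a degenerate form the case
\<open>ip y y = 0\<close> needs its own argument.
\<close>

lemma ip_le_norms:
 assumes "x \<in> X" "y \<in> X"
 shows "\<bar>ip x y\<bar> \<le> p x * p y"
proof -
 have quadratic: "0 \<le> ip x x + 2 * a * ip x y + a\<^sup>2 * ip y y" for a
 proof -
  have "ip (x + a *\<^sub>R y) (x + a *\<^sub>R y) = ip x x + 2 * a * ip x y + a\<^sup>2 * ip y y"
   using assms by (simp add: ip_add_left ip_add_right ip_scaleR_left ip_scaleR_right
     ip_commute[of y x] power2_eq_square algebra_simps)
  then show ?thesis using ip_nonneg[of "x + a *\<^sub>R y"] assms by auto
 qed
 have "(ip x y)\<^sup>2 \<le> ip x x * ip y y"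
 proof (cases "ip y y = 0")
  case True
  have "ip x y = 0"
  proof (rule ccontr)
   assume "ip x y \<noteq> 0"
   with quadratic[of "- (ip x x + 1) / (2 * ip x y)"] True show False by (simp add: field_simps)
  qed
  then show ?thesis by (simp add: True)
 next
  case False
  then have "0 < ip y y" using ip_nonneg[OF assms(2)] by simp
  then show ?thesis
   using quadratic[of "- ip x y / ip y y"] by (simp add: field_simps power2_eq_square)
 qed
 then have "\<bar>ip x y\<bar> \<le> sqrt (ip x x * ip y y)"
  by (metis real_sqrt_abs real_sqrt_le_mono)
 then show ?thesis using assms by (simp add: p_eq real_sqrt_mult)
qed

lemma p_triangle:
 assumes "x \<in> X" "y \<in> X"
 shows "p (x + y) \<le> p x + p y"
proof -
 have "(p (x + y))\<^sup>2 = (p x)\<^sup>2 + 2 * ip x y + (p y)\<^sup>2"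
  using assms by (simp add: p_square ip_add_left ip_add_right ip_commute[of y x])
 also have "\<dots> \<le> (p x + p y)\<^sup>2"
  using ip_le_norms[OF assms] by (simp add: power2_eq_square algebra_simps)
 finally show ?thesis
  using assms by (auto intro: power2_le_imp_le)
qed

lemma p_minus_commute: "\<lbrakk>x \<in> X; y \<in> X\<rbrakk> \<Longrightarrow> p (x - y) = p (y - x)"
 using p_scaleR[of "x - y" "-1"] by simp

lemma p_triangle_diff: "\<lbrakk>x \<in> X; y \<in> X; z \<in> X\<rbrakk> \<Longrightarrow> p (x - z) \<le> p (x - y) + p (y - z)"
 using p_triangle[of "x - y" "y - z"] by simp

lemma p_diff_le: "\<lbrakk>x \<in> X; y \<in> X\<rbrakk> \<Longrightarrow> p (x - y) \<le> p x + p y"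
 using p_triangle[of x "- y"] p_scaleR[of y "-1"] X_scaleR[of y "-1"] by simp

lemma p_abs_diff_le:
 assumes "x \<in> X" "y \<in> X"
 shows "\<bar>p x - p y\<bar> \<le> p (x - y)"
 using p_triangle[of "x - y" y] p_triangle[of "y - x" x] p_minus_commute[of x y] assms by auto

lemma p_null_cong: "\<lbrakk>x \<in> X; y \<in> X; p (x - y) = 0\<rbrakk> \<Longrightarrow> p x = p y"
 using p_abs_diff_le[of x y] by simp

lemma p_LIMSEQ:
 assumes "\<And>n. f n \<in> X" "x \<in> X" "(\<lambda>n. p (f n - x)) \<longlonglongrightarrow> 0"
 shows "(\<lambda>n. p (f n)) \<longlonglongrightarrow> p x"
proof -
 have "(\<lambda>n. p (f n) - p x) \<longlonglongrightarrow> 0"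
  using assms(3) by (rule Lim_null_comparison[rotated]) (simp add: assms p_abs_diff_le)
 then show ?thesis by (simp add: LIM_zero_iff)
qed

text \<open>
Vector identities below are proved by testing with these functionals. The bound is an argument, as
estimates that are uniform in a parameter are needed.
\<close>

definition bounded_functional :: "('v \<Rightarrow> real) \<Rightarrow> real \<Rightarrow> bool" where
 "bounded_functional l K \<longleftrightarrow> 0 \<le> K \<and>
   (\<forall>x\<in>X. \<forall>y\<in>X. l (x + y) = l x + l y) \<and> (\<forall>a. \<forall>x\<in>X. l (a *\<^sub>R x) = a * l x) \<and>
   (\<forall>x\<in>X. \<bar>l x\<bar> \<le> K * p x)"

lemma functionalD:
 assumes "bounded_functional l K"
 shows "0 \<le> K" "\<lbrakk>x \<in> X; y \<in> X\<rbrakk> \<Longrightarrow> l (x + y) = l x + l y"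
  "x \<in> X \<Longrightarrow> l (a *\<^sub>R x) = a * l x" "x \<in> X \<Longrightarrow> \<bar>l x\<bar> \<le> K * p x"
  "\<lbrakk>x \<in> X; y \<in> X\<rbrakk> \<Longrightarrow> l (x - y) = l x - l y" "l 0 = 0"
proof -
 note d = assms[unfolded bounded_functional_def]
 show "0 \<le> K" "\<lbrakk>x \<in> X; y \<in> X\<rbrakk> \<Longrightarrow> l (x + y) = l x + l y"
  "x \<in> X \<Longrightarrow> l (a *\<^sub>R x) = a * l x" "x \<in> X \<Longrightarrow> \<bar>l x\<bar> \<le> K * p x"
  using d by auto
 show "l (x - y) = l x - l y" if "x \<in> X" "y \<in> X"
 proof -
  have "l (x + (-1) *\<^sub>R y) = l x + (-1) * l y" using d that X_scaleR[of y "-1"] by metis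
  then show ?thesis by simp
 qed
 show "l 0 = 0" using d X_zero by (metis mult_zero_left scaleR_zero_left)
qed

lemma functional_null_cong:
 assumes "bounded_functional l K" "x \<in> X" "y \<in> X" "p (x - y) = 0"
 shows "l x = l y"
proof -
 have "\<bar>l (x - y)\<bar> \<le> K * 0" using functionalD(4)[OF assms(1), of "x - y"] assms by auto
 then show ?thesis using functionalD(5)[OF assms(1-3)] by simp
qed

lemma functional_sum:
 assumes "bounded_functional l K" "\<And>i. i \<in> J \<Longrightarrow> f i \<in> X"
 shows "l (sum f J) = (\<Sum>i\<in>J. l (f i))"
 using assms(2)
proof (induction J rule: infinite_finite_induct)
 case (insert i J)
 then show ?case using functionalD(2)[OF assms(1), of "f i" "sum f J"] by (auto intro!: X_sum)
qed (simp_all add: functionalD(6)[OF assms(1)])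

lemma bounded_functional_ip:
 assumes "y \<in> X"
 shows "bounded_functional (\<lambda>x. ip x y) (p y)"
 unfolding bounded_functional_def
 using ip_le_norms[OF _ assms] assms by (auto simp: ip_add_left ip_scaleR_left mult.commute)

lemma functional_LIMSEQ:
 assumes "bounded_functional l K" "\<And>n. f n \<in> X" "x \<in> X" "(\<lambda>n. p (f n - x)) \<longlonglongrightarrow> 0"
 shows "(\<lambda>n. l (f n)) \<longlonglongrightarrow> l x"
proof -
 have "(\<lambda>n. K * p (f n - x)) \<longlonglongrightarrow> 0"
  using tendsto_mult_right_zero[OF assms(4)] .
 then have "(\<lambda>n. l (f n) - l x) \<longlonglongrightarrow> 0"
 proof (rule Lim_null_comparison[rotated], intro always_eventually allI)
  fix n show "norm (l (f n) - l x) \<le> K * p (f n - x)"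
   using functionalD(4,5)[OF assms(1)] assms(2,3) by (metis X_diff real_norm_def)
 qed
 then show ?thesis by (simp add: LIM_zero_iff)
qed

section \<open>The Bochner integral in a seminormed space\<close>

lemma strongly_measurableE:
 assumes "strongly_measurable_in X p M f"
 obtains g where "\<And>n. simple_function M (g n)" "\<And>n. g n ` space M \<subseteq> X"
  "AE x in M. (\<lambda>n. p (f x - g n x)) \<longlonglongrightarrow> 0" "AE x in M. f x \<in> X"
 using assms unfolding strongly_measurable_in_def by blast

lemma bochner_integralE:
 assumes "has_bochner_integral_in X p M f I"
 obtains g where "\<And>n. Bochner_Integration.simple_bochner_integrable M (g n)" "\<And>n. g n ` space M \<subseteq> X"
   "(\<lambda>n. \<integral>\<^sup>+x. ennreal (p (f x - g n x)) \<partial>M) \<longlonglongrightarrow> 0"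
   "(\<lambda>n. p (Bochner_Integration.simple_bochner_integral M (g n) - I)) \<longlonglongrightarrow> 0"
   "I \<in> X" "strongly_measurable_in X p M f"
 using assms unfolding has_bochner_integral_in_def by blast

lemma strongly_measurableI:
 assumes "AE x in M. f x \<in> X" "\<And>n. simple_function M (g n)" "\<And>n. g n ` space M \<subseteq> X"
  "AE x in M. (\<lambda>n. p (f x - g n x)) \<longlonglongrightarrow> 0"
 shows "strongly_measurable_in X p M f"
 unfolding strongly_measurable_in_def
 by (intro conjI exI[of _ g] allI assms)

lemma bochner_integralI:
 assumes "I \<in> X" "strongly_measurable_in X p M f"
  "\<And>n. Bochner_Integration.simple_bochner_integrable M (g n)" "\<And>n. g n ` space M \<subseteq> X"
  "(\<lambda>n. \<integral>\<^sup>+x. ennreal (p (f x - g n x)) \<partial>M) \<longlonglongrightarrow> 0"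
  "(\<lambda>n. p (Bochner_Integration.simple_bochner_integral M (g n) - I)) \<longlonglongrightarrow> 0"
 shows "has_bochner_integral_in X p M f I"
 unfolding has_bochner_integral_in_def
 by (intro conjI exI[of _ g] allI assms)

lemma strongly_measurable_simple:
 assumes "simple_function M g" "g ` space M \<subseteq> X"
 shows "strongly_measurable_in X p M g"
 unfolding strongly_measurable_in_def
 using assms by (auto intro!: AE_I2 exI[of _ "\<lambda>_. g"])

lemma strongly_measurable_diff:
 assumes "strongly_measurable_in X p M f" "strongly_measurable_in X p M g"
 shows "strongly_measurable_in X p M (\<lambda>x. f x - g x)"
proof -
 obtain a where a: "\<And>n. simple_function M (a n)" "\<And>n. a n ` space M \<subseteq> X"
   "AE x in M. (\<lambda>n. p (f x - a n x)) \<longlonglongrightarrow> 0" "AE x in M. f x \<in> X"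
  by (rule strongly_measurableE[OF assms(1)]) (rule that)
 obtain b where b: "\<And>n. simple_function M (b n)" "\<And>n. b n ` space M \<subseteq> X"
   "AE x in M. (\<lambda>n. p (g x - b n x)) \<longlonglongrightarrow> 0" "AE x in M. g x \<in> X"
  by (rule strongly_measurableE[OF assms(2)]) (rule that)
 note fX = a(4) and gX = b(4)
 have aX: "a n x \<in> X" and bX: "b n x \<in> X" if "x \<in> space M" for n x
  using a(2) b(2) that by blast+
 show ?thesis unfolding strongly_measurable_in_def
 proof (intro conjI exI allI)
  show "AE x in M. f x - g x \<in> X" using fX gX by eventually_elim auto
  show "simple_function M (\<lambda>x. a n x - b n x)" for n
   using a(1) b(1) by (intro simple_function_compose2[where h="(-)"]) auto
  show "(\<lambda>x. a n x - b n x) ` space M \<subseteq> X" for n using aX bX by auto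
  show "AE x in M. (\<lambda>n. p (f x - g x - (a n x - b n x))) \<longlonglongrightarrow> 0"
   using a(3) b(3) fX gX AE_space
  proof eventually_elim
   case (elim x)
   have "(\<lambda>n. p (f x - a n x) + p (g x - b n x)) \<longlonglongrightarrow> 0"
    using tendsto_add[OF elim(1,2)] by simp
   then show ?case
   proof (rule Lim_null_comparison[rotated], intro always_eventually allI)
    fix n
    have "p ((f x - a n x) - (g x - b n x)) \<le> p (f x - a n x) + p (g x - b n x)"
     using elim aX bX by (intro p_diff_le) auto
    moreover have eq: "(f x - a n x) - (g x - b n x) = f x - g x - (a n x - b n x)"
     by (simp add: algebra_simps)
    ultimately have "p (f x - g x - (a n x - b n x)) \<le> p (f x - a n x) + p (g x - b n x)"
     by (simp only: eq)
    moreover have "f x - g x - (a n x - b n x) \<in> X" using elim aX bX by auto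
    ultimately show "norm (p (f x - g x - (a n x - b n x))) \<le> p (f x - a n x) + p (g x - b n x)"
     using p_nonneg[of "f x - g x - (a n x - b n x)"] unfolding real_norm_def by simp
   qed
  qed
 qed
qed

lemma strongly_measurable_cong:
 assumes f: "strongly_measurable_in X p M f" and eq: "AE x in M. g x \<in> X \<and> p (f x - g x) = 0"
 shows "strongly_measurable_in X p M g"
proof -
 obtain a where a: "\<And>n. simple_function M (a n)" "\<And>n. a n ` space M \<subseteq> X"
   "AE x in M. (\<lambda>n. p (f x - a n x)) \<longlonglongrightarrow> 0" "AE x in M. f x \<in> X"
  by (rule strongly_measurableE[OF f]) (rule that)
 have "AE x in M. (\<lambda>n. p (g x - a n x)) \<longlonglongrightarrow> 0"
  using a(3) eq a(4) AE_space
 proof eventually_elim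
  case (elim x)
  have "p (f x - a n x) = p (g x - a n x)" for n
   using elim a(2)[of n] by (intro p_null_cong) auto
  then show ?case using elim(1) by simp
 qed
 then show ?thesis
  using a eq by (intro strongly_measurableI[of _ _ a]) auto
qed

text \<open>
The functional maps approximating simple functions to real ones, which reduces measurability to the
limit theorem for a complete measure.
\<close>

lemma functional_measurable:
 assumes "complete_measure M" "bounded_functional l K" "strongly_measurable_in X p M f"
 shows "(\<lambda>x. l (f x)) \<in> borel_measurable M"
proof -
 obtain a where a: "\<And>n. simple_function M (a n)" "\<And>n. a n ` space M \<subseteq> X"
   "AE x in M. (\<lambda>n. p (f x - a n x)) \<longlonglongrightarrow> 0" "AE x in M. f x \<in> X"
  by (rule strongly_measurableE[OF assms(3)]) (rule that)
 show ?thesis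
 proof (rule complete_measure.borel_measurable_AE_LIMSEQ[OF assms(1)])
  show "(\<lambda>x. l (a n x)) \<in> borel_measurable M" for n
   using simple_function_compose1[OF a(1)] by (rule borel_measurable_simple_function)
  show "AE x in M. (\<lambda>n. l (a n x)) \<longlonglongrightarrow> l (f x)"
   using a(3,4) AE_space
  proof eventually_elim
   case (elim x)
   have "(\<lambda>n. p (a n x - f x)) \<longlonglongrightarrow> 0"
    using elim a(2) by (subst p_minus_commute) auto
   then show ?case using elim a(2) by (intro functional_LIMSEQ[OF assms(2)]) auto
  qed
 qed
qed

lemma p_measurable:
 assumes "complete_measure M" "strongly_measurable_in X p M f"
 shows "(\<lambda>x. p (f x)) \<in> borel_measurable M"
proof -
 obtain a where a: "\<And>n. simple_function M (a n)" "\<And>n. a n ` space M \<subseteq> X"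
   "AE x in M. (\<lambda>n. p (f x - a n x)) \<longlonglongrightarrow> 0" "AE x in M. f x \<in> X"
  by (rule strongly_measurableE[OF assms(2)]) (rule that)
 show ?thesis
 proof (rule complete_measure.borel_measurable_AE_LIMSEQ[OF assms(1)])
  show "(\<lambda>x. p (a n x)) \<in> borel_measurable M" for n
   using simple_function_compose1[OF a(1)] by (rule borel_measurable_simple_function)
  show "AE x in M. (\<lambda>n. p (a n x)) \<longlonglongrightarrow> p (f x)"
   using a(3,4) AE_space
  proof eventually_elim
   case (elim x)
   have "(\<lambda>n. p (a n x - f x)) \<longlonglongrightarrow> 0"
    using elim a(2) by (subst p_minus_commute) auto
   then show ?case using elim a(2) by (intro p_LIMSEQ) auto
  qed
 qed
qed

lemma simple_bochner_integral_in_X: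
 assumes "g ` space M \<subseteq> X"
 shows "Bochner_Integration.simple_bochner_integral M g \<in> X"
 unfolding Bochner_Integration.simple_bochner_integral_def using assms by (auto intro!: X_sum)

lemma simple_bochner_functional:
 assumes l: "bounded_functional l K"
  and g: "Bochner_Integration.simple_bochner_integrable M g" "g ` space M \<subseteq> X"
 shows "Bochner_Integration.simple_bochner_integrable M (\<lambda>x. l (g x))"
  and "Bochner_Integration.simple_bochner_integral M (\<lambda>x. l (g x))
    = l (Bochner_Integration.simple_bochner_integral M g)"
proof -
 have sf: "simple_function M g" and fin: "emeasure M {y \<in> space M. g y \<noteq> 0} \<noteq> \<infinity>"
  using g(1) by (auto elim: Bochner_Integration.simple_bochner_integrable.cases)
 have "emeasure M {y \<in> space M. l (g y) \<noteq> 0} \<le> emeasure M {y \<in> space M. g y \<noteq> 0}"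
  using sf by (intro emeasure_mono) (auto simp: functionalD(6)[OF l])
 with fin have "emeasure M {y \<in> space M. l (g y) \<noteq> 0} \<noteq> \<infinity>"
  by (metis infinity_ennreal_def neq_top_trans)
 then show sbi: "Bochner_Integration.simple_bochner_integrable M (\<lambda>x. l (g x))"
  using simple_function_compose1[OF sf] by (intro Bochner_Integration.simple_bochner_integrable.intros) auto
 show "Bochner_Integration.simple_bochner_integral M (\<lambda>x. l (g x))
    = l (Bochner_Integration.simple_bochner_integral M g)"
  unfolding simple_bochner_integral_partition[OF sbi sf, of l, simplified]
  unfolding Bochner_Integration.simple_bochner_integral_def
  using g(2) by (subst functional_sum[OF l]) (auto simp: functionalD(3)[OF l] intro!: sum.cong)
qed

text \<open>
The Bochner integral is unique up to null vectors only; this lemma is the way to compute with it.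
\<close>

lemma bochner_functional:
 assumes M: "complete_measure M" and l: "bounded_functional l K"
  and f: "has_bochner_integral_in X p M f I"
 shows "has_bochner_integral M (\<lambda>x. l (f x)) (l I)"
proof -
 obtain g where g: "\<And>n. Bochner_Integration.simple_bochner_integrable M (g n)" "\<And>n. g n ` space M \<subseteq> X"
   "(\<lambda>n. \<integral>\<^sup>+x. ennreal (p (f x - g n x)) \<partial>M) \<longlonglongrightarrow> 0"
   "(\<lambda>n. p (Bochner_Integration.simple_bochner_integral M (g n) - I)) \<longlonglongrightarrow> 0"
  and I: "I \<in> X" and sm: "strongly_measurable_in X p M f"
  by (rule bochner_integralE[OF f]) (rule that)
 have fX: "AE x in M. f x \<in> X" using sm by (simp add: strongly_measurable_in_def)
 show ?thesis
 proof (rule has_bochner_integral.intros)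
  show "(\<lambda>x. l (f x)) \<in> borel_measurable M" using functional_measurable[OF M l sm] .
  show "Bochner_Integration.simple_bochner_integrable M (\<lambda>x. l (g n x))" for n
   using simple_bochner_functional(1)[OF l g(1,2)] .
  have meas: "(\<lambda>x. p (f x - g n x)) \<in> borel_measurable M" for n
   using g(1)[of n] g(2)[of n]
   by (intro p_measurable[OF M] strongly_measurable_diff sm strongly_measurable_simple)
     (auto elim: Bochner_Integration.simple_bochner_integrable.cases)
  have "(\<integral>\<^sup>+x. ennreal (norm (l (f x) - l (g n x))) \<partial>M) \<le> ennreal K * (\<integral>\<^sup>+x. ennreal (p (f x - g n x)) \<partial>M)" for n
  proof -
   have "(\<integral>\<^sup>+x. ennreal (norm (l (f x) - l (g n x))) \<partial>M) \<le> (\<integral>\<^sup>+x. ennreal K * ennreal (p (f x - g n x)) \<partial>M)"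
   proof (rule nn_integral_mono_AE)
    show "AE x in M. ennreal (norm (l (f x) - l (g n x))) \<le> ennreal K * ennreal (p (f x - g n x))"
     using fX AE_space
    proof eventually_elim
     case (elim x)
     then have gx: "g n x \<in> X" using g(2) by auto
     have "norm (l (f x) - l (g n x)) = \<bar>l (f x - g n x)\<bar>"
      using functionalD(5)[OF l elim(1) gx] by simp
     also have "\<dots> \<le> K * p (f x - g n x)" using functionalD(4)[OF l] elim gx by auto
     finally show ?case
      using functionalD(1)[OF l] elim gx by (simp add: ennreal_leI flip: ennreal_mult)
    qed
   qed
   also have "\<dots> = ennreal K * (\<integral>\<^sup>+x. ennreal (p (f x - g n x)) \<partial>M)"
    using meas by (intro nn_integral_cmult) auto
   finally show ?thesis .
  qed
  moreover have "(\<lambda>n. ennreal K * (\<integral>\<^sup>+x. ennreal (p (f x - g n x)) \<partial>M)) \<longlonglongrightarrow> ennreal K * 0"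
   by (intro ennreal_tendsto_cmult g(3)) auto
  ultimately show "(\<lambda>n. \<integral>\<^sup>+x. ennreal (norm (l (f x) - l (g n x))) \<partial>M) \<longlonglongrightarrow> 0"
   using tendsto_sandwich[OF always_eventually always_eventually tendsto_const, OF allI allI]
   by (metis (no_types, lifting) mult_zero_right zero_le)
  show "(\<lambda>n. Bochner_Integration.simple_bochner_integral M (\<lambda>x. l (g n x))) \<longlonglongrightarrow> l I"
   unfolding simple_bochner_functional(2)[OF l g(1,2)]
   by (rule functional_LIMSEQ[OF l _ I g(4)]) (rule simple_bochner_integral_in_X[OF g(2)])
 qed
qed

text \<open>
Tested with the functional \<open>ip (I - J)\<close>, the claim is a bound on a real integral.
\<close>

lemma bochner_diff_bound:
 assumes M: "complete_measure M"
  and f: "has_bochner_integral_in X p M f I" and g: "has_bochner_integral_in X p M g J"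
  and h: "integrable M h" "AE x in M. p (f x - g x) \<le> h x"
 shows "p (I - J) \<le> (\<integral>x. h x \<partial>M)"
proof -
 have IJ: "I \<in> X" "J \<in> X" and fX: "AE x in M. f x \<in> X" and gX: "AE x in M. g x \<in> X"
  using f g by (auto simp: has_bochner_integral_in_def strongly_measurable_in_def)
 define y where "y = I - J"
 have y: "y \<in> X" using IJ by (simp add: y_def)
 note l = bounded_functional_ip[OF y]
 have fi: "has_bochner_integral M (\<lambda>x. ip (f x) y) (ip I y)"
  and gi: "has_bochner_integral M (\<lambda>x. ip (g x) y) (ip J y)"
  using bochner_functional[OF M l] f g by auto
 have "(p y)\<^sup>2 = ip I y - ip J y"
  using functionalD(5)[OF l IJ] y by (simp add: p_square y_def)
 also have "\<dots> = (\<integral>x. ip (f x) y - ip (g x) y \<partial>M)"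
  using has_bochner_integral_diff[OF fi gi] by (simp add: has_bochner_integral_integral_eq)
 also have "\<dots> \<le> (\<integral>x. h x * p y \<partial>M)"
 proof (rule integral_mono_AE)
  show "integrable M (\<lambda>x. ip (f x) y - ip (g x) y)"
   using has_bochner_integral_diff[OF fi gi] by (rule integrable.intros)
  show "integrable M (\<lambda>x. h x * p y)" using h by simp
  show "AE x in M. ip (f x) y - ip (g x) y \<le> h x * p y"
   using fX gX h(2)
  proof eventually_elim
   case (elim x)
   have "ip (f x) y - ip (g x) y = ip (f x - g x) y" using functionalD(5)[OF l] elim by simp
   also have "\<dots> \<le> p (f x - g x) * p y" using ip_le_norms[of "f x - g x" y] elim y by auto
   also have "\<dots> \<le> h x * p y" using elim y by (intro mult_right_mono) auto
   finally show ?case .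
  qed
 qed
 also have "\<dots> = (\<integral>x. h x \<partial>M) * p y" by simp
 finally have le: "p y * p y \<le> (\<integral>x. h x \<partial>M) * p y" by (simp add: power2_eq_square)
 have "AE x in M. 0 \<le> h x"
  using fX gX h(2) by eventually_elim (meson X_diff order_trans p_nonneg)
 then have "0 \<le> (\<integral>x. h x \<partial>M)" by (rule integral_nonneg_AE)
 then show ?thesis using le p_nonneg[OF y] unfolding y_def[symmetric]
  by (metis mult_right_le_imp_le order_le_less)
qed

lemma bochner_cong:
 assumes f: "has_bochner_integral_in X p M f I"
  and eq: "AE x in M. g x \<in> X \<and> p (f x - g x) = 0" and J: "J \<in> X" "p (I - J) = 0"
 shows "has_bochner_integral_in X p M g J"
proof -
 obtain a where a: "\<And>n. Bochner_Integration.simple_bochner_integrable M (a n)" "\<And>n. a n ` space M \<subseteq> X"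
   "(\<lambda>n. \<integral>\<^sup>+x. ennreal (p (f x - a n x)) \<partial>M) \<longlonglongrightarrow> 0"
   "(\<lambda>n. p (Bochner_Integration.simple_bochner_integral M (a n) - I)) \<longlonglongrightarrow> 0"
  and I: "I \<in> X" and sm: "strongly_measurable_in X p M f"
  by (rule bochner_integralE[OF f]) (rule that)
 have fX: "AE x in M. f x \<in> X" using sm by (simp add: strongly_measurable_in_def)
 have "(\<integral>\<^sup>+x. ennreal (p (f x - a n x)) \<partial>M) = (\<integral>\<^sup>+x. ennreal (p (g x - a n x)) \<partial>M)" for n
 proof (rule nn_integral_cong_AE)
  show "AE x in M. ennreal (p (f x - a n x)) = ennreal (p (g x - a n x))"
   using eq fX AE_space
  proof eventually_elim
   case (elim x)
   then have "p (f x - a n x) = p (g x - a n x)" using a(2)[of n] by (intro p_null_cong) auto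
   then show ?case by simp
  qed
 qed
 moreover have "p (Bochner_Integration.simple_bochner_integral M (a n) - I)
   = p (Bochner_Integration.simple_bochner_integral M (a n) - J)" for n
  using simple_bochner_integral_in_X[OF a(2)] I J p_minus_commute[OF J(1) I] by (intro p_null_cong) auto
 ultimately show ?thesis
  using strongly_measurable_cong[OF sm eq] J(1) a by (intro bochner_integralI[of J _ _ a]) auto
qed

lemma has_bochner_in_simple:
 assumes "Bochner_Integration.simple_bochner_integrable M g" "g ` space M \<subseteq> X"
 shows "has_bochner_integral_in X p M g (Bochner_Integration.simple_bochner_integral M g)"
 unfolding has_bochner_integral_in_def
proof (intro conjI exI[of _ "\<lambda>_. g"] allI)
 show "strongly_measurable_in X p M g"
  using assms by (auto intro!: strongly_measurable_simple elim: Bochner_Integration.simple_bochner_integrable.cases)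
qed (use assms simple_bochner_integral_in_X in auto)

end

locale complete_semi_hilbert = semi_hilbert +
 assumes complete_X:
  "\<lbrakk>\<And>n. f n \<in> X; \<And>e. 0 < e \<Longrightarrow> \<exists>N. \<forall>m\<ge>N. \<forall>n\<ge>N. p (f m - f n) < e\<rbrakk>
    \<Longrightarrow> \<exists>x\<in>X. (\<lambda>n. p (f n - x)) \<longlonglongrightarrow> 0"
begin

text \<open>
The integrals of the \<open>s n\<close> form a Cauchy sequence, because \<open>h n\<close> dominates the errors in mean.
\<close>

lemma bochner_existence:
 assumes M: "complete_measure M"
  and f: "\<And>x. x \<in> space M \<Longrightarrow> f x \<in> X"
  and s: "\<And>n. Bochner_Integration.simple_bochner_integrable M (s n)" "\<And>n. s n ` space M \<subseteq> X"
  and h: "\<And>n. integrable M (h n)" "\<And>n x. x \<in> space M \<Longrightarrow> p (f x - s n x) \<le> h n x"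
    "(\<lambda>n. \<integral>x. h n x \<partial>M) \<longlonglongrightarrow> 0" "\<And>x. x \<in> space M \<Longrightarrow> (\<lambda>n. h n x) \<longlonglongrightarrow> 0"
 shows "\<exists>I. has_bochner_integral_in X p M f I"
proof -
 let ?I = "\<lambda>n. Bochner_Integration.simple_bochner_integral M (s n)"
 have sX: "\<And>n x. x \<in> space M \<Longrightarrow> s n x \<in> X" using s(2) by auto
 have IX: "?I n \<in> X" for n using simple_bochner_integral_in_X[OF s(2)] .
 have h0: "0 \<le> h n x" if "x \<in> space M" for n x
  using h(2)[OF that] p_nonneg[OF X_diff[OF f[OF that] sX[OF that]]] by (meson order_trans)
 have bound: "p (?I m - ?I n) \<le> (\<integral>x. h m x \<partial>M) + (\<integral>x. h n x \<partial>M)" for m n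
 proof -
  have "p (?I m - ?I n) \<le> (\<integral>x. h m x + h n x \<partial>M)"
  proof (rule bochner_diff_bound[OF M has_bochner_in_simple[OF s] has_bochner_in_simple[OF s]])
   show "AE x in M. p (s m x - s n x) \<le> h m x + h n x"
   proof (rule AE_I2)
    fix x assume x: "x \<in> space M"
    have "p (s m x - s n x) \<le> p (s m x - f x) + p (f x - s n x)"
     using x f sX by (intro p_triangle_diff) auto
    then show "p (s m x - s n x) \<le> h m x + h n x"
     using h(2)[OF x, of m] h(2)[OF x, of n] p_minus_commute[OF f[OF x] sX[OF x], of m] by simp
   qed
  qed (use h in auto)
  then show ?thesis using h(1) by simp
 qed
 have "\<exists>x\<in>X. (\<lambda>n. p (?I n - x)) \<longlonglongrightarrow> 0"
 proof (rule complete_X)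
  fix e :: real assume "0 < e"
  then obtain N where "\<And>n. n \<ge> N \<Longrightarrow> \<bar>\<integral>x. h n x \<partial>M\<bar> < e / 2"
   using LIMSEQ_D[OF h(3), of "e / 2"] by auto
  then show "\<exists>N. \<forall>m\<ge>N. \<forall>n\<ge>N. p (?I m - ?I n) < e"
   using bound by (intro exI[of _ N]) (smt (verit) field_sum_of_halves)
 qed (rule IX)
 then obtain I where I: "I \<in> X" "(\<lambda>n. p (?I n - I)) \<longlonglongrightarrow> 0" by auto
 have pw: "(\<lambda>n. p (f x - s n x)) \<longlonglongrightarrow> 0" if "x \<in> space M" for x
  using h(4)[OF that]
  by (rule Lim_null_comparison[rotated]) (use h(2) f sX that in auto)
 have "(\<lambda>n. \<integral>\<^sup>+x. ennreal (p (f x - s n x)) \<partial>M) \<longlonglongrightarrow> 0"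
 proof (rule tendsto_sandwich[OF _ _ tendsto_const])
  show "\<forall>\<^sub>F n in sequentially. (\<integral>\<^sup>+x. ennreal (p (f x - s n x)) \<partial>M) \<le> ennreal (\<integral>x. h n x \<partial>M)"
   using h(1,2) h0
   by (intro always_eventually allI)
     (auto simp: nn_integral_eq_integral[symmetric] intro!: nn_integral_mono ennreal_leI)
  show "(\<lambda>n. ennreal (\<integral>x. h n x \<partial>M)) \<longlonglongrightarrow> 0"
   using h(3) by (simp add: tendsto_ennrealI flip: ennreal_0)
 qed auto
 moreover have "strongly_measurable_in X p M f"
  using s f pw by (intro strongly_measurableI[of _ _ s] AE_I2)
   (auto elim: Bochner_Integration.simple_bochner_integrable.cases)
 ultimately have "has_bochner_integral_in X p M f I"
  using I s by (intro bochner_integralI[of _ _ _ s])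
 then show ?thesis ..
qed

end

section \<open>Continuous functions into a seminormed space\<close>

lemma has_bochner_integral_lebesgue_on_D:
 fixes f :: "real \<Rightarrow> real"
 assumes "has_bochner_integral (lebesgue_on S) f I" "S \<in> sets lebesgue"
 shows "f absolutely_integrable_on S" "(f has_integral I) S"
proof -
 have i: "integrable (lebesgue_on S) f" "integral\<^sup>L (lebesgue_on S) f = I"
  using assms(1) by (auto simp: has_bochner_integral_iff)
 then show "f absolutely_integrable_on S"
  using assms(2) by (simp add: set_integrable_def integrable_restrict_space)
 show "(f has_integral I) S"
  using i assms(2) has_integral_integral_lebesgue_on by blast
qed

lemma absolutely_integrable_imp_integrable_lebesgue_on:
 fixes f :: "real \<Rightarrow> real"
 assumes "f absolutely_integrable_on S" "S \<in> sets lebesgue"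
 shows "integrable (lebesgue_on S) f" "integral\<^sup>L (lebesgue_on S) f = integral S f"
proof -
 show "integrable (lebesgue_on S) f"
  using assms by (simp add: set_integrable_def integrable_restrict_space)
 then show "integral\<^sup>L (lebesgue_on S) f = integral S f"
  using assms(2) by (rule lebesgue_integral_eq_integral)
qed

lemma finite_emeasure_lebesgue_on_Icc:
 "emeasure (lebesgue_on {a..b::real}) A < \<infinity>"
proof -
 have "finite_measure (lebesgue_on {a..b})" by (rule finite_measure_lebesgue_on) auto
 then show ?thesis by (metis finite_measure.emeasure_finite infinity_ennreal_def less_top)
qed

context semi_hilbert
begin

lemma cont_inD:
 assumes "continuous_on_in X p T x"
 shows "t \<in> T \<Longrightarrow> x t \<in> X" "t \<in> T \<Longrightarrow> ((\<lambda>s. p (x s - x t)) \<longlongrightarrow> 0) (at t within T)"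
 using assms by (auto simp: continuous_on_in_def)

lemma cont_in_subset: "\<lbrakk>continuous_on_in X p T x; T' \<subseteq> T\<rbrakk> \<Longrightarrow> continuous_on_in X p T' x"
 unfolding continuous_on_in_def by (meson subsetD tendsto_within_subset)

text \<open>
Continuity with values in \<open>X\<close> passes to real functions, where the library applies.
\<close>

lemma continuous_on_controlled:
 assumes x: "continuous_on_in X p T x"
  and f: "\<And>s t. \<lbrakk>s \<in> T; t \<in> T\<rbrakk> \<Longrightarrow> \<bar>f s - f t\<bar> \<le> K * p (x s - x t)"
 shows "continuous_on T (f :: real \<Rightarrow> real)"
 unfolding continuous_on_def
proof
 fix t assume t: "t \<in> T"
 have "((\<lambda>s. K * p (x s - x t)) \<longlongrightarrow> 0) (at t within T)"
  using tendsto_mult_right_zero[OF cont_inD(2)[OF x t]] .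
 then have "((\<lambda>s. f s - f t) \<longlongrightarrow> 0) (at t within T)"
  by (rule Lim_null_comparison[rotated]) (use f t in \<open>auto simp: eventually_at_filter\<close>)
 then show "(f \<longlongrightarrow> f t) (at t within T)" by (simp add: LIM_zero_iff)
qed

lemma continuous_on_p_diff:
 assumes "continuous_on_in X p T x" "y \<in> X"
 shows "continuous_on T (\<lambda>s. p (x s - y))"
proof (rule continuous_on_controlled[OF assms(1), of _ 1])
 fix s t assume "s \<in> T" "t \<in> T"
 then have "x s \<in> X" "x t \<in> X" using cont_inD(1)[OF assms(1)] by auto
 then show "\<bar>p (x s - y) - p (x t - y)\<bar> \<le> 1 * p (x s - x t)"
  using p_abs_diff_le[of "x s - y" "x t - y"] assms(2) by auto
qed

lemma continuous_on_p: "continuous_on_in X p T x \<Longrightarrow> continuous_on T (\<lambda>s. p (x s))"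
 using continuous_on_p_diff[of T x 0] by simp

lemma continuous_on_functional:
 assumes "continuous_on_in X p T x" "bounded_functional l K"
 shows "continuous_on T (\<lambda>s. l (x s))"
proof (rule continuous_on_controlled[OF assms(1)])
 fix s t assume "s \<in> T" "t \<in> T"
 then have X: "x s \<in> X" "x t \<in> X" using cont_inD(1)[OF assms(1)] by auto
 show "\<bar>l (x s) - l (x t)\<bar> \<le> K * p (x s - x t)"
  using functionalD(4)[OF assms(2), of "x s - x t"] functionalD(5)[OF assms(2) X] X by simp
qed

lemma cont_in_compose:
 assumes "continuous_on_in X p T x" "continuous_on S g" "g ` S \<subseteq> T"
 shows "continuous_on_in X p S (\<lambda>s. x (g s))"
 unfolding continuous_on_in_def
proof (intro conjI ballI)
 fix t assume t: "t \<in> S"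
 then have gt: "g t \<in> T" using assms(3) by auto
 show "x (g t) \<in> X" using cont_inD(1)[OF assms(1) gt] .
 have "continuous_on S (\<lambda>s. p (x (g s) - x (g t)))"
  using continuous_on_compose2[OF continuous_on_p_diff[OF assms(1) cont_inD(1)[OF assms(1) gt]] assms(2,3)] .
 then show "((\<lambda>s. p (x (g s) - x (g t))) \<longlongrightarrow> 0) (at t within S)"
  using t by (simp add: continuous_on_def) (metis diff_self p_zero)
qed

lemma cont_in_const: "y \<in> X \<Longrightarrow> continuous_on_in X p T (\<lambda>_. y)"
 by (simp add: continuous_on_in_def)

lemma cont_in_uniform:
 assumes x: "continuous_on_in X p {a..b} x" and e: "0 < e"
 shows "\<exists>d>0. \<forall>s\<in>{a..b}. \<forall>t\<in>{a..b}. \<bar>s - t\<bar> < d \<longrightarrow> p (x s - x t) < e"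
proof -
 let ?f = "\<lambda>z::real \<times> real. p (x (fst z) - x (snd z))"
 have X: "\<And>s. s \<in> {a..b} \<Longrightarrow> x s \<in> X" using cont_inD(1)[OF x] .
 have "continuous_on ({a..b} \<times> {a..b}) ?f"
  unfolding continuous_on_def
 proof
  fix z assume z: "z \<in> {a..b} \<times> {a..b}"
  then have zX: "x (fst z) \<in> X" "x (snd z) \<in> X" using X by auto
  let ?g = "\<lambda>w::real \<times> real. p (x (fst w) - x (fst z)) + p (x (snd w) - x (snd z))"
  have "continuous_on ({a..b} \<times> {a..b}) ?g"
   by (intro continuous_on_add continuous_on_compose2[OF continuous_on_p_diff[OF x]] zX continuous_intros) auto
  then have "(?g \<longlongrightarrow> ?g z) (at z within ({a..b} \<times> {a..b}))"
   using z unfolding continuous_on_def by blast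
  then have "(?g \<longlongrightarrow> 0) (at z within ({a..b} \<times> {a..b}))" by simp
  then have "((\<lambda>w. ?f w - ?f z) \<longlongrightarrow> 0) (at z within ({a..b} \<times> {a..b}))"
  proof (rule Lim_null_comparison[rotated])
   have "norm (?f w - ?f z) \<le> ?g w" if "w \<in> {a..b} \<times> {a..b}" for w
   proof -
    have wX: "x (fst w) \<in> X" "x (snd w) \<in> X" using X that by auto
    have "\<bar>?f w - ?f z\<bar> \<le> p ((x (fst w) - x (snd w)) - (x (fst z) - x (snd z)))"
     using wX zX by (intro p_abs_diff_le) auto
    also have "(x (fst w) - x (snd w)) - (x (fst z) - x (snd z))
      = (x (fst w) - x (fst z)) - (x (snd w) - x (snd z))" by (simp add: algebra_simps)
    also have "p \<dots> \<le> ?g w" using wX zX by (intro p_diff_le) auto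
    finally show ?thesis by simp
   qed
   then show "\<forall>\<^sub>F w in at z within {a..b} \<times> {a..b}. norm (?f w - ?f z) \<le> ?g w"
    by (auto simp: eventually_at_filter)
  qed
  then show "(?f \<longlongrightarrow> ?f z) (at z within ({a..b} \<times> {a..b}))" by (rule LIM_zero_cancel)
 qed
 then have "uniformly_continuous_on ({a..b} \<times> {a..b}) ?f"
  by (rule compact_uniformly_continuous) (auto intro: compact_Times)
 then obtain d where d: "d > 0" "\<And>z w. \<lbrakk>z \<in> {a..b} \<times> {a..b}; w \<in> {a..b} \<times> {a..b}; dist w z < d\<rbrakk>
   \<Longrightarrow> dist (?f w) (?f z) < e"
  unfolding uniformly_continuous_on_def using e by blast
 show ?thesis
 proof (intro exI[of _ d] conjI ballI impI)
  fix s t assume st: "s \<in> {a..b}" "t \<in> {a..b}" "\<bar>s - t\<bar> < d"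
  have "dist (?f (s, t)) (?f (t, t)) < e"
   using st by (intro d(2)) (auto simp: dist_Pair_Pair dist_real_def)
  then show "p (x s - x t) < e" using X st by (simp add: dist_real_def)
 qed (rule d(1))
qed

lemma cont_in_bounded:
 assumes x: "continuous_on_in X p {a..b} x"
 shows "\<exists>P\<ge>0. \<forall>s\<in>{a..b}. p (x s) \<le> P"
proof -
 have "bounded ((\<lambda>s. p (x s)) ` {a..b})"
  using compact_continuous_image[OF continuous_on_p[OF x]] compact_imp_bounded by blast
 then obtain P where "P > 0" "\<forall>s\<in>{a..b}. \<bar>p (x s)\<bar> \<le> P"
  by (auto simp: bounded_pos)
 then show ?thesis by (intro exI[of _ P]) auto
qed

text \<open>Sampling at the points of a fine grid makes simple functions out of continuous ones.\<close>

lemma cont_in_grid: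
 assumes x: "continuous_on_in X p {a..b} x" and e: "0 < e"
 shows "\<exists>g. simple_function (lebesgue_on {a..b}) g \<and> g ` {a..b} \<subseteq> {a..b} \<and>
   (\<forall>s\<in>{a..b}. p (x s - x (g s)) \<le> e)"
proof -
 obtain d where d: "d > 0" "\<And>s t. \<lbrakk>s \<in> {a..b}; t \<in> {a..b}; \<bar>s - t\<bar> < d\<rbrakk> \<Longrightarrow> p (x s - x t) < e"
  using cont_in_uniform[OF x e] by auto
 define n where "n = nat \<lceil>1 / d\<rceil> + 1"
 have n: "0 < real n" "1 / real n < d"
 proof -
  show "0 < real n" by (simp add: n_def)
  have "1 / d < real n" unfolding n_def using of_nat_ceiling[of "1 / d"] by linarith
  with \<open>0 < real n\<close> show "1 / real n < d" using d(1) by (metis divide_less_eq mult.commute)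
 qed
 define g where "g s = max a (real_of_int \<lfloor>s * real n\<rfloor> / real n)" for s
 have le: "real_of_int \<lfloor>s * real n\<rfloor> / real n \<le> s" "s - 1 / real n \<le> real_of_int \<lfloor>s * real n\<rfloor> / real n" for s
 proof -
  have "real_of_int \<lfloor>s * real n\<rfloor> \<le> s * real n" "s * real n - 1 \<le> real_of_int \<lfloor>s * real n\<rfloor>"
   by linarith+
  moreover have "s - 1 / real n = (s * real n - 1) / real n" using n(1) by (simp add: diff_divide_distrib)
  ultimately show "real_of_int \<lfloor>s * real n\<rfloor> / real n \<le> s" "s - 1 / real n \<le> real_of_int \<lfloor>s * real n\<rfloor> / real n"
   using n(1) by (auto simp: pos_divide_le_eq intro: divide_right_mono)
 qed
 have g: "g s \<in> {a..b}" "\<bar>s - g s\<bar> < d" if "s \<in> {a..b}" for s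
  using le[of s] n(2) that by (auto simp: g_def max_def)
 have "simple_function (lebesgue_on {a..b}) g"
 proof (rule simple_function_borel_measurable)
  show "g \<in> borel_measurable (lebesgue_on {a..b})"
  proof -
   have "g \<in> borel_measurable borel" unfolding g_def by measurable
   then show ?thesis by (simp add: measurable_completion measurable_restrict_space1)
  qed
  have "g ` {a..b} \<subseteq> (\<lambda>i. max a (real_of_int i / real n)) ` {\<lfloor>a * real n\<rfloor>..\<lfloor>b * real n\<rfloor>}"
   using n(1) by (auto simp: g_def intro!: imageI floor_mono mult_right_mono)
  then show "finite (g ` space (lebesgue_on {a..b}))"
   by (metis finite_atLeastAtMost_int finite_imageI finite_subset space_lebesgue_on)
 qed
 moreover have "\<forall>s\<in>{a..b}. p (x s - x (g s)) \<le> e" using g d(2) by (meson less_imp_le)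
 ultimately show ?thesis using g(1) by blast
qed

end

context complete_semi_hilbert
begin

text \<open>
The integrand is approximated by simple functions in each factor: the weight \<open>c\<close> in mean, and \<open>x\<close> and
\<open>y\<close> uniformly, by sampling on a grid.
\<close>

lemma bochner_exists_weighted:
 assumes c: "c absolutely_integrable_on {a..b}"
  and x: "continuous_on_in X p {a..b} x" and y: "continuous_on_in X p {a..b} y"
 shows "\<exists>I. has_bochner_integral_in X p (lebesgue_on {a..b}) (\<lambda>s. c s *\<^sub>R x s + y s) I"
proof -
 let ?M = "lebesgue_on {a..b}"
 have ci: "integrable ?M c" using absolutely_integrable_imp_integrable_lebesgue_on[OF c] by auto
 have xX: "\<And>s. s \<in> {a..b} \<Longrightarrow> x s \<in> X" and yX: "\<And>s. s \<in> {a..b} \<Longrightarrow> y s \<in> X"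
  using cont_inD(1)[OF x] cont_inD(1)[OF y] by auto
 obtain cs where cs: "\<And>n. simple_function ?M (cs n)"
   "\<And>s. s \<in> {a..b} \<Longrightarrow> (\<lambda>n. cs n s) \<longlonglongrightarrow> c s" "\<And>s n. s \<in> {a..b} \<Longrightarrow> \<bar>cs n s\<bar> \<le> 2 * \<bar>c s\<bar>"
  by (rule integrable_implies_simple_function_sequence[OF ci]) (rule that; simp)
 have "\<forall>n. \<exists>g. simple_function ?M g \<and> g ` {a..b} \<subseteq> {a..b} \<and> (\<forall>s\<in>{a..b}. p (x s - x (g s)) \<le> 1 / Suc n)"
  by (intro allI cont_in_grid x) simp
 from choice[OF this] obtain g where "\<forall>n. simple_function ?M (g n) \<and> g n ` {a..b} \<subseteq> {a..b} \<and>
   (\<forall>s\<in>{a..b}. p (x s - x (g n s)) \<le> 1 / Suc n)" ..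
 then have g: "\<And>n. simple_function ?M (g n)" "\<And>n s. s \<in> {a..b} \<Longrightarrow> g n s \<in> {a..b}"
   "\<And>n s. s \<in> {a..b} \<Longrightarrow> p (x s - x (g n s)) \<le> 1 / Suc n"
  by (blast, blast, blast)
 have "\<forall>n. \<exists>g. simple_function ?M g \<and> g ` {a..b} \<subseteq> {a..b} \<and> (\<forall>s\<in>{a..b}. p (y s - y (g s)) \<le> 1 / Suc n)"
  by (intro allI cont_in_grid y) simp
 from choice[OF this] obtain g' where "\<forall>n. simple_function ?M (g' n) \<and> g' n ` {a..b} \<subseteq> {a..b} \<and>
   (\<forall>s\<in>{a..b}. p (y s - y (g' n s)) \<le> 1 / Suc n)" ..
 then have g': "\<And>n. simple_function ?M (g' n)" "\<And>n s. s \<in> {a..b} \<Longrightarrow> g' n s \<in> {a..b}"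
   "\<And>n s. s \<in> {a..b} \<Longrightarrow> p (y s - y (g' n s)) \<le> 1 / Suc n"
  by (blast, blast, blast)
 obtain P where P: "P \<ge> 0" "\<And>s. s \<in> {a..b} \<Longrightarrow> p (x s) \<le> P"
  using cont_in_bounded[OF x] by auto
 define sn where "sn n s = cs n s *\<^sub>R x (g n s) + y (g' n s)" for n s
 define h where "h n s = \<bar>c s - cs n s\<bar> * P + 2 * \<bar>c s\<bar> * (1 / Suc n) + 1 / Suc n" for n s
 have snX: "sn n s \<in> X" if "s \<in> {a..b}" for n s
  using that g g' xX yX by (auto simp: sn_def)
 show ?thesis
 proof (rule bochner_existence)
  show "complete_measure ?M" by (rule complete_measure_lebesgue_on) auto
  show "c s *\<^sub>R x s + y s \<in> X" if "s \<in> space ?M" for s using that xX yX by auto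
  show "sn n ` space ?M \<subseteq> X" for n using snX by auto
  show "Bochner_Integration.simple_bochner_integrable ?M (sn n)" for n
  proof
   show "simple_function ?M (sn n)"
    unfolding sn_def
    by (intro simple_function_compose2[OF simple_function_compose2[OF cs(1) g(1), of "\<lambda>u v. u *\<^sub>R x v"] g'(1),
       of "\<lambda>u v. u + y v"])
   show "emeasure ?M {s \<in> space ?M. sn n s \<noteq> 0} \<noteq> \<infinity>"
    using finite_emeasure_lebesgue_on_Icc by (metis less_irrefl)
  qed
  have csi: "integrable ?M (cs n)" for n
  proof (rule Bochner_Integration.integrable_bound[of _ "\<lambda>s. 2 * c s"])
   show "integrable ?M (\<lambda>s. 2 * c s)" using ci by simp
   show "cs n \<in> borel_measurable ?M" using cs(1) by (rule borel_measurable_simple_function)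
   show "AE s in ?M. norm (cs n s) \<le> norm (2 * c s)" using cs(3) by (intro AE_I2) (simp add: abs_mult)
  qed
  have onei: "integrable ?M (\<lambda>s. k)" for k :: real
   using absolutely_integrable_imp_integrable_lebesgue_on(1)[OF absolutely_integrable_continuous_real, of a b "\<lambda>_. k"]
   by auto
  show hi: "integrable ?M (h n)" for n
   unfolding h_def
   by (intro Bochner_Integration.integrable_add integrable_mult_left integrable_mult_right integrable_abs
      Bochner_Integration.integrable_diff ci csi onei)
  show "p (c s *\<^sub>R x s + y s - sn n s) \<le> h n s" if "s \<in> space ?M" for n s
  proof -
   have s: "s \<in> {a..b}" using that by simp
   note X = xX[OF s] yX[OF s] xX[OF g(2)[OF s, of n]] yX[OF g'(2)[OF s, of n]]
   have "c s *\<^sub>R x s + y s - sn n s = ((c s - cs n s) *\<^sub>R x s + cs n s *\<^sub>R (x s - x (g n s))) + (y s - y (g' n s))"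
    by (simp add: sn_def algebra_simps)
   also have "p \<dots> \<le> p ((c s - cs n s) *\<^sub>R x s + cs n s *\<^sub>R (x s - x (g n s))) + p (y s - y (g' n s))"
    using X by (intro p_triangle) auto
   also have "\<dots> \<le> (p ((c s - cs n s) *\<^sub>R x s) + p (cs n s *\<^sub>R (x s - x (g n s)))) + p (y s - y (g' n s))"
    using X by (intro add_mono p_triangle) auto
   also have "\<dots> = \<bar>c s - cs n s\<bar> * p (x s) + \<bar>cs n s\<bar> * p (x s - x (g n s)) + p (y s - y (g' n s))"
    using X by (simp add: p_scaleR)
   also have "\<dots> \<le> h n s"
    unfolding h_def using P s cs(3)[OF s, of n] g(3)[OF s, of n] g'(3)[OF s, of n] X
    by (intro add_mono mult_mono) auto
   finally show ?thesis .
  qed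
  show hlim: "(\<lambda>n. h n s) \<longlonglongrightarrow> 0" if "s \<in> space ?M" for s
  proof -
   have "(\<lambda>n. h n s) \<longlonglongrightarrow> \<bar>c s - c s\<bar> * P + 2 * \<bar>c s\<bar> * 0 + 0"
    unfolding h_def using that cs(2)[of s] by (intro tendsto_intros LIMSEQ_Suc[OF lim_1_over_n]) auto
   then show ?thesis by simp
  qed
  have "(\<lambda>n. integral\<^sup>L ?M (h n)) \<longlonglongrightarrow> integral\<^sup>L ?M (\<lambda>_. 0)"
  proof (rule integral_dominated_convergence[where w = "\<lambda>s. 3 * \<bar>c s\<bar> * P + 2 * \<bar>c s\<bar> + 1"])
   show "h n \<in> borel_measurable ?M" for n using hi by auto
   show "integrable ?M (\<lambda>s. 3 * \<bar>c s\<bar> * P + 2 * \<bar>c s\<bar> + 1)"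
    by (intro Bochner_Integration.integrable_add integrable_mult_left integrable_mult_right integrable_abs ci onei)
   show "AE s in ?M. (\<lambda>n. h n s) \<longlonglongrightarrow> 0" using hlim by (intro AE_I2)
   show "AE s in ?M. norm (h n s) \<le> 3 * \<bar>c s\<bar> * P + 2 * \<bar>c s\<bar> + 1" for n
   proof (rule AE_I2)
    fix s assume "s \<in> space ?M"
    then have s: "s \<in> {a..b}" by simp
    have "\<bar>c s - cs n s\<bar> * P \<le> 3 * \<bar>c s\<bar> * P"
     using P(1) cs(3)[OF s, of n] by (intro mult_right_mono) auto
    moreover have "2 * \<bar>c s\<bar> * (1 / Suc n) \<le> 2 * \<bar>c s\<bar> * 1" by (intro mult_left_mono) auto
    moreover have "(1::real) / Suc n \<le> 1" by simp
    moreover have "0 \<le> h n s" using P(1) by (simp add: h_def)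
    ultimately show "norm (h n s) \<le> 3 * \<bar>c s\<bar> * P + 2 * \<bar>c s\<bar> + 1"
     unfolding h_def real_norm_def by linarith
   qed
  qed auto
  then show "(\<lambda>n. integral\<^sup>L ?M (h n)) \<longlonglongrightarrow> 0" by simp
 qed
qed

end

section \<open>Stable semigroups and variation of constants\<close>

lemma continuous_on_by_control:
 fixes f :: "'a::topological_space \<Rightarrow> real"
 assumes "\<And>z. z \<in> A \<Longrightarrow> \<exists>g. continuous_on A g \<and> g z = 0 \<and> (\<forall>w\<in>A. \<bar>f w - f z\<bar> \<le> g w)"
 shows "continuous_on A f"
 unfolding continuous_on_def
proof
 fix z assume z: "z \<in> A"
 then obtain g where g: "continuous_on A g" "g z = 0" "\<forall>w\<in>A. \<bar>f w - f z\<bar> \<le> g w"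
  using assms by blast
 have "(g \<longlongrightarrow> 0) (at z within A)" using g(1,2) z unfolding continuous_on_def by metis
 then have "((\<lambda>w. f w - f z) \<longlongrightarrow> 0) (at z within A)"
  by (rule Lim_null_comparison[rotated]) (use g(3) in \<open>auto simp: eventually_at_filter\<close>)
 then show "(f \<longlongrightarrow> f z) (at z within A)" by (rule LIM_zero_cancel)
qed

text \<open>
Fubini's theorem on the triangle \<open>s \<le> r\<close>. The kernel is an integrable function of \<open>s\<close> times a
continuous function, which is what variation of constants produces.
\<close>

lemma triangle_swap:
 fixes a :: "real \<Rightarrow> real" and c :: "real \<times> real \<Rightarrow> real"
 assumes a: "a absolutely_integrable_on {0..T}" and c: "continuous_on ({0..T} \<times> {0..T}) c"
 shows "integral {0..T} (\<lambda>r. integral {0..r} (\<lambda>s. a s * c (r, s)))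
    = integral {0..T} (\<lambda>s. integral {s..T} (\<lambda>r. a s * c (r, s)))" (is ?eq)
  and "(\<lambda>r. integral {0..r} (\<lambda>s. a s * c (r, s))) integrable_on {0..T}" (is ?int1)
  and "(\<lambda>s. integral {s..T} (\<lambda>r. a s * c (r, s))) integrable_on {0..T}" (is ?int2)
proof -
 define N where "N = lebesgue_on {0..T}"
 have spN: "space N = {0..T}" by (simp add: N_def)
 interpret N: finite_measure N unfolding N_def by (rule finite_measure_lebesgue_on) auto
 interpret NN: pair_sigma_finite N N ..
 note aN = absolutely_integrable_imp_integrable_lebesgue_on(1)[OF a, folded N_def, simplified]
 define f where "f r s = (if s \<le> r then a s * c (r, s) else 0)" for r s
 have bc: "bounded (c ` ({0..T} \<times> {0..T}))"
  using compact_continuous_image[OF c] compact_Times[OF compact_Icc compact_Icc] compact_imp_bounded by blast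
 then obtain C where C: "0 < C" "\<And>r s. \<lbrakk>r \<in> {0..T}; s \<in> {0..T}\<rbrakk> \<Longrightarrow> \<bar>c (r, s)\<bar> \<le> C"
  unfolding bounded_pos by (metis SigmaI imageI real_norm_def)
 have idN: "(\<lambda>z. z) \<in> N \<rightarrow>\<^sub>M (borel :: real measure)"
  unfolding N_def using id_borel_measurable_lebesgue_on[unfolded id_def] .
 have aM: "a \<in> borel_measurable N" using aN by auto
 have cm: "(\<lambda>z. indicator ({0..T} \<times> {0..T}) z *\<^sub>R c z) \<in> borel_measurable borel"
  using c by (intro borel_measurable_continuous_on_indicator) (auto intro: borel_closed closed_Times)
 have idm: "(\<lambda>z. z) \<in> N \<Otimes>\<^sub>M N \<rightarrow>\<^sub>M (borel :: (real \<times> real) measure)"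
  using measurable_Pair[OF measurable_compose[OF measurable_fst idN] measurable_compose[OF measurable_snd idN]]
  by (simp add: borel_prod)
 have "(\<lambda>z. if snd z \<le> fst z then a (snd z) * (indicator ({0..T} \<times> {0..T}) z *\<^sub>R c z) else 0)
   \<in> borel_measurable (N \<Otimes>\<^sub>M N)"
  using borel_measurable_le[OF measurable_compose[OF measurable_snd idN] measurable_compose[OF measurable_fst idN]]
  by (intro measurable_If borel_measurable_times measurable_compose[OF idm cm] measurable_compose[OF measurable_snd aM])
    (auto simp: id_def)
 moreover have "(if snd z \<le> fst z then a (snd z) * (indicator ({0..T} \<times> {0..T}) z *\<^sub>R c z) else 0) = case_prod f z"
  if "z \<in> space (N \<Otimes>\<^sub>M N)" for z
  using that by (auto simp: f_def space_pair_measure spN indicator_def split: prod.split)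
 ultimately have fm: "case_prod f \<in> borel_measurable (N \<Otimes>\<^sub>M N)"
  by (rule measurable_cong[THEN iffD1, rotated])
 have fb: "\<bar>f r s\<bar> \<le> C * \<bar>a s\<bar>" if "r \<in> {0..T}" "s \<in> {0..T}" for r s
  using C(1) C(2)[OF that] by (auto simp: f_def abs_mult mult.commute[of C] intro: mult_left_mono)
 have sec1: "integrable N (\<lambda>s. f r s)" if "r \<in> {0..T}" for r
 proof (rule Bochner_Integration.integrable_bound[of _ "\<lambda>s. C * a s"])
  show "integrable N (\<lambda>s. C * a s)" using aN by simp
  show "(\<lambda>s. f r s) \<in> borel_measurable N"
   using measurable_Pair2[OF fm, of r] that by (simp add: spN)
  show "AE s in N. norm (f r s) \<le> norm (C * a s)"
   using fb[OF that] C(1) by (intro AE_I2) (simp add: spN abs_mult)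
 qed
 have fi: "integrable (N \<Otimes>\<^sub>M N) (case_prod f)"
 proof (rule NN.Fubini_integrable[OF fm])
  show "AE r in N. integrable N (\<lambda>s. case_prod f (r, s))"
   using sec1 by (intro AE_I2) (simp add: spN)
  show "integrable N (\<lambda>r. \<integral>s. norm (case_prod f (r, s)) \<partial>N)"
  proof (rule Bochner_Integration.integrable_bound[of _ "\<lambda>r. \<integral>s. C * \<bar>a s\<bar> \<partial>N"])
   show "(\<lambda>r. \<integral>s. norm (case_prod f (r, s)) \<partial>N) \<in> borel_measurable N"
    using fm by (intro N.borel_measurable_lebesgue_integral) (simp add: case_prod_beta')
   show "AE r in N. norm (\<integral>s. norm (case_prod f (r, s)) \<partial>N) \<le> norm (\<integral>s. C * \<bar>a s\<bar> \<partial>N)"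
   proof (rule AE_I2)
    fix r assume r: "r \<in> space N"
    have "(\<integral>s. norm (case_prod f (r, s)) \<partial>N) \<le> (\<integral>s. C * \<bar>a s\<bar> \<partial>N)"
     using sec1 aN r fb by (intro integral_mono) (auto simp: spN)
    then show "norm (\<integral>s. norm (case_prod f (r, s)) \<partial>N) \<le> norm (\<integral>s. C * \<bar>a s\<bar> \<partial>N)"
     by (simp add: integral_nonneg_AE)
   qed
  qed simp
 qed
 have i1: "(\<integral>s. f r s \<partial>N) = integral {0..r} (\<lambda>s. a s * c (r, s))" if r: "r \<in> {0..T}" for r
 proof -
  have "(\<integral>s. f r s \<partial>N) = integral {0..T} (f r)"
   using sec1[OF r] unfolding N_def by (intro lebesgue_integral_eq_integral) auto
  also have "\<dots> = integral {0..T} (\<lambda>s. if s \<in> {..r} then a s * c (r, s) else 0)"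
   by (intro integral_cong) (auto simp: f_def)
  also have "\<dots> = integral ({..r} \<inter> {0..T}) (\<lambda>s. a s * c (r, s))"
   by (rule integral_restrict_Int)
  also have "{..r} \<inter> {0..T} = {0..r}" using r by auto
  finally show ?thesis .
 qed
 have i2: "(\<integral>r. f r s \<partial>N) = integral {s..T} (\<lambda>r. a s * c (r, s))"
  if s: "s \<in> {0..T}" "integrable N (\<lambda>r. f r s)" for s
 proof -
  have "(\<integral>r. f r s \<partial>N) = integral {0..T} (\<lambda>r. f r s)"
   using s(2) unfolding N_def by (intro lebesgue_integral_eq_integral) auto
  also have "\<dots> = integral {0..T} (\<lambda>r. if r \<in> {s..} then a s * c (r, s) else 0)"
   by (intro integral_cong) (auto simp: f_def)
  also have "\<dots> = integral ({s..} \<inter> {0..T}) (\<lambda>r. a s * c (r, s))"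
   by (rule integral_restrict_Int)
  also have "{s..} \<inter> {0..T} = {s..T}" using s by auto
  finally show ?thesis .
 qed
 have sec2: "integrable N (\<lambda>r. f r s)" if "s \<in> {0..T}" for s
 proof (rule Bochner_Integration.integrable_bound[of _ "\<lambda>r. C * \<bar>a s\<bar>"])
  show "(\<lambda>r. f r s) \<in> borel_measurable N"
   using measurable_Pair1[OF fm, of s] that by (simp add: spN)
  show "AE r in N. norm (f r s) \<le> norm (C * \<bar>a s\<bar>)"
   using fb that C(1) by (intro AE_I2) (simp add: spN abs_mult)
 qed simp
 have I1: "integrable N (\<lambda>r. integral {0..r} (\<lambda>s. a s * c (r, s)))"
  using NN.integrable_fst[OF fi] i1 by (subst Bochner_Integration.integrable_cong[OF refl, of _ _ "\<lambda>r. \<integral>s. f r s \<partial>N"]) (auto simp: spN)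
 have I2: "integrable N (\<lambda>s. integral {s..T} (\<lambda>r. a s * c (r, s)))"
  using NN.integrable_snd[OF fi] i2 sec2 by (subst Bochner_Integration.integrable_cong[OF refl, of _ _ "\<lambda>s. \<integral>r. f r s \<partial>N"]) (auto simp: spN)
 show ?int1 ?int2 using I1 I2 unfolding N_def by (auto intro: integrable_on_lebesgue_on)
 have "integral {0..T} (\<lambda>r. integral {0..r} (\<lambda>s. a s * c (r, s))) = (\<integral>r. integral {0..r} (\<lambda>s. a s * c (r, s)) \<partial>N)"
  using I1 unfolding N_def by (intro lebesgue_integral_eq_integral[symmetric]) auto
 also have "\<dots> = (\<integral>r. (\<integral>s. f r s \<partial>N) \<partial>N)"
  using i1 by (intro Bochner_Integration.integral_cong) (auto simp: spN)
 also have "\<dots> = (\<integral>s. (\<integral>r. f r s \<partial>N) \<partial>N)" using NN.Fubini_integral[OF fi] by simp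
 also have "\<dots> = (\<integral>s. integral {s..T} (\<lambda>r. a s * c (r, s)) \<partial>N)"
  using i2 sec2 by (intro Bochner_Integration.integral_cong) (auto simp: spN)
 also have "\<dots> = integral {0..T} (\<lambda>s. integral {s..T} (\<lambda>r. a s * c (r, s)))"
  using I2 unfolding N_def by (intro lebesgue_integral_eq_integral) auto
 finally show ?eq .
qed

locale stable_semigroup = semi_hilbert +
 fixes S :: "real \<Rightarrow> 'a \<Rightarrow> 'a" and M \<omega> :: real
 assumes C0: "C0_semigroup_in X p S"
  and M_pos: "0 < M" and omega_pos: "0 < \<omega>"
  and stable: "\<lbrakk>t \<ge> 0; U \<in> X\<rbrakk> \<Longrightarrow> p (S t U) \<le> M * exp (- \<omega> * t) * p U"
begin

lemma S_X [simp, intro]: "\<lbrakk>0 \<le> t; U \<in> X\<rbrakk> \<Longrightarrow> S t U \<in> X"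
 and S_linear: "\<lbrakk>0 \<le> t; U \<in> X; V \<in> X\<rbrakk> \<Longrightarrow> p (S t (a *\<^sub>R U + b *\<^sub>R V) - (a *\<^sub>R S t U + b *\<^sub>R S t V)) = 0"
 and S_zero: "U \<in> X \<Longrightarrow> p (S 0 U - U) = 0"
 and S_add: "\<lbrakk>0 \<le> s; 0 \<le> t; U \<in> X\<rbrakk> \<Longrightarrow> p (S (s + t) U - S s (S t U)) = 0"
 and S_right: "U \<in> X \<Longrightarrow> ((\<lambda>t. p (S t U - U)) \<longlongrightarrow> 0) (at_right 0)"
 using C0 unfolding C0_semigroup_in_def by auto

lemma S_bound: "\<lbrakk>0 \<le> t; U \<in> X\<rbrakk> \<Longrightarrow> p (S t U) \<le> M * p U"
proof -
 assume t: "0 \<le> t" "U \<in> X"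
 have "exp (- \<omega> * t) \<le> 1" using t omega_pos by simp
 then have "M * exp (- \<omega> * t) * p U \<le> M * 1 * p U"
  using M_pos t by (intro mult_right_mono mult_left_mono) auto
 then show ?thesis using stable[OF t] by simp
qed

lemma S_diff:
 assumes "0 \<le> t" "U \<in> X" "V \<in> X"
 shows "p (S t (U - V) - (S t U - S t V)) = 0"
 using S_linear[OF assms, of 1 "-1"] by simp

lemma S_lipschitz:
 assumes "0 \<le> t" "U \<in> X" "V \<in> X"
 shows "p (S t U - S t V) \<le> M * p (U - V)"
proof -
 have "p (S t U - S t V) = p (S t (U - V))"
  using S_diff[OF assms] assms by (metis S_X X_diff p_null_cong)
 then show ?thesis using S_bound[of t "U - V"] assms by auto
qed

lemma S_lipschitz_exp:
 assumes "0 \<le> t" "U \<in> X" "V \<in> X"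
 shows "p (S t U - S t V) \<le> M * exp (- \<omega> * t) * p (U - V)"
proof -
 have "p (S t U - S t V) = p (S t (U - V))"
  using S_diff[OF assms] assms by (metis S_X X_diff p_null_cong)
 then show ?thesis using stable[of t "U - V"] assms by auto
qed

lemma functional_S:
 assumes "bounded_functional l K" "0 \<le> t"
 shows "bounded_functional (\<lambda>U. l (S t U)) (K * M)"
 unfolding bounded_functional_def
proof (intro conjI ballI allI)
 note lD = functionalD[OF assms(1)]
 show "0 \<le> K * M" using lD(1) M_pos by simp
 fix x assume x: "x \<in> X"
 show "\<bar>l (S t x)\<bar> \<le> K * M * p x"
  using lD(4)[OF S_X[OF assms(2) x]] S_bound[OF assms(2) x] lD(1) by (smt (verit) mult.assoc mult_left_mono)
 show "l (S t (x + y)) = l (S t x) + l (S t y)" if y: "y \<in> X" for y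
  using functional_null_cong[OF assms(1) _ _ S_linear[OF assms(2) x y, of 1 1]] x y assms(2) lD(2)
  by (metis S_X X_add scaleR_one)
 show "l (S t (a *\<^sub>R x)) = a * l (S t x)" for a
  using functional_null_cong[OF assms(1) _ _ S_linear[OF assms(2) x x, of a 0]] x assms(2) lD(3)
  by (metis S_X X_scaleR add.right_neutral scaleR_zero_left)
qed

text \<open>
The semigroup law up to null vectors: \<open>S t U - S s U\<close> is \<open>S s (S (t - s) U - U)\<close>.
\<close>

lemma S_increment:
 assumes "0 \<le> s" "s \<le> t" "U \<in> X"
 shows "p (S t U - S s U) \<le> M * p (S (t - s) U - U)"
proof -
 have "p (S t U - S s U) \<le> p (S (s + (t - s)) U - S s (S (t - s) U)) + p (S s (S (t - s) U) - S s U)"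
  using assms p_triangle_diff[of "S t U" "S s (S (t - s) U)" "S s U"] by auto
 also have "\<dots> \<le> 0 + M * p (S (t - s) U - U)"
  using assms by (intro add_mono S_lipschitz) (use S_add[of s "t - s" U] in auto)
 finally show ?thesis by simp
qed

lemma S_small_time:
 assumes "U \<in> X" "0 < e"
 shows "\<exists>d>0. \<forall>h. 0 \<le> h \<and> h < d \<longrightarrow> p (S h U - U) < e"
proof -
 obtain d where d: "d > 0" "\<And>h. \<lbrakk>0 < h; h < d\<rbrakk> \<Longrightarrow> \<bar>p (S h U - U)\<bar> < e"
  using tendstoD[OF S_right[OF assms(1)] assms(2)] by (auto simp: eventually_at_right_field)
 have "p (S h U - U) < e" if "0 \<le> h" "h < d" for h
  using d(2)[of h] that S_zero[OF assms(1)] assms(2) by (cases "h = 0") auto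
 then show ?thesis using d(1) by blast
qed

lemma cont_in_orbit:
 assumes V: "V \<in> X"
 shows "continuous_on_in X p {0..} (\<lambda>t. S t V)"
 unfolding continuous_on_in_def
proof (intro conjI ballI)
 fix t :: real assume t: "t \<in> {0..}"
 then show "S t V \<in> X" using V by auto
 show "((\<lambda>s. p (S s V - S t V)) \<longlongrightarrow> 0) (at t within {0..})"
 proof (rule tendstoI)
  fix e :: real assume "0 < e"
  then obtain d where d: "d > 0" "\<And>h. \<lbrakk>0 \<le> h; h < d\<rbrakk> \<Longrightarrow> p (S h V - V) < e / M"
   using S_small_time[OF V, of "e / M"] M_pos by auto
  have "p (S s V - S t V) < e" if "s \<ge> 0" "\<bar>s - t\<bar> < d" for s
  proof -
   have "p (S s V - S t V) \<le> M * p (S \<bar>s - t\<bar> V - V)"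
   proof (cases "s \<le> t")
    case True
    then show ?thesis using S_increment[of s t V] that V t p_minus_commute[of "S s V" "S t V"] by auto
   next
    case False
    then show ?thesis using S_increment[of t s V] that V t by auto
   qed
   also have "\<dots> < M * (e / M)" using d(2) that M_pos by (intro mult_strict_left_mono) auto
   finally show ?thesis using M_pos by simp
  qed
  then show "\<forall>\<^sub>F s in at t within {0..}. dist (p (S s V - S t V)) 0 < e"
   unfolding eventually_at using d(1) V t by (intro exI[of _ d]) (auto simp: dist_real_def)
 qed
qed

text \<open>
Strong continuity is uniform on the range of \<open>x\<close>, which is compact and can be replaced by finitely
many points because the semigroup is equicontinuous.
\<close>

lemma S_uniform_small_time:
 assumes x: "continuous_on_in X p {a..b} x" and e: "0 < e"
 shows "\<exists>d>0. \<forall>h. 0 \<le> h \<and> h < d \<longrightarrow> (\<forall>s\<in>{a..b}. p (S h (x s) - x s) < e)"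
proof -
 define e' where "e' = e / (M + 2)"
 have e': "0 < e'" "(M + 2) * e' = e" using e M_pos by (auto simp: e'_def)
 obtain g where g: "simple_function (lebesgue_on {a..b}) g" "g ` {a..b} \<subseteq> {a..b}"
   "\<And>s. s \<in> {a..b} \<Longrightarrow> p (x s - x (g s)) \<le> e'"
  using cont_in_grid[OF x e'(1)] by blast
 have fin: "finite (g ` {a..b})" using simple_functionD(1)[OF g(1)] by simp
 have xX: "\<And>s. s \<in> {a..b} \<Longrightarrow> x s \<in> X" using cont_inD(1)[OF x] .
 have "\<forall>v. \<exists>d>0. v \<in> {a..b} \<longrightarrow> (\<forall>h. 0 \<le> h \<and> h < d \<longrightarrow> p (S h (x v) - x v) < e')"
  using S_small_time[OF xX e'(1)] by (meson zero_less_one)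
 from choice[OF this] obtain d where d: "\<And>v. d v > 0"
   "\<And>v h. \<lbrakk>v \<in> {a..b}; 0 \<le> h; h < d v\<rbrakk> \<Longrightarrow> p (S h (x v) - x v) < e'"
  by blast
 define d0 where "d0 = Min (insert 1 (d ` g ` {a..b}))"
 have "d0 > 0" unfolding d0_def using fin d(1) by (subst Min_gr_iff) auto
 moreover have "p (S h (x s) - x s) < e" if h: "0 \<le> h" "h < d0" and s: "s \<in> {a..b}" for h s
 proof -
  have gs: "g s \<in> {a..b}" using g(2) s by blast
  have "d0 \<le> d (g s)" unfolding d0_def using fin s by (intro Min_le) auto
  then have sm: "p (S h (x (g s)) - x (g s)) < e'" using d(2)[OF gs] h by auto
  note X = xX[OF s] xX[OF gs]
  have "p (S h (x s) - x s) \<le> p (S h (x s) - S h (x (g s))) + p (S h (x (g s)) - x s)"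
   using X h by (intro p_triangle_diff) auto
  also have "p (S h (x (g s)) - x s) \<le> p (S h (x (g s)) - x (g s)) + p (x (g s) - x s)"
   using X h by (intro p_triangle_diff) auto
  also have "p (S h (x s) - S h (x (g s))) \<le> M * e'"
   using S_lipschitz[OF h(1) X] g(3)[OF s] M_pos by (meson less_imp_le mult_left_mono order_trans)
  finally have "p (S h (x s) - x s) < M * e' + (e' + e')"
   using sm g(3)[OF s] p_minus_commute[OF X] by linarith
  then show ?thesis using e'(2) by (simp add: algebra_simps)
 qed
 ultimately show ?thesis by blast
qed

text \<open>
Joint continuity of \<open>(t, s) \<mapsto> S t (x s)\<close>, tested with a functional since \<open>X\<close> carries no topology of
its own.
\<close>

lemma continuous_on_joint:
 assumes x: "continuous_on_in X p T x" and l: "bounded_functional l K"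
  and f: "continuous_on A f" "\<And>z. z \<in> A \<Longrightarrow> 0 \<le> f z" and g: "continuous_on A g" "g ` A \<subseteq> T"
 shows "continuous_on A (\<lambda>z. l (S (f z) (x (g z))))"
proof (rule continuous_on_by_control)
 fix z assume z: "z \<in> A"
 have xX: "\<And>s. s \<in> T \<Longrightarrow> x s \<in> X" using cont_inD(1)[OF x] .
 have gz: "x (g z) \<in> X" using z g(2) xX by auto
 let ?c = "\<lambda>w. K * (M * p (x (g w) - x (g z)) + p (S (f w) (x (g z)) - S (f z) (x (g z))))"
 show "\<exists>c. continuous_on A c \<and> c z = 0 \<and> (\<forall>w\<in>A. \<bar>l (S (f w) (x (g w))) - l (S (f z) (x (g z)))\<bar> \<le> c w)"
 proof (intro exI[of _ ?c] conjI ballI)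
  show "continuous_on A ?c"
   using f(2) z gz
   by (intro continuous_intros continuous_on_compose2[OF continuous_on_p_diff[OF x] g]
     continuous_on_compose2[OF continuous_on_p_diff[OF cont_in_orbit] f(1)]) auto
  fix w assume w: "w \<in> A"
  have gw: "x (g w) \<in> X" using w g(2) xX by auto
  have X: "S (f w) (x (g w)) \<in> X" "S (f z) (x (g z)) \<in> X" "S (f w) (x (g z)) \<in> X"
   using gw gz f(2) w z by auto
  have "\<bar>l (S (f w) (x (g w))) - l (S (f z) (x (g z)))\<bar> \<le> K * p (S (f w) (x (g w)) - S (f z) (x (g z)))"
   using functionalD(4,5)[OF l] X by (metis X_diff)
  also have "\<dots> \<le> K * (p (S (f w) (x (g w)) - S (f w) (x (g z))) + p (S (f w) (x (g z)) - S (f z) (x (g z))))"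
   using functionalD(1)[OF l] X by (intro mult_left_mono p_triangle_diff)
  also have "\<dots> \<le> ?c w"
   using functionalD(1)[OF l] S_lipschitz[OF f(2)[OF w] gw gz] by (intro mult_left_mono add_right_mono)
  finally show "\<bar>l (S (f w) (x (g w))) - l (S (f z) (x (g z)))\<bar> \<le> ?c w" .
 qed simp
qed

lemma cont_in_S_reversed:
 assumes x: "continuous_on_in X p {0..t} x"
 shows "continuous_on_in X p {0..t} (\<lambda>s. S (t - s) (x s))"
 unfolding continuous_on_in_def
proof (intro conjI ballI)
 have xX: "\<And>s. s \<in> {0..t} \<Longrightarrow> x s \<in> X" using cont_inD(1)[OF x] .
 fix s0 assume s0: "s0 \<in> {0..t}"
 then show "S (t - s0) (x s0) \<in> X" using xX by auto
 have o: "continuous_on {0..t} (\<lambda>s. p (S (t - s) (x s0) - S (t - s0) (x s0)))"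
  using s0 xX[OF s0]
  by (intro continuous_on_compose2[OF continuous_on_p_diff[OF cont_in_orbit[OF xX[OF s0]]], of "S (t - s0) (x s0)" _ "\<lambda>s. t - s"] continuous_intros) auto
 have "continuous_on {0..t} (\<lambda>s. M * p (x s - x s0) + p (S (t - s) (x s0) - S (t - s0) (x s0)))"
  using s0 xX by (intro continuous_intros o continuous_on_p_diff[OF x]) auto
 then have "((\<lambda>s. M * p (x s - x s0) + p (S (t - s) (x s0) - S (t - s0) (x s0))) \<longlongrightarrow>
   M * p (x s0 - x s0) + p (S (t - s0) (x s0) - S (t - s0) (x s0))) (at s0 within {0..t})"
  using s0 unfolding continuous_on_def by blast
 then have lim: "((\<lambda>s. M * p (x s - x s0) + p (S (t - s) (x s0) - S (t - s0) (x s0))) \<longlongrightarrow> 0) (at s0 within {0..t})"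
  by simp
 show "((\<lambda>s. p (S (t - s) (x s) - S (t - s0) (x s0))) \<longlongrightarrow> 0) (at s0 within {0..t})"
 proof (rule Lim_null_comparison[OF _ lim])
  have "norm (p (S (t - s) (x s) - S (t - s0) (x s0)))
   \<le> M * p (x s - x s0) + p (S (t - s) (x s0) - S (t - s0) (x s0))" if s: "s \<in> {0..t}" for s
  proof -
   have X: "S (t - s) (x s) \<in> X" "S (t - s) (x s0) \<in> X" "S (t - s0) (x s0) \<in> X"
    using s s0 xX by auto
   have "p (S (t - s) (x s) - S (t - s0) (x s0))
     \<le> p (S (t - s) (x s) - S (t - s) (x s0)) + p (S (t - s) (x s0) - S (t - s0) (x s0))"
    using X by (intro p_triangle_diff)
   also have "\<dots> \<le> M * p (x s - x s0) + p (S (t - s) (x s0) - S (t - s0) (x s0))"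
    using s s0 xX by (intro add_right_mono S_lipschitz) auto
   finally show ?thesis using X by simp
  qed
  then show "\<forall>\<^sub>F s in at s0 within {0..t}. norm (p (S (t - s) (x s) - S (t - s0) (x s0)))
   \<le> M * p (x s - x s0) + p (S (t - s) (x s0) - S (t - s0) (x s0))"
   by (auto simp: eventually_at_filter)
 qed
qed

lemma functional_convolution:
 assumes a: "a absolutely_integrable_on {0..t}"
  and x: "continuous_on_in X p {0..t} x" and y: "continuous_on_in X p {0..t} y"
  and l: "bounded_functional l K"
  and I: "has_bochner_integral_in X p (lebesgue_on {0..t}) (\<lambda>s. S (t - s) (a s *\<^sub>R x s + y s)) I"
 shows "((\<lambda>s. a s * l (S (t - s) (x s)) + l (S (t - s) (y s))) has_integral l I) {0..t}"
  and "(\<lambda>s. a s * l (S (t - s) (x s)) + l (S (t - s) (y s))) absolutely_integrable_on {0..t}"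
proof -
 have "has_bochner_integral (lebesgue_on {0..t}) (\<lambda>s. l (S (t - s) (a s *\<^sub>R x s + y s))) (l I)"
  by (rule bochner_functional[OF complete_measure_lebesgue_on l I]) auto
 moreover have "l (S (t - s) (a s *\<^sub>R x s + y s)) = a s * l (S (t - s) (x s)) + l (S (t - s) (y s))"
  if "s \<in> space (lebesgue_on {0..t})" for s
 proof -
  have s: "s \<in> {0..t}" using that by simp
  have X: "x s \<in> X" "y s \<in> X" using s cont_inD(1)[OF x] cont_inD(1)[OF y] by auto
  note f = functionalD[OF functional_S[OF l, of "t - s"]]
  show ?thesis using f(2)[of "a s *\<^sub>R x s" "y s"] f(3)[of "x s" "a s"] X s by simp
 qed
 ultimately have "has_bochner_integral (lebesgue_on {0..t}) (\<lambda>s. a s * l (S (t - s) (x s)) + l (S (t - s) (y s))) (l I)"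
  by (rule has_bochner_integral_cong[OF refl _ refl, THEN iffD1, rotated])
 from has_bochner_integral_lebesgue_on_D[OF this]
 show "((\<lambda>s. a s * l (S (t - s) (x s)) + l (S (t - s) (y s))) has_integral l I) {0..t}"
  and "(\<lambda>s. a s * l (S (t - s) (x s)) + l (S (t - s) (y s))) absolutely_integrable_on {0..t}" by auto
qed

end

locale semigroup_in = stable_semigroup + complete_semi_hilbert
begin

lemma convolution_exists:
 assumes a: "a absolutely_integrable_on {0..t}"
  and x: "continuous_on_in X p {0..t} x" and y: "continuous_on_in X p {0..t} y"
 shows "\<exists>I. has_bochner_integral_in X p (lebesgue_on {0..t}) (\<lambda>s. S (t - s) (a s *\<^sub>R x s + y s)) I"
proof -
 obtain I where I: "has_bochner_integral_in X p (lebesgue_on {0..t}) (\<lambda>s. a s *\<^sub>R S (t - s) (x s) + S (t - s) (y s)) I"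
  using bochner_exists_weighted[OF a cont_in_S_reversed[OF x] cont_in_S_reversed[OF y]] by auto
 have "has_bochner_integral_in X p (lebesgue_on {0..t}) (\<lambda>s. S (t - s) (a s *\<^sub>R x s + y s)) I"
 proof (rule bochner_cong[OF I])
  show "AE s in lebesgue_on {0..t}. S (t - s) (a s *\<^sub>R x s + y s) \<in> X \<and>
    p (a s *\<^sub>R S (t - s) (x s) + S (t - s) (y s) - S (t - s) (a s *\<^sub>R x s + y s)) = 0"
  proof (rule AE_I2)
   fix s assume "s \<in> space (lebesgue_on {0..t})"
   then have s: "s \<in> {0..t}" by simp
   have X: "x s \<in> X" "y s \<in> X" using s cont_inD(1)[OF x] cont_inD(1)[OF y] by auto
   then show "S (t - s) (a s *\<^sub>R x s + y s) \<in> X \<and>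
    p (a s *\<^sub>R S (t - s) (x s) + S (t - s) (y s) - S (t - s) (a s *\<^sub>R x s + y s)) = 0"
    using S_linear[of "t - s" "x s" "y s" "a s" 1] s
     p_minus_commute[of "a s *\<^sub>R S (t - s) (x s) + S (t - s) (y s)" "S (t - s) (a s *\<^sub>R x s + y s)"] by auto
  qed
  show "I \<in> X" "p (I - I) = 0" using I by (auto simp: has_bochner_integral_in_def)
 qed
 then show ?thesis ..
qed

end

lemma scaled_half: "\<lbrakk>(0::real) < m; 0 < k\<rbrakk> \<Longrightarrow> m * (e / (2 * m * k)) * k = e / 2"
 by simp

section \<open>Mild solutions in weak form\<close>

context semigroup_in
begin

text \<open>
Splitting the integral up to \<open>t'\<close> at \<open>t\<close>: on \<open>{0..t}\<close> the integrand changes by the factor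
\<open>S (t' - t) - 1\<close>, which is small on the range of \<open>x\<close> and \<open>y\<close>, and the remainder is an integral over a
short interval.
\<close>

lemma convolution_increment:
 assumes a: "a absolutely_integrable_on {0..T}"
  and x: "continuous_on_in X p {0..T} x" and y: "continuous_on_in X p {0..T} y"
  and tt: "0 \<le> t" "t \<le> t'" "t' \<le> T"
  and I: "has_bochner_integral_in X p (lebesgue_on {0..t}) (\<lambda>s. S (t - s) (a s *\<^sub>R x s + y s)) I"
  and I': "has_bochner_integral_in X p (lebesgue_on {0..t'}) (\<lambda>s. S (t' - s) (a s *\<^sub>R x s + y s)) I'"
  and e: "0 \<le> e" "\<And>s. s \<in> {0..T} \<Longrightarrow> p (S (t' - t) (x s) - x s) \<le> e"
   "\<And>s. s \<in> {0..T} \<Longrightarrow> p (S (t' - t) (y s) - y s) \<le> e"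
  and P: "0 \<le> P" "\<And>s. s \<in> {0..T} \<Longrightarrow> p (x s) \<le> P" "\<And>s. s \<in> {0..T} \<Longrightarrow> p (y s) \<le> P"
 shows "p (I' - I) \<le> M * e * integral {0..T} (\<lambda>s. \<bar>a s\<bar> + 1) + M * P * integral {t..t'} (\<lambda>s. \<bar>a s\<bar> + 1)"
proof -
 define z where "z = I' - I"
 have IX: "I \<in> X" "I' \<in> X" using I I' by (auto simp: has_bochner_integral_in_def)
 have zX: "z \<in> X" using IX by (simp add: z_def)
 let ?l = "\<lambda>u. ip u z"
 note l = bounded_functional_ip[OF zX]
 have xX: "\<And>s. s \<in> {0..T} \<Longrightarrow> x s \<in> X" and yX: "\<And>s. s \<in> {0..T} \<Longrightarrow> y s \<in> X"
  using cont_inD(1)[OF x] cont_inD(1)[OF y] by auto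
 have sub: "a absolutely_integrable_on {0..t}" "a absolutely_integrable_on {0..t'}"
   "continuous_on_in X p {0..t} x" "continuous_on_in X p {0..t} y" "continuous_on_in X p {0..t'} x" "continuous_on_in X p {0..t'} y"
  using tt by (auto intro: absolutely_integrable_on_subinterval[OF a] cont_in_subset[OF x] cont_in_subset[OF y])
 define f where "f s = a s * ?l (S (t - s) (x s)) + ?l (S (t - s) (y s))" for s
 define f' where "f' s = a s * ?l (S (t' - s) (x s)) + ?l (S (t' - s) (y s))" for s
 have f: "(f has_integral ?l I) {0..t}" "f integrable_on {0..t}"
  using functional_convolution(1)[OF sub(1,3,4) l I] unfolding f_def by (auto simp: integrable_on_def)
 have f': "(f' has_integral ?l I') {0..t'}"
  using functional_convolution(1)[OF sub(2,5,6) l I'] unfolding f'_def .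
 have f'i: "f' integrable_on {0..t'}" "f' integrable_on {0..t}" "f' integrable_on {t..t'}"
  using f' tt by (auto simp: integrable_on_def intro: integrable_on_subinterval[unfolded integrable_on_def])
 have bi: "(\<lambda>s. \<bar>a s\<bar> + 1) integrable_on {c..d}" if "0 \<le> c" "d \<le> T" for c d
 proof (rule integrable_on_subinterval)
  show "(\<lambda>s. \<bar>a s\<bar> + 1) integrable_on {0..T}"
   using a by (intro integrable_add) (auto simp: absolutely_integrable_on_def)
 qed (use that in auto)
 have "(p z)\<^sup>2 = ?l I' - ?l I" using functionalD(5)[OF l IX(2,1)] zX by (simp add: p_square z_def)
 also have "\<dots> = integral {0..t'} f' - integral {0..t} f" using f f' by (simp add: integral_unique)
 also have "\<dots> = integral {0..t} (\<lambda>s. f' s - f s) + integral {t..t'} f'"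
  using hk_integral_combine[OF tt(1,2) f'i(1)]
   hk_integral_diff[OF f'i(2) f(2)] by simp
 also have "\<dots> \<le> integral {0..t} (\<lambda>s. (M * e * p z) * (\<bar>a s\<bar> + 1)) + integral {t..t'} (\<lambda>s. (M * P * p z) * (\<bar>a s\<bar> + 1))"
 proof (rule add_mono)
  show "integral {0..t} (\<lambda>s. f' s - f s) \<le> integral {0..t} (\<lambda>s. (M * e * p z) * (\<bar>a s\<bar> + 1))"
  proof (rule integral_le)
   show "(\<lambda>s. f' s - f s) integrable_on {0..t}" using f'i(2) f(2) by (rule integrable_diff)
   show "(\<lambda>s. (M * e * p z) * (\<bar>a s\<bar> + 1)) integrable_on {0..t}"
    using bi[of 0 t] tt by (intro integrable_on_mult_right) auto
   fix s assume s: "s \<in> {0..t}"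
   then have s': "s \<in> {0..T}" using tt by auto
   have incr: "\<bar>?l (S (t' - s) u) - ?l (S (t - s) u)\<bar> \<le> M * e * p z" if u: "u \<in> X" "p (S (t' - t) u - u) \<le> e" for u
   proof -
    have X: "S (t' - s) u \<in> X" "S (t - s) u \<in> X" "S (t' - t) u \<in> X" using u s tt by auto
    have "p (S (t' - s) u - S (t - s) u)
      \<le> p (S (t - s + (t' - t)) u - S (t - s) (S (t' - t) u)) + p (S (t - s) (S (t' - t) u) - S (t - s) u)"
     using X s tt p_triangle_diff[OF X(1) S_X[OF _ X(3)] X(2), of "t - s"] by (simp add: algebra_simps)
    also have "\<dots> \<le> 0 + M * p (S (t' - t) u - u)"
     using s tt u X by (intro add_mono S_lipschitz) (use S_add[of "t - s" "t' - t" u] in auto)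
    also have "\<dots> \<le> M * e" using u M_pos by simp
    finally have "p (S (t' - s) u - S (t - s) u) * p z \<le> M * e * p z"
     using zX by (intro mult_right_mono) auto
    then show ?thesis
     using functionalD(4,5)[OF l] X by (metis X_diff mult.commute order_trans)
   qed
   have "f' s - f s = a s * (?l (S (t' - s) (x s)) - ?l (S (t - s) (x s))) + (?l (S (t' - s) (y s)) - ?l (S (t - s) (y s)))"
    by (simp add: f_def f'_def algebra_simps)
   also have "\<dots> \<le> \<bar>a s\<bar> * (M * e * p z) + M * e * p z"
   proof (rule add_mono)
    have "a s * (?l (S (t' - s) (x s)) - ?l (S (t - s) (x s))) \<le> \<bar>a s\<bar> * \<bar>?l (S (t' - s) (x s)) - ?l (S (t - s) (x s))\<bar>"
     by (metis abs_ge_self abs_mult)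
    also have "\<dots> \<le> \<bar>a s\<bar> * (M * e * p z)" using incr[OF xX[OF s'] e(2)[OF s']] by (intro mult_left_mono) auto
    finally show "a s * (?l (S (t' - s) (x s)) - ?l (S (t - s) (x s))) \<le> \<bar>a s\<bar> * (M * e * p z)" .
    show "?l (S (t' - s) (y s)) - ?l (S (t - s) (y s)) \<le> M * e * p z"
     using incr[OF yX[OF s'] e(3)[OF s']] by simp
   qed
   finally show "f' s - f s \<le> (M * e * p z) * (\<bar>a s\<bar> + 1)" by (simp add: algebra_simps)
  qed
  show "integral {t..t'} f' \<le> integral {t..t'} (\<lambda>s. (M * P * p z) * (\<bar>a s\<bar> + 1))"
  proof (rule integral_le)
   show "f' integrable_on {t..t'}" by (rule f'i(3))
   show "(\<lambda>s. (M * P * p z) * (\<bar>a s\<bar> + 1)) integrable_on {t..t'}"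
    using bi[of t t'] tt by (intro integrable_on_mult_right) auto
   fix s assume s: "s \<in> {t..t'}"
   then have s': "s \<in> {0..T}" using tt by auto
   have b: "\<bar>?l (S (t' - s) u)\<bar> \<le> M * P * p z" if u: "u \<in> X" "p u \<le> P" for u
   proof -
    have "\<bar>?l (S (t' - s) u)\<bar> \<le> p z * p (S (t' - s) u)" using s u functionalD(4)[OF l] by auto
    also have "\<dots> \<le> p z * (M * P)"
     using S_bound[of "t' - s" u] s u zX M_pos by (intro mult_left_mono) (auto intro: order_trans mult_left_mono)
    finally show ?thesis by (simp add: mult_ac)
   qed
   have "f' s \<le> \<bar>a s\<bar> * \<bar>?l (S (t' - s) (x s))\<bar> + \<bar>?l (S (t' - s) (y s))\<bar>"
    unfolding f'_def by (intro add_mono) (auto simp flip: abs_mult)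
   also have "\<dots> \<le> \<bar>a s\<bar> * (M * P * p z) + M * P * p z"
    using b[OF xX[OF s'] P(2)[OF s']] b[OF yX[OF s'] P(3)[OF s']] by (intro add_mono mult_left_mono) auto
   finally show "f' s \<le> (M * P * p z) * (\<bar>a s\<bar> + 1)" by (simp add: algebra_simps)
  qed
 qed
 also have "\<dots> = (M * e * integral {0..t} (\<lambda>s. \<bar>a s\<bar> + 1) + M * P * integral {t..t'} (\<lambda>s. \<bar>a s\<bar> + 1)) * p z"
  unfolding integral_mult_right by (simp add: distrib_right distrib_left mult_ac)
 also have "\<dots> \<le> (M * e * integral {0..T} (\<lambda>s. \<bar>a s\<bar> + 1) + M * P * integral {t..t'} (\<lambda>s. \<bar>a s\<bar> + 1)) * p z"
  using zX M_pos e(1) tt bi[of 0 t] bi[of 0 T]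
  by (intro mult_right_mono add_right_mono mult_left_mono integral_subset_le) auto
 finally have le: "p z * p z \<le> (M * e * integral {0..T} (\<lambda>s. \<bar>a s\<bar> + 1) + M * P * integral {t..t'} (\<lambda>s. \<bar>a s\<bar> + 1)) * p z"
  by (simp add: power2_eq_square)
 have "0 \<le> M * e * integral {0..T} (\<lambda>s. \<bar>a s\<bar> + 1) + M * P * integral {t..t'} (\<lambda>s. \<bar>a s\<bar> + 1)"
  using M_pos e(1) P(1) tt bi by (intro add_nonneg_nonneg mult_nonneg_nonneg hk_integral_nonneg) auto
 then show ?thesis using le p_nonneg[OF zX] unfolding z_def[symmetric]
  by (metis mult_right_le_imp_le order_le_less)
qed

lemma convolution_continuous:
 assumes a: "a absolutely_integrable_on {0..T}"
  and x: "continuous_on_in X p {0..T} x" and y: "continuous_on_in X p {0..T} y"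
  and I: "\<And>t. t \<in> {0..T} \<Longrightarrow>
   has_bochner_integral_in X p (lebesgue_on {0..t}) (\<lambda>s. S (t - s) (a s *\<^sub>R x s + y s)) (I t)"
 shows "continuous_on_in X p {0..T} I"
 unfolding continuous_on_in_def
proof (intro conjI ballI)
 fix t assume t: "t \<in> {0..T}"
 have IX: "I s \<in> X" if "s \<in> {0..T}" for s using I[OF that] by (simp add: has_bochner_integral_in_def)
 show "I t \<in> X" using IX[OF t] .
 let ?b = "\<lambda>s. \<bar>a s\<bar> + 1"
 define B where "B = integral {0..T} ?b"
 have bi: "?b integrable_on {0..T}"
  using a by (intro integrable_add) (auto simp: absolutely_integrable_on_def)
 have B0: "0 \<le> B" unfolding B_def using bi by (intro hk_integral_nonneg) auto
 obtain P1 P2 where "P1 \<ge> 0" "\<forall>s\<in>{0..T}. p (x s) \<le> P1" "P2 \<ge> 0" "\<forall>s\<in>{0..T}. p (y s) \<le> P2"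
  using cont_in_bounded[OF x] cont_in_bounded[OF y] by blast
 then obtain P where P: "0 \<le> P" "\<And>s. s \<in> {0..T} \<Longrightarrow> p (x s) \<le> P" "\<And>s. s \<in> {0..T} \<Longrightarrow> p (y s) \<le> P"
  by (intro that[of "P1 + P2"]) (auto intro: add_increasing add_increasing2)
 have Bc: "continuous_on {0..T} (\<lambda>t. integral {0..t} ?b)" using indefinite_integral_continuous_1[OF bi] .
 show "((\<lambda>s. p (I s - I t)) \<longlongrightarrow> 0) (at t within {0..T})"
 proof (rule tendstoI)
  fix \<epsilon> :: real assume \<epsilon>: "0 < \<epsilon>"
  define e where "e = \<epsilon> / (2 * M * (B + 1))"
  have e: "0 < e" "M * e * B < \<epsilon> / 2"
  proof -
   show "0 < e" using \<epsilon> M_pos B0 by (simp add: e_def)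
   have "M * e * B < M * e * (B + 1)" using \<open>0 < e\<close> M_pos by simp
   also have "\<dots> = \<epsilon> / 2" unfolding e_def using M_pos B0 by (intro scaled_half) auto
   finally show "M * e * B < \<epsilon> / 2" .
  qed
  obtain d1 where d1: "d1 > 0" "\<And>h s. \<lbrakk>0 \<le> h; h < d1; s \<in> {0..T}\<rbrakk> \<Longrightarrow> p (S h (x s) - x s) < e"
   using S_uniform_small_time[OF x e(1)] by auto
  obtain d2 where d2: "d2 > 0" "\<And>h s. \<lbrakk>0 \<le> h; h < d2; s \<in> {0..T}\<rbrakk> \<Longrightarrow> p (S h (y s) - y s) < e"
   using S_uniform_small_time[OF y e(1)] by auto
  have "\<epsilon> / (2 * M * (P + 1)) > 0" using \<epsilon> M_pos P(1) by simp
  then obtain d3 where d3: "d3 > 0" "\<And>s. \<lbrakk>s \<in> {0..T}; dist s t < d3\<rbrakk>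
    \<Longrightarrow> dist (integral {0..s} ?b) (integral {0..t} ?b) < \<epsilon> / (2 * M * (P + 1))"
   using Bc t unfolding continuous_on_iff by blast
  have main: "p (I v - I u) < \<epsilon>"
   if uv: "u \<in> {0..T}" "v \<in> {0..T}" "u \<le> v" "v - u < d1" "v - u < d2"
    "\<bar>integral {0..v} ?b - integral {0..u} ?b\<bar> < \<epsilon> / (2 * M * (P + 1))" for u v
  proof -
   have "integral {0..v} ?b - integral {0..u} ?b = integral {u..v} ?b"
    using hk_integral_combine[of 0 u v ?b] uv integrable_on_subinterval[OF bi, of 0 v] by auto
   then have small: "integral {u..v} ?b \<le> \<epsilon> / (2 * M * (P + 1))" using uv(6) by linarith
   have "p (I v - I u) \<le> M * e * B + M * P * integral {u..v} ?b"
    unfolding B_def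
    using uv d1(2)[of "v - u"] d2(2)[of "v - u"] e(1) P I
    by (intro convolution_increment[OF a x y]) (auto intro: less_imp_le)
   also have "M * P * integral {u..v} ?b \<le> M * (P + 1) * (\<epsilon> / (2 * M * (P + 1)))"
    using M_pos P(1) small uv \<epsilon>
    by (intro mult_mono hk_integral_nonneg integrable_on_subinterval[OF bi]) auto
   also have "\<dots> = M * (\<epsilon> / (2 * M * (P + 1))) * (P + 1)" by (simp only: mult_ac)
   also have "\<dots> = \<epsilon> / 2" using M_pos P(1) by (intro scaled_half) auto
   finally show ?thesis using e(2) by linarith
  qed
  have "p (I s - I t) < \<epsilon>" if s: "s \<in> {0..T}" "dist s t < min d1 (min d2 d3)" for s
  proof (cases "s \<le> t")
   case True
   then have "p (I t - I s) < \<epsilon>"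
    using s t d3(2)[OF s(1)] by (intro main) (auto simp: dist_real_def abs_minus_commute)
   then show ?thesis using p_minus_commute[OF IX[OF s(1)] IX[OF t]] by simp
  next
   case False
   then show ?thesis
    using s t d3(2)[OF s(1)] by (intro main) (auto simp: dist_real_def)
  qed
  then show "\<forall>\<^sub>F s in at t within {0..T}. dist (p (I s - I t)) 0 < \<epsilon>"
   unfolding eventually_at using d1(1) d2(1) d3(1) IX t
   by (intro exI[of _ "min d1 (min d2 d3)"]) (auto simp: dist_real_def)
 qed
qed

text \<open>
The fundamental theorem for orbits: \<open>S h J - J\<close> is the integral of the orbit over \<open>{t..t + h}\<close> minus
the one over \<open>{0..h}\<close>, and each of them divided by \<open>h\<close> converges.
\<close>

lemma orbit_integral_in_generator:
 assumes t: "0 \<le> t" and V: "V \<in> X"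
  and J: "has_bochner_integral_in X p (lebesgue_on {0..t}) (\<lambda>r. S r V) J"
 shows "((\<lambda>h. p ((1 / h) *\<^sub>R (S h J - J) - (S t V - V))) \<longlongrightarrow> 0) (at_right 0)"
proof (rule tendstoI)
 have JX: "J \<in> X" using J by (simp add: has_bochner_integral_in_def)
 fix e :: real assume e: "0 < e"
 define e' where "e' = e / (2 * M + 2)"
 have e': "0 < e'" "(M + 1) * e' < e"
 proof -
  show "0 < e'" using e M_pos by (simp add: e'_def)
  have "(2 * M + 2) * e' = e" using M_pos by (simp add: e'_def)
  then have "2 * ((M + 1) * e') = e" by (simp add: algebra_simps)
  then show "(M + 1) * e' < e" using e by linarith
 qed
 obtain d where d: "d > 0" "\<And>h. \<lbrakk>0 \<le> h; h < d\<rbrakk> \<Longrightarrow> p (S h V - V) < e'"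
  using S_small_time[OF V e'(1)] by auto
 have "p ((1 / h) *\<^sub>R (S h J - J) - (S t V - V)) < e" if h: "0 < h" "h < d" for h
 proof -
  \<comment> \<open>\<open>(p y)\<^sup>2\<close> is the value at \<open>y\<close> of the functional \<open>ip y\<close>, which turns the claim into one on real integrals\<close>
  define y where "y = (S h J - J) - h *\<^sub>R (S t V - V)"
  have X: "S h J \<in> X" "S t V \<in> X" using h t V JX by auto
  have yX: "y \<in> X" using X V JX by (simp add: y_def)
  define f where "f r = ip (S r V) y" for r
  note l = bounded_functional_ip[OF yX]
  have fc: "continuous_on {0..} f"
   unfolding f_def using continuous_on_functional[OF cont_in_orbit[OF V] l] .
  have fi: "f integrable_on {c..c'}" if "0 \<le> c" for c c'
   using that by (intro integrable_continuous_interval continuous_on_subset[OF fc]) auto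
  have "has_bochner_integral (lebesgue_on {0..t}) (\<lambda>r. ip (S r V) y) (ip J y)"
   by (rule bochner_functional[OF complete_measure_lebesgue_on l J]) auto
  from has_bochner_integral_lebesgue_on_D(2)[OF this]
  have i1: "ip J y = integral {0..t} f" by (simp add: f_def[abs_def] integral_unique)
  have "has_bochner_integral (lebesgue_on {0..t}) (\<lambda>r. ip (S h (S r V)) y) (ip (S h J) y)"
   by (rule bochner_functional[OF complete_measure_lebesgue_on functional_S[OF l] J]) (use h in auto)
  from has_bochner_integral_lebesgue_on_D(2)[OF this]
  have "ip (S h J) y = integral {0..t} (\<lambda>r. ip (S h (S r V)) y)" by (simp add: integral_unique)
  also have "\<dots> = integral {0..t} (\<lambda>r. f (r + h))"
  proof (rule integral_cong)
   fix r assume r: "r \<in> {0..t}"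
   show "ip (S h (S r V)) y = f (r + h)"
    unfolding f_def using functional_null_cong[OF l _ _ S_add[of h r V]] h r V by (auto simp: add.commute)
  qed
  also have "\<dots> = integral {h..t + h} f"
   using integral_shift_real_ivl[of h h "t + h" f] by simp
  finally have i2: "ip (S h J) y = integral {h..t + h} f" .
  have "(p y)\<^sup>2 = ip (S h J) y - ip J y - h * (f t - ip V y)"
   using functionalD(2,3,5)[OF l] X JX V yX by (simp add: p_square y_def f_def)
  also have "\<dots> = integral {t..t + h} f - integral {0..h} f - h * (f t - ip V y)"
   unfolding i1 i2
   using hk_integral_combine[of 0 h "t + h" f]
    hk_integral_combine[of 0 t "t + h" f] h t fi by auto
  also have "\<dots> = integral {t..t + h} (\<lambda>r. f r - f t) - integral {0..h} (\<lambda>r. f r - ip V y)"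
   using hk_integral_diff[OF fi[OF t, of "t + h"] integrable_const_ivl, of "f t"]
    hk_integral_diff[OF fi[of 0 h] integrable_const_ivl, of "ip V y"] h
   by (simp add: algebra_simps)
  also have "\<dots> \<le> h * (M * e' * p y) + h * (e' * p y)"
  proof -
   have "norm (integral {t..t + h} (\<lambda>r. f r - f t)) \<le> M * e' * p y * (t + h - t)"
   proof (rule integral_bound)
    show "continuous_on {t..t + h} (\<lambda>r. f r - f t)"
     using t by (intro continuous_intros continuous_on_subset[OF fc]) auto
    show "norm (f r - f t) \<le> M * e' * p y" if r: "r \<in> {t..t + h}" for r
    proof -
     have "\<bar>f r - f t\<bar> \<le> p y * p (S r V - S t V)"
      unfolding f_def using functionalD(4,5)[OF l] r t V by (metis S_X X_diff atLeastAtMost_iff order_trans)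
     also have "\<dots> \<le> p y * (M * p (S (r - t) V - V))"
      using S_increment[of t r V] r t V yX by (intro mult_left_mono) auto
     also have "\<dots> \<le> p y * (M * e')"
      using d(2)[of "r - t"] r h M_pos yX by (intro mult_left_mono) auto
     finally show ?thesis by (simp add: mult_ac)
    qed
   qed (use h in auto)
   moreover have "norm (integral {0..h} (\<lambda>r. f r - ip V y)) \<le> e' * p y * (h - 0)"
   proof (rule integral_bound)
    show "continuous_on {0..h} (\<lambda>r. f r - ip V y)"
     by (intro continuous_intros continuous_on_subset[OF fc]) auto
    show "norm (f r - ip V y) \<le> e' * p y" if r: "r \<in> {0..h}" for r
    proof (cases "r = h")
     case True
     have "\<bar>f r - ip V y\<bar> \<le> p y * p (S r V - V)"
      unfolding f_def using functionalD(4,5)[OF l] r V by (metis S_X X_diff atLeastAtMost_iff)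
     also have "\<dots> \<le> p y * e'" using d(2)[of r] r h yX by (intro mult_left_mono) auto
     finally show ?thesis by (simp add: mult_ac)
    next
     case False
     have "\<bar>f r - ip V y\<bar> \<le> p y * p (S r V - V)"
      unfolding f_def using functionalD(4,5)[OF l] r V by (metis S_X X_diff atLeastAtMost_iff)
     also have "\<dots> \<le> p y * e'" using d(2)[of r] r h yX by (intro mult_left_mono) auto
     finally show ?thesis by (simp add: mult_ac)
    qed
   qed (use h in auto)
   ultimately show ?thesis by (simp add: mult_ac)
  qed
  also have "\<dots> = h * ((M + 1) * e') * p y" by (simp add: algebra_simps)
  finally have "p y * p y \<le> h * ((M + 1) * e') * p y" by (simp add: power2_eq_square)
  then have py: "p y \<le> h * ((M + 1) * e')"
   using p_nonneg[OF yX] h M_pos e'(1) by (cases "p y = 0") auto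
  have "(1 / h) *\<^sub>R (S h J - J) - (S t V - V) = (1 / h) *\<^sub>R y"
   using h by (simp add: y_def scaleR_diff_right)
  then have "p ((1 / h) *\<^sub>R (S h J - J) - (S t V - V)) = p y / h"
   using p_scaleR[OF yX] h by simp
  also have "\<dots> \<le> (M + 1) * e'" using py h by (simp add: field_simps)
  finally show ?thesis using e'(2) by simp
 qed
 then show "\<forall>\<^sub>F h in at_right 0. dist (p ((1 / h) *\<^sub>R (S h J - J) - (S t V - V))) 0 < e"
  unfolding eventually_at_right_field using d(1) V JX t by (intro exI[of _ d]) (auto simp: dist_real_def)
qed

text \<open>
\<open>l\<close> is in the domain of the adjoint of the generator, with image \<open>l'\<close>. The generator enters through
its difference quotients, as its graph is only determined up to null vectors.
\<close>

definition adjoint_functionals :: "('a \<Rightarrow> real) \<Rightarrow> ('a \<Rightarrow> real) \<Rightarrow> bool" where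
 "adjoint_functionals l l' \<longleftrightarrow>
   (\<forall>U\<in>X. \<forall>V\<in>X. ((\<lambda>h. p ((1 / h) *\<^sub>R (S h U - U) - V)) \<longlongrightarrow> 0) (at_right 0) \<longrightarrow> l V = l' U)"

text \<open>
The integral \<open>J\<close> of the orbit is in the domain of the generator, which maps it to \<open>S t V - V\<close>; the claim
is \<open>adjoint_functionals\<close> at \<open>J\<close>. This holds for every \<open>V\<close>, without any regularity.
\<close>

lemma functional_orbit:
 assumes l: "bounded_functional l K" and l': "bounded_functional l' K'"
  and ll': "adjoint_functionals l l'" and t: "0 \<le> t" and V: "V \<in> X"
 shows "l (S t V) = l V + integral {0..t} (\<lambda>r. l' (S r V))"
proof -
 obtain J where J: "has_bochner_integral_in X p (lebesgue_on {0..t}) (\<lambda>r. S r V) J"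
  using bochner_exists_weighted[where c = "\<lambda>_. 0" and a = 0 and b = t and x = "\<lambda>_. 0" and y = "\<lambda>r. S r V"] cont_in_const[OF X_zero]
   cont_in_subset[OF cont_in_orbit[OF V], of "{0..t}"] absolutely_integrable_continuous_real[of 0 t "\<lambda>_. 0"] by auto
 then have JX: "J \<in> X" by (simp add: has_bochner_integral_in_def)
 have "l (S t V - V) = l' J"
  using ll' orbit_integral_in_generator[OF t V J] JX V t unfolding adjoint_functionals_def by auto
 moreover have "has_bochner_integral (lebesgue_on {0..t}) (\<lambda>r. l' (S r V)) (l' J)"
  by (rule bochner_functional[OF complete_measure_lebesgue_on l' J]) auto
 from has_bochner_integral_lebesgue_on_D(2)[OF this]
 have "l' J = integral {0..t} (\<lambda>r. l' (S r V))" by (simp add: integral_unique)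
 ultimately show ?thesis using functionalD(5)[OF l, of "S t V" V] V t by simp
qed

text \<open>
The weak form of \<open>U' = A U + a x + y\<close> for functionals that do not see the forcing. Inserting the
variation of constants formula under the integral and exchanging the order of integration reduces it
to \<open>functional_orbit\<close> for each of the vectors \<open>U0\<close>, \<open>x s\<close>, \<open>y s\<close>.
\<close>

lemma functional_mild:
 assumes a: "a absolutely_integrable_on {0..T}" and T: "0 \<le> T"
  and x: "continuous_on_in X p {0..T} x" and y: "continuous_on_in X p {0..T} y"
  and l: "bounded_functional l K" and l': "bounded_functional l' K'"
  and ll': "adjoint_functionals l l'"
  and lx: "\<And>s. s \<in> {0..T} \<Longrightarrow> l (x s) = 0" and ly: "\<And>s. s \<in> {0..T} \<Longrightarrow> l (y s) = 0"
  and U0: "U0 \<in> X" and U: "\<And>t. t \<in> {0..T} \<Longrightarrow> U t \<in> X"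
  and mild: "\<And>t. t \<in> {0..T} \<Longrightarrow> has_bochner_integral_in X p (lebesgue_on {0..t})
    (\<lambda>s. S (t - s) (a s *\<^sub>R x s + y s)) (U t - S t U0)"
 shows "l (U T) = l U0 + integral {0..T} (\<lambda>r. l' (U r))"
proof -
 have xX: "\<And>s. s \<in> {0..T} \<Longrightarrow> x s \<in> X" and yX: "\<And>s. s \<in> {0..T} \<Longrightarrow> y s \<in> X"
  using cont_inD(1)[OF x] cont_inD(1)[OF y] by auto
 define c where "c = (\<lambda>u z. l' (S (max 0 (fst z - snd z)) (u (snd z))))"
 have cc: "continuous_on ({0..T} \<times> {0..T}) (c u)" if "continuous_on_in X p {0..T} u" for u
  unfolding c_def by (intro continuous_on_joint[OF that l'] continuous_intros) auto
 note cx = cc[OF x] and cy = cc[OF y]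
 have one: "(\<lambda>_. 1::real) absolutely_integrable_on {0..T}"
  by (intro absolutely_integrable_continuous_real continuous_intros)
 note swx = triangle_swap[OF a cx] and swy = triangle_swap[OF one cy]
 have free_i: "(\<lambda>r. l' (S r U0)) integrable_on {0..T}"
  by (intro integrable_continuous_interval continuous_on_subset[OF continuous_on_functional[OF cont_in_orbit[OF U0] l']]) auto
 have rhs: "l' (U r) = l' (S r U0) + (integral {0..r} (\<lambda>s. a s * c x (r, s)) + integral {0..r} (\<lambda>s. 1 * c y (r, s)))"
  if r: "r \<in> {0..T}" for r
 proof -
  have sub: "a absolutely_integrable_on {0..r}" "continuous_on_in X p {0..r} x" "continuous_on_in X p {0..r} y"
   using r by (auto intro: absolutely_integrable_on_subinterval[OF a] cont_in_subset[OF x] cont_in_subset[OF y])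
  have "l' (U r - S r U0) = integral {0..r} (\<lambda>s. a s * l' (S (r - s) (x s)) + l' (S (r - s) (y s)))"
   using functional_convolution(1)[OF sub l' mild[OF r]] by (simp add: integral_unique)
  also have "\<dots> = integral {0..r} (\<lambda>s. a s * c x (r, s) + 1 * c y (r, s))"
   by (intro integral_cong) (auto simp: c_def max_def)
  also have "\<dots> = integral {0..r} (\<lambda>s. a s * c x (r, s)) + integral {0..r} (\<lambda>s. 1 * c y (r, s))"
  proof (rule hk_integral_add)
   have yi: "continuous_on {0..r} (\<lambda>s. c y (r, s))"
    using r by (intro continuous_on_compose2[OF cy] continuous_intros) auto
   then show "(\<lambda>s. 1 * c y (r, s)) integrable_on {0..r}" by (simp add: integrable_continuous_interval)
   have xi: "continuous_on {0..r} (\<lambda>s. c x (r, s))"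
    using r by (intro continuous_on_compose2[OF cx] continuous_intros) auto
   have "(\<lambda>s. c x (r, s) * a s) absolutely_integrable_on {0..r}"
   proof (rule absolutely_integrable_bounded_measurable_product_real[OF _ _ _ sub(1)])
    show "(\<lambda>s. c x (r, s)) \<in> borel_measurable (lebesgue_on {0..r})"
     using xi by (intro continuous_imp_measurable_on_sets_lebesgue) auto
    show "bounded ((\<lambda>s. c x (r, s)) ` {0..r})"
     using compact_continuous_image[OF xi] compact_imp_bounded by blast
   qed auto
   then show "(\<lambda>s. a s * c x (r, s)) integrable_on {0..r}"
    by (simp add: mult.commute absolutely_integrable_on_def)
  qed
  finally show ?thesis using functionalD(5)[OF l' U[OF r], of "S r U0"] r U0 by auto
 qed
 have "integral {0..T} (\<lambda>r. l' (U r)) = integral {0..T} (\<lambda>r. l' (S r U0) + (integral {0..r} (\<lambda>s. a s * c x (r, s)) + integral {0..r} (\<lambda>s. 1 * c y (r, s))))"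
  using rhs by (intro integral_cong) auto
 also have "\<dots> = integral {0..T} (\<lambda>r. l' (S r U0))
   + (integral {0..T} (\<lambda>r. integral {0..r} (\<lambda>s. a s * c x (r, s))) + integral {0..T} (\<lambda>r. integral {0..r} (\<lambda>s. 1 * c y (r, s))))"
  using free_i swx(2) swy(2) by (simp add: hk_integral_add integrable_add)
 finally have R: "integral {0..T} (\<lambda>r. l' (U r)) = integral {0..T} (\<lambda>r. l' (S r U0))
   + (integral {0..T} (\<lambda>s. integral {s..T} (\<lambda>r. a s * c x (r, s))) + integral {0..T} (\<lambda>s. integral {s..T} (\<lambda>r. 1 * c y (r, s))))"
  using swx(1) swy(1) by simp
 have inner: "l (S (T - s) (u s)) = integral {s..T} (\<lambda>r. c u (r, s))"
  if s: "s \<in> {0..T}" and u: "continuous_on_in X p {0..T} u" "l (u s) = 0" for s u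
 proof -
  have us: "u s \<in> X" using cont_inD(1)[OF u(1) s] .
  have "l (S (T - s) (u s)) = integral {0..T - s} (\<lambda>r. l' (S r (u s)))"
   using functional_orbit[OF l l' ll' _ us, of "T - s"] s u(2) by simp
  also have "\<dots> = integral {0..T - s} (\<lambda>r. l' (S (max 0 (r + s - s)) (u s)))"
   by (intro integral_cong) auto
  also have "\<dots> = integral {s..T} (\<lambda>r. c u (r, s))"
   using integral_shift_real_ivl[of s s T "\<lambda>r. c u (r, s)"] by (simp add: c_def)
  finally show ?thesis .
 qed
 have T': "T \<in> {0..T}" using T by simp
 have "l (U T - S T U0) = integral {0..T} (\<lambda>s. a s * l (S (T - s) (x s)) + l (S (T - s) (y s)))"
  using functional_convolution(1)[OF a x y l mild[OF T']] by (simp add: integral_unique)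
 also have "\<dots> = integral {0..T} (\<lambda>s. integral {s..T} (\<lambda>r. a s * c x (r, s)) + integral {s..T} (\<lambda>r. 1 * c y (r, s)))"
  using inner[OF _ x lx] inner[OF _ y ly] by (intro integral_cong) auto
 also have "\<dots> = integral {0..T} (\<lambda>s. integral {s..T} (\<lambda>r. a s * c x (r, s))) + integral {0..T} (\<lambda>s. integral {s..T} (\<lambda>r. 1 * c y (r, s)))"
  using swx(3) swy(3) by (rule hk_integral_add)
 finally show ?thesis
  using R functional_orbit[OF l l' ll' T U0] functionalD(5)[OF l U[OF T'], of "S T U0"] T U0 by auto
qed

end

section \<open>Integral inequalities and comparison of convolutions\<close>

lemma absolutely_integrable_times_continuous:
 fixes a f :: "real \<Rightarrow> real"
 assumes "a absolutely_integrable_on {c..d}" "continuous_on {c..d} f"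
 shows "(\<lambda>s. a s * f s) absolutely_integrable_on {c..d}"
proof -
 have "(\<lambda>s. f s * a s) absolutely_integrable_on {c..d}"
 proof (rule absolutely_integrable_bounded_measurable_product_real[OF _ _ _ assms(1)])
  show "f \<in> borel_measurable (lebesgue_on {c..d})"
   using assms(2) by (intro continuous_imp_measurable_on_sets_lebesgue) auto
  show "bounded (f ` {c..d})"
   using compact_continuous_image[OF assms(2)] compact_imp_bounded by blast
 qed auto
 then show ?thesis by (simp add: mult.commute)
qed

text \<open>
The kernel is merely integrable, so the usual differentiation is replaced by a partition of
\<open>{0..T}\<close> on whose pieces \<open>A = \<integral> b\<close> grows by \<open>d\<close>: the right-hand side \<open>\<psi>\<close> is increasing, whence
\<open>(1 - d) * \<psi> t \<le> \<psi> s\<close> on each piece, and \<open>(1 - A T / n)\<^sup>n\<close> tends to \<open>exp (- A T)\<close>.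
\<close>

lemma gronwall_integrable_kernel:
 fixes \<phi> b :: "real \<Rightarrow> real"
 assumes T: "0 \<le> T" and cont: "continuous_on {0..T} \<phi>" and pos: "\<And>t. t \<in> {0..T} \<Longrightarrow> 0 \<le> \<phi> t"
  and b: "b absolutely_integrable_on {0..T}" and b0: "\<And>t. t \<in> {0..T} \<Longrightarrow> 0 \<le> b t"
  and le: "\<And>t. t \<in> {0..T} \<Longrightarrow> \<phi> t \<le> a + integral {0..t} (\<lambda>s. b s * \<phi> s)"
 shows "\<phi> T \<le> a * exp (integral {0..T} b)"
proof -
 define A where "A t = integral {0..t} b" for t
 define \<psi> where "\<psi> t = a + integral {0..t} (\<lambda>s. b s * \<phi> s)" for t
 have bi: "b integrable_on {0..T}" using b by (simp add: absolutely_integrable_on_def)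
 have b\<phi>: "(\<lambda>s. b s * \<phi> s) integrable_on {0..T}"
  using absolutely_integrable_times_continuous[OF b cont] by (simp add: absolutely_integrable_on_def)
 have Ac: "continuous_on {0..T} A" unfolding A_def using indefinite_integral_continuous_1[OF bi] .
 have A_incr: "A t - A s = integral {s..t} b" if "0 \<le> s" "s \<le> t" "t \<le> T" for s t
  unfolding A_def using that hk_integral_combine[of 0 s t b] integrable_on_subinterval[OF bi, of 0 t] by auto
 have \<psi>_incr: "\<psi> t - \<psi> s = integral {s..t} (\<lambda>s. b s * \<phi> s)" if "0 \<le> s" "s \<le> t" "t \<le> T" for s t
  unfolding \<psi>_def using that hk_integral_combine[of 0 s t "\<lambda>s. b s * \<phi> s"] integrable_on_subinterval[OF b\<phi>, of 0 t] by auto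
 have \<psi>_mono: "\<psi> s \<le> \<psi> t" if st: "0 \<le> s" "s \<le> t" "t \<le> T" for s t
 proof -
  have "0 \<le> integral {s..t} (\<lambda>s. b s * \<phi> s)"
   using st pos b0 by (intro hk_integral_nonneg integrable_on_subinterval[OF b\<phi>]) auto
  then show ?thesis using \<psi>_incr[OF st] by simp
 qed
 have step: "\<psi> t - \<psi> s \<le> \<psi> t * (A t - A s)" if st: "0 \<le> s" "s \<le> t" "t \<le> T" for s t
 proof -
  have "integral {s..t} (\<lambda>s. b s * \<phi> s) \<le> integral {s..t} (\<lambda>s. \<psi> t * b s)"
  proof (rule integral_le)
   show "(\<lambda>s. b s * \<phi> s) integrable_on {s..t}" using st by (intro integrable_on_subinterval[OF b\<phi>]) auto
   show "(\<lambda>s. \<psi> t * b s) integrable_on {s..t}"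
    using st by (intro integrable_on_mult_right integrable_on_subinterval[OF bi]) auto
   fix r assume r: "r \<in> {s..t}"
   have "\<phi> r \<le> \<psi> t" using le[of r] \<psi>_mono[of r t] r st by (auto simp: \<psi>_def)
   then show "b r * \<phi> r \<le> \<psi> t * b r" using b0[of r] r st by (simp add: mult.commute mult_right_mono)
  qed
  then show ?thesis using \<psi>_incr[OF st] A_incr[OF st] by simp
 qed
 have A0: "A 0 = 0" and \<psi>0: "\<psi> 0 = a" by (simp_all add: A_def \<psi>_def)
 have A_nonneg: "0 \<le> A t" if "t \<in> {0..T}" for t
  unfolding A_def using that b0 by (intro hk_integral_nonneg integrable_on_subinterval[OF bi]) auto
 have \<psi>_nonneg: "0 \<le> \<psi> t" if "t \<in> {0..T}" for t
  using le[OF that] pos[OF that] by (simp add: \<psi>_def)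
 have ind: "\<psi> t * (1 - d) ^ i \<le> a" if d: "0 \<le> d" "d < 1" and t: "t \<in> {0..T}" "A t \<le> real i * d" for d i t
  using t
 proof (induction i arbitrary: t)
  case 0
  then have "A t = 0" using A_nonneg[of t] by simp
  then show ?case using step[of 0 t] 0 A0 \<psi>0 by simp
 next
  case (Suc i)
  show ?case
  proof (cases "A t \<le> real i * d")
   case True
   have "\<psi> t * (1 - d) ^ Suc i \<le> \<psi> t * (1 - d) ^ i"
    using \<psi>_nonneg[OF Suc.prems(1)] d by (intro mult_left_mono power_decreasing) auto
   then show ?thesis using Suc.IH[OF Suc.prems(1) True] by simp
  next
   case False
   have "\<exists>s. 0 \<le> s \<and> s \<le> t \<and> A s = real i * d"
    using False d Suc.prems by (intro IVT' continuous_on_subset[OF Ac]) (auto simp: A0)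
   then obtain s where s: "0 \<le> s" "s \<le> t" "A s = real i * d" by auto
   have "\<psi> t * (A t - A s) \<le> \<psi> t * d"
    using Suc.prems s \<psi>_nonneg by (intro mult_left_mono) (auto simp: algebra_simps)
   then have "\<psi> t * (1 - d) \<le> \<psi> s"
    using step[of s t] s Suc.prems by (simp add: algebra_simps)
   then have "\<psi> t * (1 - d) * (1 - d) ^ i \<le> \<psi> s * (1 - d) ^ i"
    using d by (intro mult_right_mono) auto
   also have "\<dots> \<le> a" using s Suc.prems by (intro Suc.IH) auto
   finally show ?thesis by (simp add: mult_ac)
  qed
 qed
 have "(\<lambda>n. \<psi> T * (1 + (- A T) / real n) ^ n) \<longlonglongrightarrow> \<psi> T * exp (- A T)"
  by (intro tendsto_intros tendsto_exp_limit_sequentially)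
 moreover have "\<forall>\<^sub>F n in sequentially. \<psi> T * (1 + (- A T) / real n) ^ n \<le> a"
 proof -
  obtain N :: nat where N: "A T < real N" using reals_Archimedean2 by blast
  have "\<psi> T * (1 + (- A T) / real n) ^ n \<le> a" if "n \<ge> max N 1" for n
   using ind[of "A T / real n" T n] A_nonneg[of T] T N that by simp
  then show ?thesis unfolding eventually_sequentially by blast
 qed
 ultimately have "\<psi> T * exp (- A T) \<le> a" by (intro tendsto_upperbound) auto
 then have "\<psi> T \<le> a * exp (A T)" by (simp add: exp_minus field_simps)
 then show ?thesis using le[of T] T by (simp add: \<psi>_def A_def)
qed

text \<open>
The substitution \<open>s \<mapsto> s + \<tau>\<close>; the interval may be enlarged up to \<open>t\<close> since the integrand is
nonnegative. This trades the delay in \<open>\<phi>\<close> for a shift of the kernel, as Gronwall's inequality needs.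
\<close>

lemma integral_delay_le:
 fixes \<phi> g :: "real \<Rightarrow> real"
 assumes \<tau>: "0 < \<tau>" and t: "0 \<le> t"
  and cont: "continuous_on {-\<tau>..t} \<phi>" and pos: "\<And>s. s \<in> {-\<tau>..t} \<Longrightarrow> 0 \<le> \<phi> s"
  and g: "g absolutely_integrable_on {0..t + \<tau>}" and g0: "\<And>s. 0 \<le> g s"
 shows "integral {0..t} (\<lambda>s. g s * \<phi> (s - \<tau>))
   \<le> integral {-\<tau>..0} (\<lambda>s. g (s + \<tau>) * \<phi> s) + integral {0..t} (\<lambda>s. g (s + \<tau>) * \<phi> s)"
proof -
 have "(\<lambda>s. g s * \<phi> (s - \<tau>)) integrable_on {0..t + \<tau>}"
 proof -
  have "continuous_on {0..t + \<tau>} (\<lambda>s. \<phi> (s - \<tau>))"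
   by (rule continuous_on_compose2[OF cont]) (auto intro!: continuous_intros)
  then show ?thesis
   using absolutely_integrable_times_continuous[OF g] by (simp add: absolutely_integrable_on_def)
 qed
 then have "((\<lambda>s. g s * \<phi> (s - \<tau>)) has_integral integral {0..t + \<tau>} (\<lambda>s. g s * \<phi> (s - \<tau>))) {0..t + \<tau>}"
  by (rule integrable_integral)
 then have "((\<lambda>s. g (s + \<tau>) * \<phi> (s + \<tau> - \<tau>)) has_integral integral {0..t + \<tau>} (\<lambda>s. g s * \<phi> (s - \<tau>))) {0 - \<tau>..t + \<tau> - \<tau>}"
  by (rule has_integral_shift_real_ivl)
 then have hi: "((\<lambda>s. g (s + \<tau>) * \<phi> s) has_integral integral {0..t + \<tau>} (\<lambda>s. g s * \<phi> (s - \<tau>))) {-\<tau>..t}"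
  by simp
 then have i: "(\<lambda>s. g (s + \<tau>) * \<phi> s) integrable_on {-\<tau>..t}" by (auto simp: integrable_on_def)
 have "integral {0..t} (\<lambda>s. g s * \<phi> (s - \<tau>)) = integral {-\<tau>..t - \<tau>} (\<lambda>s. g (s + \<tau>) * \<phi> s)"
  using integral_shift_real_ivl[of 0 \<tau> t "\<lambda>s. g s * \<phi> (s - \<tau>)"] by simp
 also have "\<dots> \<le> integral {-\<tau>..t} (\<lambda>s. g (s + \<tau>) * \<phi> s)"
  using \<tau> pos g0 by (intro integral_subset_le integrable_on_subinterval[OF i] i) auto
 also have "\<dots> = integral {-\<tau>..0} (\<lambda>s. g (s + \<tau>) * \<phi> s) + integral {0..t} (\<lambda>s. g (s + \<tau>) * \<phi> s)"
  using \<tau> t by (intro hk_integral_combine[symmetric] i) auto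
 finally show ?thesis .
qed

context semi_hilbert
begin

text \<open>Nonlinear terms inherit continuity from the states on which they depend.\<close>

lemma cont_in_controlled:
 assumes U: "continuous_on_in X p T U" and W: "continuous_on_in X p T W"
  and V: "\<And>t. t \<in> T \<Longrightarrow> V t \<in> X"
  and le: "\<And>s t. \<lbrakk>s \<in> T; t \<in> T\<rbrakk> \<Longrightarrow> p (V s - V t) \<le> K * (p (U s - U t) + p (W s - W t))"
 shows "continuous_on_in X p T V"
 unfolding continuous_on_in_def
proof (intro conjI ballI)
 fix t assume t: "t \<in> T"
 show "V t \<in> X" using V[OF t] .
 have "((\<lambda>s. K * (p (U s - U t) + p (W s - W t))) \<longlongrightarrow> K * (0 + 0)) (at t within T)"
  by (intro tendsto_intros cont_inD(2)[OF U t] cont_inD(2)[OF W t])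
 then have "((\<lambda>s. K * (p (U s - U t) + p (W s - W t))) \<longlongrightarrow> 0) (at t within T)" by simp
 then show "((\<lambda>s. p (V s - V t)) \<longlongrightarrow> 0) (at t within T)"
  by (rule Lim_null_comparison[rotated]) (use le V t in \<open>auto simp: eventually_at_filter\<close>)
qed

lemma cont_in_cong:
 assumes "continuous_on_in X p T U" "\<And>t. t \<in> T \<Longrightarrow> V t \<in> X" "\<And>t. t \<in> T \<Longrightarrow> p (U t - V t) = 0"
 shows "continuous_on_in X p T V"
proof (rule cont_in_controlled[OF assms(1,1,2), of _ 1])
 fix s t assume st: "s \<in> T" "t \<in> T"
 then have X: "U s \<in> X" "U t \<in> X" "V s \<in> X" "V t \<in> X" using cont_inD(1)[OF assms(1)] assms(2) by auto
 have "p (V s - V t) \<le> p (V s - U s) + (p (U s - U t) + p (U t - V t))"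
  using p_triangle_diff[OF X(3,1,4)] p_triangle_diff[OF X(1,2,4)] by linarith
 moreover have "p (V s - U s) = 0" "p (U t - V t) = 0" "0 \<le> p (U s - U t)"
  using assms(3) st p_minus_commute[OF X(1,3)] X by auto
 ultimately show "p (V s - V t) \<le> 1 * (p (U s - U t) + p (U s - U t))" by simp
qed auto

lemma cont_in_glue:
 assumes U: "continuous_on_in X p {a..c} U" "continuous_on_in X p {c..} U" and ac: "a \<le> c"
 shows "continuous_on_in X p {a..} U"
proof -
 have un: "{a..} = {a..c} \<union> {c..}" using ac by auto
 have UX: "U t \<in> X" if "t \<in> {a..}" for t
  using that cont_inD(1)[OF U(1)] cont_inD(1)[OF U(2)] unfolding un by auto
 have "((\<lambda>s. p (U s - U t)) \<longlongrightarrow> 0) (at t within {a..})" if t: "t \<in> {a..}" for t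
 proof -
  have "continuous_on ({a..c} \<union> {c..}) (\<lambda>s. p (U s - U t))"
   using UX[OF t] by (intro continuous_on_closed_Un continuous_on_p_diff U) auto
  then have "((\<lambda>s. p (U s - U t)) \<longlongrightarrow> p (U t - U t)) (at t within {a..})"
   using t unfolding un[symmetric] continuous_on_def by blast
  then show ?thesis by simp
 qed
 then show ?thesis using UX by (simp add: continuous_on_in_def)
qed

lemma cont_in_halfline:
 assumes "\<And>T. continuous_on_in X p {a..T} U"
 shows "continuous_on_in X p {a..} U"
 unfolding continuous_on_in_def
proof (intro conjI ballI)
 fix t assume t: "t \<in> {a..}"
 then show "U t \<in> X" using cont_inD(1)[OF assms[of t]] by auto
 have "at t within {a..} = at t within {a..t+1}"
  by (rule at_within_nhd[of _ "{..<t+1}"]) auto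
 then show "((\<lambda>s. p (U s - U t)) \<longlongrightarrow> 0) (at t within {a..})"
  using cont_inD(2)[OF assms[of "t + 1"], of t] t by simp
qed

lemma cont_in_uniform_limit:
 assumes U: "\<And>n. continuous_on_in X p T (U n)" and V: "\<And>t. t \<in> T \<Longrightarrow> V t \<in> X"
  and e: "e \<longlonglongrightarrow> 0" "\<And>n t. t \<in> T \<Longrightarrow> p (U n t - V t) \<le> e n"
 shows "continuous_on_in X p T V"
 unfolding continuous_on_in_def
proof (intro conjI ballI)
 fix t assume t: "t \<in> T"
 show "V t \<in> X" using V[OF t] .
 show "((\<lambda>s. p (V s - V t)) \<longlongrightarrow> 0) (at t within T)"
 proof (rule tendstoI)
  fix \<epsilon> :: real assume \<epsilon>: "0 < \<epsilon>"
  obtain n where n: "e n < \<epsilon> / 3"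
   using order_tendstoD(2)[OF e(1), of "\<epsilon> / 3"] \<epsilon> by (auto simp: eventually_sequentially)
  have "\<forall>\<^sub>F s in at t within T. \<bar>p (U n s - U n t)\<bar> < \<epsilon> / 3"
   using tendstoD[OF cont_inD(2)[OF U t], of "\<epsilon> / 3" n] \<epsilon> by simp
  moreover have "\<forall>\<^sub>F s in at t within T. s \<in> T" by (simp add: eventually_at_filter)
  ultimately show "\<forall>\<^sub>F s in at t within T. dist (p (V s - V t)) 0 < \<epsilon>"
  proof eventually_elim
   case (elim s)
   have X: "U n s \<in> X" "U n t \<in> X" "V s \<in> X" "V t \<in> X" using cont_inD(1)[OF U] V elim t by auto
   have "p (V s - V t) \<le> p (V s - U n s) + (p (U n s - U n t) + p (U n t - V t))"
    using p_triangle_diff[OF X(3,1,4)] p_triangle_diff[OF X(1,2,4)] by linarith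
   then show ?case
    using elim n e(2)[OF elim(2), of n] e(2)[OF t, of n] p_minus_commute[OF X(1,3)] X by (simp add: dist_real_def)
  qed
 qed
qed

lemma has_bochner_in_zero: "has_bochner_integral_in X p M (\<lambda>_. 0) 0"
proof -
 have s: "Bochner_Integration.simple_bochner_integrable M (\<lambda>_. 0)"
  by (auto intro!: Bochner_Integration.simple_bochner_integrable.intros)
 have "has_bochner_integral_in X p M (\<lambda>_. 0) (Bochner_Integration.simple_bochner_integral M (\<lambda>_. 0))"
  by (rule has_bochner_in_simple[OF s]) auto
 moreover have "Bochner_Integration.simple_bochner_integral M (\<lambda>_. 0) = (0::'v)"
  unfolding Bochner_Integration.simple_bochner_integral_def by (intro sum.neutral) auto
 ultimately show ?thesis by metis
qed

text \<open>The tail of the geometric series bounds the distance to the limit.\<close>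

lemma geometric_limit_bound:
 assumes U: "\<And>n. U n \<in> X" and L: "L \<in> X" "(\<lambda>n. p (U n - L)) \<longlonglongrightarrow> 0"
  and step: "\<And>n. p (U (Suc n) - U n) \<le> C * (1/2) ^ n"
 shows "p (U n - L) \<le> 2 * C * (1/2) ^ n"
proof -
 have tele: "p (U (n + k) - U n) \<le> 2 * C * (1/2) ^ n - 2 * C * (1/2) ^ (n + k)" for k
 proof (induction k)
  case (Suc k)
  have "p (U (n + Suc k) - U n) \<le> p (U (Suc (n + k)) - U (n + k)) + p (U (n + k) - U n)"
   using p_triangle_diff[of "U (Suc (n + k))" "U (n + k)" "U n"] U by simp
  also have "\<dots> \<le> C * (1/2) ^ (n + k) + (2 * C * (1/2) ^ n - 2 * C * (1/2) ^ (n + k))"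
   using step Suc.IH by (intro add_mono)
  finally show ?case by simp
 qed simp
 have C: "0 \<le> C" using order_trans[OF p_nonneg[OF X_diff[OF U U]] step[of 0]] by simp
 have "p (U n - L) \<le> 2 * C * (1/2) ^ n + p (U (n + k) - L)" for k
 proof -
  have "p (U n - L) \<le> p (U n - U (n + k)) + p (U (n + k) - L)"
   by (intro p_triangle_diff U L)
  moreover have "0 \<le> 2 * C * (1/2) ^ (n + k)" using C by simp
  ultimately show ?thesis using tele[of k] p_minus_commute[OF U U, of n "n + k"] by linarith
 qed
 moreover have "(\<lambda>k. 2 * C * (1/2) ^ n + p (U (n + k) - L)) \<longlonglongrightarrow> 2 * C * (1/2) ^ n + 0"
  using LIMSEQ_ignore_initial_segment[OF L(2), of n] by (intro tendsto_intros) (simp add: add.commute)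
 ultimately show ?thesis using tendsto_lowerbound[of _ "2 * C * (1/2) ^ n + 0" sequentially "p (U n - L)"] by auto
qed

end

context complete_semi_hilbert
begin

lemma geometric_converges:
 assumes U: "\<And>n. U n \<in> X" and step: "\<And>n. p (U (Suc n) - U n) \<le> C * (1/2) ^ n"
 shows "\<exists>L\<in>X. (\<lambda>n. p (U n - L)) \<longlonglongrightarrow> 0"
proof (rule complete_X[OF U])
 have C: "0 \<le> C" using order_trans[OF p_nonneg[OF X_diff[OF U U]] step[of 0]] by simp
 have tele: "p (U (n + k) - U n) \<le> 2 * C * (1/2) ^ n - 2 * C * (1/2) ^ (n + k)" for n k
 proof (induction k)
  case (Suc k)
  have "p (U (n + Suc k) - U n) \<le> p (U (Suc (n + k)) - U (n + k)) + p (U (n + k) - U n)"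
   using p_triangle_diff[of "U (Suc (n + k))" "U (n + k)" "U n"] U by simp
  also have "\<dots> \<le> C * (1/2) ^ (n + k) + (2 * C * (1/2) ^ n - 2 * C * (1/2) ^ (n + k))"
   using step Suc.IH by (intro add_mono)
  finally show ?case by simp
 qed simp
 fix e :: real assume "0 < e"
 have "(\<lambda>n. 4 * C * (1/2) ^ n) \<longlonglongrightarrow> 0" by (intro tendsto_mult_right_zero LIMSEQ_realpow_zero) auto
 from order_tendstoD(2)[OF this \<open>0 < e\<close>] obtain N where N: "4 * C * (1/2) ^ N < e"
  by (auto simp: eventually_sequentially)
 have "p (U m - U n) < e" if mn: "m \<ge> N" "n \<ge> N" for m n
 proof -
  have "p (U j - U N) \<le> 2 * C * (1/2) ^ N" if "j \<ge> N" for j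
  proof -
   have "0 \<le> 2 * C * (1/2) ^ j" using C by simp
   then show ?thesis using tele[of N "j - N"] that by simp
  qed
  from add_mono[OF this[OF mn(1)] this[OF mn(2)]]
  have "p (U m - U N) + p (U n - U N) \<le> 4 * C * (1/2) ^ N" by simp
  moreover have "p (U m - U n) \<le> p (U m - U N) + p (U N - U n)" by (intro p_triangle_diff U)
  ultimately show ?thesis using N p_minus_commute[OF U U, of n N] by linarith
 qed
 then show "\<exists>N. \<forall>m\<ge>N. \<forall>n\<ge>N. p (U m - U n) < e" by blast
qed

end

context semigroup_in
begin

text \<open>
The Lipschitz estimate behind existence, uniqueness and decay; it keeps the decay factor of the
semigroup inside the integral.
\<close>

lemma convolution_compare:
 assumes a: "a absolutely_integrable_on {0..t}"
  and x: "continuous_on_in X p {0..t} x" and y: "continuous_on_in X p {0..t} y"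
  and x': "continuous_on_in X p {0..t} x'" and y': "continuous_on_in X p {0..t} y'"
  and I: "has_bochner_integral_in X p (lebesgue_on {0..t}) (\<lambda>s. S (t - s) (a s *\<^sub>R x s + y s)) I"
  and I': "has_bochner_integral_in X p (lebesgue_on {0..t}) (\<lambda>s. S (t - s) (a s *\<^sub>R x' s + y' s)) I'"
  and fg: "continuous_on {0..t} f" "continuous_on {0..t} g"
   "\<And>s. s \<in> {0..t} \<Longrightarrow> p (x s - x' s) \<le> f s" "\<And>s. s \<in> {0..t} \<Longrightarrow> p (y s - y' s) \<le> g s"
 shows "p (I - I') \<le> integral {0..t} (\<lambda>s. M * exp (- \<omega> * (t - s)) * (\<bar>a s\<bar> * f s + g s))"
proof -
 let ?h = "\<lambda>s. M * exp (- \<omega> * (t - s)) * (\<bar>a s\<bar> * f s + g s)"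
 have "(\<lambda>s. \<bar>a s\<bar> * (M * exp (- \<omega> * (t - s)) * f s)) absolutely_integrable_on {0..t}"
  using fg a by (intro absolutely_integrable_times_continuous continuous_intros set_integrable_abs)
 moreover have "(\<lambda>s. M * exp (- \<omega> * (t - s)) * g s) absolutely_integrable_on {0..t}"
  using fg by (intro absolutely_integrable_continuous_real continuous_intros)
 ultimately have "(\<lambda>s. \<bar>a s\<bar> * (M * exp (- \<omega> * (t - s)) * f s) + M * exp (- \<omega> * (t - s)) * g s) absolutely_integrable_on {0..t}"
  by (rule set_integral_add(1))
 moreover have "(\<lambda>s. \<bar>a s\<bar> * (M * exp (- \<omega> * (t - s)) * f s) + M * exp (- \<omega> * (t - s)) * g s) = ?h"
  by (simp add: fun_eq_iff algebra_simps)
 ultimately have hi: "?h absolutely_integrable_on {0..t}" by simp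
 note hi' = absolutely_integrable_imp_integrable_lebesgue_on[OF hi]
 have "p (I - I') \<le> (\<integral>s. ?h s \<partial>lebesgue_on {0..t})"
 proof (rule bochner_diff_bound[OF complete_measure_lebesgue_on I I' hi'(1)])
  show "AE s in lebesgue_on {0..t}. p (S (t - s) (a s *\<^sub>R x s + y s) - S (t - s) (a s *\<^sub>R x' s + y' s)) \<le> ?h s"
  proof (rule AE_I2)
   fix s assume "s \<in> space (lebesgue_on {0..t})"
   then have s: "s \<in> {0..t}" by simp
   have X: "x s \<in> X" "y s \<in> X" "x' s \<in> X" "y' s \<in> X"
    using s cont_inD(1)[OF x] cont_inD(1)[OF y] cont_inD(1)[OF x'] cont_inD(1)[OF y'] by auto
   have "p (S (t - s) (a s *\<^sub>R x s + y s) - S (t - s) (a s *\<^sub>R x' s + y' s))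
     \<le> M * exp (- \<omega> * (t - s)) * p ((a s *\<^sub>R x s + y s) - (a s *\<^sub>R x' s + y' s))"
    using s X by (intro S_lipschitz_exp) auto
   also have "(a s *\<^sub>R x s + y s) - (a s *\<^sub>R x' s + y' s) = a s *\<^sub>R (x s - x' s) + (y s - y' s)"
    by (simp add: algebra_simps)
   also have "p \<dots> \<le> \<bar>a s\<bar> * f s + g s"
   proof -
    have "p (a s *\<^sub>R (x s - x' s) + (y s - y' s)) \<le> p (a s *\<^sub>R (x s - x' s)) + p (y s - y' s)"
     using X by (intro p_triangle) auto
    also have "\<dots> \<le> \<bar>a s\<bar> * f s + g s"
     using X fg s by (intro add_mono) (auto simp: p_scaleR intro: mult_left_mono)
    finally show ?thesis .
   qed
   finally show "p (S (t - s) (a s *\<^sub>R x s + y s) - S (t - s) (a s *\<^sub>R x' s + y' s)) \<le> ?h s"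
    using M_pos by (simp add: mult_left_mono)
  qed
 qed auto
 then show ?thesis using hi'(2) by simp
qed

lemma convolution_zero:
 "0 \<le> t \<Longrightarrow> has_bochner_integral_in X p (lebesgue_on {0..t}) (\<lambda>s. S (t - s) (a s *\<^sub>R 0 + 0)) 0"
proof (rule bochner_cong[OF has_bochner_in_zero])
 show "AE s in lebesgue_on {0..t}. S (t - s) (a s *\<^sub>R 0 + 0) \<in> X \<and> p (0 - S (t - s) (a s *\<^sub>R 0 + 0)) = 0"
 proof (rule AE_I2)
  fix s assume s: "s \<in> space (lebesgue_on {0..t})"
  have "p (S (t - s) 0) = 0"
   using S_bound[of "t - s" 0] p_nonneg[OF S_X[of "t - s" 0]] s by (intro antisym) auto
  then show "S (t - s) (a s *\<^sub>R 0 + 0) \<in> X \<and> p (0 - S (t - s) (a s *\<^sub>R 0 + 0)) = 0"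
   using s p_minus_commute[of 0 "S (t - s) 0"] by auto
 qed
qed auto

lemma convolution_bound:
 assumes t: "0 \<le> t" and a: "a absolutely_integrable_on {0..t}"
  and x: "continuous_on_in X p {0..t} x" and y: "continuous_on_in X p {0..t} y"
  and I: "has_bochner_integral_in X p (lebesgue_on {0..t}) (\<lambda>s. S (t - s) (a s *\<^sub>R x s + y s)) I"
  and fg: "continuous_on {0..t} f" "continuous_on {0..t} g"
   "\<And>s. s \<in> {0..t} \<Longrightarrow> p (x s) \<le> f s" "\<And>s. s \<in> {0..t} \<Longrightarrow> p (y s) \<le> g s"
 shows "p I \<le> integral {0..t} (\<lambda>s. M * exp (- \<omega> * (t - s)) * (\<bar>a s\<bar> * f s + g s))"
 using convolution_compare[OF a x y cont_in_const[OF X_zero] cont_in_const[OF X_zero] I convolution_zero[OF t] fg(1,2)] fg(3,4)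
 by simp

end

section \<open>Uniqueness and decay for delayed equations\<close>

locale delayed_semigroup = semigroup_in +
 fixes \<tau> :: real and \<alpha> :: "real \<Rightarrow> real"
 assumes tau_pos: "0 < \<tau>"
  and alpha_int: "\<And>T. \<alpha> absolutely_integrable_on {0..T}"
begin

text \<open>
The forcing \<open>\<alpha> s *\<^sub>R x s + y s\<close> is an independent argument, so that solutions of the truncated and of
the original equation are covered by the same estimates.
\<close>

definition mild_solution ::
  "(real \<Rightarrow> 'a) \<Rightarrow> (real \<Rightarrow> 'a) \<Rightarrow> (real \<Rightarrow> 'a) \<Rightarrow> bool" where
 "mild_solution x y U \<longleftrightarrow> (\<forall>t\<ge>0. has_bochner_integral_in X p (lebesgue_on {0..t})
    (\<lambda>s. S (t - s) (\<alpha> s *\<^sub>R x s + y s)) (U t - S t (U 0)))"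

text \<open>
In the norm weighted with \<open>exp (- l * s)\<close> a delayed term gains the factor \<open>exp (- l * \<tau>)\<close>. This
replaces the smallness of short time integrals, which is not available uniformly for integrable \<open>\<alpha>\<close>.
\<close>

lemma integral_delay_exp_le:
 assumes T: "t \<in> {0..T}" and l: "0 < l"
 shows "integral {0..t} (\<lambda>s. \<bar>\<alpha> s\<bar> * exp (l * (s - \<tau>))) \<le> exp (l * (t - \<tau>)) * integral {0..T} (\<lambda>s. \<bar>\<alpha> s\<bar>)"
proof -
 have ai: "(\<lambda>s. \<bar>\<alpha> s\<bar>) absolutely_integrable_on {0..t'}" for t' using alpha_int by (rule set_integrable_abs)
 have "integral {0..t} (\<lambda>s. \<bar>\<alpha> s\<bar> * exp (l * (s - \<tau>))) \<le> integral {0..t} (\<lambda>s. exp (l * (t - \<tau>)) * \<bar>\<alpha> s\<bar>)"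
 proof (rule integral_le)
  have "(\<lambda>s. \<bar>\<alpha> s\<bar> * exp (l * (s - \<tau>))) absolutely_integrable_on {0..t}"
   by (intro absolutely_integrable_times_continuous ai continuous_intros)
  then show "(\<lambda>s. \<bar>\<alpha> s\<bar> * exp (l * (s - \<tau>))) integrable_on {0..t}" by (simp add: absolutely_integrable_on_def)
  show "(\<lambda>s. exp (l * (t - \<tau>)) * \<bar>\<alpha> s\<bar>) integrable_on {0..t}"
   using ai[of t] by (intro integrable_on_mult_right) (simp add: absolutely_integrable_on_def)
  fix s assume "s \<in> {0..t}"
  then have "exp (l * (s - \<tau>)) \<le> exp (l * (t - \<tau>))" using l by simp
  then show "\<bar>\<alpha> s\<bar> * exp (l * (s - \<tau>)) \<le> exp (l * (t - \<tau>)) * \<bar>\<alpha> s\<bar>" by (simp add: mult.commute mult_left_mono)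
 qed
 also have "\<dots> = exp (l * (t - \<tau>)) * integral {0..t} (\<lambda>s. \<bar>\<alpha> s\<bar>)" by simp
 also have "\<dots> \<le> exp (l * (t - \<tau>)) * integral {0..T} (\<lambda>s. \<bar>\<alpha> s\<bar>)"
  using T ai[of t] ai[of T] by (intro mult_left_mono integral_subset_le) (auto simp: absolutely_integrable_on_def)
 finally show ?thesis .
qed

text \<open>
Gronwall's inequality for \<open>p (U t - V t)\<close>: the delay is moved to the kernel by \<open>integral_delay_le\<close>, and
the contribution of the initial interval is zero.
\<close>

lemma mild_difference_vanishes:
 assumes T: "0 \<le> T" and b: "0 \<le> b" and K: "0 \<le> K"
  and U: "continuous_on_in X p {-\<tau>..T} U" and V: "continuous_on_in X p {-\<tau>..T} V"
  and init: "\<And>s. s \<in> {-\<tau>..0} \<Longrightarrow> p (U s - V s) = 0"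
  and mildU: "mild_solution x y U" and mildV: "mild_solution x' y' V"
  and cx: "continuous_on_in X p {0..T} x" and cy: "continuous_on_in X p {0..T} y"
  and cx': "continuous_on_in X p {0..T} x'" and cy': "continuous_on_in X p {0..T} y'"
  and x: "\<And>s. s \<in> {0..T} \<Longrightarrow> p (x s - x' s) \<le> b * p (U (s - \<tau>) - V (s - \<tau>))"
  and y: "\<And>s. s \<in> {0..T} \<Longrightarrow> p (y s - y' s) \<le> K * (p (U s - V s) + p (U (s - \<tau>) - V (s - \<tau>)))"
 shows "p (U T - V T) = 0"
proof -
 have UX: "\<And>s. s \<in> {-\<tau>..T} \<Longrightarrow> U s \<in> X" and VX: "\<And>s. s \<in> {-\<tau>..T} \<Longrightarrow> V s \<in> X"
  using cont_inD(1)[OF U] cont_inD(1)[OF V] by auto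
 define \<phi> where "\<phi> t = p (U t - V t)" for t
 have cU: "continuous_on_in X p {-\<tau>..T} (\<lambda>s. U s - V s)"
 proof (rule cont_in_controlled[OF U V, of _ 1])
  fix s t assume st: "s \<in> {-\<tau>..T}" "t \<in> {-\<tau>..T}"
  have eq: "U s - V s - (U t - V t) = (U s - U t) - (V s - V t)" by (simp add: algebra_simps)
  show "p (U s - V s - (U t - V t)) \<le> 1 * (p (U s - U t) + p (V s - V t))"
   unfolding eq mult_1 using UX[OF st(1)] UX[OF st(2)] VX[OF st(1)] VX[OF st(2)] by (intro p_diff_le X_diff)
 qed (use UX VX in auto)
 have c\<phi>: "continuous_on {-\<tau>..T} \<phi>" unfolding \<phi>_def using continuous_on_p[OF cU] .
 have \<phi>0: "0 \<le> \<phi> s" if "s \<in> {-\<tau>..T}" for s unfolding \<phi>_def using UX[OF that] VX[OF that] by simp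
 define g where "g s = M * (b * \<bar>\<alpha> s\<bar> + K)" for s
 have g: "g absolutely_integrable_on {0..t}" for t
  unfolding g_def
  by (intro set_integrable_mult_right set_integral_add(1) set_integrable_abs alpha_int absolutely_integrable_continuous_real continuous_intros)
 have g0: "0 \<le> g s" for s unfolding g_def using M_pos b K by simp
 have gs: "(\<lambda>s. g (s + \<tau>)) absolutely_integrable_on {0..t}" for t
 proof -
  have "g absolutely_integrable_on {\<tau>..t + \<tau>}"
   using tau_pos by (intro absolutely_integrable_on_subinterval[OF g[of "t + \<tau>"]]) auto
  then show ?thesis
   using g0 has_integral_shift_real_ivl[of g _ \<tau> "t + \<tau>" \<tau>] unfolding absolutely_integrable_on_def integrable_on_def by auto
 qed
 have est: "\<phi> t \<le> 0 + integral {0..t} (\<lambda>s. (g (s + \<tau>) + M * K) * \<phi> s)" if t: "t \<in> {0..T}" for t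
 proof -
  have c1: "continuous_on {0..t} \<phi>" using t tau_pos by (intro continuous_on_subset[OF c\<phi>]) auto
  have c2: "continuous_on {0..t} (\<lambda>s. \<phi> (s - \<tau>))"
   using t tau_pos by (intro continuous_on_compose2[OF c\<phi>] continuous_intros) auto
  let ?I = "U t - S t (U 0)" and ?I' = "V t - S t (V 0)"
  have U0: "U 0 \<in> X" "V 0 \<in> X" "U t \<in> X" "V t \<in> X" using UX VX t tau_pos by auto
  have SX: "S t (U 0) \<in> X" "S t (V 0) \<in> X" using U0 t by auto
  have "p (?I - ?I') \<le> integral {0..t} (\<lambda>s. M * exp (- \<omega> * (t - s)) * (\<bar>\<alpha> s\<bar> * (b * \<phi> (s - \<tau>)) + K * (\<phi> s + \<phi> (s - \<tau>))))"
   using t mildU mildV x y unfolding mild_solution_def \<phi>_def[symmetric]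
   by (intro convolution_compare[OF alpha_int cont_in_subset[OF cx] cont_in_subset[OF cy] cont_in_subset[OF cx'] cont_in_subset[OF cy']]
     continuous_intros c1 c2) auto
  also have "\<dots> \<le> integral {0..t} (\<lambda>s. g s * \<phi> (s - \<tau>) + M * K * \<phi> s)"
  proof (rule integral_le)
   have "(\<lambda>s. \<bar>\<alpha> s\<bar> * (M * exp (- \<omega> * (t - s)) * (b * \<phi> (s - \<tau>))) + M * exp (- \<omega> * (t - s)) * (K * (\<phi> s + \<phi> (s - \<tau>)))) absolutely_integrable_on {0..t}"
    by (intro set_integral_add(1) absolutely_integrable_times_continuous set_integrable_abs alpha_int
      absolutely_integrable_continuous_real continuous_intros c1 c2)
   then show "(\<lambda>s. M * exp (- \<omega> * (t - s)) * (\<bar>\<alpha> s\<bar> * (b * \<phi> (s - \<tau>)) + K * (\<phi> s + \<phi> (s - \<tau>)))) integrable_on {0..t}"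
    by (simp add: absolutely_integrable_on_def algebra_simps)
   have "(\<lambda>s. g s * \<phi> (s - \<tau>) + M * K * \<phi> s) absolutely_integrable_on {0..t}"
    by (intro set_integral_add(1) absolutely_integrable_times_continuous g
      absolutely_integrable_continuous_real continuous_intros c1 c2)
   then show "(\<lambda>s. g s * \<phi> (s - \<tau>) + M * K * \<phi> s) integrable_on {0..t}" by (simp add: absolutely_integrable_on_def)
   fix s assume s: "s \<in> {0..t}"
   have nn: "0 \<le> \<phi> s" "0 \<le> \<phi> (s - \<tau>)" using s t tau_pos by (auto intro!: \<phi>0)
   have "M * exp (- \<omega> * (t - s)) * (\<bar>\<alpha> s\<bar> * (b * \<phi> (s - \<tau>)) + K * (\<phi> s + \<phi> (s - \<tau>)))
     \<le> M * 1 * (\<bar>\<alpha> s\<bar> * (b * \<phi> (s - \<tau>)) + K * (\<phi> s + \<phi> (s - \<tau>)))"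
    using M_pos omega_pos s b K nn by (intro mult_right_mono mult_left_mono) auto
   then show "M * exp (- \<omega> * (t - s)) * (\<bar>\<alpha> s\<bar> * (b * \<phi> (s - \<tau>)) + K * (\<phi> s + \<phi> (s - \<tau>))) \<le> g s * \<phi> (s - \<tau>) + M * K * \<phi> s"
    by (simp add: g_def algebra_simps)
  qed
  also have "\<dots> = integral {0..t} (\<lambda>s. g s * \<phi> (s - \<tau>)) + integral {0..t} (\<lambda>s. M * K * \<phi> s)"
  proof (rule hk_integral_add)
   show "(\<lambda>s. g s * \<phi> (s - \<tau>)) integrable_on {0..t}"
    using absolutely_integrable_times_continuous[OF g c2] by (simp add: absolutely_integrable_on_def)
   show "(\<lambda>s. M * K * \<phi> s) integrable_on {0..t}" by (intro integrable_continuous_interval continuous_intros c1)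
  qed
  also have "integral {0..t} (\<lambda>s. g s * \<phi> (s - \<tau>))
    \<le> integral {-\<tau>..0} (\<lambda>s. g (s + \<tau>) * \<phi> s) + integral {0..t} (\<lambda>s. g (s + \<tau>) * \<phi> s)"
   using t tau_pos by (intro integral_delay_le g g0 continuous_on_subset[OF c\<phi>] \<phi>0) auto
  also have "integral {-\<tau>..0} (\<lambda>s. g (s + \<tau>) * \<phi> s) = integral {-\<tau>..0} (\<lambda>s. 0)"
   using init by (intro integral_cong) (simp add: \<phi>_def)
  also have "integral {-\<tau>..0} (\<lambda>s. 0) + integral {0..t} (\<lambda>s. g (s + \<tau>) * \<phi> s) + integral {0..t} (\<lambda>s. M * K * \<phi> s)
    = integral {0..t} (\<lambda>s. (g (s + \<tau>) + M * K) * \<phi> s)"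
  proof -
   have "(\<lambda>s. g (s + \<tau>) * \<phi> s) integrable_on {0..t}"
    using absolutely_integrable_times_continuous[OF gs c1] by (simp add: absolutely_integrable_on_def)
   moreover have "(\<lambda>s. M * K * \<phi> s) integrable_on {0..t}" by (intro integrable_continuous_interval continuous_intros c1)
   ultimately have "integral {0..t} (\<lambda>s. g (s + \<tau>) * \<phi> s + M * K * \<phi> s)
     = integral {0..t} (\<lambda>s. g (s + \<tau>) * \<phi> s) + integral {0..t} (\<lambda>s. M * K * \<phi> s)"
    by (rule hk_integral_add)
   then show ?thesis by (simp add: distrib_right)
  qed
  finally have main: "p (?I - ?I') \<le> integral {0..t} (\<lambda>s. (g (s + \<tau>) + M * K) * \<phi> s)" by simp
  have "p (S t (U 0) - S t (V 0)) \<le> M * p (U 0 - V 0)" using t U0 by (intro S_lipschitz) auto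
  moreover have "p (U 0 - V 0) = 0" using init tau_pos by simp
  moreover have "\<phi> t \<le> p (?I - ?I') + p (S t (U 0) - S t (V 0))"
  proof -
   have "U t - V t = (?I - ?I') + (S t (U 0) - S t (V 0))" by simp
   then show ?thesis unfolding \<phi>_def using U0 SX by (metis X_diff p_triangle)
  qed
  ultimately show ?thesis using main by simp
 qed
 have "\<phi> T \<le> 0 * exp (integral {0..T} (\<lambda>s. g (s + \<tau>) + M * K))"
 proof (rule gronwall_integrable_kernel[OF T _ _ _ _ est])
  show "continuous_on {0..T} \<phi>" using tau_pos by (intro continuous_on_subset[OF c\<phi>]) auto
  show "0 \<le> \<phi> t" if "t \<in> {0..T}" for t using that tau_pos by (intro \<phi>0) auto
  show "(\<lambda>s. g (s + \<tau>) + M * K) absolutely_integrable_on {0..T}"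
   by (intro set_integral_add(1) gs absolutely_integrable_continuous_real continuous_intros)
  show "0 \<le> g (t + \<tau>) + M * K" for t using g0[of "t + \<tau>"] M_pos K by simp
 qed
 then show ?thesis using \<phi>0[of T] T tau_pos by (simp add: \<phi>_def)
qed

text \<open>
Gronwall's inequality for \<open>exp (\<omega> * t) * p (U t)\<close>. Shifting the delay costs \<open>exp (\<omega> * \<tau>)\<close> and
separates the contribution of the initial interval, which gives the constant \<open>b * \<sigma> + l * \<tau>\<close>. In the
exponent remain \<open>\<gamma> + \<omega>' * t\<close> from the delayed linear term and \<open>M * (exp (\<omega> * \<tau>) + 1) * l * t\<close> from the
nonlinear one.
\<close>

lemma mild_decay:
 assumes b: "0 \<le> b" and l: "0 \<le> l" and \<rho>: "0 \<le> \<rho>"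
  and U: "continuous_on_in X p {-\<tau>..} U"
  and init: "\<And>s. s \<in> {-\<tau>..0} \<Longrightarrow> p (U s) \<le> \<rho>"
  and mild: "mild_solution x y U"
  and cx: "continuous_on_in X p {0..} x" and cy: "continuous_on_in X p {0..} y"
  and x: "\<And>s. s \<ge> 0 \<Longrightarrow> p (x s) \<le> b * p (U (s - \<tau>))"
  and y: "\<And>s. s \<ge> 0 \<Longrightarrow> p (y s) \<le> l * (p (U s) + p (U (s - \<tau>)))"
  and sigma: "integral {0..\<tau>} (\<lambda>s. \<bar>\<alpha> s\<bar>) \<le> \<sigma>"
  and growth: "\<And>t. t > 0 \<Longrightarrow> M * b * exp (\<omega> * \<tau>) * integral {0..t} (\<lambda>s. \<bar>\<alpha> (s + \<tau>)\<bar>) \<le> \<gamma> + \<omega>' * t"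
  and gamma: "0 \<le> \<gamma>" and t: "0 \<le> t"
 shows "p (U t) \<le> \<rho> * (M + M * exp (\<omega> * \<tau>) * (b * \<sigma> + l * \<tau>)) * exp \<gamma>
   * exp (- (\<omega> - \<omega>' - M * (exp (\<omega> * \<tau>) + 1) * l) * t)"
proof -
 have UX: "\<And>s. s \<in> {-\<tau>..} \<Longrightarrow> U s \<in> X" using cont_inD(1)[OF U] by auto
 define \<phi> where "\<phi> t = exp (\<omega> * t) * p (U t)" for t
 have c\<phi>: "continuous_on {-\<tau>..} \<phi>" unfolding \<phi>_def by (intro continuous_intros continuous_on_p[OF U])
 have \<phi>0: "0 \<le> \<phi> s" if "s \<in> {-\<tau>..}" for s unfolding \<phi>_def using UX[OF that] by simp
 define E where "E = exp (\<omega> * \<tau>)"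
 have E: "0 < E" by (simp add: E_def)
 define g where "g s = M * E * (b * \<bar>\<alpha> s\<bar> + l)" for s
 have ai: "(\<lambda>s. \<bar>\<alpha> s\<bar>) absolutely_integrable_on {0..t}" for t using alpha_int by (rule set_integrable_abs)
 have g: "g absolutely_integrable_on {0..t}" for t
  unfolding g_def
  by (intro set_integrable_mult_right set_integral_add(1) ai absolutely_integrable_continuous_real continuous_intros)
 have g0: "0 \<le> g s" for s unfolding g_def using M_pos b l E by simp
 have shift: "(\<lambda>s. f (s + \<tau>)) absolutely_integrable_on {0..t}"
  if f: "\<And>t. f absolutely_integrable_on {0..t}" "\<And>s. 0 \<le> f s" for f :: "real \<Rightarrow> real" and t
 proof -
  have "f absolutely_integrable_on {\<tau>..t + \<tau>}"
   using tau_pos by (intro absolutely_integrable_on_subinterval[OF f(1)[of "t + \<tau>"]]) auto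
  then show ?thesis
   using f(2) has_integral_shift_real_ivl[of f _ \<tau> "t + \<tau>" \<tau>] unfolding absolutely_integrable_on_def integrable_on_def by auto
 qed
 note gs = shift[OF g g0]
 define a where "a = \<rho> * (M + M * E * (b * \<sigma> + l * \<tau>))"
 have est: "\<phi> t \<le> a + integral {0..t} (\<lambda>s. (g (s + \<tau>) + M * l) * \<phi> s)" if t: "0 \<le> t" for t
 proof -
  have c1: "continuous_on {0..t} \<phi>" using t tau_pos by (intro continuous_on_subset[OF c\<phi>]) auto
  have c2: "continuous_on {0..t} (\<lambda>s. \<phi> (s - \<tau>))"
   using t tau_pos by (intro continuous_on_compose2[OF c\<phi>] continuous_intros) auto
  have d1: "continuous_on {0..t} (\<lambda>s. p (U s))"
   using t tau_pos by (intro continuous_on_subset[OF continuous_on_p[OF U]]) auto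
  have d2: "continuous_on {0..t} (\<lambda>s. p (U (s - \<tau>)))"
   using t tau_pos by (intro continuous_on_compose2[OF continuous_on_p[OF U]] continuous_intros) auto
  have X: "U 0 \<in> X" "U t \<in> X" "S t (U 0) \<in> X" using UX t tau_pos by auto
  have "p (U t - S t (U 0)) \<le> integral {0..t} (\<lambda>s. M * exp (- \<omega> * (t - s)) * (\<bar>\<alpha> s\<bar> * (b * p (U (s - \<tau>))) + l * (p (U s) + p (U (s - \<tau>)))))"
   using t mild x y unfolding mild_solution_def
   by (intro convolution_bound[OF t alpha_int cont_in_subset[OF cx] cont_in_subset[OF cy]] continuous_intros d1 d2) auto
  then have "exp (\<omega> * t) * p (U t - S t (U 0)) \<le> exp (\<omega> * t) * integral {0..t} (\<lambda>s. M * exp (- \<omega> * (t - s)) * (\<bar>\<alpha> s\<bar> * (b * p (U (s - \<tau>))) + l * (p (U s) + p (U (s - \<tau>)))))"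
   by (intro mult_left_mono) auto
  also have "\<dots> = integral {0..t} (\<lambda>s. exp (\<omega> * t) * (M * exp (- \<omega> * (t - s)) * (\<bar>\<alpha> s\<bar> * (b * p (U (s - \<tau>))) + l * (p (U s) + p (U (s - \<tau>))))))"
   by simp
  also have "\<dots> = integral {0..t} (\<lambda>s. g s * \<phi> (s - \<tau>) + M * l * \<phi> s)"
  proof (rule integral_cong)
   fix s
   have e1: "exp (\<omega> * t) * exp (- \<omega> * (t - s)) = exp (\<omega> * s)" by (simp add: exp_add[symmetric] algebra_simps)
   have e2: "exp (\<omega> * s) = E * exp (\<omega> * (s - \<tau>))" by (simp add: E_def exp_add[symmetric] algebra_simps)
   have "exp (\<omega> * t) * (M * exp (- \<omega> * (t - s)) * (\<bar>\<alpha> s\<bar> * (b * p (U (s - \<tau>))) + l * (p (U s) + p (U (s - \<tau>)))))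
     = (exp (\<omega> * t) * exp (- \<omega> * (t - s))) * (M * ((b * \<bar>\<alpha> s\<bar> + l) * p (U (s - \<tau>)) + l * p (U s)))"
    by (simp add: algebra_simps)
   also have "\<dots> = M * (b * \<bar>\<alpha> s\<bar> + l) * (exp (\<omega> * s) * p (U (s - \<tau>))) + M * l * (exp (\<omega> * s) * p (U s))"
    unfolding e1 by (simp add: algebra_simps)
   also have "exp (\<omega> * s) * p (U (s - \<tau>)) = E * \<phi> (s - \<tau>)" unfolding e2 \<phi>_def by simp
   also have "exp (\<omega> * s) * p (U s) = \<phi> s" by (simp add: \<phi>_def)
   finally show "exp (\<omega> * t) * (M * exp (- \<omega> * (t - s)) * (\<bar>\<alpha> s\<bar> * (b * p (U (s - \<tau>))) + l * (p (U s) + p (U (s - \<tau>)))))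
     = g s * \<phi> (s - \<tau>) + M * l * \<phi> s"
    by (simp add: g_def mult_ac)
  qed
  also have "\<dots> = integral {0..t} (\<lambda>s. g s * \<phi> (s - \<tau>)) + integral {0..t} (\<lambda>s. M * l * \<phi> s)"
  proof (rule hk_integral_add)
   show "(\<lambda>s. g s * \<phi> (s - \<tau>)) integrable_on {0..t}"
    using absolutely_integrable_times_continuous[OF g c2] by (simp add: absolutely_integrable_on_def)
   show "(\<lambda>s. M * l * \<phi> s) integrable_on {0..t}" by (intro integrable_continuous_interval continuous_intros c1)
  qed
  also have "integral {0..t} (\<lambda>s. g s * \<phi> (s - \<tau>))
    \<le> integral {-\<tau>..0} (\<lambda>s. g (s + \<tau>) * \<phi> s) + integral {0..t} (\<lambda>s. g (s + \<tau>) * \<phi> s)"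
   using t tau_pos by (intro integral_delay_le g g0 continuous_on_subset[OF c\<phi>] \<phi>0) auto
  also have "integral {-\<tau>..0} (\<lambda>s. g (s + \<tau>) * \<phi> s) \<le> \<rho> * (M * E * (b * \<sigma> + l * \<tau>))"
  proof -
   have sh: "((\<lambda>s. g (s + \<tau>)) has_integral integral {0..\<tau>} g) {-\<tau>..0}"
    using has_integral_shift_real_ivl[of g "integral {0..\<tau>} g" 0 \<tau> \<tau>] g[of \<tau>]
    by (auto simp: absolutely_integrable_on_def)
   have shi: "(\<lambda>s. g (s + \<tau>)) absolutely_integrable_on {-\<tau>..0}"
    using sh g0 by (auto simp: absolutely_integrable_on_def integrable_on_def)
   have "integral {-\<tau>..0} (\<lambda>s. g (s + \<tau>) * \<phi> s) \<le> integral {-\<tau>..0} (\<lambda>s. \<rho> * g (s + \<tau>))"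
   proof (rule integral_le)
    show "(\<lambda>s. g (s + \<tau>) * \<phi> s) integrable_on {-\<tau>..0}"
     using absolutely_integrable_times_continuous[OF shi continuous_on_subset[OF c\<phi>]] by (auto simp: absolutely_integrable_on_def)
    show "(\<lambda>s. \<rho> * g (s + \<tau>)) integrable_on {-\<tau>..0}" using sh by (intro integrable_on_mult_right) (auto simp: integrable_on_def)
    fix s assume s: "s \<in> {-\<tau>..0}"
    have "exp (\<omega> * s) * p (U s) \<le> 1 * \<rho>"
     using s init[OF s] omega_pos UX[of s] by (intro mult_mono) (auto simp: mult_nonneg_nonpos)
    then have "g (s + \<tau>) * (exp (\<omega> * s) * p (U s)) \<le> g (s + \<tau>) * \<rho>"
     using g0[of "s + \<tau>"] by (intro mult_left_mono) auto
    then show "g (s + \<tau>) * \<phi> s \<le> \<rho> * g (s + \<tau>)" by (simp add: \<phi>_def mult_ac)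
   qed
   also have "\<dots> = \<rho> * integral {0..\<tau>} g" using sh by (simp add: integral_unique)
   also have "integral {0..\<tau>} g = M * E * (b * integral {0..\<tau>} (\<lambda>s. \<bar>\<alpha> s\<bar>) + l * \<tau>)"
   proof -
    have "integral {0..\<tau>} (\<lambda>s. b * \<bar>\<alpha> s\<bar> + l) = integral {0..\<tau>} (\<lambda>s. b * \<bar>\<alpha> s\<bar>) + integral {0..\<tau>} (\<lambda>s. l)"
     using ai[of \<tau>] by (intro hk_integral_add integrable_on_mult_right)
      (auto simp: absolutely_integrable_on_def)
    then show ?thesis unfolding g_def using tau_pos by simp
   qed
   also have "\<rho> * \<dots> \<le> \<rho> * (M * E * (b * \<sigma> + l * \<tau>))"
    using sigma \<rho> M_pos E b by (intro mult_left_mono add_right_mono) auto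
   finally show ?thesis .
  qed
  finally have main: "exp (\<omega> * t) * p (U t - S t (U 0)) \<le> \<rho> * (M * E * (b * \<sigma> + l * \<tau>))
   + integral {0..t} (\<lambda>s. g (s + \<tau>) * \<phi> s) + integral {0..t} (\<lambda>s. M * l * \<phi> s)" by simp
  have "(\<lambda>s. g (s + \<tau>) * \<phi> s) integrable_on {0..t}"
   using absolutely_integrable_times_continuous[OF gs c1] by (simp add: absolutely_integrable_on_def)
  moreover have "(\<lambda>s. M * l * \<phi> s) integrable_on {0..t}" by (intro integrable_continuous_interval continuous_intros c1)
  ultimately have "integral {0..t} (\<lambda>s. g (s + \<tau>) * \<phi> s + M * l * \<phi> s)
     = integral {0..t} (\<lambda>s. g (s + \<tau>) * \<phi> s) + integral {0..t} (\<lambda>s. M * l * \<phi> s)"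
   by (rule hk_integral_add)
  then have comb: "integral {0..t} (\<lambda>s. g (s + \<tau>) * \<phi> s) + integral {0..t} (\<lambda>s. M * l * \<phi> s)
    = integral {0..t} (\<lambda>s. (g (s + \<tau>) + M * l) * \<phi> s)"
   by (simp add: distrib_right)
  have "p (U t) \<le> p (U t - S t (U 0)) + p (S t (U 0))"
   using p_triangle[of "U t - S t (U 0)" "S t (U 0)"] X by simp
  then have "\<phi> t \<le> exp (\<omega> * t) * p (U t - S t (U 0)) + exp (\<omega> * t) * p (S t (U 0))"
   unfolding \<phi>_def by (simp add: distrib_left[symmetric])
  also have "exp (\<omega> * t) * p (S t (U 0)) \<le> exp (\<omega> * t) * (M * exp (- \<omega> * t) * p (U 0))"
   using stable[OF t X(1)] by (intro mult_left_mono) auto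
  also have "\<dots> = M * p (U 0)" by (simp add: exp_minus)
  also have "\<dots> \<le> M * \<rho>" using init[of 0] tau_pos M_pos by simp
  finally show ?thesis using main comb by (simp add: a_def algebra_simps)
 qed
 have a0: "0 \<le> a"
 proof -
  have "0 \<le> integral {0..\<tau>} (\<lambda>s. \<bar>\<alpha> s\<bar>)"
   using ai[of \<tau>] by (intro hk_integral_nonneg) (auto simp: absolutely_integrable_on_def)
  then have "0 \<le> \<sigma>" using sigma by simp
  then show ?thesis unfolding a_def using \<rho> M_pos E b l tau_pos by simp
 qed
 have "\<phi> t \<le> a * exp (integral {0..t} (\<lambda>s. g (s + \<tau>) + M * l))"
 proof (rule gronwall_integrable_kernel[OF t])
  show "continuous_on {0..t} \<phi>" using tau_pos by (intro continuous_on_subset[OF c\<phi>]) auto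
  show "0 \<le> \<phi> s" if "s \<in> {0..t}" for s using that tau_pos by (intro \<phi>0) auto
  show "(\<lambda>s. g (s + \<tau>) + M * l) absolutely_integrable_on {0..t}"
   by (intro set_integral_add(1) gs absolutely_integrable_continuous_real continuous_intros)
  show "0 \<le> g (s + \<tau>) + M * l" for s using g0[of "s + \<tau>"] M_pos l by simp
 qed (use est in auto)
 also have "integral {0..t} (\<lambda>s. g (s + \<tau>) + M * l) \<le> \<gamma> + (\<omega>' + M * (E + 1) * l) * t"
 proof -
  have as: "(\<lambda>s. \<bar>\<alpha> (s + \<tau>)\<bar>) absolutely_integrable_on {0..t}" using shift[OF ai] by simp
  have "integral {0..t} (\<lambda>s. g (s + \<tau>) + M * l) = integral {0..t} (\<lambda>s. (M * b * E) * \<bar>\<alpha> (s + \<tau>)\<bar> + (M * E * l + M * l))"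
   by (intro integral_cong) (simp add: g_def algebra_simps)
  also have "\<dots> = M * b * E * integral {0..t} (\<lambda>s. \<bar>\<alpha> (s + \<tau>)\<bar>) + (M * E * l + M * l) * t"
   using as t by (subst hk_integral_add)
    (auto simp: absolutely_integrable_on_def intro: integrable_on_mult_right)
  also have "\<dots> \<le> \<gamma> + \<omega>' * t + (M * E * l + M * l) * t"
   using growth[of t] gamma t unfolding E_def by (cases "t = 0") auto
  finally show ?thesis by (simp add: algebra_simps)
 qed
 finally have "\<phi> t \<le> a * exp (\<gamma> + (\<omega>' + M * (E + 1) * l) * t)"
  using a0 by (simp add: mult_left_mono)
 then have "exp (- \<omega> * t) * \<phi> t \<le> exp (- \<omega> * t) * (a * exp (\<gamma> + (\<omega>' + M * (E + 1) * l) * t))"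
  by (intro mult_left_mono) auto
 also have "exp (- \<omega> * t) * \<phi> t = p (U t)" by (simp add: \<phi>_def exp_minus)
 also have "exp (- \<omega> * t) * (a * exp (\<gamma> + (\<omega>' + M * (E + 1) * l) * t)) = a * exp \<gamma> * exp (- (\<omega> - \<omega>' - M * (E + 1) * l) * t)"
  by (simp add: mult_exp_exp algebra_simps)
 finally show ?thesis unfolding a_def E_def .
qed

end

section \<open>Global solutions for Lipschitz nonlinearities\<close>

locale delayed_problem = delayed_semigroup +
 fixes Bo :: "'a \<Rightarrow> 'a" and F :: "'a \<Rightarrow> 'a \<Rightarrow> 'a" and b K :: real and \<Phi> :: "real \<Rightarrow> 'a"
 assumes b0: "0 \<le> b" and K0: "0 \<le> K"
  and Bo_X: "U \<in> X \<Longrightarrow> Bo U \<in> X"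
  and Bo_lipschitz: "\<lbrakk>U \<in> X; V \<in> X\<rbrakk> \<Longrightarrow> p (Bo U - Bo V) \<le> b * p (U - V)"
  and F_X: "\<lbrakk>U \<in> X; V \<in> X\<rbrakk> \<Longrightarrow> F U V \<in> X"
  and F_lipschitz: "\<lbrakk>U \<in> X; V \<in> X; U' \<in> X; V' \<in> X\<rbrakk>
    \<Longrightarrow> p (F U V - F U' V') \<le> K * (p (U - U') + p (V - V'))"
  and \<Phi>_cont: "continuous_on_in X p {-\<tau>..0} \<Phi>"
begin

abbreviation delayed_term :: "(real \<Rightarrow> 'a) \<Rightarrow> real \<Rightarrow> 'a" where
 "delayed_term U \<equiv> \<lambda>s. Bo (U (s - \<tau>))"

abbreviation nonlinear_term :: "(real \<Rightarrow> 'a) \<Rightarrow> real \<Rightarrow> 'a" where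
 "nonlinear_term U \<equiv> \<lambda>s. F (U s) (U (s - \<tau>))"

lemma delayed_cont:
 assumes "continuous_on_in X p {-\<tau>..} U"
 shows "continuous_on_in X p {0..} (\<lambda>s. U (s - \<tau>))"
 by (rule cont_in_compose[OF assms]) (auto intro!: continuous_intros)

lemma terms_cont:
 assumes U: "continuous_on_in X p {-\<tau>..} U"
 shows "continuous_on_in X p {0..} (delayed_term U)" "continuous_on_in X p {0..} (nonlinear_term U)"
proof -
 have U0: "continuous_on_in X p {0..} U" using tau_pos by (intro cont_in_subset[OF U]) auto
 note Ud = delayed_cont[OF U]
 note X = cont_inD(1)[OF U0] cont_inD(1)[OF Ud]
 show "continuous_on_in X p {0..} (delayed_term U)"
 proof (rule cont_in_controlled[OF Ud Ud, of _ b])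
  fix s t :: real assume st: "s \<in> {0..}" "t \<in> {0..}"
  have "p (Bo (U (s - \<tau>)) - Bo (U (t - \<tau>))) \<le> b * p (U (s - \<tau>) - U (t - \<tau>))"
   by (intro Bo_lipschitz X st)
  also have "\<dots> \<le> b * (p (U (s - \<tau>) - U (t - \<tau>)) + p (U (s - \<tau>) - U (t - \<tau>)))"
   using b0 X(2)[OF st(1)] X(2)[OF st(2)] by (intro mult_left_mono) auto
  finally show "p (Bo (U (s - \<tau>)) - Bo (U (t - \<tau>))) \<le> b * (p (U (s - \<tau>) - U (t - \<tau>)) + p (U (s - \<tau>) - U (t - \<tau>)))" .
 qed (use X Bo_X in auto)
 show "continuous_on_in X p {0..} (nonlinear_term U)"
  by (rule cont_in_controlled[OF U0 Ud, of _ K]) (use X F_X F_lipschitz in auto)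
qed

definition convolution :: "(real \<Rightarrow> 'a) \<Rightarrow> real \<Rightarrow> 'a" where
 "convolution U t = (SOME I. has_bochner_integral_in X p (lebesgue_on {0..t})
   (\<lambda>s. S (t - s) (\<alpha> s *\<^sub>R delayed_term U s + nonlinear_term U s)) I)"

lemma convolution:
 assumes U: "continuous_on_in X p {-\<tau>..} U"
 shows "has_bochner_integral_in X p (lebesgue_on {0..t})
   (\<lambda>s. S (t - s) (\<alpha> s *\<^sub>R delayed_term U s + nonlinear_term U s)) (convolution U t)"
proof -
 have "\<exists>I. has_bochner_integral_in X p (lebesgue_on {0..t})
   (\<lambda>s. S (t - s) (\<alpha> s *\<^sub>R delayed_term U s + nonlinear_term U s)) I"
  by (intro convolution_exists alpha_int cont_in_subset[OF terms_cont(1)[OF U]] cont_in_subset[OF terms_cont(2)[OF U]]) auto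
 then show ?thesis unfolding convolution_def by (rule someI_ex)
qed

text \<open>
For \<open>t \<le> 0\<close> the iterate is the datum, so that all iterates agree there.
\<close>

definition picard :: "(real \<Rightarrow> 'a) \<Rightarrow> real \<Rightarrow> 'a" where
 "picard U t = (if t \<le> 0 then \<Phi> t else S t (\<Phi> 0) + convolution U t)"

lemma \<Phi>0_X: "\<Phi> 0 \<in> X" using cont_inD(1)[OF \<Phi>_cont] tau_pos by auto

lemma p_convolution_0:
 assumes U: "continuous_on_in X p {-\<tau>..} U"
 shows "p (convolution U 0) = 0"
proof -
 have sub: "continuous_on_in X p {0..0} (delayed_term U)" "continuous_on_in X p {0..0} (nonlinear_term U)"
  by (auto intro: cont_in_subset[OF terms_cont(1)[OF U]] cont_in_subset[OF terms_cont(2)[OF U]])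
 have "p (convolution U 0) \<le> integral {0..0} (\<lambda>s. M * exp (- \<omega> * (0 - s)) * (\<bar>\<alpha> s\<bar> * p (delayed_term U s) + p (nonlinear_term U s)))"
  by (rule convolution_bound[OF _ alpha_int sub convolution[OF U] continuous_on_p[OF sub(1)] continuous_on_p[OF sub(2)]]) auto
 moreover have "convolution U 0 \<in> X" using convolution[OF U] by (simp add: has_bochner_integral_in_def)
 ultimately show ?thesis by (intro antisym) auto
qed

lemma picard_cont:
 assumes U: "continuous_on_in X p {-\<tau>..} U"
 shows "continuous_on_in X p {-\<tau>..} (picard U)"
proof (rule cont_in_glue[where c = 0])
 have cX: "convolution U t \<in> X" for t using convolution[OF U] by (simp add: has_bochner_integral_in_def)
 show "continuous_on_in X p {-\<tau>..0} (picard U)"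
  by (rule cont_in_cong[OF \<Phi>_cont]) (use cont_inD(1)[OF \<Phi>_cont] in \<open>auto simp: picard_def\<close>)
 show "continuous_on_in X p {0..} (picard U)"
 proof (rule cont_in_halfline)
  fix T
  have cc: "continuous_on_in X p {0..T} (convolution U)"
   using convolution[OF U]
   by (intro convolution_continuous[OF alpha_int cont_in_subset[OF terms_cont(1)[OF U]] cont_in_subset[OF terms_cont(2)[OF U]]]) auto
  have co: "continuous_on_in X p {0..T} (\<lambda>t. S t (\<Phi> 0))"
   by (rule cont_in_subset[OF cont_in_orbit[OF \<Phi>0_X]]) auto
  have "continuous_on_in X p {0..T} (\<lambda>t. S t (\<Phi> 0) + convolution U t)"
  proof (rule cont_in_controlled[OF cc co, of _ 1])
   fix s t assume st: "s \<in> {0..T}" "t \<in> {0..T}"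
   have eq: "S s (\<Phi> 0) + convolution U s - (S t (\<Phi> 0) + convolution U t)
     = (convolution U s - convolution U t) + (S s (\<Phi> 0) - S t (\<Phi> 0))" by simp
   show "p (S s (\<Phi> 0) + convolution U s - (S t (\<Phi> 0) + convolution U t))
     \<le> 1 * (p (convolution U s - convolution U t) + p (S s (\<Phi> 0) - S t (\<Phi> 0)))"
    unfolding eq mult_1 using st cX \<Phi>0_X by (intro p_triangle) auto
  qed (use cX \<Phi>0_X in auto)
  then show "continuous_on_in X p {0..T} (picard U)"
  proof (rule cont_in_cong)
   fix t assume t: "t \<in> {0..T}"
   show "picard U t \<in> X" using t cX \<Phi>0_X by (auto simp: picard_def)
   show "p (S t (\<Phi> 0) + convolution U t - picard U t) = 0"
   proof (cases "t = 0")
    case True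
    have "p (S 0 (\<Phi> 0) + convolution U 0 - \<Phi> 0) \<le> p (S 0 (\<Phi> 0) - \<Phi> 0) + p (convolution U 0)"
     using p_triangle[of "S 0 (\<Phi> 0) - \<Phi> 0" "convolution U 0"] cX \<Phi>0_X by (simp add: algebra_simps)
    then have "p (S 0 (\<Phi> 0) + convolution U 0 - \<Phi> 0) \<le> 0"
     using S_zero[OF \<Phi>0_X] p_convolution_0[OF U] by simp
    then have "p (S 0 (\<Phi> 0) + convolution U 0 - \<Phi> 0) = 0"
     using p_nonneg[of "S 0 (\<Phi> 0) + convolution U 0 - \<Phi> 0"] cX \<Phi>0_X by (intro antisym) auto
    then show ?thesis using True by (simp add: picard_def)
   next
    case False
    then show ?thesis using t by (simp add: picard_def)
   qed
  qed
 qed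
qed (use tau_pos in auto)

lemma convolution_lipschitz:
 assumes U: "continuous_on_in X p {-\<tau>..} U" and V: "continuous_on_in X p {-\<tau>..} V"
  and t: "0 \<le> t" and q: "continuous_on {-\<tau>..t} q" "\<And>s. s \<in> {-\<tau>..t} \<Longrightarrow> p (U s - V s) \<le> q s"
   "\<And>s. s \<in> {-\<tau>..t} \<Longrightarrow> 0 \<le> q s"
 shows "p (convolution U t - convolution V t)
   \<le> M * (b * integral {0..t} (\<lambda>s. \<bar>\<alpha> s\<bar> * q (s - \<tau>)) + K * integral {0..t} (\<lambda>s. q s + q (s - \<tau>)))"
proof -
 have c1: "continuous_on {0..t} q" using tau_pos by (intro continuous_on_subset[OF q(1)]) auto
 have c2: "continuous_on {0..t} (\<lambda>s. q (s - \<tau>))"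
  using tau_pos by (intro continuous_on_compose2[OF q(1)] continuous_intros) auto
 have UX: "\<And>s. s \<ge> -\<tau> \<Longrightarrow> U s \<in> X" and VX: "\<And>s. s \<ge> -\<tau> \<Longrightarrow> V s \<in> X"
  using cont_inD(1)[OF U] cont_inD(1)[OF V] by auto
 have "p (convolution U t - convolution V t)
   \<le> integral {0..t} (\<lambda>s. M * exp (- \<omega> * (t - s)) * (\<bar>\<alpha> s\<bar> * (b * q (s - \<tau>)) + K * (q s + q (s - \<tau>))))"
 proof (rule convolution_compare[OF alpha_int cont_in_subset[OF terms_cont(1)[OF U]] cont_in_subset[OF terms_cont(2)[OF U]]
    cont_in_subset[OF terms_cont(1)[OF V]] cont_in_subset[OF terms_cont(2)[OF V]] convolution[OF U] convolution[OF V]])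
  fix s assume s: "s \<in> {0..t}"
  then have X: "U s \<in> X" "V s \<in> X" "U (s - \<tau>) \<in> X" "V (s - \<tau>) \<in> X" using UX VX tau_pos by auto
  have qs: "p (U (s - \<tau>) - V (s - \<tau>)) \<le> q (s - \<tau>)" "p (U s - V s) \<le> q s" using s tau_pos by (auto intro: q(2))
  show "p (delayed_term U s - delayed_term V s) \<le> b * q (s - \<tau>)"
   using Bo_lipschitz[OF X(3,4)] mult_left_mono[OF qs(1) b0] by simp
  show "p (nonlinear_term U s - nonlinear_term V s) \<le> K * (q s + q (s - \<tau>))"
   using F_lipschitz[OF X(1,3,2,4)] mult_left_mono[OF add_mono[OF qs(2,1)] K0] by simp
 qed (auto intro!: continuous_intros c1 c2)
 also have "\<dots> \<le> integral {0..t} (\<lambda>s. M * (b * (\<bar>\<alpha> s\<bar> * q (s - \<tau>)) + K * (q s + q (s - \<tau>))))"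
 proof (rule integral_le)
  have "(\<lambda>s. \<bar>\<alpha> s\<bar> * (M * exp (- \<omega> * (t - s)) * (b * q (s - \<tau>))) + M * exp (- \<omega> * (t - s)) * (K * (q s + q (s - \<tau>)))) absolutely_integrable_on {0..t}"
   by (intro set_integral_add(1) absolutely_integrable_times_continuous set_integrable_abs alpha_int
     absolutely_integrable_continuous_real continuous_intros c1 c2)
  then show "(\<lambda>s. M * exp (- \<omega> * (t - s)) * (\<bar>\<alpha> s\<bar> * (b * q (s - \<tau>)) + K * (q s + q (s - \<tau>)))) integrable_on {0..t}"
   by (simp add: absolutely_integrable_on_def algebra_simps)
  have "(\<lambda>s. \<bar>\<alpha> s\<bar> * (M * b * q (s - \<tau>)) + M * K * (q s + q (s - \<tau>))) absolutely_integrable_on {0..t}"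
   by (intro set_integral_add(1) absolutely_integrable_times_continuous set_integrable_abs alpha_int
     absolutely_integrable_continuous_real continuous_intros c1 c2)
  then show "(\<lambda>s. M * (b * (\<bar>\<alpha> s\<bar> * q (s - \<tau>)) + K * (q s + q (s - \<tau>)))) integrable_on {0..t}"
   by (simp add: absolutely_integrable_on_def algebra_simps)
  fix s assume s: "s \<in> {0..t}"
  have nn: "0 \<le> q s" "0 \<le> q (s - \<tau>)" using s tau_pos by (auto intro!: q(3))
  have "M * exp (- \<omega> * (t - s)) * (\<bar>\<alpha> s\<bar> * (b * q (s - \<tau>)) + K * (q s + q (s - \<tau>)))
    \<le> M * 1 * (\<bar>\<alpha> s\<bar> * (b * q (s - \<tau>)) + K * (q s + q (s - \<tau>)))"
   using M_pos omega_pos s b0 K0 nn by (intro mult_right_mono mult_left_mono) auto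
  then show "M * exp (- \<omega> * (t - s)) * (\<bar>\<alpha> s\<bar> * (b * q (s - \<tau>)) + K * (q s + q (s - \<tau>)))
    \<le> M * (b * (\<bar>\<alpha> s\<bar> * q (s - \<tau>)) + K * (q s + q (s - \<tau>)))"
   by (simp add: mult_ac)
 qed
 also have "\<dots> = M * integral {0..t} (\<lambda>s. b * (\<bar>\<alpha> s\<bar> * q (s - \<tau>)) + K * (q s + q (s - \<tau>)))"
  by simp
 also have "integral {0..t} (\<lambda>s. b * (\<bar>\<alpha> s\<bar> * q (s - \<tau>)) + K * (q s + q (s - \<tau>)))
   = integral {0..t} (\<lambda>s. b * (\<bar>\<alpha> s\<bar> * q (s - \<tau>))) + integral {0..t} (\<lambda>s. K * (q s + q (s - \<tau>)))"
 proof (rule hk_integral_add)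
  have "(\<lambda>s. \<bar>\<alpha> s\<bar> * q (s - \<tau>)) absolutely_integrable_on {0..t}"
   by (intro absolutely_integrable_times_continuous set_integrable_abs alpha_int c2)
  then show "(\<lambda>s. b * (\<bar>\<alpha> s\<bar> * q (s - \<tau>))) integrable_on {0..t}"
   by (intro integrable_on_mult_right) (simp add: absolutely_integrable_on_def)
  show "(\<lambda>s. K * (q s + q (s - \<tau>))) integrable_on {0..t}"
   by (intro integrable_continuous_interval continuous_intros c1 c2)
 qed
 finally show ?thesis by simp
qed

definition picard_sequence :: "nat \<Rightarrow> real \<Rightarrow> 'a" where
 "picard_sequence n = (picard ^^ n) (\<lambda>t. \<Phi> (min t 0))"

lemma picard_sequence_Suc: "picard_sequence (Suc n) = picard (picard_sequence n)"
 by (simp add: picard_sequence_def)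

lemma picard_sequence_cont: "continuous_on_in X p {-\<tau>..} (picard_sequence n)"
proof (induction n)
 case 0
 have "continuous_on_in X p {-\<tau>..} (\<lambda>t. \<Phi> (min t 0))"
  using tau_pos by (intro cont_in_compose[OF \<Phi>_cont] continuous_intros) auto
 then show ?case by (simp add: picard_sequence_def)
next
 case (Suc n)
 then show ?case unfolding picard_sequence_Suc by (rule picard_cont)
qed

lemma picard_sequence_initial: "t \<le> 0 \<Longrightarrow> picard_sequence n t = \<Phi> t"
 by (cases n) (auto simp: picard_sequence_def picard_def)

text \<open>
A weight under which the Picard map halves distances: the delayed linear term gains
\<open>exp (- l * \<tau>)\<close>, the Lipschitz terms gain \<open>1 / l\<close> by integration.
\<close>

lemma picard_weight_exists:
 assumes "0 \<le> A"
 shows "\<exists>l>0. M * (b * (exp (- l * \<tau>) * A) + K * (2 / l)) \<le> 1 / 2"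
proof -
 \<comment> \<open>by \<open>exp (- l * \<tau>) \<le> 1 / (l * \<tau>)\<close>, every term is at most a constant over \<open>l\<close>\<close>
 define l where "l = 2 * M * (b * (A / \<tau>) + K * 2) + 1"
 have l: "0 < l" unfolding l_def using M_pos b0 K0 assms tau_pos by (intro add_nonneg_pos mult_nonneg_nonneg add_nonneg_nonneg) auto
 have "exp (- l * \<tau>) \<le> 1 / (l * \<tau>)"
 proof -
  have "l * \<tau> \<le> exp (l * \<tau>)" using exp_ge_add_one_self[of "l * \<tau>"] by linarith
  then show ?thesis using l tau_pos by (simp add: exp_minus field_simps)
 qed
 then have "exp (- l * \<tau>) * A \<le> 1 / (l * \<tau>) * A" using assms by (intro mult_right_mono)
 then have "M * (b * (exp (- l * \<tau>) * A) + K * (2 / l)) \<le> M * (b * (1 / (l * \<tau>) * A) + K * (2 / l))"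
  using M_pos b0 by (intro mult_left_mono add_right_mono) auto
 also have "\<dots> = (M * (b * (A / \<tau>) + K * 2)) / l" using l tau_pos by (simp add: field_simps)
 also have "\<dots> \<le> 1 / 2" using l by (simp add: l_def field_simps)
 finally show ?thesis using l by blast
qed

text \<open>
Contraction by one half in the norm weighted with \<open>exp (- l * t)\<close>; on a bounded interval the weight
only changes the constant.
\<close>

lemma picard_geometric:
 shows "\<exists>C. \<forall>n. \<forall>t\<in>{-\<tau>..T}. p (picard_sequence (Suc n) t - picard_sequence n t) \<le> C * (1/2) ^ n"
proof -
 define A where "A = integral {0..T} (\<lambda>s. \<bar>\<alpha> s\<bar>)"
 have ai: "(\<lambda>s. \<bar>\<alpha> s\<bar>) absolutely_integrable_on {0..t}" for t using alpha_int by (rule set_integrable_abs)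
 have A: "0 \<le> A" unfolding A_def using ai[of T]
  by (intro hk_integral_nonneg) (auto simp: absolutely_integrable_on_def)
 obtain l where l: "0 < l" "M * (b * (exp (- l * \<tau>) * A) + K * (2 / l)) \<le> 1 / 2"
  using picard_weight_exists[OF A] by auto
 let ?U = picard_sequence
 note cont = picard_sequence_cont
 have UX: "?U n t \<in> X" if "t \<ge> -\<tau>" for n t using cont_inD(1)[OF cont] that by auto
 have "\<exists>P\<ge>0. \<forall>s\<in>{-\<tau>..T}. p (?U 1 s) \<le> P" "\<exists>P\<ge>0. \<forall>s\<in>{-\<tau>..T}. p (?U 0 s) \<le> P"
  by (intro cont_in_bounded cont_in_subset[OF cont]; auto)+
 then obtain P1 P0 where P: "P1 \<ge> 0" "\<And>s. s \<in> {-\<tau>..T} \<Longrightarrow> p (?U 1 s) \<le> P1"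
   "P0 \<ge> 0" "\<And>s. s \<in> {-\<tau>..T} \<Longrightarrow> p (?U 0 s) \<le> P0" by blast
 define C where "C = (P1 + P0) * exp (l * \<tau>)"
 have C: "0 \<le> C" using P by (simp add: C_def)
 have ind: "p (?U (Suc n) t - ?U n t) \<le> C * (1/2) ^ n * exp (l * t)" if "t \<in> {-\<tau>..T}" for n t
  using that
 proof (induction n arbitrary: t)
  case 0
  have "p (?U (Suc 0) t - ?U 0 t) \<le> P1 + P0"
   using p_diff_le[of "?U 1 t" "?U 0 t"] P(2,4)[OF 0] UX[of t] 0 by fastforce
  also have "\<dots> \<le> (P1 + P0) * (exp (l * \<tau>) * exp (l * t))"
  proof -
   have "0 \<le> l * (\<tau> + t)" using l(1) 0 by simp
   then have "1 \<le> exp (l * \<tau>) * exp (l * t)" by (simp add: exp_add[symmetric] distrib_left)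
   then show ?thesis using P mult_left_mono[of 1 "exp (l * \<tau>) * exp (l * t)" "P1 + P0"] by simp
  qed
  finally show ?case by (simp add: C_def mult.assoc)
 next
  case (Suc n)
  show ?case
  proof (cases "t \<le> 0")
   case True
   then show ?thesis using C by (simp add: picard_sequence_initial)
  next
   case False
   then have t: "0 < t" "t \<in> {0..T}" using Suc.prems by auto
   let ?q = "\<lambda>s. C * (1/2) ^ n * exp (l * s)"
   have i1: "integral {0..t} (\<lambda>s. \<bar>\<alpha> s\<bar> * ?q (s - \<tau>)) \<le> C * (1/2) ^ n * (exp (l * (t - \<tau>)) * A)"
   proof -
    have "integral {0..t} (\<lambda>s. \<bar>\<alpha> s\<bar> * ?q (s - \<tau>)) = integral {0..t} (\<lambda>s. (C * (1/2) ^ n) * (\<bar>\<alpha> s\<bar> * exp (l * (s - \<tau>))))"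
     by (intro integral_cong) (simp add: mult_ac)
    also have "\<dots> = C * (1/2) ^ n * integral {0..t} (\<lambda>s. \<bar>\<alpha> s\<bar> * exp (l * (s - \<tau>)))" by (rule integral_mult_right)
    also have "\<dots> \<le> C * (1/2) ^ n * (exp (l * (t - \<tau>)) * A)"
     using integral_delay_exp_le[OF t(2) l(1)] C unfolding A_def by (intro mult_left_mono) auto
    finally show ?thesis .
   qed
   have i2: "integral {0..t} (\<lambda>s. ?q s + ?q (s - \<tau>)) \<le> C * (1/2) ^ n * (2 * exp (l * t) / l)"
   proof -
    have "integral {0..t} (\<lambda>s. ?q s + ?q (s - \<tau>)) \<le> integral {0..t} (\<lambda>s. (C * (1/2) ^ n * 2) * exp (l * s))"
    proof (rule integral_le)
     fix s
     have "exp (l * (s - \<tau>)) \<le> exp (l * s)" using l(1) tau_pos by simp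
     then have "C * (1/2) ^ n * exp (l * (s - \<tau>)) \<le> C * (1/2) ^ n * exp (l * s)"
      using C by (intro mult_left_mono) auto
     moreover have "(C * (1/2) ^ n * 2) * exp (l * s) = ?q s + ?q s" by (simp add: algebra_simps)
     ultimately show "?q s + ?q (s - \<tau>) \<le> (C * (1/2) ^ n * 2) * exp (l * s)" by linarith
    qed (intro integrable_continuous_interval continuous_intros)+
    also have "\<dots> = (C * (1/2) ^ n * 2) * integral {0..t} (\<lambda>s. exp (l * s))" by (rule integral_mult_right)
    also have "integral {0..t} (\<lambda>s. exp (l * s)) = exp (l * t) / l - exp (l * 0) / l"
    proof (rule integral_unique, rule fundamental_theorem_of_calculus)
     show "((\<lambda>s. exp (l * s) / l) has_vector_derivative exp (l * s)) (at s within {0..t})" for s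
      using l(1) by (auto intro!: derivative_eq_intros simp: has_real_derivative_iff_has_vector_derivative[symmetric])
    qed (use t in auto)
    also have "(C * (1/2) ^ n * 2) * (exp (l * t) / l - exp (l * 0) / l) \<le> (C * (1/2) ^ n * 2) * (exp (l * t) / l)"
     using C l(1) by (intro mult_left_mono) auto
    finally show ?thesis by simp
   qed
   have split: "?U (Suc (Suc n)) t - ?U (Suc n) t = convolution (?U (Suc n)) t - convolution (?U n) t"
    using t(1) unfolding picard_sequence_Suc by (simp add: picard_def)
   have "p (convolution (?U (Suc n)) t - convolution (?U n) t)
     \<le> M * (b * integral {0..t} (\<lambda>s. \<bar>\<alpha> s\<bar> * ?q (s - \<tau>)) + K * integral {0..t} (\<lambda>s. ?q s + ?q (s - \<tau>)))"
    using t Suc.IH C by (intro convolution_lipschitz[OF cont cont] continuous_intros) auto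
   then have "p (convolution (?U (Suc n)) t - convolution (?U n) t)
     \<le> M * (b * (C * (1/2) ^ n * (exp (l * (t - \<tau>)) * A)) + K * (C * (1/2) ^ n * (2 * exp (l * t) / l)))"
    using mult_left_mono[OF add_mono[OF mult_left_mono[OF i1 b0] mult_left_mono[OF i2 K0]] less_imp_le[OF M_pos]]
    by (rule order_trans)
   also have "\<dots> = C * (1/2) ^ n * exp (l * t) * (M * (b * (exp (- l * \<tau>) * A) + K * (2 / l)))"
   proof -
    have eq: "exp (l * (t - \<tau>)) = exp (l * t) * exp (- l * \<tau>)"
     by (simp add: exp_add[symmetric] right_diff_distrib)
    have "M * (b * (z * (x * y * A)) + K * (z * (2 * x / l))) = z * x * (M * (b * (y * A) + K * (2 / l)))" for x y z
     by (simp add: algebra_simps)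
    then show ?thesis unfolding eq .
   qed
   also have "\<dots> \<le> C * (1/2) ^ n * exp (l * t) * (1 / 2)"
    using l(2) C by (intro mult_left_mono) auto
   finally show ?thesis unfolding split by (simp add: mult_ac)
  qed
 qed
 have "p (?U (Suc n) t - ?U n t) \<le> (C * exp (l * T)) * (1/2) ^ n" if t: "t \<in> {-\<tau>..T}" for n t
 proof -
  have "C * (1/2) ^ n * exp (l * t) \<le> C * (1/2) ^ n * exp (l * T)"
   using t l(1) C by (intro mult_left_mono) auto
  then show ?thesis using ind[OF t, of n] by (simp add: mult_ac)
 qed
 then show ?thesis by blast
qed

text \<open>
The iterates converge locally uniformly; their limit is a fixed point because the Picard map is
Lipschitz for the same estimate.
\<close>

theorem mild_solution_exists:
 "\<exists>U. continuous_on_in X p {-\<tau>..} U \<and> (\<forall>s\<le>0. U s = \<Phi> s) \<and>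
   mild_solution (delayed_term U) (nonlinear_term U) U"
proof -
 let ?U = picard_sequence
 note cont = picard_sequence_cont
 have UX: "?U n t \<in> X" if "t \<ge> -\<tau>" for n t using cont_inD(1)[OF cont] that by auto
 have lim: "\<exists>L. L \<in> X \<and> (\<lambda>n. p (?U n t - L)) \<longlonglongrightarrow> 0" if t: "t \<ge> -\<tau>" for t
 proof -
  obtain C where "\<forall>n. \<forall>s\<in>{-\<tau>..t}. p (?U (Suc n) s - ?U n s) \<le> C * (1/2) ^ n"
   using picard_geometric[of t] by blast
  then show ?thesis using geometric_converges[of "\<lambda>n. ?U n t" C] UX t by auto
 qed
 define V where "V t = (if t \<le> 0 then \<Phi> t else (SOME L. L \<in> X \<and> (\<lambda>n. p (?U n t - L)) \<longlonglongrightarrow> 0))" for t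
 have V: "V t \<in> X" "(\<lambda>n. p (?U n t - V t)) \<longlonglongrightarrow> 0" if t: "t \<ge> -\<tau>" for t
 proof -
  have "V t \<in> X \<and> (\<lambda>n. p (?U n t - V t)) \<longlonglongrightarrow> 0"
  proof (cases "t \<le> 0")
   case True
   then show ?thesis using t cont_inD(1)[OF \<Phi>_cont, of t] by (simp add: V_def picard_sequence_initial)
  next
   case False
   then show ?thesis using someI_ex[OF lim[OF t]] by (simp add: V_def)
  qed
  then show "V t \<in> X" "(\<lambda>n. p (?U n t - V t)) \<longlonglongrightarrow> 0" by auto
 qed
 have rate: "\<exists>C. 0 \<le> C \<and> (\<forall>n. \<forall>t\<in>{-\<tau>..T}. p (?U n t - V t) \<le> C * (1/2) ^ n)" for T
 proof -
  obtain C where C: "\<And>n t. t \<in> {-\<tau>..T} \<Longrightarrow> p (?U (Suc n) t - ?U n t) \<le> C * (1/2) ^ n"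
   using picard_geometric[of T] by blast
  have bd: "p (?U n t - V t) \<le> 2 * C * (1/2) ^ n" if t: "t \<in> {-\<tau>..T}" for n t
   using t by (intro geometric_limit_bound UX V C) auto
  have "p (?U n t - V t) \<le> max 0 (2 * C) * (1/2) ^ n" if t: "t \<in> {-\<tau>..T}" for n t
  proof -
   have "2 * C * (1/2) ^ n \<le> max 0 (2 * C) * (1/2) ^ n" by (intro mult_right_mono) auto
   then show ?thesis using bd[OF t, of n] by linarith
  qed
  then show ?thesis by (intro exI[of _ "max 0 (2 * C)"]) auto
 qed
 have half: "(\<lambda>n. c * (1/2) ^ n) \<longlonglongrightarrow> 0" for c :: real
  by (intro tendsto_mult_right_zero LIMSEQ_realpow_zero) auto
 have Vc: "continuous_on_in X p {-\<tau>..} V"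
 proof (rule cont_in_halfline)
  fix T
  obtain C where C: "\<And>n t. t \<in> {-\<tau>..T} \<Longrightarrow> p (?U n t - V t) \<le> C * (1/2) ^ n" using rate[of T] by blast
  show "continuous_on_in X p {-\<tau>..T} V"
   by (rule cont_in_uniform_limit[OF _ _ half C]) (auto intro: cont_in_subset[OF cont] V)
 qed
 have "has_bochner_integral_in X p (lebesgue_on {0..t})
    (\<lambda>s. S (t - s) (\<alpha> s *\<^sub>R delayed_term V s + nonlinear_term V s)) (V t - S t (V 0))" if t: "0 \<le> t" for t
 proof (rule bochner_cong[OF convolution[OF Vc]])
  have cX: "convolution U t \<in> X" if "continuous_on_in X p {-\<tau>..} U" for U t
   using convolution[OF that] by (simp add: has_bochner_integral_in_def)
  have V0: "V 0 = \<Phi> 0" by (simp add: V_def)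
  have X: "V t \<in> X" "S t (\<Phi> 0) \<in> X" "convolution V t \<in> X"
   using V t \<Phi>0_X cX[OF Vc] tau_pos by auto
  show "V t - S t (V 0) \<in> X" using X V0 by simp
  show "AE s in lebesgue_on {0..t}. S (t - s) (\<alpha> s *\<^sub>R delayed_term V s + nonlinear_term V s) \<in> X \<and>
    p (S (t - s) (\<alpha> s *\<^sub>R delayed_term V s + nonlinear_term V s) - S (t - s) (\<alpha> s *\<^sub>R delayed_term V s + nonlinear_term V s)) = 0"
   using cont_inD(1)[OF terms_cont(1)[OF Vc]] cont_inD(1)[OF terms_cont(2)[OF Vc]] by (intro AE_I2) auto
  show "p (convolution V t - (V t - S t (V 0))) = 0"
  proof (cases "t = 0")
   case True
   have "p (convolution V 0 - (\<Phi> 0 - S 0 (\<Phi> 0))) \<le> p (convolution V 0) + p (\<Phi> 0 - S 0 (\<Phi> 0))"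
    using cX[OF Vc] \<Phi>0_X by (intro p_diff_le) auto
   then have "p (convolution V 0 - (\<Phi> 0 - S 0 (\<Phi> 0))) \<le> 0"
    using p_convolution_0[OF Vc] S_zero[OF \<Phi>0_X] p_minus_commute[of "\<Phi> 0" "S 0 (\<Phi> 0)"] \<Phi>0_X by simp
   moreover have "0 \<le> p (convolution V 0 - (\<Phi> 0 - S 0 (\<Phi> 0)))" using cX[OF Vc] \<Phi>0_X by simp
   ultimately show ?thesis using True V0 by simp
  next
   case False
   obtain C where C: "0 \<le> C" "\<And>n s. s \<in> {-\<tau>..t} \<Longrightarrow> p (?U n s - V s) \<le> C * (1/2) ^ n" using rate[of t] by blast
   define D where "D = M * (b * (C * integral {0..t} (\<lambda>s. \<bar>\<alpha> s\<bar>)) + K * (2 * C * t)) + C"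
   have "p (convolution V t - (V t - S t (\<Phi> 0))) \<le> D * (1/2) ^ n" for n
   proof -
    let ?q = "\<lambda>s::real. C * (1/2) ^ n"
    have "p (convolution (?U n) t - convolution V t) \<le> M * (b * integral {0..t} (\<lambda>s. \<bar>\<alpha> s\<bar> * ?q (s - \<tau>)) + K * integral {0..t} (\<lambda>s. ?q s + ?q (s - \<tau>)))"
     using t C by (intro convolution_lipschitz[OF cont Vc] continuous_intros) auto
    also have "\<dots> = M * (b * (C * integral {0..t} (\<lambda>s. \<bar>\<alpha> s\<bar>)) + K * (2 * C * t)) * (1/2) ^ n"
     using t by (simp add: algebra_simps)
    finally have c1: "p (convolution (?U n) t - convolution V t) \<le> M * (b * (C * integral {0..t} (\<lambda>s. \<bar>\<alpha> s\<bar>)) + K * (2 * C * t)) * (1/2) ^ n" .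
    have "p (?U (Suc n) t - V t) \<le> C * (1/2) ^ Suc n" using C(2)[of t "Suc n"] t tau_pos by auto
    also have "\<dots> \<le> C * (1/2) ^ n" using C(1) by simp
    finally have c2: "p (?U (Suc n) t - V t) \<le> C * (1/2) ^ n" .
    have eq: "?U (Suc n) t = S t (\<Phi> 0) + convolution (?U n) t"
     using False t unfolding picard_sequence_Suc by (simp add: picard_def)
    have Y: "convolution (?U n) t \<in> X" using cX[OF cont] .
    have split: "convolution V t - (V t - S t (\<Phi> 0)) = (convolution V t - convolution (?U n) t) + (?U (Suc n) t - V t)"
     unfolding eq by simp
    have "p ((convolution V t - convolution (?U n) t) + (?U (Suc n) t - V t)) \<le> p (convolution V t - convolution (?U n) t) + p (?U (Suc n) t - V t)"
     using X Y UX[of t] t tau_pos by (intro p_triangle) auto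
    also have "\<dots> \<le> D * (1/2) ^ n"
     using c1 c2 p_minus_commute[OF X(3) Y] by (simp add: D_def distrib_right)
    finally show ?thesis unfolding split .
   qed
   then have "p (convolution V t - (V t - S t (\<Phi> 0))) \<le> 0"
    using LIMSEQ_le_const[OF half[of D]] by blast
   moreover have "0 \<le> p (convolution V t - (V t - S t (\<Phi> 0)))" using X by simp
   ultimately show ?thesis using V0 by simp
  qed
 qed
 then have "mild_solution (delayed_term V) (nonlinear_term V) V" by (simp add: mild_solution_def)
 moreover have "\<forall>s\<le>0. V s = \<Phi> s" by (simp add: V_def)
 ultimately show ?thesis using Vc by blast
qed

end

section \<open>Weighted spaces of square integrable functions\<close>

context semi_hilbert
begin

lemma strongly_measurable_scaleR:
 assumes "strongly_measurable_in X p M f"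
 shows "strongly_measurable_in X p M (\<lambda>x. c *\<^sub>R f x)"
proof -
 obtain a where a: "\<And>n. simple_function M (a n)" "\<And>n. a n ` space M \<subseteq> X"
   "AE x in M. (\<lambda>n. p (f x - a n x)) \<longlonglongrightarrow> 0" "AE x in M. f x \<in> X"
  by (rule strongly_measurableE[OF assms]) (rule that)
 show ?thesis
 proof (rule strongly_measurableI[where g = "\<lambda>n x. c *\<^sub>R a n x"])
  show "AE x in M. c *\<^sub>R f x \<in> X" using a(4) by eventually_elim auto
  show "simple_function M (\<lambda>x. c *\<^sub>R a n x)" for n using a(1) by (rule simple_function_compose1)
  show "(\<lambda>x. c *\<^sub>R a n x) ` space M \<subseteq> X" for n using a(2)[of n] by auto
  show "AE x in M. (\<lambda>n. p (c *\<^sub>R f x - c *\<^sub>R a n x)) \<longlonglongrightarrow> 0"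
   using a(3,4) AE_space
  proof eventually_elim
   case (elim x)
   have "p (c *\<^sub>R f x - c *\<^sub>R a n x) = \<bar>c\<bar> * p (f x - a n x)" for n
    using elim a(2)[of n] by (subst scaleR_diff_right[symmetric], intro p_scaleR) auto
   then show ?case using tendsto_mult_right_zero[OF elim(1)] by simp
  qed
 qed
qed

lemma strongly_measurable_add:
 assumes "strongly_measurable_in X p M f" "strongly_measurable_in X p M g"
 shows "strongly_measurable_in X p M (\<lambda>x. f x + g x)"
 using strongly_measurable_diff[OF assms(1) strongly_measurable_scaleR[OF assms(2), of "-1"]] by simp

lemma ip_measurable:
 assumes M: "complete_measure M" and f: "strongly_measurable_in X p M f" and g: "strongly_measurable_in X p M g"
 shows "(\<lambda>x. ip (f x) (g x)) \<in> borel_measurable M"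
proof -
 have fX: "AE x in M. f x \<in> X" and gX: "AE x in M. g x \<in> X"
  using f g by (auto simp: strongly_measurable_in_def)
 show ?thesis
 proof (rule complete_measure.borel_measurable_AE_LIMSEQ[OF M])
  show "(\<lambda>x. ((p (f x))\<^sup>2 + (p (g x))\<^sup>2 - (p (f x - g x))\<^sup>2) / 2) \<in> borel_measurable M"
   using p_measurable[OF M f] p_measurable[OF M g] p_measurable[OF M strongly_measurable_diff[OF f g]] by measurable
  show "AE x in M. (\<lambda>n. ((p (f x))\<^sup>2 + (p (g x))\<^sup>2 - (p (f x - g x))\<^sup>2) / 2) \<longlonglongrightarrow> ip (f x) (g x)"
   using fX gX
  proof eventually_elim
   case (elim x)
   note fl = functionalD(5)[OF bounded_functional_ip]
   have "(p (f x - g x))\<^sup>2 = ip (f x) (f x - g x) - ip (g x) (f x - g x)"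
    using elim by (subst p_square) (auto intro: fl)
   also have "ip (f x) (f x - g x) = ip (f x) (f x) - ip (f x) (g x)"
    using elim fl[of "f x" "f x" "g x"] ip_commute[of "f x" "f x - g x"] ip_commute[of "g x" "f x"] by auto
   also have "ip (g x) (f x - g x) = ip (f x) (g x) - ip (g x) (g x)"
    using elim fl[of "g x" "f x" "g x"] ip_commute[of "g x" "f x - g x"] by auto
   finally have "((p (f x))\<^sup>2 + (p (g x))\<^sup>2 - (p (f x - g x))\<^sup>2) / 2 = ip (f x) (g x)"
    using elim by (simp add: p_square)
   then show ?case by simp
  qed
 qed
qed

end

text \<open>
The weight may vanish, in which case the seminorm does not see the values of a function there.
\<close>

locale weighted_L2 = semi_hilbert +
 fixes M :: "'i measure" and k :: "'i \<Rightarrow> real"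
 assumes M_complete: "complete_measure M"
  and k_integrable: "integrable M k"
  and k_nonneg: "s \<in> space M \<Longrightarrow> 0 \<le> k s"
begin

definition L2 :: "('i \<Rightarrow> 'a) set" where
 "L2 = {w. strongly_measurable_in X p M w \<and> integrable M (\<lambda>s. k s * (p (w s))\<^sup>2)}"

definition L2_ip :: "('i \<Rightarrow> 'a) \<Rightarrow> ('i \<Rightarrow> 'a) \<Rightarrow> real" where
 "L2_ip v w = (\<integral>s. k s * ip (v s) (w s) \<partial>M)"

definition L2_norm :: "('i \<Rightarrow> 'a) \<Rightarrow> real" where
 "L2_norm w = sqrt (L2_ip w w)"

lemma k_measurable: "k \<in> borel_measurable M" using k_integrable by auto

lemma L2_D:
 assumes "w \<in> L2"
 shows "strongly_measurable_in X p M w" "integrable M (\<lambda>s. k s * (p (w s))\<^sup>2)" "AE s in M. w s \<in> X"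
 using assms by (auto simp: L2_def strongly_measurable_in_def)

lemma L2_ip_integrable:
 assumes v: "v \<in> L2" and w: "w \<in> L2"
 shows "integrable M (\<lambda>s. k s * ip (v s) (w s))"
proof (rule Bochner_Integration.integrable_bound)
 show "integrable M (\<lambda>s. k s * (p (v s))\<^sup>2 + k s * (p (w s))\<^sup>2)" using L2_D(2) v w by auto
 show "(\<lambda>s. k s * ip (v s) (w s)) \<in> borel_measurable M"
  using ip_measurable[OF M_complete L2_D(1)[OF v] L2_D(1)[OF w]] k_measurable by measurable
 show "AE s in M. norm (k s * ip (v s) (w s)) \<le> norm (k s * (p (v s))\<^sup>2 + k s * (p (w s))\<^sup>2)"
  using L2_D(3)[OF v] L2_D(3)[OF w] AE_space
 proof eventually_elim
  case (elim s)
  have "2 * (p (v s) * p (w s)) \<le> (p (v s))\<^sup>2 + (p (w s))\<^sup>2"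
   using sum_squares_bound[of "p (v s)" "p (w s)"] by (simp add: mult.assoc)
  moreover have "0 \<le> p (v s) * p (w s)" using elim by simp
  ultimately have "\<bar>ip (v s) (w s)\<bar> \<le> (p (v s))\<^sup>2 + (p (w s))\<^sup>2"
   using ip_le_norms[OF elim(1,2)] by linarith
  then have "k s * \<bar>ip (v s) (w s)\<bar> \<le> k s * ((p (v s))\<^sup>2 + (p (w s))\<^sup>2)"
   using k_nonneg[OF elim(3)] by (rule mult_left_mono)
  then show ?case using k_nonneg[OF elim(3)] by (simp add: abs_mult distrib_left)
 qed
qed

lemma L2_I:
 assumes w: "strongly_measurable_in X p M w" and i: "integrable M g"
  and le: "AE s in M. k s * (p (w s))\<^sup>2 \<le> g s"
 shows "w \<in> L2"
proof -
 have "integrable M (\<lambda>s. k s * (p (w s))\<^sup>2)"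
 proof (rule Bochner_Integration.integrable_bound[OF i])
  show "(\<lambda>s. k s * (p (w s))\<^sup>2) \<in> borel_measurable M"
   using p_measurable[OF M_complete w] k_measurable by measurable
  show "AE s in M. norm (k s * (p (w s))\<^sup>2) \<le> norm (g s)"
   using le AE_space by eventually_elim (simp add: k_nonneg)
 qed
 then show ?thesis using w by (simp add: L2_def)
qed

lemma L2_add:
 assumes v: "v \<in> L2" and w: "w \<in> L2"
 shows "(\<lambda>s. v s + w s) \<in> L2"
proof (rule L2_I)
 show "strongly_measurable_in X p M (\<lambda>s. v s + w s)"
  by (intro strongly_measurable_add L2_D v w)
 show "integrable M (\<lambda>s. k s * (p (v s))\<^sup>2 + (k s * (p (w s))\<^sup>2 + 2 * (k s * ip (v s) (w s))))"
  using L2_D(2)[OF v] L2_D(2)[OF w] L2_ip_integrable[OF v w] by auto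
 show "AE s in M. k s * (p (v s + w s))\<^sup>2 \<le> k s * (p (v s))\<^sup>2 + (k s * (p (w s))\<^sup>2 + 2 * (k s * ip (v s) (w s)))"
  using L2_D(3)[OF v] L2_D(3)[OF w]
  by eventually_elim (simp add: p_square ip_add_left ip_add_right ip_commute[of "w _" "v _"] algebra_simps)
qed

lemma L2_scaleR:
 assumes v: "v \<in> L2"
 shows "(\<lambda>s. c *\<^sub>R v s) \<in> L2"
proof (rule L2_I)
 show "strongly_measurable_in X p M (\<lambda>s. c *\<^sub>R v s)"
  by (intro strongly_measurable_scaleR L2_D v)
 show "integrable M (\<lambda>s. c\<^sup>2 * (k s * (p (v s))\<^sup>2))" using L2_D(2)[OF v] by auto
 show "AE s in M. k s * (p (c *\<^sub>R v s))\<^sup>2 \<le> c\<^sup>2 * (k s * (p (v s))\<^sup>2)"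
  using L2_D(3)[OF v] by eventually_elim (simp add: p_scaleR power_mult_distrib)
qed

lemma L2_zero: "(\<lambda>s. 0) \<in> L2"
 unfolding L2_def by (auto intro!: strongly_measurable_simple)

lemma L2_const: "x \<in> X \<Longrightarrow> (\<lambda>s. x) \<in> L2"
 unfolding L2_def using k_integrable by (auto intro!: strongly_measurable_simple)

lemma L2_diff:
 assumes v: "v \<in> L2" and w: "w \<in> L2"
 shows "(\<lambda>s. v s - w s) \<in> L2"
 using L2_add[OF v L2_scaleR[OF w, of "-1"]] by simp

lemma L2_ip_nonneg: "w \<in> L2 \<Longrightarrow> 0 \<le> L2_ip w w"
 unfolding L2_ip_def
proof (rule integral_nonneg_AE)
 assume w: "w \<in> L2"
 show "AE s in M. 0 \<le> k s * ip (w s) (w s)"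
  using L2_D(3)[OF w] AE_space by eventually_elim (simp add: k_nonneg ip_nonneg)
qed

lemma L2_norm_square:
 assumes w: "w \<in> L2"
 shows "(L2_norm w)\<^sup>2 = (\<integral>s. k s * (p (w s))\<^sup>2 \<partial>M)"
proof -
 have "(L2_norm w)\<^sup>2 = L2_ip w w" using L2_ip_nonneg[OF w] by (simp add: L2_norm_def)
 also have "\<dots> = (\<integral>s. k s * (p (w s))\<^sup>2 \<partial>M)"
  unfolding L2_ip_def
 proof (rule integral_cong_AE)
  show "(\<lambda>s. k s * ip (w s) (w s)) \<in> borel_measurable M" using L2_ip_integrable[OF w w] by auto
  show "(\<lambda>s. k s * (p (w s))\<^sup>2) \<in> borel_measurable M" using L2_D(2)[OF w] by auto
  show "AE s in M. k s * ip (w s) (w s) = k s * (p (w s))\<^sup>2"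
   using L2_D(3)[OF w] by eventually_elim (simp add: p_square)
 qed
 finally show ?thesis .
qed

lemma L2_norm_nonneg: "w \<in> L2 \<Longrightarrow> 0 \<le> L2_norm w"
 using L2_ip_nonneg by (simp add: L2_norm_def)

lemma L2_semi_hilbert: "semi_hilbert L2 L2_ip L2_norm"
proof
 show "subspace L2"
  using L2_zero L2_add L2_scaleR by (auto simp: subspace_def plus_fun_def zero_fun_def scaleR_fun_def)
 fix v w :: "'i \<Rightarrow> 'a" assume v: "v \<in> L2" and w: "w \<in> L2"
 have vX: "AE s in M. v s \<in> X" and wX: "AE s in M. w s \<in> X" using L2_D(3) v w by auto
 show "L2_ip v w = L2_ip w v"
  unfolding L2_ip_def
 proof (rule integral_cong_AE)
  show "AE s in M. k s * ip (v s) (w s) = k s * ip (w s) (v s)"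
   using vX wX by eventually_elim (simp add: ip_commute)
 qed (use L2_ip_integrable v w in auto)
 show "L2_ip (a *\<^sub>R v) w = a * L2_ip v w" for a
 proof -
  have "L2_ip (a *\<^sub>R v) w = (\<integral>s. a * (k s * ip (v s) (w s)) \<partial>M)"
   unfolding L2_ip_def scaleR_fun_def
  proof (rule integral_cong_AE)
   show "AE s in M. k s * ip (a *\<^sub>R v s) (w s) = a * (k s * ip (v s) (w s))"
    using vX wX by eventually_elim (simp add: ip_scaleR_left)
  qed (use L2_ip_integrable[OF v w] L2_ip_integrable[OF L2_scaleR[OF v, of a] w] in auto)
  then show ?thesis by (simp add: L2_ip_def)
 qed
 show "L2_ip (v + u) w = L2_ip v w + L2_ip u w" if u: "u \<in> L2" for u
 proof -
  have uX: "AE s in M. u s \<in> X" using L2_D(3) u by auto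
  have "L2_ip (v + u) w = (\<integral>s. k s * ip (v s) (w s) + k s * ip (u s) (w s) \<partial>M)"
   unfolding L2_ip_def plus_fun_def
  proof (rule integral_cong_AE)
   show "AE s in M. k s * ip (v s + u s) (w s) = k s * ip (v s) (w s) + k s * ip (u s) (w s)"
    using vX wX uX by eventually_elim (simp add: ip_add_left distrib_left)
   show "(\<lambda>s. k s * ip (v s) (w s) + k s * ip (u s) (w s)) \<in> borel_measurable M"
    using L2_ip_integrable[OF v w] L2_ip_integrable[OF u w] by auto
   show "(\<lambda>s. k s * ip (v s + u s) (w s)) \<in> borel_measurable M"
    using L2_ip_integrable[OF L2_add[OF v u] w] by auto
  qed
  then show ?thesis using L2_ip_integrable[OF v w] L2_ip_integrable[OF u w] by (simp add: L2_ip_def)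
 qed
 show "0 \<le> L2_ip v v" using L2_ip_nonneg[OF v] .
 show "L2_norm v = sqrt (L2_ip v v)" by (simp add: L2_norm_def)
qed

text \<open>
The approximating simple functions are set to zero where they exceed \<open>p (w s) + 1\<close>; the error is then
dominated and converges almost everywhere.
\<close>

lemma L2_simple_dense:
 assumes w: "w \<in> L2" and e: "0 < e"
 shows "\<exists>g. simple_function M g \<and> g ` space M \<subseteq> X \<and> g \<in> L2 \<and> L2_norm (\<lambda>s. w s - g s) < e"
proof -
 obtain a where a: "\<And>n. simple_function M (a n)" "\<And>n. a n ` space M \<subseteq> X"
   "AE x in M. (\<lambda>n. p (w x - a n x)) \<longlonglongrightarrow> 0" "AE x in M. w x \<in> X"
  by (rule strongly_measurableE[OF L2_D(1)[OF w]]) (rule that)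
 have aX: "a n s \<in> X" if "s \<in> space M" for n s using a(2)[of n] that by auto
 define g where "g n s = (if p (a n s) \<le> p (w s) + 1 then a n s else 0)" for n s
 have pw: "(\<lambda>s. p (w s)) \<in> borel_measurable M" using p_measurable[OF M_complete L2_D(1)[OF w]] .
 have pa: "(\<lambda>s. p (a n s)) \<in> borel_measurable M" for n
  using simple_function_compose1[OF a(1)] by (rule borel_measurable_simple_function)
 have gs: "simple_function M (g n)" for n
  unfolding g_def
 proof (rule simple_function_If)
  show "{s \<in> space M. p (a n s) \<le> p (w s) + 1} \<in> sets M"
   using pa pw by measurable
 qed (use a(1) in auto)
 have gX: "g n ` space M \<subseteq> X" for n using aX by (auto simp: g_def)
 have gb: "p (g n s) \<le> p (w s) + 1" if "w s \<in> X" for n s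
  using p_nonneg[OF that] by (simp add: g_def)
 have dom: "integrable M (\<lambda>s. 8 * (k s * (p (w s))\<^sup>2) + 2 * k s)"
  using L2_D(2)[OF w] k_integrable by auto
 have sm: "strongly_measurable_in X p M (g n)" for n using gs gX by (rule strongly_measurable_simple)
 have gL: "g n \<in> L2" for n
 proof (rule L2_I[OF sm dom])
  show "AE s in M. k s * (p (g n s))\<^sup>2 \<le> 8 * (k s * (p (w s))\<^sup>2) + 2 * k s"
   using a(4) AE_space
  proof eventually_elim
   case (elim s)
   have gXs: "g n s \<in> X" using gX[of n] elim by auto
   have "(p (g n s))\<^sup>2 \<le> (p (w s) + 1)\<^sup>2" using gb[OF elim(1)] gXs by (intro power_mono) auto
   also have "\<dots> \<le> 8 * (p (w s))\<^sup>2 + 2"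
    using sum_squares_bound[of "p (w s)" 1] zero_le_power2[of "p (w s)"]
    unfolding power2_sum power_one mult_1_right by linarith
   finally have "k s * (p (g n s))\<^sup>2 \<le> k s * (8 * (p (w s))\<^sup>2 + 2)"
    using k_nonneg[OF elim(2)] by (rule mult_left_mono)
   then show ?case by (simp add: algebra_simps)
  qed
 qed
 have dL: "(\<lambda>s. w s - g n s) \<in> L2" for n using L2_diff[OF w gL] .
 have "(\<lambda>n. \<integral>s. k s * (p (w s - g n s))\<^sup>2 \<partial>M) \<longlonglongrightarrow> (\<integral>s. 0 \<partial>M)"
 proof (rule integral_dominated_convergence[OF _ _ dom])
  show "(\<lambda>s. k s * (p (w s - g n s))\<^sup>2) \<in> borel_measurable M" for n using L2_D(2)[OF dL] by auto
  show "AE s in M. (\<lambda>n. k s * (p (w s - g n s))\<^sup>2) \<longlonglongrightarrow> 0"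
   using a(3,4) AE_space
  proof eventually_elim
   case (elim s)
   have "\<forall>\<^sub>F n in sequentially. p (w s - a n s) < 1"
    using order_tendstoD(2)[OF elim(1)] by simp
   then have ev: "\<forall>\<^sub>F n in sequentially. k s * (p (w s - a n s))\<^sup>2 = k s * (p (w s - g n s))\<^sup>2"
   proof eventually_elim
    case (elim n)
    then have "p (a n s) \<le> p (w s) + 1"
     using p_triangle_diff[of "a n s" "w s" 0] p_minus_commute[of "w s" "a n s"] aX \<open>s \<in> space M\<close> \<open>w s \<in> X\<close> by auto
    then show ?case by (simp add: g_def)
   qed
   have "(\<lambda>n. k s * (p (w s - a n s))\<^sup>2) \<longlonglongrightarrow> k s * 0\<^sup>2"
    by (intro tendsto_intros elim)
   then show ?case using tendsto_cong[OF ev] by simp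
  qed
  show "AE s in M. norm (k s * (p (w s - g n s))\<^sup>2) \<le> 8 * (k s * (p (w s))\<^sup>2) + 2 * k s" for n
   using a(4) AE_space
  proof eventually_elim
   case (elim s)
   have gXs: "g n s \<in> X" using gX[of n] elim by auto
   have "p (w s - g n s) \<le> p (w s) + (p (w s) + 1)"
    using p_diff_le[OF elim(1) gXs] gb[OF elim(1), of n] by linarith
   then have "(p (w s - g n s))\<^sup>2 \<le> (2 * p (w s) + 1)\<^sup>2" using elim gXs by (intro power_mono) auto
   also have "\<dots> \<le> 8 * (p (w s))\<^sup>2 + 2"
    using sum_squares_bound[of "2 * p (w s)" 1] by (simp add: power2_sum power_mult_distrib)
   finally have "k s * (p (w s - g n s))\<^sup>2 \<le> k s * (8 * (p (w s))\<^sup>2 + 2)"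
    using k_nonneg[OF elim(2)] by (rule mult_left_mono)
   then show ?case using k_nonneg[OF elim(2)] by (simp add: algebra_simps)
  qed
 qed auto
 then have "(\<lambda>n. (L2_norm (\<lambda>s. w s - g n s))\<^sup>2) \<longlonglongrightarrow> 0"
  using L2_norm_square[OF dL] by simp
 from order_tendstoD(2)[OF this, of "e\<^sup>2"] e obtain n where "(L2_norm (\<lambda>s. w s - g n s))\<^sup>2 < e\<^sup>2"
  by (auto simp: eventually_sequentially)
 then have "L2_norm (\<lambda>s. w s - g n s) < e" using e by (meson less_imp_le power_less_imp_less_base)
 then show ?thesis using gs gX gL by blast
qed

text \<open>
Young's inequality \<open>q \<le> 2\<^sup>j q\<^sup>2 + 2\<^sup>-\<^sup>j\<close>: since the weight has finite mass, geometric decay of the norms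
gives geometric decay in mean.
\<close>

lemma L2_L1_bound:
 assumes w: "w \<in> L2" and q: "L2_norm w \<le> C * (1/2) ^ j" and C: "0 \<le> C"
 shows "integrable M (\<lambda>s. k s * p (w s))"
  and "(\<integral>s. k s * p (w s) \<partial>M) \<le> (C\<^sup>2 + (\<integral>s. k s \<partial>M)) * (1/2) ^ j"
proof -
 have pw: "(\<lambda>s. p (w s)) \<in> borel_measurable M" using p_measurable[OF M_complete L2_D(1)[OF w]] .
 have young: "AE s in M. k s * p (w s) \<le> 2 ^ j * (k s * (p (w s))\<^sup>2) + (1/2) ^ j * k s"
  using L2_D(3)[OF w] AE_space
 proof eventually_elim
  case (elim s)
  have c: "(1/2::real) ^ j * 2 ^ j = 1" by (simp add: power_mult_distrib[symmetric])
  have "0 \<le> (1/2) ^ j * (2 ^ j * p (w s) - 1)\<^sup>2" by simp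
  also have "\<dots> = ((1/2) ^ j * 2 ^ j) * (2 ^ j * (p (w s))\<^sup>2) - 2 * (((1/2) ^ j * 2 ^ j) * p (w s)) + (1/2) ^ j"
   by (simp add: power2_eq_square algebra_simps)
  finally have "2 * p (w s) \<le> 2 ^ j * (p (w s))\<^sup>2 + (1/2) ^ j" unfolding c by simp
  then have "p (w s) \<le> 2 ^ j * (p (w s))\<^sup>2 + (1/2) ^ j" using p_nonneg[OF elim(1)] by linarith
  then have "k s * p (w s) \<le> k s * (2 ^ j * (p (w s))\<^sup>2 + (1/2) ^ j)"
   using k_nonneg[OF elim(2)] by (rule mult_left_mono)
  then show ?case by (simp add: algebra_simps)
 qed
 have dom: "integrable M (\<lambda>s. 2 ^ j * (k s * (p (w s))\<^sup>2) + (1/2) ^ j * k s)"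
  using L2_D(2)[OF w] k_integrable by auto
 show i: "integrable M (\<lambda>s. k s * p (w s))"
 proof (rule Bochner_Integration.integrable_bound[OF dom])
  show "(\<lambda>s. k s * p (w s)) \<in> borel_measurable M" using pw k_measurable by measurable
  show "AE s in M. norm (k s * p (w s)) \<le> norm (2 ^ j * (k s * (p (w s))\<^sup>2) + (1/2) ^ j * k s)"
   using young L2_D(3)[OF w] AE_space by eventually_elim (simp add: k_nonneg)
 qed
 have "(\<integral>s. k s * p (w s) \<partial>M) \<le> (\<integral>s. 2 ^ j * (k s * (p (w s))\<^sup>2) + (1/2) ^ j * k s \<partial>M)"
  using i dom young by (rule integral_mono_AE)
 also have "\<dots> = 2 ^ j * (L2_norm w)\<^sup>2 + (1/2) ^ j * (\<integral>s. k s \<partial>M)"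
  using L2_D(2)[OF w] k_integrable by (simp add: L2_norm_square[OF w])
 also have "2 ^ j * (L2_norm w)\<^sup>2 \<le> 2 ^ j * (C * (1/2) ^ j)\<^sup>2"
  using q L2_norm_nonneg[OF w] by (intro mult_left_mono power_mono) auto
 also have "2 ^ j * (C * (1/2) ^ j)\<^sup>2 = C\<^sup>2 * (1/2) ^ j"
 proof -
  have c: "(2::real) ^ j * (1/2) ^ j = 1" by (simp add: power_mult_distrib[symmetric])
  have "2 ^ j * (C * (1/2) ^ j)\<^sup>2 = (2 ^ j * (1/2) ^ j) * (C\<^sup>2 * (1/2) ^ j)"
   by (simp only: power2_eq_square mult_ac)
  then show ?thesis unfolding c by simp
 qed
 finally show "(\<integral>s. k s * p (w s) \<partial>M) \<le> (C\<^sup>2 + (\<integral>s. k s \<partial>M)) * (1/2) ^ j" by (simp add: algebra_simps)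
qed

end

locale complete_weighted_L2 = weighted_L2 + complete_semi_hilbert
begin

text \<open>
The Riesz-Fischer argument: by summability in mean, the sequence is Cauchy at almost every point where
the weight is positive, and the pointwise limit is the limit in the norm.
\<close>

lemma L2_geometric_converges:
 assumes g: "\<And>j. simple_function M (g j)" "\<And>j. g j ` space M \<subseteq> X" "\<And>j. g j \<in> L2"
  and C: "0 \<le> C" and step: "\<And>j. L2_norm (g (Suc j) - g j) \<le> C * (1/2) ^ j"
 shows "\<exists>w\<in>L2. (\<lambda>j. L2_norm (g j - w)) \<longlonglongrightarrow> 0"
proof -
 interpret L2: semi_hilbert L2 L2_ip L2_norm by (rule L2_semi_hilbert)
 have gX: "g j s \<in> X" if "s \<in> space M" for j s using g(2)[of j] that by auto
 define h where "h j s = k s * p (g (Suc j) s - g j s)" for j s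
 have dL: "(\<lambda>s. g (Suc j) s - g j s) \<in> L2" for j using L2_diff g(3) by auto
 have st: "L2_norm (\<lambda>s. g (Suc j) s - g j s) \<le> C * (1/2) ^ j" for j
  using step[of j] by (simp add: fun_diff_def)
 have hi: "integrable M (h j)" and hb: "(\<integral>s. h j s \<partial>M) \<le> (C\<^sup>2 + (\<integral>s. k s \<partial>M)) * (1/2) ^ j" for j
  unfolding h_def using L2_L1_bound[OF dL st C] by auto
 have h0: "0 \<le> h j s" if "s \<in> space M" for j s
  unfolding h_def using k_nonneg that gX by simp
 have "AE s in M. summable (\<lambda>j. h j s)"
 proof -
  have fin: "(\<Sum>j. \<integral>\<^sup>+s. ennreal (h j s) \<partial>M) < \<infinity>"
  proof -
   let ?c = "C\<^sup>2 + (\<integral>s. k s \<partial>M)"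
   have "(\<integral>\<^sup>+s. ennreal (h j s) \<partial>M) \<le> ennreal (?c * (1/2) ^ j)" for j
   proof -
    have "(\<integral>\<^sup>+s. ennreal (h j s) \<partial>M) = ennreal (\<integral>s. h j s \<partial>M)"
     using hi h0 by (intro nn_integral_eq_integral AE_I2) auto
    then show ?thesis using hb[of j] by (simp add: ennreal_leI)
   qed
   then have "(\<Sum>j. \<integral>\<^sup>+s. ennreal (h j s) \<partial>M) \<le> (\<Sum>j. ennreal (?c * (1/2) ^ j))"
    by (intro suminf_le) auto
   also have "\<dots> = ennreal (\<Sum>j. ?c * (1/2) ^ j)"
   proof (rule suminf_ennreal2)
    show "summable (\<lambda>j. ?c * (1/2) ^ j)" by (intro summable_mult summable_geometric) simp
    have "0 \<le> (\<integral>s. k s \<partial>M)" using k_nonneg by (intro integral_nonneg_AE AE_I2) auto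
    then show "0 \<le> ?c * (1/2) ^ j" for j by simp
   qed
   finally show ?thesis by (simp add: le_less_trans[OF _ ennreal_less_top])
  qed
  have "(\<integral>\<^sup>+s. (\<Sum>j. ennreal (h j s)) \<partial>M) = (\<Sum>j. \<integral>\<^sup>+s. ennreal (h j s) \<partial>M)"
   using hi by (intro nn_integral_suminf) auto
  then have "AE s in M. (\<Sum>j. ennreal (h j s)) \<noteq> \<infinity>"
   using fin hi by (intro nn_integral_PInf_AE) auto
  then show ?thesis
   using AE_space
  proof eventually_elim
   case (elim s)
   then show ?case using h0 by (intro summable_suminf_not_top) auto
  qed
 qed
 then have conv: "AE s in M. 0 < k s \<longrightarrow> (\<exists>x\<in>X. (\<lambda>j. p (g j s - x)) \<longlonglongrightarrow> 0)"
  using AE_space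
 proof eventually_elim
  case (elim s)
  show ?case
  proof
   assume ks: "0 < k s"
   have "summable (\<lambda>j. (1 / k s) * h j s)" using elim by (intro summable_mult)
   then have sm: "summable (\<lambda>j. p (g (Suc j) s - g j s))" using ks by (simp add: h_def)
   show "\<exists>x\<in>X. (\<lambda>j. p (g j s - x)) \<longlonglongrightarrow> 0"
   proof (rule complete_X)
    show "g j s \<in> X" for j using gX elim by auto
    fix e :: real assume "0 < e"
    from summable_Cauchy[THEN iffD1, OF sm, rule_format, OF this]
    obtain N where N: "\<And>m n. m \<ge> N \<Longrightarrow> norm (\<Sum>j = m..<n. p (g (Suc j) s - g j s)) < e" by blast
    have tele: "p (g n s - g m s) \<le> (\<Sum>j = m..<n. p (g (Suc j) s - g j s))" if "m \<le> n" for m n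
     using that
    proof (induction n rule: dec_induct)
     case (step n)
     have "p (g (Suc n) s - g m s) \<le> p (g (Suc n) s - g n s) + p (g n s - g m s)"
      using gX elim by (intro p_triangle_diff) auto
     then show ?case using step by simp
    qed simp
    have "p (g n s - g m s) < e" if "N \<le> m" "m \<le> n" for m n
     using tele[OF that(2)] N[OF that(1), of n] by simp
    moreover have "p (g m s - g n s) = p (g n s - g m s)" for m n
     using gX elim by (intro p_minus_commute) auto
    ultimately have "\<forall>m\<ge>N. \<forall>n\<ge>N. p (g m s - g n s) < e" by (metis nle_le)
    then show "\<exists>N. \<forall>m\<ge>N. \<forall>n\<ge>N. p (g m s - g n s) < e" ..
   qed
  qed
 qed
 define w where "w s = (if 0 < k s \<and> (\<exists>x\<in>X. (\<lambda>j. p (g j s - x)) \<longlonglongrightarrow> 0)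
   then (SOME x. x \<in> X \<and> (\<lambda>j. p (g j s - x)) \<longlonglongrightarrow> 0) else 0)" for s
 have wX: "w s \<in> X" for s
 proof (cases "0 < k s \<and> (\<exists>x\<in>X. (\<lambda>j. p (g j s - x)) \<longlonglongrightarrow> 0)")
  case True
  then have "\<exists>x. x \<in> X \<and> (\<lambda>j. p (g j s - x)) \<longlonglongrightarrow> 0" by blast
  from someI_ex[OF this] True show ?thesis by (simp add: w_def)
 next
  case False
  then show ?thesis by (auto simp: w_def)
 qed
 have wlim: "AE s in M. 0 < k s \<longrightarrow> (\<lambda>j. p (g j s - w s)) \<longlonglongrightarrow> 0"
  using conv
 proof eventually_elim
  case (elim s)
  show ?case
  proof
   assume ks: "0 < k s"
   then have "\<exists>x. x \<in> X \<and> (\<lambda>j. p (g j s - x)) \<longlonglongrightarrow> 0" using elim by blast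
   from someI_ex[OF this] elim ks show "(\<lambda>j. p (g j s - w s)) \<longlonglongrightarrow> 0" by (simp add: w_def)
  qed
 qed
 have wsm: "strongly_measurable_in X p M w"
 proof (rule strongly_measurableI[where g = "\<lambda>j s. if 0 < k s then g j s else 0"])
  show "AE s in M. w s \<in> X" using wX by simp
  show "simple_function M (\<lambda>s. if 0 < k s then g j s else 0)" for j
   using k_measurable by (intro simple_function_If g) (auto simp: borel_measurable_less)
  show "(\<lambda>s. if 0 < k s then g j s else 0) ` space M \<subseteq> X" for j using gX by auto
  show "AE s in M. (\<lambda>j. p (w s - (if 0 < k s then g j s else 0))) \<longlonglongrightarrow> 0"
   using wlim AE_space
  proof eventually_elim
   case (elim s)
   show ?case
   proof (cases "0 < k s")
    case True
    then show ?thesis using elim p_minus_commute[OF wX gX, of s s] by simp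
   next
    case False
    then show ?thesis by (simp add: w_def)
   qed
  qed
 qed
 have Cauchy: "L2_norm (g i - g j) \<le> 2 * C * (1/2) ^ j" if "j \<le> i" for i j
 proof -
  have "L2_norm (g i - g j) \<le> 2 * C * (1/2) ^ j - 2 * C * (1/2) ^ i"
   using that
  proof (induction i rule: dec_induct)
   case (step i)
   have "L2_norm (g (Suc i) - g j) \<le> L2_norm (g (Suc i) - g i) + L2_norm (g i - g j)"
    by (intro L2.p_triangle_diff g)
   moreover have "2 * C * (1/2) ^ Suc i = C * (1/2) ^ i" "2 * C * (1/2) ^ i = 2 * (C * (1/2) ^ i)" by auto
   ultimately show ?case using step(3) assms(5)[of i] by linarith
  qed (use L2.p_zero in \<open>simp add: zero_fun_def\<close>)
  moreover have "0 \<le> 2 * C * (1/2) ^ i" using C by simp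
  ultimately show ?thesis by linarith
 qed
 have fatou: "(\<lambda>s. w s - g j s) \<in> L2 \<and> L2_norm (\<lambda>s. w s - g j s) \<le> 2 * C * (1/2) ^ j" for j
 proof -
  let ?u = "\<lambda>i s. ennreal (k s * (p (g i s - g j s))\<^sup>2)"
  have ij: "(\<lambda>s. g i s - g j s) \<in> L2" for i using L2_diff g(3) by auto
  have sm: "strongly_measurable_in X p M (\<lambda>s. w s - g j s)"
   by (intro strongly_measurable_diff wsm L2_D(1) g)
  have pm: "(\<lambda>s. k s * (p (w s - g j s))\<^sup>2) \<in> borel_measurable M"
   using p_measurable[OF M_complete sm] k_measurable by measurable
  have "(\<integral>\<^sup>+s. ennreal (k s * (p (w s - g j s))\<^sup>2) \<partial>M) \<le> (\<integral>\<^sup>+s. liminf (\<lambda>i. ?u i s) \<partial>M)"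
  proof (rule nn_integral_mono_AE)
   show "AE s in M. ennreal (k s * (p (w s - g j s))\<^sup>2) \<le> liminf (\<lambda>i. ?u i s)"
    using wlim AE_space
   proof eventually_elim
    case (elim s)
    show ?case
    proof (cases "0 < k s")
     case True
     have "(\<lambda>i. p ((g i s - g j s) - (w s - g j s))) \<longlonglongrightarrow> 0" using elim True by simp
     then have "(\<lambda>i. p (g i s - g j s)) \<longlonglongrightarrow> p (w s - g j s)"
      using gX elim wX by (intro p_LIMSEQ) auto
     then have "(\<lambda>i. ?u i s) \<longlonglongrightarrow> ennreal (k s * (p (w s - g j s))\<^sup>2)"
      by (intro tendsto_ennrealI tendsto_intros)
     then have "liminf (\<lambda>i. ?u i s) = ennreal (k s * (p (w s - g j s))\<^sup>2)"
      by (intro lim_imp_Liminf) auto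
     then show ?thesis by simp
    next
     case False
     then have "k s = 0" using k_nonneg[OF elim(2)] by simp
     then show ?thesis by simp
    qed
   qed
  qed
  also have "\<dots> \<le> liminf (\<lambda>i. \<integral>\<^sup>+s. ?u i s \<partial>M)"
   using L2_D(2)[OF ij] by (intro nn_integral_liminf) auto
  also have "\<dots> \<le> ennreal ((2 * C * (1/2) ^ j)\<^sup>2)"
  proof -
   have "\<forall>\<^sub>F i in sequentially. (\<integral>\<^sup>+s. ?u i s \<partial>M) \<le> ennreal ((2 * C * (1/2) ^ j)\<^sup>2)"
    unfolding eventually_sequentially
   proof (intro exI[of _ j] allI impI)
    fix i assume i: "j \<le> i"
    have "(\<integral>\<^sup>+s. ?u i s \<partial>M) = ennreal (\<integral>s. k s * (p (g i s - g j s))\<^sup>2 \<partial>M)"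
     using L2_D(2)[OF ij] k_nonneg by (intro nn_integral_eq_integral AE_I2) auto
    also have "(\<integral>s. k s * (p (g i s - g j s))\<^sup>2 \<partial>M) = (L2_norm (\<lambda>s. g i s - g j s))\<^sup>2"
     using L2_norm_square[OF ij] by simp
    also have "\<dots> \<le> (2 * C * (1/2) ^ j)\<^sup>2"
     using Cauchy[OF i] L2_norm_nonneg[OF ij] by (intro power_mono) (auto simp: fun_diff_def)
    finally show "(\<integral>\<^sup>+s. ?u i s \<partial>M) \<le> ennreal ((2 * C * (1/2) ^ j)\<^sup>2)" by (simp add: ennreal_leI)
   qed
   then show ?thesis by (rule Liminf_le[rotated]) simp
  qed
  finally have nn: "(\<integral>\<^sup>+s. ennreal (k s * (p (w s - g j s))\<^sup>2) \<partial>M) \<le> ennreal ((2 * C * (1/2) ^ j)\<^sup>2)" .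
  have pos: "AE s in M. 0 \<le> k s * (p (w s - g j s))\<^sup>2" using k_nonneg by (intro AE_I2) auto
  have int: "integrable M (\<lambda>s. k s * (p (w s - g j s))\<^sup>2)"
   using nn by (intro integrableI_nonneg pm pos) (simp add: le_less_trans[OF _ ennreal_less_top])
  have mem: "(\<lambda>s. w s - g j s) \<in> L2" using sm int by (simp add: L2_def)
  have "ennreal ((L2_norm (\<lambda>s. w s - g j s))\<^sup>2) \<le> ennreal ((2 * C * (1/2) ^ j)\<^sup>2)"
   using nn nn_integral_eq_integral[OF int pos] L2_norm_square[OF mem] by simp
  then have "(L2_norm (\<lambda>s. w s - g j s))\<^sup>2 \<le> (2 * C * (1/2) ^ j)\<^sup>2" by (simp add: ennreal_le_iff)
  then have "L2_norm (\<lambda>s. w s - g j s) \<le> 2 * C * (1/2) ^ j"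
   by (rule power2_le_imp_le) (simp add: C)
  then show ?thesis using mem by simp
 qed
 have wL: "w \<in> L2"
  using L2_add[OF conjunct1[OF fatou[of 0]] g(3)[of 0]] by simp
 have "(\<lambda>j. L2_norm (g j - w)) \<longlonglongrightarrow> 0"
 proof (rule Lim_null_comparison)
  show "\<forall>\<^sub>F j in sequentially. norm (L2_norm (g j - w)) \<le> 2 * C * (1/2) ^ j"
  proof (intro always_eventually allI)
   fix j
   have "L2_norm (g j - w) = L2_norm (w - g j)" by (rule L2.p_minus_commute[OF g(3) wL])
   also have "\<dots> \<le> 2 * C * (1/2) ^ j" using fatou[of j] by (simp add: fun_diff_def)
   finally show "norm (L2_norm (g j - w)) \<le> 2 * C * (1/2) ^ j"
    using L2.p_nonneg[OF L2.X_diff[OF g(3) wL]] by simp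
  qed
  show "(\<lambda>j. 2 * C * (1/2) ^ j) \<longlonglongrightarrow> 0" by (intro tendsto_mult_right_zero LIMSEQ_realpow_zero) auto
 qed
 then show ?thesis using wL by blast
qed

text \<open>Every Cauchy sequence is replaced by simple functions along a fast subsequence.\<close>

lemma L2_complete_semi_hilbert: "complete_semi_hilbert L2 L2_ip L2_norm"
proof -
 interpret L2: semi_hilbert L2 L2_ip L2_norm by (rule L2_semi_hilbert)
 show ?thesis
 proof
  fix f :: "nat \<Rightarrow> _"
  assume f: "\<And>n. f n \<in> L2" and cauchy: "\<And>e. 0 < e \<Longrightarrow> \<exists>N. \<forall>m\<ge>N. \<forall>n\<ge>N. L2_norm (f m - f n) < e"
  have "\<forall>j. \<exists>N. \<forall>m\<ge>N. \<forall>n\<ge>N. L2_norm (f m - f n) < (1/2) ^ j" using cauchy by simp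
  from choice[OF this] obtain N where N: "\<And>j m n. \<lbrakk>m \<ge> N j; n \<ge> N j\<rbrakk> \<Longrightarrow> L2_norm (f m - f n) < (1/2) ^ j"
   by blast
  define r where "r j = (\<Sum>i\<le>j. N i)" for j
  have r: "r j \<ge> N j" "r (Suc j) \<ge> r j" for j by (simp_all add: r_def member_le_sum)
  have "\<forall>j. \<exists>g. simple_function M g \<and> g ` space M \<subseteq> X \<and> g \<in> L2 \<and> L2_norm (\<lambda>s. f (r j) s - g s) < (1/2) ^ j"
   by (intro allI L2_simple_dense f) simp
  from choice[OF this] obtain g where g: "\<And>j. simple_function M (g j)" "\<And>j. g j ` space M \<subseteq> X" "\<And>j. g j \<in> L2"
   "\<And>j. L2_norm (f (r j) - g j) < (1/2) ^ j" by (auto simp: fun_diff_def)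
  have "L2_norm (g (Suc j) - g j) \<le> 3 * (1/2) ^ j" for j
  proof -
   have "L2_norm (g (Suc j) - g j) \<le> L2_norm (g (Suc j) - f (r (Suc j))) + (L2_norm (f (r (Suc j)) - f (r j)) + L2_norm (f (r j) - g j))"
    using L2.p_triangle_diff[OF g(3)[of "Suc j"] f[of "r (Suc j)"] g(3)[of j]]
     L2.p_triangle_diff[OF f[of "r (Suc j)"] f[of "r j"] g(3)[of j]]
    by linarith
   moreover have "L2_norm (g (Suc j) - f (r (Suc j))) = L2_norm (f (r (Suc j)) - g (Suc j))"
    by (rule L2.p_minus_commute[OF g(3) f])
   moreover have "L2_norm (f (r (Suc j)) - f (r j)) < (1/2) ^ j" using r[of j] by (intro N) auto
   moreover have "(1/2::real) ^ Suc j \<le> (1/2) ^ j" by simp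
   ultimately show ?thesis using g(4)[of j] g(4)[of "Suc j"] by linarith
  qed
  from L2_geometric_converges[OF g(1-3) _ this] obtain w where w: "w \<in> L2" "(\<lambda>j. L2_norm (g j - w)) \<longlonglongrightarrow> 0" by auto
  have "(\<lambda>n. L2_norm (f n - w)) \<longlonglongrightarrow> 0"
  proof (rule LIMSEQ_I)
   fix e :: real assume e: "0 < e"
   have "\<forall>\<^sub>F j in sequentially. L2_norm (g j - w) < e / 3"
    using order_tendstoD(2)[OF w(2), of "e / 3"] e by simp
   moreover have "\<forall>\<^sub>F j in sequentially. (1/2::real) ^ j < e / 3"
    using order_tendstoD(2)[OF LIMSEQ_realpow_zero[of "1/2::real"], of "e / 3"] e by simp
   ultimately have "\<forall>\<^sub>F j in sequentially. L2_norm (g j - w) < e / 3 \<and> (1/2::real) ^ j < e / 3"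
    by (rule eventually_conj)
   then obtain j where j: "L2_norm (g j - w) < e / 3" "(1/2::real) ^ j < e / 3"
    by (auto simp: eventually_sequentially)
   have "norm (L2_norm (f n - w) - 0) < e" if n: "n \<ge> r j" for n
   proof -
    have "L2_norm (f n - w) \<le> L2_norm (f n - f (r j)) + (L2_norm (f (r j) - g j) + L2_norm (g j - w))"
     using L2.p_triangle_diff[OF f[of n] f[of "r j"] w(1)] L2.p_triangle_diff[OF f[of "r j"] g(3)[of j] w(1)] by linarith
    moreover have "L2_norm (f n - f (r j)) < (1/2) ^ j" using r(1)[of j] n by (intro N) auto
    moreover have "0 \<le> L2_norm (f n - w)" using f w(1) by (intro L2.p_nonneg L2.X_diff)
    ultimately show ?thesis using g(4)[of j] j by simp
   qed
   then show "\<exists>no. \<forall>n\<ge>no. norm (L2_norm (f n - w) - 0) < e" by blast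
  qed
  then show "\<exists>x\<in>L2. (\<lambda>n. L2_norm (f n - x)) \<longlonglongrightarrow> 0" using w(1) by blast
 qed
qed

end

section \<open>The energy space\<close>

context stable_semigroup
begin

text \<open>
Telescoping over steps of length \<open>t / n\<close>: the derivative at time \<open>0\<close> alone bounds every increment of
the orbit, without differentiability at later times.
\<close>

lemma orbit_increment_bound:
 assumes U: "U \<in> X" and V: "V \<in> X"
  and gen: "((\<lambda>h. p ((1 / h) *\<^sub>R (S h U - U) - V)) \<longlongrightarrow> 0) (at_right 0)" and t: "0 < t"
 shows "p (S t U - U) \<le> t * M * p V"
proof -
 have step: "p (S (real j * h) U - U) \<le> real j * (M * p (S h U - U))" if h: "0 \<le> h" for j h
 proof (induction j)
  case 0
  then show ?case using S_zero[OF U] by simp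
 next
  case (Suc j)
  have X: "S (real (Suc j) * h) U \<in> X" "S (real j * h) U \<in> X" using U h by auto
  have "p (S (real (Suc j) * h) U - U) \<le> p (S (real (Suc j) * h) U - S (real j * h) U) + p (S (real j * h) U - U)"
   using X U by (intro p_triangle_diff)
  also have "p (S (real (Suc j) * h) U - S (real j * h) U) \<le> M * p (S (real (Suc j) * h - real j * h) U - U)"
   using h U by (intro S_increment) (auto intro: mult_right_mono)
  also have "real (Suc j) * h - real j * h = h" by (simp add: algebra_simps)
  finally show ?case using Suc.IH by (simp add: algebra_simps)
 qed
 have seq: "filterlim (\<lambda>n. t / real (Suc n)) (at_right 0) sequentially"
  unfolding filterlim_at
 proof
  have "(\<lambda>n. t * (1 / real (Suc n))) \<longlonglongrightarrow> t * 0" by (intro tendsto_intros LIMSEQ_Suc[OF lim_1_over_n])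
  then show "((\<lambda>n. t / real (Suc n)) \<longlongrightarrow> 0) sequentially" by simp
  show "\<forall>\<^sub>F n in sequentially. t / real (Suc n) \<in> {0<..} \<and> t / real (Suc n) \<noteq> 0" using t by simp
 qed
 have lim: "(\<lambda>n. p ((1 / (t / real (Suc n))) *\<^sub>R (S (t / real (Suc n)) U - U) - V)) \<longlonglongrightarrow> 0"
  using filterlim_compose[OF gen seq] by simp
 have "p (S t U - U) \<le> t * M * (p V + p ((1 / (t / real (Suc n))) *\<^sub>R (S (t / real (Suc n)) U - U) - V))" for n
 proof -
  define h where "h = t / real (Suc n)"
  have h: "0 < h" "real (Suc n) * h = t" using t by (auto simp: h_def)
  have X: "S h U \<in> X" "S h U - U \<in> X" using U h by auto
  have "p (S h U - U) = h * p ((1 / h) *\<^sub>R (S h U - U))" using h X by (simp add: p_scaleR)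
  also have "\<dots> \<le> h * (p V + p ((1 / h) *\<^sub>R (S h U - U) - V))"
   using p_triangle[of V "(1 / h) *\<^sub>R (S h U - U) - V"] h X V by (intro mult_left_mono) auto
  finally have le: "p (S h U - U) \<le> h * (p V + p ((1 / h) *\<^sub>R (S h U - U) - V))" .
  have "p (S t U - U) \<le> real (Suc n) * (M * p (S h U - U))" using step[of h "Suc n"] h by simp
  also have "\<dots> \<le> real (Suc n) * (M * (h * (p V + p ((1 / h) *\<^sub>R (S h U - U) - V))))"
   using le M_pos by (intro mult_left_mono) auto
  also have "\<dots> = (real (Suc n) * h) * M * (p V + p ((1 / h) *\<^sub>R (S h U - U) - V))" by (simp only: mult_ac)
  finally show ?thesis unfolding h(2) unfolding h_def .
 qed
 moreover have "(\<lambda>n. t * M * (p V + p ((1 / (t / real (Suc n))) *\<^sub>R (S (t / real (Suc n)) U - U) - V))) \<longlonglongrightarrow> t * M * (p V + 0)"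
  by (intro tendsto_intros lim)
 ultimately show ?thesis using LIMSEQ_le_const by fastforce
qed

end

text \<open>
The decay condition \<open>k' \<le> - \<zeta> k\<close> enters as monotonicity of the kernel.
\<close>

locale wave_memory =
 fixes A R :: "'h::{real_inner, banach} \<Rightarrow> 'h" and DA DR :: "'h set" and k :: "real \<Rightarrow> real"
  and S :: "real \<Rightarrow> 'h state \<Rightarrow> 'h state" and M \<omega> :: real
 assumes sqrt_A: "is_sqrt_op DA A DR R"
  and k_nonneg: "0 \<le> t \<Longrightarrow> 0 \<le> k t"
  and k_cont: "continuous_on {0..} k"
  and k_mono: "\<lbrakk>0 \<le> s; s \<le> t\<rbrakk> \<Longrightarrow> k t \<le> k s"
  and k_L1: "set_integrable lebesgue {0<..} k"
  and k_mass: "kernel_mass k < 1"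
  and S_gen: "generates_in (energy_space DR R k) (energy_norm R k) (wave_memory_op DA A DR R k) S"
  and M: "0 < M" and omega: "0 < \<omega>"
  and S_stable: "\<lbrakk>t \<ge> 0; U \<in> energy_space DR R k\<rbrakk>
    \<Longrightarrow> energy_norm R k (S t U) \<le> M * exp (- \<omega> * t) * energy_norm R k U"
begin

abbreviation "X \<equiv> energy_space DR R k"
abbreviation "E \<equiv> energy_norm R k"

lemma R_self_adjoint: "self_adjoint_on DR R"
 using sqrt_A by (simp add: is_sqrt_op_def positive_self_adjoint_on_def)

lemma DR_subspace: "subspace DR"
 and R_add: "\<lbrakk>x \<in> DR; y \<in> DR\<rbrakk> \<Longrightarrow> R (x + y) = R x + R y"
 and R_scaleR: "x \<in> DR \<Longrightarrow> R (c *\<^sub>R x) = c *\<^sub>R R x"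
 and DR_dense: "closure DR = UNIV"
 and R_symmetric: "\<lbrakk>x \<in> DR; y \<in> DR\<rbrakk> \<Longrightarrow> R x \<bullet> y = x \<bullet> R y"
 using R_self_adjoint by (auto simp: self_adjoint_on_def linear_op_on_def)

lemma DR_adjoint: "(\<And>x. x \<in> DR \<Longrightarrow> R x \<bullet> y = x \<bullet> z) \<Longrightarrow> y \<in> DR"
 using R_self_adjoint unfolding self_adjoint_on_def by blast

lemma R_zero: "R 0 = 0"
 using R_scaleR[of 0 0] DR_subspace by (simp add: subspace_0)

lemma DR_zero: "0 \<in> DR" using DR_subspace by (simp add: subspace_0)

lemma R_diff: "\<lbrakk>x \<in> DR; y \<in> DR\<rbrakk> \<Longrightarrow> R (x - y) = R x - R y"
 using R_add[of x "-1 *\<^sub>R y"] R_scaleR[of y "-1"] subspace_scale[OF DR_subspace, of y "-1"] by simp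

text \<open>\<open>D(R)\<close> is dense.\<close>

lemma orthogonal_to_DR:
 assumes "\<And>x. x \<in> DR \<Longrightarrow> x \<bullet> z = 0"
 shows "z = 0"
proof -
 have "closed {x. x \<bullet> z = 0}" by (intro closed_Collect_eq continuous_intros)
 then have "closure DR \<subseteq> {x. x \<bullet> z = 0}" using assms by (intro closure_minimal) auto
 then have "z \<bullet> z = 0" using DR_dense by blast
 then show ?thesis by simp
qed

text \<open>A self-adjoint operator is closed.\<close>

lemma R_closed:
 assumes u: "\<And>n. u n \<in> DR" and ux: "u \<longlonglongrightarrow> x" and Ru: "(\<lambda>n. R (u n)) \<longlonglongrightarrow> z"
 shows "x \<in> DR" "R x = z"
proof -
 have eq: "R y \<bullet> x = y \<bullet> z" if y: "y \<in> DR" for y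
 proof (rule LIMSEQ_unique)
  show "(\<lambda>n. R y \<bullet> u n) \<longlonglongrightarrow> R y \<bullet> x" by (intro tendsto_intros ux)
  have "(\<lambda>n. y \<bullet> R (u n)) \<longlonglongrightarrow> y \<bullet> z" by (intro tendsto_intros Ru)
  then show "(\<lambda>n. R y \<bullet> u n) \<longlonglongrightarrow> y \<bullet> z" using R_symmetric[OF y u] by simp
 qed
 show x: "x \<in> DR" using eq by (rule DR_adjoint)
 have "R x - z = 0"
 proof (rule orthogonal_to_DR)
  fix y assume y: "y \<in> DR"
  have "y \<bullet> R x = y \<bullet> z" using eq[OF y] R_symmetric[OF y x] by simp
  then show "y \<bullet> (R x - z) = 0" by (simp add: inner_diff_right)
 qed
 then show "R x = z" by simp
qed

lemma DR_semi_hilbert: "semi_hilbert DR (\<lambda>u v. R u \<bullet> R v) (sqrt_norm R)"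
 by unfold_locales
  (auto simp: DR_subspace R_add R_scaleR inner_add_left sqrt_norm_def norm_eq_sqrt_inner intro: inner_commute)

sublocale DR: semi_hilbert DR "\<lambda>u v. R u \<bullet> R v" "sqrt_norm R"
 by (rule DR_semi_hilbert)

lemma k_integrable: "integrable (lebesgue_on {0<..}) k"
 using k_L1 by (simp add: set_integrable_def integrable_restrict_space)

sublocale W: weighted_L2 DR "\<lambda>u v. R u \<bullet> R v" "sqrt_norm R" "lebesgue_on {0<..}" k
 by unfold_locales (auto intro: complete_measure.complete[OF complete_measure_lebesgue_on] k_integrable k_nonneg)

lemma L2_kernel_eq: "L2_kernel DR R k = W.L2"
 by (auto simp: L2_kernel_def W.L2_def set_integrable_def integrable_restrict_space sqrt_norm_def)

lemma energy_space_iff: "(u, v, w) \<in> X \<longleftrightarrow> u \<in> DR \<and> w \<in> W.L2"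
 by (simp add: energy_space_def L2_kernel_eq)

lemma energy_inner_eq:
 "energy_inner R k (u, v, w) (u', v', w') = (1 - kernel_mass k) * (R u \<bullet> R u') + v \<bullet> v' + W.L2_ip w w'"
 by (simp add: energy_inner_def W.L2_ip_def set_lebesgue_integral_def integral_restrict_space)

lemma energy_semi_hilbert: "semi_hilbert X (energy_inner R k) E"
proof
 interpret L2: semi_hilbert W.L2 W.L2_ip W.L2_norm by (rule W.L2_semi_hilbert)
 show "subspace X"
  using DR_zero L2.X_zero DR_subspace
  by (auto simp: subspace_def zero_prod_def energy_space_iff split: prod.splits
    intro: L2.X_add L2.X_scaleR)
 fix x y assume x: "x \<in> X" and y: "y \<in> X"
 obtain u v w where xe: "x = (u, v, w)" by (cases x) auto
 obtain u' v' w' where ye: "y = (u', v', w')" by (cases y) auto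
 have m: "u \<in> DR" "w \<in> W.L2" "u' \<in> DR" "w' \<in> W.L2" using x y by (auto simp: xe ye energy_space_iff)
 show "energy_inner R k x y = energy_inner R k y x"
  using L2.ip_commute[OF m(2,4)] by (simp add: xe ye energy_inner_eq inner_commute)
 show "energy_inner R k (a *\<^sub>R x) y = a * energy_inner R k x y" for a
  using m L2.ip_scaleR_left[OF m(2,4)] by (simp add: xe ye energy_inner_eq R_scaleR algebra_simps)
 show "energy_inner R k (x + z) y = energy_inner R k x y + energy_inner R k z y" if z: "z \<in> X" for z
 proof -
  obtain u'' v'' w'' where ze: "z = (u'', v'', w'')" by (cases z) auto
  then have m': "u'' \<in> DR" "w'' \<in> W.L2" using z by (auto simp: energy_space_iff)
  show ?thesis
   using m m' L2.ip_add_left[OF m(2) m'(2) m(4)] by (simp add: xe ye ze energy_inner_eq R_add inner_add_left algebra_simps)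
 qed
 show "0 \<le> energy_inner R k x x"
  using k_mass W.L2_ip_nonneg[OF m(2)] by (simp add: xe energy_inner_eq)
 show "E x = sqrt (energy_inner R k x x)" by (simp add: energy_norm_def)
qed

sublocale H: stable_semigroup X "energy_inner R k" E S M \<omega>
proof -
 interpret semi_hilbert X "energy_inner R k" E by (rule energy_semi_hilbert)
 show "stable_semigroup X (energy_inner R k) E S M \<omega>"
  by unfold_locales (use S_gen M omega S_stable in \<open>auto simp: generates_in_def\<close>)
qed

lemma energy_norm_square:
 assumes "(u, v, w) \<in> X"
 shows "(E (u, v, w))\<^sup>2 = (1 - kernel_mass k) * (norm (R u))\<^sup>2 + (norm v)\<^sup>2 + (W.L2_norm w)\<^sup>2"
proof -
 have "w \<in> W.L2" using assms by (simp add: energy_space_iff)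
 then have "(W.L2_norm w)\<^sup>2 = W.L2_ip w w" by (simp add: W.L2_norm_def W.L2_ip_nonneg)
 then show ?thesis
  using H.p_square[OF assms] by (simp add: energy_inner_eq power2_norm_eq_inner)
qed

lemma component_bounds:
 assumes U: "(u, v, w) \<in> X"
 shows "sqrt (1 - kernel_mass k) * norm (R u) \<le> E (u, v, w)" "norm v \<le> E (u, v, w)"
  "W.L2_norm w \<le> E (u, v, w)"
proof -
 note sq = energy_norm_square[OF U]
 have E0: "0 \<le> E (u, v, w)" using U by (rule H.p_nonneg)
 have pos: "0 \<le> (1 - kernel_mass k) * (norm (R u))\<^sup>2" using k_mass by simp
 show "norm v \<le> E (u, v, w)"
  by (rule power2_le_imp_le[OF _ E0]) (use sq pos in simp)
 show "W.L2_norm w \<le> E (u, v, w)"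
  by (rule power2_le_imp_le[OF _ E0]) (use sq pos in simp)
 show "sqrt (1 - kernel_mass k) * norm (R u) \<le> E (u, v, w)"
  by (rule power2_le_imp_le[OF _ E0]) (use sq k_mass in \<open>simp add: power_mult_distrib\<close>)
qed

lemma energy_norm_le:
 assumes U: "(u, v, w) \<in> X"
 shows "E (u, v, w) \<le> sqrt (1 - kernel_mass k) * norm (R u) + norm v + W.L2_norm w"
proof (rule power2_le_imp_le)
 have w: "0 \<le> W.L2_norm w" using U by (simp add: energy_space_iff W.L2_norm_nonneg)
 have a: "0 \<le> sqrt (1 - kernel_mass k) * norm (R u)" using k_mass by simp
 have "(sqrt (1 - kernel_mass k) * norm (R u))\<^sup>2 = (1 - kernel_mass k) * (norm (R u))\<^sup>2"
  using k_mass by (simp add: power_mult_distrib)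
 moreover have "a\<^sup>2 + b\<^sup>2 + c\<^sup>2 \<le> (a + b + c)\<^sup>2" if "0 \<le> a" "0 \<le> b" "0 \<le> c" for a b c :: real
  using that by (simp add: power2_sum)
 ultimately show "(E (u, v, w))\<^sup>2 \<le> (sqrt (1 - kernel_mass k) * norm (R u) + norm v + W.L2_norm w)\<^sup>2"
  using energy_norm_square[OF U] w a by fastforce
 show "0 \<le> sqrt (1 - kernel_mass k) * norm (R u) + norm v + W.L2_norm w" using w a by simp
qed

text \<open>
The total weight of the position and of the constant history \<open>n\<close> is \<open>(1 - k~) + k~ = 1\<close>: the image has
the norm \<open>\<parallel>R n\<parallel>\<close>, although only the velocity of the state is nonzero.
\<close>

lemma velocity_in_domain:
 assumes n: "n \<in> DR"
 shows "wave_memory_op DA A DR R k (0, n, 0) (n, 0, \<lambda>_. n)"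
proof -
 have z: "(0 :: real \<Rightarrow> 'h) \<in> L2_kernel DR R k" using W.L2_zero by (simp add: L2_kernel_eq zero_fun_def)
 have DA: "0 \<in> DA" "A 0 = 0" using sqrt_A DR_zero R_zero by (auto simp: is_sqrt_op_def)
 have V: "(n, 0, \<lambda>_. n) \<in> X" using n W.L2_const[OF n] by (simp add: energy_space_iff)
 have y: "has_bochner_integral_in DR (sqrt_norm R) (lebesgue_on {0<..}) (\<lambda>s. k s *\<^sub>R (0 :: real \<Rightarrow> 'h) s) 0"
  using DR.has_bochner_in_zero by simp
 have wd: "weak_derivative_zero_at_0 DR R k 0 0"
  unfolding weak_derivative_zero_at_0_def by (simp add: zero_fun_def DR.has_bochner_in_zero)
 have diff: "(n, 0, \<lambda>_. n) - (n, - A ((1 - kernel_mass k) *\<^sub>R 0 + 0), \<lambda>s. - (0 :: real \<Rightarrow> 'h) s + n) = 0"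
  using DA by (simp add: zero_prod_def fun_eq_iff)
 show ?thesis
  unfolding wave_memory_op_def prod.case
  using n DR_zero z V DA y wd diff H.p_zero
  by (intro conjI exI[of _ "0::'h"] exI[of _ "0 :: real \<Rightarrow> 'h"]) (auto simp: zero_fun_def)
qed

text \<open>
The orbit of \<open>(0, n, 0)\<close> moves at most by \<open>t * M * \<parallel>R n\<parallel>\<close> up to time \<open>t\<close>, by \<open>velocity_in_domain\<close>. At a
time with \<open>M * exp (- \<omega> * t) \<le> 1/2\<close> it must have moved by half of its norm \<open>\<parallel>n\<parallel>\<close>.
\<close>

lemma R_bounded_below: "\<exists>c>0. \<forall>u\<in>DR. norm u \<le> c * norm (R u)"
proof -
 obtain t :: real where t: "0 < t" "M * exp (- \<omega> * t) \<le> 1/2"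
 proof
  \<comment> \<open>the summand \<open>1\<close> makes the time positive when \<open>M = 1/2\<close>\<close>
  let ?t = "\<bar>ln (2 * M)\<bar> / \<omega> + 1"
  show "0 < ?t" using omega by (intro add_nonneg_pos) auto
  have "\<omega> * ?t = \<bar>ln (2 * M)\<bar> + \<omega>" using omega by (simp add: distrib_left)
  then have "ln (2 * M) \<le> \<omega> * ?t" using omega by linarith
  then have "exp (ln (2 * M)) \<le> exp (\<omega> * ?t)" by (simp only: exp_le_cancel_iff)
  then have "2 * M \<le> exp (\<omega> * ?t)" using M by simp
  then have "2 * M * exp (- (\<omega> * ?t)) \<le> exp (\<omega> * ?t) * exp (- (\<omega> * ?t))"
   by (intro mult_right_mono) auto
  then have "2 * M * exp (- (\<omega> * ?t)) \<le> 1" by (simp only: exp_minus_inverse)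
  then show "M * exp (- \<omega> * ?t) \<le> 1/2" by (simp only: mult_minus_left)
 qed
 have "norm n \<le> (2 * t * M) * norm (R n)" if n: "n \<in> DR" for n
 proof -
  let ?U = "(0, n, 0) :: 'h state" and ?V = "(n, 0, \<lambda>_. n) :: 'h state"
  have U: "?U \<in> X" using DR_zero W.L2_zero by (simp add: energy_space_iff zero_fun_def)
  have V: "?V \<in> X" using n W.L2_const[OF n] by (simp add: energy_space_iff)
  have gen: "((\<lambda>h. E ((1 / h) *\<^sub>R (S h ?U - ?U) - ?V)) \<longlongrightarrow> 0) (at_right 0)"
   using S_gen velocity_in_domain[OF n] U V unfolding generates_in_def by blast
  have EV: "E ?V = norm (R n)"
  proof -
   have "(W.L2_norm (\<lambda>_. n))\<^sup>2 = kernel_mass k * (norm (R n))\<^sup>2"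
    using W.L2_norm_square[OF W.L2_const[OF n]]
    by (simp add: sqrt_norm_def kernel_mass_def set_lebesgue_integral_def integral_restrict_space)
   then have "(E ?V)\<^sup>2 = (norm (R n))\<^sup>2" using energy_norm_square[OF V] by (simp add: algebra_simps)
   then show ?thesis using H.p_nonneg[OF V] by (simp add: power2_eq_iff_nonneg)
  qed
  have EU: "E ?U = norm n"
  proof -
   have "W.L2_norm 0 = 0" using semi_hilbert.p_zero[OF W.L2_semi_hilbert] .
   then have "(E ?U)\<^sup>2 = (norm n)\<^sup>2" using energy_norm_square[OF U] R_zero by simp
   then show ?thesis using H.p_nonneg[OF U] by (simp add: power2_eq_iff_nonneg)
  qed
  have SU: "S t ?U \<in> X" using t U by auto
  have "norm n \<le> E (S t ?U - ?U) + E (S t ?U)"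
   using H.p_diff_le[of "S t ?U" "S t ?U - ?U"] SU U EU by simp
  also have "\<dots> \<le> t * M * norm (R n) + 1/2 * norm n"
  proof (rule add_mono)
   show "E (S t ?U - ?U) \<le> t * M * norm (R n)"
    using H.orbit_increment_bound[OF U V gen t(1)] EV by simp
   show "E (S t ?U) \<le> 1/2 * norm n"
    using S_stable[OF less_imp_le[OF t(1)] U] mult_right_mono[OF t(2) norm_ge_zero[of n]] unfolding EU by linarith
  qed
  finally show ?thesis by simp
 qed
 moreover have "0 < 2 * t * M" using t M by simp
 ultimately show ?thesis by blast
qed

text \<open>
Sequences that are Cauchy for \<open>\<parallel>R u\<parallel>\<close> are Cauchy for \<open>\<parallel>u\<parallel>\<close> by \<open>R_bounded_below\<close>, and \<open>R\<close> is closed.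
\<close>

lemma DR_complete: "complete_semi_hilbert DR (\<lambda>u v. R u \<bullet> R v) (sqrt_norm R)"
proof
 fix f :: "nat \<Rightarrow> 'h"
 assume f: "\<And>n. f n \<in> DR" and cauchy: "\<And>e. 0 < e \<Longrightarrow> \<exists>N. \<forall>m\<ge>N. \<forall>n\<ge>N. sqrt_norm R (f m - f n) < e"
 obtain c where c: "0 < c" "\<And>u. u \<in> DR \<Longrightarrow> norm u \<le> c * norm (R u)" using R_bounded_below by blast
 have "Cauchy (\<lambda>n. R (f n))"
  unfolding Cauchy_def dist_norm using cauchy R_diff[OF f f] by (simp add: sqrt_norm_def)
 then obtain z where z: "(\<lambda>n. R (f n)) \<longlonglongrightarrow> z" by (auto simp: Cauchy_convergent_iff convergent_def)
 have "Cauchy f"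
  unfolding Cauchy_def dist_norm
 proof (intro allI impI)
  fix e :: real assume "0 < e"
  then obtain N where N: "\<And>m n. \<lbrakk>m \<ge> N; n \<ge> N\<rbrakk> \<Longrightarrow> sqrt_norm R (f m - f n) < e / c"
   using cauchy[of "e / c"] c by auto
  have "norm (f m - f n) < e" if "m \<ge> N" "n \<ge> N" for m n
  proof -
   have "norm (f m - f n) \<le> c * norm (R (f m - f n))" using f by (intro c) auto
   also have "\<dots> < c * (e / c)" using N[OF that] c by (intro mult_strict_left_mono) (auto simp: sqrt_norm_def)
   finally show ?thesis using c by simp
  qed
  then show "\<exists>M. \<forall>m\<ge>M. \<forall>n\<ge>M. norm (f m - f n) < e" by blast
 qed
 then obtain x where x: "f \<longlonglongrightarrow> x" by (auto simp: Cauchy_convergent_iff convergent_def)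
 have xD: "x \<in> DR" "R x = z" using R_closed[OF f x z] by auto
 have "(\<lambda>n. norm (R (f n) - z)) \<longlonglongrightarrow> 0" using z by (simp add: LIM_zero tendsto_norm_zero)
 then have "(\<lambda>n. sqrt_norm R (f n - x)) \<longlonglongrightarrow> 0" using xD f by (simp add: sqrt_norm_def R_diff)
 then show "\<exists>x\<in>DR. (\<lambda>n. sqrt_norm R (f n - x)) \<longlonglongrightarrow> 0" using xD by blast
qed

lemma W_complete: "complete_semi_hilbert W.L2 W.L2_ip W.L2_norm"
proof -
 interpret DRc: complete_semi_hilbert DR "\<lambda>u v. R u \<bullet> R v" "sqrt_norm R" by (rule DR_complete)
 interpret Wc: complete_weighted_L2 DR "\<lambda>u v. R u \<bullet> R v" "sqrt_norm R" "lebesgue_on {0<..}" k ..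
 show ?thesis by (rule Wc.L2_complete_semi_hilbert)
qed

lemma energy_complete: "complete_semi_hilbert X (energy_inner R k) E"
proof
 interpret L2: complete_semi_hilbert W.L2 W.L2_ip W.L2_norm by (rule W_complete)
 interpret D: complete_semi_hilbert DR "\<lambda>u v. R u \<bullet> R v" "sqrt_norm R" by (rule DR_complete)
 fix f :: "nat \<Rightarrow> 'h state"
 assume f: "\<And>n. f n \<in> X" and cauchy: "\<And>e. 0 < e \<Longrightarrow> \<exists>N. \<forall>m\<ge>N. \<forall>n\<ge>N. E (f m - f n) < e"
 define u v w where "u n = fst (f n)" and "v n = fst (snd (f n))" and "w n = snd (snd (f n))" for n
 have fe: "f n = (u n, v n, w n)" for n by (simp add: u_def v_def w_def)
 have uD: "u n \<in> DR" and wL: "w n \<in> W.L2" for n using f[of n] by (auto simp: fe energy_space_iff)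
 have d: "f m - f n = (u m - u n, v m - v n, w m - w n)" for m n by (simp add: fe)
 have dX: "(u m - u n, v m - v n, w m - w n) \<in> X" for m n using H.X_diff[OF f f] by (metis d)
 define c where "c = sqrt (1 - kernel_mass k)"
 have c: "0 < c" using k_mass by (simp add: c_def)
 have "\<exists>x\<in>DR. (\<lambda>n. sqrt_norm R (u n - x)) \<longlonglongrightarrow> 0"
 proof (rule D.complete_X[OF uD])
  fix e :: real assume "0 < e"
  then obtain N where N: "\<And>m n. \<lbrakk>m \<ge> N; n \<ge> N\<rbrakk> \<Longrightarrow> E (f m - f n) < c * e" using cauchy[of "c * e"] c by auto
  have "sqrt_norm R (u m - u n) < e" if "m \<ge> N" "n \<ge> N" for m n
  proof -
   have "c * norm (R (u m - u n)) < c * e"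
    using component_bounds(1)[OF dX, of m n] N[OF that] unfolding d c_def by linarith
   then show ?thesis using c by (simp add: sqrt_norm_def)
  qed
  then show "\<exists>N. \<forall>m\<ge>N. \<forall>n\<ge>N. sqrt_norm R (u m - u n) < e" by blast
 qed
 then obtain u0 where u0: "u0 \<in> DR" "(\<lambda>n. sqrt_norm R (u n - u0)) \<longlonglongrightarrow> 0" by blast
 have "Cauchy v"
  unfolding Cauchy_def dist_norm
 proof (intro allI impI)
  fix e :: real assume "0 < e"
  then obtain N where N: "\<And>m n. \<lbrakk>m \<ge> N; n \<ge> N\<rbrakk> \<Longrightarrow> E (f m - f n) < e" using cauchy by blast
  have "norm (v m - v n) < e" if "m \<ge> N" "n \<ge> N" for m n
   using component_bounds(2)[OF dX, of m n] N[OF that] unfolding d by linarith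
  then show "\<exists>M. \<forall>m\<ge>M. \<forall>n\<ge>M. norm (v m - v n) < e" by blast
 qed
 then obtain v0 where v0: "v \<longlonglongrightarrow> v0" by (auto simp: Cauchy_convergent_iff convergent_def)
 have "\<exists>x\<in>W.L2. (\<lambda>n. W.L2_norm (w n - x)) \<longlonglongrightarrow> 0"
 proof (rule L2.complete_X[OF wL])
  fix e :: real assume "0 < e"
  then obtain N where N: "\<And>m n. \<lbrakk>m \<ge> N; n \<ge> N\<rbrakk> \<Longrightarrow> E (f m - f n) < e" using cauchy by blast
  have "W.L2_norm (w m - w n) < e" if "m \<ge> N" "n \<ge> N" for m n
   using component_bounds(3)[OF dX, of m n] N[OF that] unfolding d by linarith
  then show "\<exists>N. \<forall>m\<ge>N. \<forall>n\<ge>N. W.L2_norm (w m - w n) < e" by blast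
 qed
 then obtain w0 where w0: "w0 \<in> W.L2" "(\<lambda>n. W.L2_norm (w n - w0)) \<longlonglongrightarrow> 0" by blast
 have x0: "(u0, v0, w0) \<in> X" using u0 w0 by (simp add: energy_space_iff)
 have "(\<lambda>n. c * sqrt_norm R (u n - u0) + norm (v n - v0) + W.L2_norm (w n - w0)) \<longlonglongrightarrow> c * 0 + 0 + 0"
  using v0 by (intro tendsto_intros u0(2) w0(2)) (simp add: LIM_zero tendsto_norm_zero)
 then have lim: "(\<lambda>n. c * sqrt_norm R (u n - u0) + norm (v n - v0) + W.L2_norm (w n - w0)) \<longlonglongrightarrow> 0" by simp
 have "(\<lambda>n. E (f n - (u0, v0, w0))) \<longlonglongrightarrow> 0"
 proof (rule Lim_null_comparison[OF _ lim], intro always_eventually allI)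
  fix n
  have eq: "f n - (u0, v0, w0) = (u n - u0, v n - v0, w n - w0)" by (simp add: fe)
  have mem: "(u n - u0, v n - v0, w n - w0) \<in> X" using H.X_diff[OF f x0] by (metis eq)
  show "norm (E (f n - (u0, v0, w0))) \<le> c * sqrt_norm R (u n - u0) + norm (v n - v0) + W.L2_norm (w n - w0)"
   unfolding eq using energy_norm_le[OF mem] H.p_nonneg[OF mem] by (simp add: c_def sqrt_norm_def)
 qed
 then show "\<exists>x\<in>X. (\<lambda>n. E (f n - x)) \<longlonglongrightarrow> 0" using x0 by blast
qed

sublocale HC: semigroup_in X "energy_inner R k" E S M \<omega>
proof -
 interpret complete_semi_hilbert X "energy_inner R k" E by (rule energy_complete)
 show "semigroup_in X (energy_inner R k) E S M \<omega>" ..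
qed

end

section \<open>The transport equation and vanishing primitives\<close>

text \<open>
\<open>Z\<close> is constant along the characteristics \<open>r \<mapsto> (t - m + r, s - m + r)\<close>, which start on the part of the
boundary where \<open>Z\<close> vanishes. Continuity of \<open>D\<close> makes \<open>Z\<close> differentiable in both variables jointly.
\<close>

lemma transport_zero:
 fixes Z D :: "real \<Rightarrow> real \<Rightarrow> real"
 assumes Zs: "\<And>t s. \<lbrakk>t \<in> {0..T}; s \<in> {0..q}\<rbrakk> \<Longrightarrow> (Z t has_real_derivative D t s) (at s within {0..q})"
  and Zt: "\<And>t s. \<lbrakk>t \<in> {0..T}; s \<in> {0..q}\<rbrakk> \<Longrightarrow> ((\<lambda>t. Z t s) has_real_derivative - D t s) (at t within {0..T})"
  and D: "continuous_on ({0..T} \<times> {0..q}) (\<lambda>z. D (fst z) (snd z))"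
  and Z0: "\<And>s. s \<in> {0..q} \<Longrightarrow> Z 0 s = 0" "\<And>t. t \<in> {0..T} \<Longrightarrow> Z t 0 = 0"
  and ts: "t \<in> {0..T}" "s \<in> {0..q}"
 shows "Z t s = 0"
proof -
 define m where "m = min t s"
 have m: "0 \<le> m" "m \<le> t" "m \<le> s" using ts by (auto simp: m_def)
 define c where "c r = (t - m + r, s - m + r)" for r
 have c: "c r \<in> {0..T} \<times> {0..q}" if "r \<in> {0..m}" for r using that m ts by (auto simp: c_def)
 have total: "((\<lambda>(x, y). Z x y) has_derivative (\<lambda>(tx, ty). - D x y * tx + blinfun_apply (D x y *\<^sub>R id_blinfun) ty))
   (at (x, y) within {0..T} \<times> {0..q})" if xy: "x \<in> {0..T}" "y \<in> {0..q}" for x y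
 proof (rule has_derivative_partialsI)
  show "((\<lambda>x. Z x y) has_derivative (*) (- D x y)) (at x within {0..T})"
   using Zt[OF xy] by (simp add: has_field_derivative_def)
  show "(Z x' has_derivative blinfun_apply (D x' y' *\<^sub>R id_blinfun)) (at y' within {0..q})"
   if "x' \<in> {0..T}" "y' \<in> {0..q}" for x' y'
  proof -
   have "blinfun_apply (D x' y' *\<^sub>R id_blinfun) = (*) (D x' y')" by (simp add: fun_eq_iff scaleR_blinfun.rep_eq)
   then show ?thesis using Zs[OF that] by (simp add: has_field_derivative_def)
  qed
  have "continuous_on ({0..T} \<times> {0..q}) (\<lambda>z. D (fst z) (snd z) *\<^sub>R (id_blinfun :: real \<Rightarrow>\<^sub>L real))"
   by (intro continuous_intros D)
  then show "continuous (at (x, y) within {0..T} \<times> {0..q}) (\<lambda>(x, y). D x y *\<^sub>R (id_blinfun :: real \<Rightarrow>\<^sub>L real))"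
   using xy by (simp add: continuous_on_eq_continuous_within case_prod_unfold)
 qed (use xy in auto)
 have "((\<lambda>r. (\<lambda>(x, y). Z x y) (c r)) has_derivative (\<lambda>h. 0)) (at r within {0..m})" if r: "r \<in> {0..m}" for r
 proof -
  have cd: "(c has_derivative (\<lambda>h. (h, h))) (at r within {0..m})"
   unfolding c_def by (auto intro!: derivative_eq_intros)
  have img: "c ` {0..m} \<subseteq> {0..T} \<times> {0..q}" using c by (intro image_subsetI)
  obtain x y where xy: "c r = (x, y)" by (cases "c r")
  have mem: "x \<in> {0..T}" "y \<in> {0..q}" using c[OF r] xy by auto
  have "((\<lambda>(x, y). Z x y) has_derivative (\<lambda>(tx, ty). - D x y * tx + blinfun_apply (D x y *\<^sub>R id_blinfun) ty)) (at (c r) within c ` {0..m})"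
   unfolding xy by (rule has_derivative_subset[OF total[OF mem] img])
  from has_derivative_in_compose[OF cd this]
  show ?thesis by (simp add: scaleR_blinfun.rep_eq)
 qed
 then have "(\<lambda>(x, y). Z x y) (c m) = (\<lambda>(x, y). Z x y) (c 0)"
  using m by (intro has_derivative_zero_unique[of "{0..m}"]) auto
 moreover have "(\<lambda>(x, y). Z x y) (c 0) = 0"
  using Z0(1)[OF ts(2)] Z0(2)[OF ts(1)] Z0 ts by (auto simp: c_def m_def min_def)
 ultimately show ?thesis by (simp add: c_def)
qed

text \<open>
The integral of \<open>f\<close> over every half line vanishes, and these generate the Borel sets.
\<close>

lemma indefinite_integral_zero_imp_AE_zero:
 fixes f :: "real \<Rightarrow> real"
 assumes f: "f absolutely_integrable_on {0..q}"
  and zero: "\<And>s. s \<in> {0..q} \<Longrightarrow> integral {0..s} f = 0" and q: "0 \<le> q"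
 shows "AE s in lebesgue. s \<in> {0..q} \<longrightarrow> f s = 0"
proof -
 let ?f = "\<lambda>s. indicator {0..q} s *\<^sub>R f s"
 have fi: "integrable lebesgue ?f" using f by (simp add: set_integrable_def)
 then obtain g where g: "g \<in> borel_measurable lborel" "AE s in lborel. ?f s = g s"
  using completion_ex_borel_measurable_real[of ?f lborel] by auto
 have ae: "AE s in lebesgue. ?f s = g s" using g(2) by (rule AE_completion)
 have gl: "g \<in> borel_measurable lebesgue" using g(1) by (simp add: measurable_completion)
 have gi': "integrable lebesgue g" using integrable_cong_AE_imp[OF fi gl] ae by (auto intro: AE_symmetric)
 then have gi: "integrable lborel g" using g(1) by (simp add: integrable_completion)
 have set0: "(\<integral>s. indicator {x<..} s * g s \<partial>lborel) = 0" for x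
 proof -
  have "(\<integral>s. indicator {x<..} s * g s \<partial>lborel) = (\<integral>s. indicator {x<..} s * g s \<partial>lebesgue)"
   using g(1) by (intro integral_completion[symmetric]) auto
  also have "\<dots> = (\<integral>s. indicator {x<..} s * ?f s \<partial>lebesgue)"
  proof (rule integral_cong_AE)
   show "AE s in lebesgue. indicator {x<..} s * g s = indicator {x<..} s * ?f s" using ae by eventually_elim simp
   show "(\<lambda>s. indicator {x<..} s * g s) \<in> borel_measurable lebesgue"
    using gl by (intro borel_measurable_times borel_measurable_indicator) auto
   show "(\<lambda>s. indicator {x<..} s * ?f s) \<in> borel_measurable lebesgue"
    using borel_measurable_integrable[OF fi] by (intro borel_measurable_times borel_measurable_indicator) auto
  qed
  also have "\<dots> = (LINT s:{0..q} \<inter> {x<..}|lebesgue. f s)"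
   unfolding set_lebesgue_integral_def by (intro Bochner_Integration.integral_cong) (auto simp: indicator_def)
  also have "\<dots> = integral ({0..q} \<inter> {x<..}) f"
   by (intro set_lebesgue_integral_eq_integral set_integrable_subset[OF f]) auto
  also have "\<dots> = 0"
  proof (cases "x < 0")
   case True
   then have "{0..q} \<inter> {x<..} = {0..q}" by auto
   then show ?thesis using zero[of q] q by simp
  next
   case x0: False
   show ?thesis
   proof (cases "x \<le> q")
    case True
    have "integral ({0..q} \<inter> {x<..}) f = integral {x..q} f"
     by (rule integral_spike_set; rule negligible_subset[of "{x}"]) (use x0 in auto)
    also have "\<dots> = integral {0..q} f - integral {0..x} f"
     using hk_integral_combine[of 0 x q f] x0 True f by (simp add: absolutely_integrable_on_def)
    finally show ?thesis using zero[of q] zero[of x] x0 True q by simp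
   next
    case False
    then have "{0..q} \<inter> {x<..} = {}" by auto
    then show ?thesis by simp
   qed
  qed
  finally show ?thesis .
 qed
 let ?P = "\<lambda>s. ennreal (max 0 (g s))" and ?N = "\<lambda>s. ennreal (max 0 (- g s))"
 have Pm: "?P \<in> borel_measurable lborel" "?N \<in> borel_measurable lborel" using g(1) by measurable
 have Pi: "integrable lborel (\<lambda>s. indicator A s * max 0 (g s))" "integrable lborel (\<lambda>s. indicator A s * max 0 (- g s))"
  if "A \<in> sets borel" for A
  using that gi by (auto intro!: integrable_real_mult_indicator[where f = "\<lambda>s. max 0 (g s)", simplified mult.commute]
    integrable_real_mult_indicator[where f = "\<lambda>s. max 0 (- g s)", simplified mult.commute] integrable_max)
 have em: "emeasure (density lborel ?P) A = ennreal (\<integral>s. indicator A s * max 0 (g s) \<partial>lborel)"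
    "emeasure (density lborel ?N) A = ennreal (\<integral>s. indicator A s * max 0 (- g s) \<partial>lborel)"
  if A: "A \<in> sets borel" for A
 proof -
  have "emeasure (density lborel ?P) A = (\<integral>\<^sup>+s. ennreal (indicator A s * max 0 (g s)) \<partial>lborel)"
   using A Pm by (subst emeasure_density) (auto intro!: nn_integral_cong simp: indicator_def)
  also have "\<dots> = ennreal (\<integral>s. indicator A s * max 0 (g s) \<partial>lborel)"
   using Pi(1)[OF A] by (intro nn_integral_eq_integral AE_I2) auto
  finally show "emeasure (density lborel ?P) A = ennreal (\<integral>s. indicator A s * max 0 (g s) \<partial>lborel)" .
  have "emeasure (density lborel ?N) A = (\<integral>\<^sup>+s. ennreal (indicator A s * max 0 (- g s)) \<partial>lborel)"
   using A Pm by (subst emeasure_density) (auto intro!: nn_integral_cong simp: indicator_def)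
  also have "\<dots> = ennreal (\<integral>s. indicator A s * max 0 (- g s) \<partial>lborel)"
   using Pi(2)[OF A] by (intro nn_integral_eq_integral AE_I2) auto
  finally show "emeasure (density lborel ?N) A = ennreal (\<integral>s. indicator A s * max 0 (- g s) \<partial>lborel)" .
 qed
 have "density lborel ?P = density lborel ?N"
 proof (rule measure_eqI_lessThan)
  fix x
  show "emeasure (density lborel ?P) {x<..} < \<infinity>" using em(1)[of "{x<..}"] by simp
  have "(\<integral>s. indicator {x<..} s * max 0 (g s) \<partial>lborel) - (\<integral>s. indicator {x<..} s * max 0 (- g s) \<partial>lborel)
    = (\<integral>s. indicator {x<..} s * max 0 (g s) - indicator {x<..} s * max 0 (- g s) \<partial>lborel)"
   using Pi by simp
  also have "\<dots> = (\<integral>s. indicator {x<..} s * g s \<partial>lborel)"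
   by (intro Bochner_Integration.integral_cong) (auto simp: indicator_def max_def)
  finally show "emeasure (density lborel ?P) {x<..} = emeasure (density lborel ?N) {x<..}"
   using em[of "{x<..}"] set0[of x] by simp
 qed auto
 moreover have "(\<integral>\<^sup>+s. ?P s \<partial>lborel) \<noteq> \<infinity>"
  using em(1)[of UNIV] Pm by (simp add: emeasure_density)
 ultimately have "AE s in lborel. ?P s = ?N s"
  using finite_density_unique[OF Pm] by simp
 then have "AE s in lborel. g s = 0" by eventually_elim (auto simp: max_def split: if_splits)
 then have "AE s in lebesgue. g s = 0" by (rule AE_completion)
 with ae show ?thesis by eventually_elim (auto simp: indicator_def)
qed

section \<open>Strong measurability on the line\<close>

lemma simple_function_lebesgue_extend:
 fixes g :: "real \<Rightarrow> 'b::zero"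
 assumes g: "simple_function (lebesgue_on A) g" and A: "A \<in> sets lebesgue"
 shows "simple_function lebesgue (\<lambda>s. if s \<in> A then g s else 0)"
 unfolding simple_function_def
proof (intro conjI ballI)
 have "(\<lambda>s. if s \<in> A then g s else 0) ` space lebesgue \<subseteq> insert 0 (g ` A)" by auto
 then show "finite ((\<lambda>s. if s \<in> A then g s else 0) ` space lebesgue)"
  using simple_functionD(1)[OF g] by (auto intro: finite_subset)
 fix v
 have "g -` {v} \<inter> A \<in> sets (lebesgue_on A)" using simple_functionD(2)[OF g] by simp
 then have 1: "g -` {v} \<inter> A \<in> sets lebesgue" using A by (simp add: sets_restrict_space_iff)
 have "(\<lambda>s. if s \<in> A then g s else 0) -` {v} \<inter> space lebesgue = (g -` {v} \<inter> A) \<union> (if v = 0 then UNIV - A else {})"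
  by (auto split: if_splits)
 then show "(\<lambda>s. if s \<in> A then g s else 0) -` {v} \<inter> space lebesgue \<in> sets lebesgue"
  using 1 sets.compl_sets[OF A] by (auto intro!: sets.Un)
qed

lemma simple_function_lebesgue_restrict:
 assumes g: "simple_function lebesgue g" and A: "A \<in> sets lebesgue"
 shows "simple_function (lebesgue_on A) g"
 unfolding simple_function_def
proof (intro conjI ballI)
 show "finite (g ` space (lebesgue_on A))"
  using simple_functionD(1)[OF g] by (rule finite_subset[rotated]) auto
 fix v
 have "g -` {v} \<inter> space lebesgue \<in> sets lebesgue" using simple_functionD(2)[OF g] by simp
 then have "g -` {v} \<inter> A \<in> sets lebesgue" using A by auto
 then show "g -` {v} \<inter> space (lebesgue_on A) \<in> sets (lebesgue_on A)" using A by (simp add: sets_restrict_space_iff)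
qed

lemma AE_lebesgue_on_iff: "A \<in> sets lebesgue \<Longrightarrow> (AE s in lebesgue_on A. P s) \<longleftrightarrow> (AE s in lebesgue. s \<in> A \<longrightarrow> P s)"
 by (simp add: AE_restrict_space_iff)

lemma lebesgue_shift_measurable: "(\<lambda>s::real. c + s) \<in> lebesgue \<rightarrow>\<^sub>M lebesgue"
 using lebesgue_affine_measurable[where c = "\<lambda>_. 1::real" and t = c] by simp

text \<open>Lebesgue measure is translation invariant.\<close>

lemma AE_lebesgue_shift:
 assumes "AE s in lebesgue. P (s :: real)"
 shows "AE s in lebesgue. P (c + s)"
proof -
 obtain N where N: "N \<in> null_sets lebesgue" "\<And>s. s \<notin> N \<Longrightarrow> P s"
  using assms unfolding completion.AE_iff_null_sets by auto
 have "(+) (- c) ` N \<in> null_sets lebesgue"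
  using negligible_translation[of N "- c"] N(1) by (simp only: negligible_iff_null_sets)
 moreover have "{s \<in> space lebesgue. \<not> P (c + s)} \<subseteq> (+) (- c) ` N"
 proof
  fix s assume "s \<in> {s \<in> space lebesgue. \<not> P (c + s)}"
  then have "c + s \<in> N" using N(2) by blast
  then show "s \<in> (+) (- c) ` N" by (intro image_eqI[of _ _ "c + s"]) auto
 qed
 ultimately show ?thesis by (rule AE_I')
qed

context semi_hilbert
begin

text \<open>Translations act on functions on the whole line; histories live on a half line.\<close>

lemma strongly_measurable_extend_iff:
 fixes f :: "real \<Rightarrow> 'v"
 assumes A: "A \<in> sets lebesgue"
 shows "strongly_measurable_in X p (lebesgue_on A) f \<longleftrightarrow> strongly_measurable_in X p lebesgue (\<lambda>s. if s \<in> A then f s else 0)"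
proof
 assume f: "strongly_measurable_in X p (lebesgue_on A) f"
 obtain a where a: "\<And>n. simple_function (lebesgue_on A) (a n)" "\<And>n. a n ` space (lebesgue_on A) \<subseteq> X"
   "AE x in lebesgue_on A. (\<lambda>n. p (f x - a n x)) \<longlonglongrightarrow> 0" "AE x in lebesgue_on A. f x \<in> X"
  by (rule strongly_measurableE[OF f]) (rule that)
 show "strongly_measurable_in X p lebesgue (\<lambda>s. if s \<in> A then f s else 0)"
 proof (rule strongly_measurableI[where g = "\<lambda>n s. if s \<in> A then a n s else 0"])
  show "AE x in lebesgue. (if x \<in> A then f x else 0) \<in> X"
   using a(4) unfolding AE_lebesgue_on_iff[OF A] by eventually_elim auto
  show "simple_function lebesgue (\<lambda>s. if s \<in> A then a n s else 0)" for n
   by (rule simple_function_lebesgue_extend[OF a(1) A])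
  show "(\<lambda>s. if s \<in> A then a n s else 0) ` space lebesgue \<subseteq> X" for n using a(2)[of n] by auto
  show "AE x in lebesgue. (\<lambda>n. p ((if x \<in> A then f x else 0) - (if x \<in> A then a n x else 0))) \<longlonglongrightarrow> 0"
   using a(3) unfolding AE_lebesgue_on_iff[OF A] by eventually_elim auto
 qed
next
 assume f: "strongly_measurable_in X p lebesgue (\<lambda>s. if s \<in> A then f s else 0)"
 obtain a where a: "\<And>n. simple_function lebesgue (a n)" "\<And>n. a n ` space lebesgue \<subseteq> X"
   "AE x in lebesgue. (\<lambda>n. p ((if x \<in> A then f x else 0) - a n x)) \<longlonglongrightarrow> 0" "AE x in lebesgue. (if x \<in> A then f x else 0) \<in> X"
  by (rule strongly_measurableE[OF f]) (rule that)
 show "strongly_measurable_in X p (lebesgue_on A) f"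
 proof (rule strongly_measurableI[where g = a])
  show "AE x in lebesgue_on A. f x \<in> X"
   unfolding AE_lebesgue_on_iff[OF A] using a(4) by eventually_elim auto
  show "simple_function (lebesgue_on A) (a n)" for n
   by (rule simple_function_lebesgue_restrict[OF a(1) A])
  show "a n ` space (lebesgue_on A) \<subseteq> X" for n using a(2)[of n] by auto
  show "AE x in lebesgue_on A. (\<lambda>n. p (f x - a n x)) \<longlonglongrightarrow> 0"
   unfolding AE_lebesgue_on_iff[OF A] using a(3) by eventually_elim auto
 qed
qed

lemma strongly_measurable_shift:
 fixes f :: "real \<Rightarrow> 'v"
 assumes f: "strongly_measurable_in X p lebesgue f"
 shows "strongly_measurable_in X p lebesgue (\<lambda>s. f (c + s))"
proof -
 obtain a where a: "\<And>n. simple_function lebesgue (a n)" "\<And>n. a n ` space lebesgue \<subseteq> X"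
   "AE x in lebesgue. (\<lambda>n. p (f x - a n x)) \<longlonglongrightarrow> 0" "AE x in lebesgue. f x \<in> X"
  by (rule strongly_measurableE[OF f]) (rule that)
 show ?thesis
 proof (rule strongly_measurableI[where g = "\<lambda>n s. a n (c + s)"])
  show "AE x in lebesgue. f (c + x) \<in> X" using AE_lebesgue_shift[OF a(4)] .
  show "AE x in lebesgue. (\<lambda>n. p (f (c + x) - a n (c + x))) \<longlonglongrightarrow> 0" using AE_lebesgue_shift[OF a(3)] .
  show "(\<lambda>s. a n (c + s)) ` space lebesgue \<subseteq> X" for n using a(2)[of n] by auto
  show "simple_function lebesgue (\<lambda>s. a n (c + s))" for n
   unfolding simple_function_def
  proof (intro conjI ballI)
   have "(\<lambda>s. a n (c + s)) ` space lebesgue \<subseteq> a n ` space lebesgue" by auto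
   then show "finite ((\<lambda>s. a n (c + s)) ` space lebesgue)" using simple_functionD(1)[OF a(1)] by (rule finite_subset)
   fix v
   have "a n -` {v} \<inter> space lebesgue \<in> sets lebesgue" using simple_functionD(2)[OF a(1)] by simp
   from measurable_sets[OF lebesgue_shift_measurable this, of c]
   show "(\<lambda>s. a n (c + s)) -` {v} \<inter> space lebesgue \<in> sets lebesgue" by (simp add: vimage_def)
  qed
 qed
qed

lemma strongly_measurable_cont:
 assumes x: "continuous_on_in X p {a..b} x"
 shows "strongly_measurable_in X p (lebesgue_on {a..b}) x"
proof -
 have "\<forall>n. \<exists>g. simple_function (lebesgue_on {a..b}) g \<and> g ` {a..b} \<subseteq> {a..b} \<and> (\<forall>s\<in>{a..b}. p (x s - x (g s)) \<le> 1 / Suc n)"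
  by (intro allI cont_in_grid x) simp
 from choice[OF this] obtain g where "\<forall>n. simple_function (lebesgue_on {a..b}) (g n) \<and> g n ` {a..b} \<subseteq> {a..b} \<and>
   (\<forall>s\<in>{a..b}. p (x s - x (g n s)) \<le> 1 / Suc n)" ..
 then have g: "\<And>n. simple_function (lebesgue_on {a..b}) (g n)" "\<And>n s. s \<in> {a..b} \<Longrightarrow> g n s \<in> {a..b}"
   "\<And>n s. s \<in> {a..b} \<Longrightarrow> p (x s - x (g n s)) \<le> 1 / Suc n"
  by (blast, blast, blast)
 have xX: "\<And>s. s \<in> {a..b} \<Longrightarrow> x s \<in> X" using cont_inD(1)[OF x] .
 show ?thesis
 proof (rule strongly_measurableI[where g = "\<lambda>n s. x (g n s)"])
  show "AE s in lebesgue_on {a..b}. x s \<in> X" using xX by (intro AE_I2) simp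
  show "simple_function (lebesgue_on {a..b}) (\<lambda>s. x (g n s))" for n using g(1) by (rule simple_function_compose1)
  show "(\<lambda>s. x (g n s)) ` space (lebesgue_on {a..b}) \<subseteq> X" for n using xX[OF g(2)] by auto
  show "AE s in lebesgue_on {a..b}. (\<lambda>n. p (x s - x (g n s))) \<longlonglongrightarrow> 0"
  proof (rule AE_I2)
   fix s assume "s \<in> space (lebesgue_on {a..b})"
   then have s: "s \<in> {a..b}" by simp
   have "(\<lambda>n. 1 / real (Suc n)) \<longlonglongrightarrow> 0" by (rule LIMSEQ_Suc[OF lim_1_over_n])
   then show "(\<lambda>n. p (x s - x (g n s))) \<longlonglongrightarrow> 0"
    by (rule Lim_null_comparison[rotated]) (use g(3)[OF s] xX[OF s] xX[OF g(2)[OF s]] in auto)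
  qed
 qed
qed

section \<open>Functionals on the energy space\<close>

text \<open>
By homogeneity, it suffices to consider vectors of norm one; on null vectors \<open>l\<close> is bounded, hence zero.
\<close>

lemma linear_bound_from_quadratic:
 assumes scale: "\<And>c x. x \<in> X \<Longrightarrow> l (c *\<^sub>R x) = c * l x"
  and quad: "\<And>x. x \<in> X \<Longrightarrow> \<bar>l x\<bar> \<le> a + b * (p x)\<^sup>2" and x: "x \<in> X"
 shows "\<bar>l x\<bar> \<le> (a + b) * p x"
proof (cases "p x = 0")
 case False
 then have px: "0 < p x" using p_nonneg[OF x] by simp
 have "\<bar>l ((1 / p x) *\<^sub>R x)\<bar> \<le> a + b * (p ((1 / p x) *\<^sub>R x))\<^sup>2" using x by (intro quad) auto
 also have "p ((1 / p x) *\<^sub>R x) = 1" using px x by (simp add: p_scaleR)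
 finally have "\<bar>(1 / p x) * l x\<bar> \<le> a + b" using scale[OF x] by simp
 then show ?thesis using px by (simp add: abs_mult field_simps)
next
 case True
 have le: "\<bar>c\<bar> * \<bar>l x\<bar> \<le> a" for c
  using quad[of "c *\<^sub>R x"] x True by (simp add: scale[OF x] p_scaleR abs_mult)
 have "\<bar>l x\<bar> = 0"
 proof (rule ccontr)
  assume "\<bar>l x\<bar> \<noteq> 0"
  then show False using le[of "(\<bar>a\<bar> + 1) / \<bar>l x\<bar>"] by (simp add: abs_mult)
 qed
 then show ?thesis using True by simp
qed

end

lemma (in semi_hilbert) bounded_functional_combine:
 assumes l: "bounded_functional l K" and l': "bounded_functional l' K'"
 shows "bounded_functional (\<lambda>x. a * l x + b * l' x) (\<bar>a\<bar> * K + \<bar>b\<bar> * K')"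
 unfolding bounded_functional_def
proof (intro conjI ballI allI)
 note d = functionalD[OF l] and d' = functionalD[OF l']
 show "0 \<le> \<bar>a\<bar> * K + \<bar>b\<bar> * K'" using d(1) d'(1) by simp
 fix x assume x: "x \<in> X"
 show "a * l (x + y) + b * l' (x + y) = a * l x + b * l' x + (a * l y + b * l' y)" if "y \<in> X" for y
  using d(2)[OF x that] d'(2)[OF x that] by (simp add: algebra_simps)
 show "a * l (c *\<^sub>R x) + b * l' (c *\<^sub>R x) = c * (a * l x + b * l' x)" for c
  using d(3)[OF x] d'(3)[OF x] by (simp add: algebra_simps)
 have "\<bar>a * l x + b * l' x\<bar> \<le> \<bar>a\<bar> * \<bar>l x\<bar> + \<bar>b\<bar> * \<bar>l' x\<bar>" by (metis abs_mult abs_triangle_ineq)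
 also have "\<dots> \<le> \<bar>a\<bar> * (K * p x) + \<bar>b\<bar> * (K' * p x)"
  using d(4)[OF x] d'(4)[OF x] by (intro add_mono mult_left_mono) auto
 finally show "\<bar>a * l x + b * l' x\<bar> \<le> (\<bar>a\<bar> * K + \<bar>b\<bar> * K') * p x" by (simp add: algebra_simps)
qed

lemma has_integral_half_open:
 fixes f :: "real \<Rightarrow> 'b::banach"
 shows "(f has_integral y) {0..s} \<longleftrightarrow> (f has_integral y) {0<..s}"
 by (rule has_integral_spike_set_eq; rule negligible_subset[of "{0}"]) auto

lemma integral_eq_AE_positive:
 fixes f g :: "real \<Rightarrow> real"
 assumes "AE \<sigma> in lebesgue_on {0<..}. \<sigma> \<le> s \<longrightarrow> f \<sigma> = g \<sigma>"
 shows "integral {0..s} f = integral {0..s} g"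
proof -
 have "AE \<sigma> in lebesgue. 0 < \<sigma> \<longrightarrow> \<sigma> \<le> s \<longrightarrow> f \<sigma> = g \<sigma>"
  using assms by (simp add: AE_lebesgue_on_iff)
 then obtain N where N: "N \<in> null_sets lebesgue" "\<And>\<sigma>. \<sigma> \<notin> N \<Longrightarrow> 0 < \<sigma> \<longrightarrow> \<sigma> \<le> s \<longrightarrow> f \<sigma> = g \<sigma>"
  unfolding completion.AE_iff_null_sets by auto
 have "negligible (insert 0 N)" using N(1) by (simp add: negligible_iff_null_sets[symmetric])
 then show ?thesis
  by (rule integral_spike) (use N(2) in force)
qed

context wave_memory
begin

text \<open>
The histories are tested with the primitive of \<open>R w \<bullet> e\<close>; point values of \<open>w\<close> are not defined, and the
weight \<open>k\<close> may vanish beyond some point, so \<open>s\<close> is restricted to \<open>k s > 0\<close> below.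
\<close>

definition pair :: "'h \<Rightarrow> real \<Rightarrow> (real \<Rightarrow> 'h) \<Rightarrow> real" where
 "pair e s w = integral {0..s} (\<lambda>\<sigma>. R (w \<sigma>) \<bullet> e)"

text \<open>
One integration more absorbs the derivative \<open>w\<^sub>s\<close> in the generator, see \<open>history_adjoint\<close>.
\<close>

definition pair2 :: "'h \<Rightarrow> real \<Rightarrow> (real \<Rightarrow> 'h) \<Rightarrow> real" where
 "pair2 e s w = integral {0..s} (\<lambda>\<sigma>. pair e \<sigma> w)"

lemma R_inner_functional: "DR.bounded_functional (\<lambda>u. R u \<bullet> e) (norm e)"
 unfolding DR.bounded_functional_def
 by (auto simp: R_add R_scaleR inner_add_left sqrt_norm_def mult.commute intro: Cauchy_Schwarz_ineq2[THEN order_trans])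

lemma k_positive_below: "\<lbrakk>0 \<le> \<sigma>; \<sigma> \<le> s; 0 < k s\<rbrakk> \<Longrightarrow> 0 < k \<sigma>"
 using k_mono[of \<sigma> s] by simp

text \<open>
On \<open>{0..s}\<close> the weight is at least \<open>k s\<close>, and \<open>q \<le> 1 + q\<^sup>2\<close>. The bound is quadratic in \<open>w\<close>;
\<open>linear_bound_from_quadratic\<close> makes it linear.
\<close>

lemma pair_integrable_bound:
 assumes w: "w \<in> W.L2" and s: "0 \<le> s" "0 < k s"
 shows "(\<lambda>\<sigma>. R (w \<sigma>) \<bullet> e) absolutely_integrable_on {0..s}"
  and "\<bar>pair e s w\<bar> \<le> norm e * s + norm e * (1 / k s) * (W.L2_norm w)\<^sup>2"
proof -
 define f where "f \<sigma> = R (w \<sigma>) \<bullet> e" for \<sigma>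
 define q where "q \<sigma> = k \<sigma> * (norm (R (w \<sigma>)))\<^sup>2" for \<sigma>
 define h where "h \<sigma> = norm e + norm e * (1 / k s) * q \<sigma>" for \<sigma>
 have qi: "integrable (lebesgue_on {0<..}) q" and qn: "(\<integral>\<sigma>. q \<sigma> \<partial>lebesgue_on {0<..}) = (W.L2_norm w)\<^sup>2"
  using W.L2_D(2)[OF w] W.L2_norm_square[OF w] by (simp_all add: q_def[abs_def] sqrt_norm_def)
 have qa: "q absolutely_integrable_on {0<..}"
  using qi by (simp add: set_integrable_def integrable_restrict_space)
 have qI: "integral {0<..} q = (W.L2_norm w)\<^sup>2" using lebesgue_integral_eq_integral[OF qi] qn by simp
 have qs: "q absolutely_integrable_on {0<..s}" by (rule set_integrable_subset[OF qa]) auto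
 have q0: "0 \<le> q \<sigma>" if "0 < \<sigma>" for \<sigma> using that k_nonneg[of \<sigma>] by (simp add: q_def)
 have fm: "f \<in> borel_measurable (lebesgue_on {0<..s})"
 proof -
  have "f \<in> borel_measurable (lebesgue_on {0<..})"
   unfolding f_def by (rule DR.functional_measurable[OF complete_measure_lebesgue_on R_inner_functional W.L2_D(1)[OF w]]) auto
  then show ?thesis by (rule measurable_restrict_mono) auto
 qed
 have ci: "(\<lambda>_. norm e) integrable_on {0<..s}" "integral {0<..s} (\<lambda>_. norm e) = norm e * s"
 proof -
  have "((\<lambda>_. norm e) has_integral norm e * s) {0..s}" using has_integral_const_real[of "norm e" 0 s] s by (simp add: mult.commute)
  then have "((\<lambda>_. norm e) has_integral norm e * s) {0<..s}"
   by (subst (asm) has_integral_half_open)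
  then show "(\<lambda>_. norm e) integrable_on {0<..s}" "integral {0<..s} (\<lambda>_. norm e) = norm e * s" by (auto simp: integral_unique integrable_on_def)
 qed
 have qi': "(\<lambda>\<sigma>. norm e * (1 / k s) * q \<sigma>) integrable_on {0<..s}"
  using qs by (intro integrable_on_mult_right) (simp add: absolutely_integrable_on_def)
 have hi: "h integrable_on {0<..s}" unfolding h_def using ci(1) qi' by (rule integrable_add)
 have fh: "norm (f \<sigma>) \<le> h \<sigma>" if \<sigma>: "\<sigma> \<in> {0<..s}" for \<sigma>
 proof -
  have "norm (R (w \<sigma>)) \<le> 1 + (norm (R (w \<sigma>)))\<^sup>2"
   using sum_squares_bound[of "norm (R (w \<sigma>))" 1] norm_ge_zero[of "R (w \<sigma>)"]
   unfolding power_one mult_1_right by linarith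
  also have "(norm (R (w \<sigma>)))\<^sup>2 \<le> (1 / k s) * q \<sigma>"
  proof -
   have "k s * (norm (R (w \<sigma>)))\<^sup>2 \<le> q \<sigma>" unfolding q_def using k_mono[of \<sigma> s] \<sigma> by (intro mult_right_mono) auto
   then show ?thesis using s(2) by (simp add: field_simps)
  qed
  finally have "norm (R (w \<sigma>)) * norm e \<le> (1 + (1 / k s) * q \<sigma>) * norm e" by (intro mult_right_mono) auto
  then have "\<bar>f \<sigma>\<bar> \<le> (1 + (1 / k s) * q \<sigma>) * norm e"
   unfolding f_def using Cauchy_Schwarz_ineq2[of "R (w \<sigma>)" e] by linarith
  then show ?thesis by (simp add: h_def algebra_simps)
 qed
 have fa: "f absolutely_integrable_on {0<..s}"
  by (rule measurable_bounded_by_integrable_imp_absolutely_integrable[OF fm _ hi fh]) auto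
 then show "(\<lambda>\<sigma>. R (w \<sigma>) \<bullet> e) absolutely_integrable_on {0..s}"
  unfolding f_def by (rule absolutely_integrable_spike_set) (auto intro: negligible_subset[of "{0}"])
 have "pair e s w = integral {0<..s} f"
  unfolding pair_def f_def by (rule integral_spike_set; rule negligible_subset[of "{0}"]) auto
 also have "\<bar>\<dots>\<bar> \<le> integral {0<..s} h"
  using integral_norm_bound_integral[of f "{0<..s}" h] fa hi fh by (simp add: absolutely_integrable_on_def)
 also have "\<dots> = norm e * s + norm e * (1 / k s) * integral {0<..s} q"
  unfolding h_def using hk_integral_add[OF ci(1) qi'] ci(2) by simp
 also have "\<dots> \<le> norm e * s + norm e * (1 / k s) * integral {0<..} q"
  using qs qa q0 s by (intro add_left_mono mult_left_mono integral_subset_le) (auto simp: absolutely_integrable_on_def)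
 finally show "\<bar>pair e s w\<bar> \<le> norm e * s + norm e * (1 / k s) * (W.L2_norm w)\<^sup>2" by (simp add: qI)
qed

lemma pair_add:
 assumes v: "v \<in> W.L2" and w: "w \<in> W.L2" and s: "0 \<le> s" "0 < k s"
 shows "pair e s (\<lambda>\<sigma>. v \<sigma> + w \<sigma>) = pair e s v + pair e s w"
proof -
 have "pair e s (\<lambda>\<sigma>. v \<sigma> + w \<sigma>) = integral {0..s} (\<lambda>\<sigma>. R (v \<sigma>) \<bullet> e + R (w \<sigma>) \<bullet> e)"
  unfolding pair_def
 proof (rule integral_eq_AE_positive)
  show "AE \<sigma> in lebesgue_on {0<..}. \<sigma> \<le> s \<longrightarrow> R (v \<sigma> + w \<sigma>) \<bullet> e = R (v \<sigma>) \<bullet> e + R (w \<sigma>) \<bullet> e"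
   using W.L2_D(3)[OF v] W.L2_D(3)[OF w] by eventually_elim (simp add: R_add inner_add_left)
 qed
 then show ?thesis
  unfolding pair_def using pair_integrable_bound(1)[OF v s] pair_integrable_bound(1)[OF w s]
  by (simp add: hk_integral_add absolutely_integrable_on_def)
qed

lemma pair_scaleR:
 assumes v: "v \<in> W.L2"
 shows "pair e s (\<lambda>\<sigma>. c *\<^sub>R v \<sigma>) = c * pair e s v"
proof -
 have "pair e s (\<lambda>\<sigma>. c *\<^sub>R v \<sigma>) = integral {0..s} (\<lambda>\<sigma>. c * (R (v \<sigma>) \<bullet> e))"
  unfolding pair_def
 proof (rule integral_eq_AE_positive)
  show "AE \<sigma> in lebesgue_on {0<..}. \<sigma> \<le> s \<longrightarrow> R (c *\<^sub>R v \<sigma>) \<bullet> e = c * (R (v \<sigma>) \<bullet> e)"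
   using W.L2_D(3)[OF v] by eventually_elim (simp add: R_scaleR)
 qed
 then show ?thesis unfolding pair_def by simp
qed

definition pair_const :: "'h \<Rightarrow> real \<Rightarrow> real" where
 "pair_const e q = norm e * (q + 1 / k q)"

lemma pair_const_nonneg: "\<lbrakk>0 \<le> q; 0 < k q\<rbrakk> \<Longrightarrow> 0 \<le> pair_const e q"
 by (simp add: pair_const_def)

lemma pair_bound:
 assumes w: "w \<in> W.L2" and q: "0 < k q" and s: "s \<in> {0..q}"
 shows "\<bar>pair e s w\<bar> \<le> pair_const e q * W.L2_norm w"
proof -
 have sk: "0 \<le> s" "0 < k s" using s q k_positive_below[of s q] by auto
 have "\<bar>pair e s w\<bar> \<le> (norm e * s + norm e * (1 / k s)) * W.L2_norm w"
 proof (rule semi_hilbert.linear_bound_from_quadratic[OF W.L2_semi_hilbert _ _ w])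
  show "pair e s (c *\<^sub>R x) = c * pair e s x" if "x \<in> W.L2" for c x
   using pair_scaleR[OF that] by (simp add: scaleR_fun_def)
  show "\<bar>pair e s x\<bar> \<le> norm e * s + norm e * (1 / k s) * (W.L2_norm x)\<^sup>2" if "x \<in> W.L2" for x
   using pair_integrable_bound(2)[OF that sk] .
 qed
 also have "\<dots> \<le> pair_const e q * W.L2_norm w"
 proof -
  have "1 / k s \<le> 1 / k q" using k_mono[of s q] s q by (intro divide_left_mono) (auto simp: sk)
  then have "norm e * s + norm e * (1 / k s) \<le> norm e * q + norm e * (1 / k q)"
   using s by (intro add_mono mult_left_mono) auto
  then show ?thesis
   unfolding pair_const_def using W.L2_norm_nonneg[OF w] by (intro mult_right_mono) (auto simp: distrib_left)
 qed
 finally show ?thesis .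
qed

lemma pair_cont:
 assumes w: "w \<in> W.L2" and q: "0 \<le> q" "0 < k q"
 shows "continuous_on {0..q} (\<lambda>s. pair e s w)"
 unfolding pair_def using pair_integrable_bound(1)[OF w q]
 by (intro indefinite_integral_continuous_1) (simp add: absolutely_integrable_on_def)

lemma pair_zero [simp]: "pair e 0 w = 0" "pair2 e 0 w = 0"
 by (simp_all add: pair_def pair2_def)

lemma pair2_add:
 assumes v: "v \<in> W.L2" and w: "w \<in> W.L2" and s: "0 \<le> s" "0 < k s"
 shows "pair2 e s (\<lambda>\<sigma>. v \<sigma> + w \<sigma>) = pair2 e s v + pair2 e s w"
proof -
 have "pair2 e s (\<lambda>\<sigma>. v \<sigma> + w \<sigma>) = integral {0..s} (\<lambda>\<sigma>. pair e \<sigma> v + pair e \<sigma> w)"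
  unfolding pair2_def using s k_positive_below[of _ s] by (intro integral_cong pair_add v w) auto
 then show ?thesis unfolding pair2_def
  using pair_cont[OF v s] pair_cont[OF w s] by (simp add: hk_integral_add integrable_continuous_interval)
qed

lemma pair2_scaleR:
 assumes v: "v \<in> W.L2"
 shows "pair2 e s (\<lambda>\<sigma>. c *\<^sub>R v \<sigma>) = c * pair2 e s v"
 unfolding pair2_def using pair_scaleR[OF v] by simp

lemma pair2_bound:
 assumes w: "w \<in> W.L2" and s: "0 \<le> s" "0 < k s"
 shows "\<bar>pair2 e s w\<bar> \<le> pair_const e s * s * W.L2_norm w"
proof -
 have "norm (integral {0..s} (\<lambda>\<sigma>. pair e \<sigma> w)) \<le> (pair_const e s * W.L2_norm w) * (s - 0)"
  using pair_bound[OF w s(2)] s by (intro integral_bound pair_cont w) auto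
 then show ?thesis by (simp add: pair2_def mult_ac)
qed

lemma history_functional:
 assumes add: "\<And>v w. \<lbrakk>v \<in> W.L2; w \<in> W.L2\<rbrakk> \<Longrightarrow> l (\<lambda>\<sigma>. v \<sigma> + w \<sigma>) = l v + l w"
  and scale: "\<And>c w. w \<in> W.L2 \<Longrightarrow> l (\<lambda>\<sigma>. c *\<^sub>R w \<sigma>) = c * l w"
  and bound: "\<And>w. w \<in> W.L2 \<Longrightarrow> \<bar>l w\<bar> \<le> K * W.L2_norm w" and K: "0 \<le> K"
 shows "H.bounded_functional (\<lambda>U. l (snd (snd U))) K"
 unfolding H.bounded_functional_def
proof (intro conjI ballI allI K)
 fix x assume x: "x \<in> X"
 obtain u v w where xe: "x = (u, v, w)" by (cases x) auto
 have w: "w \<in> W.L2" using x by (simp add: xe energy_space_iff)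
 show "l (snd (snd (x + y))) = l (snd (snd x)) + l (snd (snd y))" if y: "y \<in> X" for y
 proof -
  obtain u' v' w' where ye: "y = (u', v', w')" by (cases y) auto
  have w': "w' \<in> W.L2" using y by (simp add: ye energy_space_iff)
  show ?thesis using add[OF w w'] by (simp add: xe ye plus_fun_def)
 qed
 show "l (snd (snd (c *\<^sub>R x))) = c * l (snd (snd x))" for c
  using scale[OF w] by (simp add: xe scaleR_fun_def)
 have "K * W.L2_norm w \<le> K * E x" using component_bounds(3) x K unfolding xe by (intro mult_left_mono) auto
 then show "\<bar>l (snd (snd x))\<bar> \<le> K * E x" using bound[OF w] by (simp add: xe)
qed

lemma pair_functional:
 assumes s: "0 \<le> s" "0 < k s"
 shows "H.bounded_functional (\<lambda>U. pair e s (snd (snd U))) (pair_const e s)"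
 using s by (intro history_functional pair_add pair_scaleR pair_bound pair_const_nonneg) auto

lemma pair2_functional:
 assumes s: "0 \<le> s" "0 < k s"
 shows "H.bounded_functional (\<lambda>U. pair2 e s (snd (snd U))) (pair_const e s * s)"
 using s pair_const_nonneg[OF s] by (intro history_functional pair2_add pair2_scaleR pair2_bound) auto

lemma position_functional: "H.bounded_functional (\<lambda>U. R (fst U) \<bullet> e) (norm e / sqrt (1 - kernel_mass k))"
 unfolding H.bounded_functional_def
proof (intro conjI ballI allI)
 have c: "0 < sqrt (1 - kernel_mass k)" using k_mass by simp
 then show "0 \<le> norm e / sqrt (1 - kernel_mass k)" by simp
 fix x assume x: "x \<in> X"
 obtain u v w where xe: "x = (u, v, w)" by (cases x) auto
 have u: "u \<in> DR" using x by (simp add: xe energy_space_iff)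
 show "R (fst (x + y)) \<bullet> e = R (fst x) \<bullet> e + R (fst y) \<bullet> e" if y: "y \<in> X" for y
  using y u by (cases y) (auto simp: xe energy_space_iff R_add inner_add_left)
 show "R (fst (c *\<^sub>R x)) \<bullet> e = c * (R (fst x) \<bullet> e)" for c using u by (simp add: xe R_scaleR)
 have "\<bar>R u \<bullet> e\<bar> \<le> norm (R u) * norm e" by (rule Cauchy_Schwarz_ineq2)
 also have "\<dots> \<le> (E x / sqrt (1 - kernel_mass k)) * norm e"
  using component_bounds(1)[of u v w] x c by (intro mult_right_mono) (simp_all add: xe pos_le_divide_eq mult.commute)
 finally show "\<bar>R (fst x) \<bullet> e\<bar> \<le> norm e / sqrt (1 - kernel_mass k) * E x" by (simp add: xe mult.commute)
qed

lemma velocity_functional: "H.bounded_functional (\<lambda>U. fst (snd U) \<bullet> e) (norm e)"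
 unfolding H.bounded_functional_def
proof (intro conjI ballI allI)
 fix x assume x: "x \<in> X"
 obtain u v w where xe: "x = (u, v, w)" by (cases x) auto
 show "fst (snd (x + y)) \<bullet> e = fst (snd x) \<bullet> e + fst (snd y) \<bullet> e" for y
  by (simp add: inner_add_left)
 show "fst (snd (c *\<^sub>R x)) \<bullet> e = c * (fst (snd x) \<bullet> e)" for c by simp
 have "\<bar>v \<bullet> e\<bar> \<le> norm v * norm e" by (rule Cauchy_Schwarz_ineq2)
 also have "\<dots> \<le> E x * norm e" using component_bounds(2)[of u v w] x by (intro mult_right_mono) (simp_all add: xe)
 finally show "\<bar>fst (snd x) \<bullet> e\<bar> \<le> norm e * E x" by (simp add: xe mult.commute)
qed simp

lemma generator_components:
 assumes U: "(u, v, w) \<in> X" and V: "V \<in> X"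
  and gen: "((\<lambda>h. E ((1 / h) *\<^sub>R (S h (u, v, w) - (u, v, w)) - V)) \<longlongrightarrow> 0) (at_right 0)"
 obtains z b where "v \<in> DR" "z \<in> W.L2" "weak_derivative_zero_at_0 DR R k w z"
  "(v, b, \<lambda>s. - z s + v) \<in> X" "E (V - (v, b, \<lambda>s. - z s + v)) = 0"
proof -
 have op: "wave_memory_op DA A DR R k (u, v, w) V"
  using S_gen U V gen unfolding generates_in_def by blast
 then obtain y z where v: "v \<in> DR" and z: "z \<in> W.L2" "weak_derivative_zero_at_0 DR R k w z"
  "E (V - (v, - A ((1 - kernel_mass k) *\<^sub>R u + y), \<lambda>s. - z s + v)) = 0"
  unfolding wave_memory_op_def L2_kernel_eq by auto
 have "(\<lambda>s. - z s + v) \<in> W.L2"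
  using W.L2_add[OF W.L2_scaleR[OF z(1), of "-1"] W.L2_const[OF v]] by simp
 then have "(v, - A ((1 - kernel_mass k) *\<^sub>R u + y), \<lambda>s. - z s + v) \<in> X" using v by (simp add: energy_space_iff)
 then show ?thesis using that v z by blast
qed

text \<open>The first component of the generator is \<open>v\<close>.\<close>

lemma position_adjoint:
 assumes e: "e \<in> DR"
 shows "HC.adjoint_functionals (\<lambda>U. R (fst U) \<bullet> e) (\<lambda>U. fst (snd U) \<bullet> R e)"
 unfolding HC.adjoint_functionals_def
proof (intro ballI impI)
 fix U V assume U: "U \<in> X" and V: "V \<in> X" and gen: "((\<lambda>h. E ((1 / h) *\<^sub>R (S h U - U) - V)) \<longlongrightarrow> 0) (at_right 0)"
 obtain u v w where Ue: "U = (u, v, w)" by (cases U) auto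
 obtain z b where z: "v \<in> DR" "z \<in> W.L2" "weak_derivative_zero_at_0 DR R k w z"
  "(v, b, \<lambda>s. - z s + v) \<in> X" "E (V - (v, b, \<lambda>s. - z s + v)) = 0"
  by (rule generator_components[OF U[unfolded Ue] V gen[unfolded Ue]]) (rule that)
 have "R (fst V) \<bullet> e = R v \<bullet> e" using H.functional_null_cong[OF position_functional V z(4,5), of e] by simp
 then show "R (fst V) \<bullet> e = fst (snd U) \<bullet> R e" using R_symmetric[OF z(1) e] by (simp add: Ue)
qed

lemma pair_weak_derivative:
 assumes wd: "weak_derivative_zero_at_0 DR R k w z"
 shows "AE \<sigma> in lebesgue_on {0<..}. 0 < k \<sigma> \<longrightarrow> pair e \<sigma> z = R (w \<sigma>) \<bullet> e"
 using wd[unfolded weak_derivative_zero_at_0_def]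
proof eventually_elim
 case (elim \<sigma>)
 show ?case
 proof
  assume "0 < k \<sigma>"
  with elim have hb: "has_bochner_integral_in DR (sqrt_norm R) (lebesgue_on {0<..\<sigma>}) z (w \<sigma>)" by blast
  have "has_bochner_integral (lebesgue_on {0<..\<sigma>}) (\<lambda>x. R (z x) \<bullet> e) (R (w \<sigma>) \<bullet> e)"
   by (rule DR.bochner_functional[OF complete_measure_lebesgue_on R_inner_functional hb]) auto
  from has_bochner_integral_lebesgue_on_D(2)[OF this]
  have "((\<lambda>x. R (z x) \<bullet> e) has_integral R (w \<sigma>) \<bullet> e) {0<..\<sigma>}" by simp
  then have "((\<lambda>x. R (z x) \<bullet> e) has_integral R (w \<sigma>) \<bullet> e) {0..\<sigma>}"
   by (subst has_integral_half_open)
  then show "pair e \<sigma> z = R (w \<sigma>) \<bullet> e" by (simp add: pair_def integral_unique)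
 qed
qed

text \<open>
The third component of the generator is \<open>- w\<^sub>s + v\<close>, the double primitive of \<open>w\<^sub>s\<close> is the simple one of
\<open>w\<close> as \<open>w 0 = 0\<close>, and \<open>v\<close> is constant in \<open>s\<close>.
\<close>

lemma history_adjoint:
 assumes e: "e \<in> DR" and s: "0 \<le> s" "0 < k s"
 shows "HC.adjoint_functionals (\<lambda>U. pair2 e s (snd (snd U)))
   (\<lambda>U. (-1) * pair e s (snd (snd U)) + s\<^sup>2 / 2 * (fst (snd U) \<bullet> R e))"
 unfolding HC.adjoint_functionals_def
proof (intro ballI impI)
 fix U V assume U: "U \<in> X" and V: "V \<in> X" and gen: "((\<lambda>h. E ((1 / h) *\<^sub>R (S h U - U) - V)) \<longlongrightarrow> 0) (at_right 0)"
 obtain u v w where Ue: "U = (u, v, w)" by (cases U) auto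
 obtain z b where z: "v \<in> DR" "z \<in> W.L2" "weak_derivative_zero_at_0 DR R k w z"
  "(v, b, \<lambda>s. - z s + v) \<in> X" "E (V - (v, b, \<lambda>s. - z s + v)) = 0"
  by (rule generator_components[OF U[unfolded Ue] V gen[unfolded Ue]]) (rule that)
 have "pair2 e s (snd (snd V)) = pair2 e s (\<lambda>\<sigma>. (-1) *\<^sub>R z \<sigma> + v)"
  using H.functional_null_cong[OF pair2_functional[OF s] V z(4,5), of e] by simp
 also have "\<dots> = (-1) * pair2 e s z + pair2 e s (\<lambda>_. v)"
  using pair2_add[OF W.L2_scaleR[OF z(2), of "-1"] W.L2_const[OF z(1)] s, of e] pair2_scaleR[OF z(2), of e s "-1"] by simp
 also have "pair2 e s z = pair e s w"
  unfolding pair2_def pair_def[of e s]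
 proof (rule integral_eq_AE_positive)
  show "AE \<sigma> in lebesgue_on {0<..}. \<sigma> \<le> s \<longrightarrow> pair e \<sigma> z = R (w \<sigma>) \<bullet> e"
   using pair_weak_derivative[OF z(3), of e] AE_space
  proof eventually_elim
   case (elim \<sigma>)
   then show ?case using k_positive_below[of \<sigma> s] s by auto
  qed
 qed
 also have "pair2 e s (\<lambda>_. v) = s\<^sup>2 / 2 * (R v \<bullet> e)"
 proof -
  have "pair2 e s (\<lambda>_. v) = integral {0..s} (\<lambda>\<sigma>. \<sigma> * (R v \<bullet> e))"
   unfolding pair2_def by (intro integral_cong) (simp add: pair_def)
  also have "\<dots> = integral {0..s} (\<lambda>\<sigma>. \<sigma>) * (R v \<bullet> e)" by simp
  also have "integral {0..s} (\<lambda>\<sigma>. \<sigma>) = s\<^sup>2 / 2" using ident_has_integral[OF s(1)] by (simp add: integral_unique)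
  finally show ?thesis .
 qed
 also have "R v \<bullet> e = v \<bullet> R e" by (rule R_symmetric[OF z(1) e])
 finally show "pair2 e s (snd (snd V)) = (-1) * pair e s (snd (snd U)) + s\<^sup>2 / 2 * (fst (snd U) \<bullet> R e)"
  by (simp add: Ue)
qed

end

section \<open>The structure of mild solutions of the wave equation\<close>

lemma has_real_derivative_cong_on:
 assumes "(f has_real_derivative d) (at x within S)" "x \<in> S" "\<And>y. y \<in> S \<Longrightarrow> g y = f y"
 shows "(g has_real_derivative d) (at x within S)"
 by (rule has_field_derivative_transform_within[OF assms(1) zero_less_one assms(2)]) (simp add: assms(3))

text \<open>
The situation in which the abstract equation can be identified with the second-order one: the forcing
acts on the velocity alone, and the initial history comes from a function \<open>f0\<close>.
\<close>

locale memory_mild = wave_memory +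
 fixes a :: "real \<Rightarrow> real" and x y U :: "real \<Rightarrow> 'a state" and f0 :: "real \<Rightarrow> 'a" and v0 :: 'a
 assumes a_int: "\<And>T. a absolutely_integrable_on {0..T}"
  and x_cont: "continuous_on_in X E {0..} x" and y_cont: "continuous_on_in X E {0..} y"
  and x_form: "\<And>s. 0 \<le> s \<Longrightarrow> fst (x s) = 0 \<and> snd (snd (x s)) = 0"
  and y_form: "\<And>s. 0 \<le> s \<Longrightarrow> fst (y s) = 0 \<and> snd (snd (y s)) = 0"
  and U_cont: "continuous_on_in X E {0..} U"
  and U_0: "U 0 = (f0 0, v0, history f0 0)"
  and mild: "\<And>t. 0 \<le> t \<Longrightarrow> has_bochner_integral_in X E (lebesgue_on {0..t})
    (\<lambda>s. S (t - s) (a s *\<^sub>R x s + y s)) (U t - S t (U 0))"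
begin

definition u where "u t = fst (U t)"
definition v where "v t = fst (snd (U t))"
definition w where "w t = snd (snd (U t))"

lemma U_eq: "U t = (u t, v t, w t)" by (simp add: u_def v_def w_def)

lemma U_X: "0 \<le> t \<Longrightarrow> (u t, v t, w t) \<in> X"
 using H.cont_inD(1)[OF U_cont, of t] by (simp add: U_eq)

lemma u_DR: "0 \<le> t \<Longrightarrow> u t \<in> DR" and w_L2: "0 \<le> t \<Longrightarrow> w t \<in> W.L2"
 using U_X by (auto simp: energy_space_iff)

lemma u_0: "u 0 = f0 0" and w_0: "w 0 = history f0 0" by (auto simp: u_def w_def U_0)

lemma history_L2: "history f0 0 \<in> W.L2" using w_L2[of 0] w_0 by simp
lemma f0_DR: "f0 0 \<in> DR" using u_DR[of 0] u_0 by simp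

lemma weak_equation:
 assumes l: "H.bounded_functional l K" and l': "H.bounded_functional l' K'"
  and ad: "HC.adjoint_functionals l l'" and t: "0 \<le> t"
  and zero: "\<And>V. \<lbrakk>V \<in> X; fst V = 0; snd (snd V) = 0\<rbrakk> \<Longrightarrow> l V = 0"
 shows "l (U t) = l (U 0) + integral {0..t} (\<lambda>r. l' (U r))"
proof (rule HC.functional_mild[OF a_int t H.cont_in_subset[OF x_cont] H.cont_in_subset[OF y_cont] l l' ad])
 show "l (x s) = 0" if "s \<in> {0..t}" for s using that x_form[of s] H.cont_inD(1)[OF x_cont, of s] by (intro zero) auto
 show "l (y s) = 0" if "s \<in> {0..t}" for s using that y_form[of s] H.cont_inD(1)[OF y_cont, of s] by (intro zero) auto
 show "U 0 \<in> X" using H.cont_inD(1)[OF U_cont, of 0] by simp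
 show "U r \<in> X" if "r \<in> {0..t}" for r using that H.cont_inD(1)[OF U_cont, of r] by simp
qed (use mild in auto)

lemma position_equation:
 assumes e: "e \<in> DR" and t: "0 \<le> t"
 shows "R (u t) \<bullet> e = R (u 0) \<bullet> e + integral {0..t} (\<lambda>r. v r \<bullet> R e)"
 using weak_equation[OF position_functional velocity_functional position_adjoint[OF e] t]
 by (simp add: u_def v_def R_zero)

lemma v_cont: "continuous_on {0..} v"
 unfolding continuous_on_def
proof
 fix t :: real assume t: "t \<in> {0..}"
 have "((\<lambda>s. E (U s - U t)) \<longlongrightarrow> 0) (at t within {0..})" using H.cont_inD(2)[OF U_cont t] .
 then have "((\<lambda>s. v s - v t) \<longlongrightarrow> 0) (at t within {0..})"
 proof (rule Lim_null_comparison[rotated])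
  have "norm (v s - v t) \<le> E (U s - U t)" if "0 \<le> s" for s
  proof -
   have eq: "U s - U t = (u s - u t, v s - v t, w s - w t)" by (simp add: U_eq)
   have mem: "(u s - u t, v s - v t, w s - w t) \<in> X"
    using H.X_diff[OF U_X[OF that] U_X] t by simp
   show ?thesis unfolding eq by (rule component_bounds(2)[OF mem])
  qed
  then show "\<forall>\<^sub>F s in at t within {0..}. norm (v s - v t) \<le> E (U s - U t)"
   by (auto simp: eventually_at_filter)
 qed
 then show "(v \<longlongrightarrow> v t) (at t within {0..})" by (rule LIM_zero_cancel)
qed

text \<open>
\<open>position_equation\<close> says that \<open>d = u t - u 0 - \<integral> v\<close> is orthogonal to the range of \<open>R\<close>. Hence \<open>d\<close> is in the
domain of the adjoint of \<open>R\<close>, which is \<open>R\<close>, and \<open>R d = 0\<close>; as \<open>R\<close> is bounded below, \<open>d = 0\<close>. The velocity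
is only known to be in \<open>H\<close>, so \<open>R\<close> cannot be applied to the integral directly.
\<close>

lemma u_integral:
 assumes t: "0 \<le> t"
 shows "u t = u 0 + integral {0..t} v"
proof -
 have vi: "v integrable_on {0..t}" by (intro integrable_continuous_interval continuous_on_subset[OF v_cont]) auto
 define d where "d = u t - u 0 - integral {0..t} v"
 have orth: "R e \<bullet> d = 0" if e: "e \<in> DR" for e
 proof -
  have "integral {0..t} (\<lambda>r. v r \<bullet> R e) = integral {0..t} v \<bullet> R e"
   using integral_linear[OF vi bounded_linear_inner_left[of "R e"]] by (simp add: o_def)
  moreover have "R (u t) \<bullet> e = u t \<bullet> R e" "R (u 0) \<bullet> e = u 0 \<bullet> R e"
   using R_symmetric u_DR t e by auto
  ultimately have "u t \<bullet> R e = u 0 \<bullet> R e + integral {0..t} v \<bullet> R e"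
   using position_equation[OF e t] by simp
  then show ?thesis by (simp add: d_def inner_diff_right inner_commute)
 qed
 have dD: "d \<in> DR" by (rule DR_adjoint[of _ 0]) (simp add: orth)
 have "R d = 0"
  by (rule orthogonal_to_DR) (use orth R_symmetric[OF _ dD] in simp)
 moreover obtain c where "norm d \<le> c * norm (R d)" using R_bounded_below dD by blast
 ultimately have "d = 0" by simp
 then show ?thesis by (simp add: d_def algebra_simps)
qed

lemma u_derivative:
 assumes t: "0 < t"
 shows "(u has_vector_derivative v t) (at t)"
proof -
 have deriv: "((\<lambda>t. u 0 + integral {0..t} v) has_vector_derivative v t) (at t within {0..t+1})"
  using integral_has_vector_derivative[OF continuous_on_subset[OF v_cont], of 0 "t + 1" t] t
  by (auto intro!: derivative_eq_intros)
 have "(u has_vector_derivative v t) (at t within {0..t+1})"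
 proof (rule has_vector_derivative_transform[OF _ _ deriv])
  show "t \<in> {0..t+1}" using t by simp
  show "u r = u 0 + integral {0..r} v" if "r \<in> {0..t+1}" for r using that by (intro u_integral) simp
 qed
 moreover have "at t within {0..t+1} = at t" using t by (intro at_within_interior) auto
 ultimately show ?thesis by simp
qed

lemma u_cont: "continuous_on_in DR (sqrt_norm R) {0..} u"
 unfolding continuous_on_in_def
proof (intro conjI ballI)
 fix t :: real assume t: "t \<in> {0..}"
 then show "u t \<in> DR" using u_DR by simp
 have c: "0 < sqrt (1 - kernel_mass k)" using k_mass by simp
 have "((\<lambda>s. (1 / sqrt (1 - kernel_mass k)) * E (U s - U t)) \<longlongrightarrow> 0) (at t within {0..})"
  using tendsto_mult_right_zero[OF H.cont_inD(2)[OF U_cont t]] .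
 then show "((\<lambda>s. sqrt_norm R (u s - u t)) \<longlongrightarrow> 0) (at t within {0..})"
 proof (rule Lim_null_comparison[rotated])
  have "norm (sqrt_norm R (u s - u t)) \<le> (1 / sqrt (1 - kernel_mass k)) * E (U s - U t)" if "0 \<le> s" for s
  proof -
   have eq: "U s - U t = (u s - u t, v s - v t, w s - w t)" by (simp add: U_eq)
   have mem: "(u s - u t, v s - v t, w s - w t) \<in> X"
    using H.X_diff[OF U_X[OF that] U_X] t by simp
   show ?thesis unfolding eq using component_bounds(1)[OF mem] c
    by (simp add: sqrt_norm_def pos_le_divide_eq mult.commute)
  qed
  then show "\<forall>\<^sub>F s in at t within {0..}. norm (sqrt_norm R (u s - u t)) \<le> (1 / sqrt (1 - kernel_mass k)) * E (U s - U t)"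
   by (auto simp: eventually_at_filter)
 qed
qed

definition full :: "real \<Rightarrow> 'a" where "full s = (if s \<le> 0 then f0 s else u s)"

abbreviation past where "past \<equiv> history f0 0"

lemma past_0: "past 0 = 0" by (simp add: history_def)

lemma full_nonneg: "0 \<le> s \<Longrightarrow> full s = u s" using u_0 by (simp add: full_def)

lemma history_full:
 assumes t: "0 \<le> t" and s: "0 < s"
 shows "history full t s = (if s \<le> t then u t - u (t - s) else (u t - f0 0) + past (s - t))"
 using t s full_nonneg[OF t] full_nonneg[of "t - s"] by (auto simp: history_def full_def u_0)

text \<open>
The history up to time \<open>t\<close> is bounded in \<open>D(R)\<close>, and the part before is the initial history shifted by
\<open>t\<close> up to a constant; as \<open>k\<close> decreases, the shift does not increase the weighted norm.
\<close>

lemma history_full_L2: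
 assumes t: "0 \<le> t"
 shows "history full t \<in> W.L2"
proof -
 define w1 where "w1 s = (if s \<in> {0<..t} then u t - u (t - s) else 0)" for s
 define w2 where "w2 s = (if s \<in> {t<..} then (u t - f0 0) + past (s - t) else 0)" for s
 have half: "{0<..} \<in> sets (lebesgue :: real measure)" "{t<..} \<in> sets (lebesgue :: real measure)" "{0<..t} \<in> sets lebesgue" "{0..t} \<in> sets lebesgue" by auto
 have ut: "u t \<in> DR" using u_DR t by simp
 have c1: "continuous_on_in DR (sqrt_norm R) {0..t} (\<lambda>s. u t - u (t - s))"
 proof (rule DR.cont_in_controlled[of _ "\<lambda>s. u (t - s)" "\<lambda>s. u (t - s)" _ 1])
  show c: "continuous_on_in DR (sqrt_norm R) {0..t} (\<lambda>s. u (t - s))"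
   by (rule DR.cont_in_compose[OF u_cont]) (auto intro!: continuous_intros)
  then show "continuous_on_in DR (sqrt_norm R) {0..t} (\<lambda>s. u (t - s))" .
  show "u t - u (t - s) \<in> DR" if "s \<in> {0..t}" for s using ut u_DR[of "t - s"] that by auto
  fix s r assume sr: "s \<in> {0..t}" "r \<in> {0..t}"
  have D: "u (t - s) \<in> DR" "u (t - r) \<in> DR" using u_DR sr by auto
  have "sqrt_norm R (u t - u (t - s) - (u t - u (t - r))) = sqrt_norm R (u (t - r) - u (t - s))" by simp
  also have "\<dots> = sqrt_norm R (u (t - s) - u (t - r))" by (rule DR.p_minus_commute[OF D(2,1)])
  finally show "sqrt_norm R (u t - u (t - s) - (u t - u (t - r)))
    \<le> 1 * (sqrt_norm R (u (t - s) - u (t - r)) + sqrt_norm R (u (t - s) - u (t - r)))"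
   by (simp add: sqrt_norm_def)
 qed
 have sm1: "strongly_measurable_in DR (sqrt_norm R) lebesgue w1"
 proof -
  have "strongly_measurable_in DR (sqrt_norm R) lebesgue (\<lambda>s. if s \<in> {0..t} then u t - u (t - s) else 0)"
   by (rule DR.strongly_measurable_extend_iff[OF half(4), THEN iffD1, OF DR.strongly_measurable_cont[OF c1]])
  then show ?thesis
  proof (rule DR.strongly_measurable_cong)
   have "w1 s \<in> DR" for s using ut u_DR[of "t - s"] DR_zero by (auto simp: w1_def)
   moreover have "AE s in lebesgue. s \<noteq> (0::real)" using AE_completion[OF AE_lborel_singleton[of 0]] .
   ultimately show "AE s in lebesgue. w1 s \<in> DR \<and> sqrt_norm R ((if s \<in> {0..t} then u t - u (t - s) else 0) - w1 s) = 0"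
    by (auto simp: w1_def elim!: eventually_mono)
  qed
 qed
 have pastD: "AE s in lebesgue. 0 < s \<longrightarrow> past s \<in> DR"
  using W.L2_D(3)[OF history_L2] by (simp add: AE_lebesgue_on_iff[OF half(1)])
 have sm2: "strongly_measurable_in DR (sqrt_norm R) lebesgue w2"
 proof -
  have "strongly_measurable_in DR (sqrt_norm R) (lebesgue_on {0<..}) (\<lambda>s. (u t - f0 0) + past s)"
   using DR.strongly_measurable_add[OF W.L2_D(1)[OF W.L2_const[of "u t - f0 0"]] W.L2_D(1)[OF history_L2]] ut f0_DR by simp
  then have "strongly_measurable_in DR (sqrt_norm R) lebesgue (\<lambda>s. if s \<in> {0<..} then (u t - f0 0) + past s else 0)"
   by (rule DR.strongly_measurable_extend_iff[OF half(1), THEN iffD1])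
  from DR.strongly_measurable_shift[OF this, of "- t"]
  have "strongly_measurable_in DR (sqrt_norm R) lebesgue (\<lambda>s. if - t + s \<in> {0<..} then (u t - f0 0) + past (- t + s) else 0)" .
  also have "(\<lambda>s. if - t + s \<in> {0<..} then (u t - f0 0) + past (- t + s) else 0) = w2"
   by (auto simp: w2_def fun_eq_iff)
  finally show ?thesis .
 qed
 have sm: "strongly_measurable_in DR (sqrt_norm R) (lebesgue_on {0<..}) (history full t)"
 proof -
  have "(\<lambda>s. if s \<in> {0<..} then history full t s else 0) = (\<lambda>s. w1 s + w2 s)"
   using history_full[OF t] t by (auto simp: w1_def w2_def fun_eq_iff)
  then show ?thesis
   using DR.strongly_measurable_add[OF sm1 sm2] DR.strongly_measurable_extend_iff[OF half(1)] by simp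
 qed
 obtain P where P: "0 \<le> P" "\<And>s. s \<in> {0..t} \<Longrightarrow> sqrt_norm R (u t - u (t - s)) \<le> P"
  using DR.cont_in_bounded[OF c1] by blast
 define B where "B = P + norm (R (u t - f0 0))"
 define qq where "qq s = indicator {0<..} s * (k s * (norm (R (past s)))\<^sup>2)" for s
 have qi: "integrable lebesgue qq"
  using W.L2_D(2)[OF history_L2] by (simp add: qq_def[abs_def] integrable_restrict_space sqrt_norm_def)
 have qsi: "integrable (lebesgue_on {0<..}) (\<lambda>s. qq (s - t))"
 proof -
  have i: "integrable lebesgue (\<lambda>s. qq (- t + 1 * s))" by (rule lebesgue_integrable_real_affine[OF qi]) simp
  have "integrable lebesgue (\<lambda>s. indicator {0<..} s *\<^sub>R qq (- t + 1 * s))"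
   by (rule integrable_mult_indicator[OF half(1) i])
  then show ?thesis by (simp add: integrable_restrict_space)
 qed
 show ?thesis
 proof (rule W.L2_I[OF sm])
  show "integrable (lebesgue_on {0<..}) (\<lambda>s. 2 * B\<^sup>2 * k s + 2 * qq (s - t))"
   using k_integrable qsi by auto
  have pD: "AE s in lebesgue. 0 < - t + s \<longrightarrow> past (- t + s) \<in> DR" using AE_lebesgue_shift[OF pastD] .
  then have pD': "AE s in lebesgue_on {0<..}. t < s \<longrightarrow> past (s - t) \<in> DR"
   by (simp add: AE_lebesgue_on_iff[OF half(1)]) (auto elim!: eventually_mono)
  show "AE s in lebesgue_on {0<..}. k s * (sqrt_norm R (history full t s))\<^sup>2 \<le> 2 * B\<^sup>2 * k s + 2 * qq (s - t)"
   using pD' AE_space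
  proof eventually_elim
   case (elim s)
   then have s: "0 < s" by simp
   have ks: "0 \<le> k s" using s k_nonneg by simp
   have q0: "0 \<le> qq (s - t)" using k_nonneg[of "s - t"] by (auto simp: qq_def indicator_def)
   show ?case
   proof (cases "s \<le> t")
    case True
    have "sqrt_norm R (history full t s) \<le> B"
     using P(2)[of s] True s history_full[OF t s] by (simp add: B_def add_increasing2)
    then have "(sqrt_norm R (history full t s))\<^sup>2 \<le> B\<^sup>2" by (intro power_mono) (auto simp: sqrt_norm_def)
    also have "B\<^sup>2 \<le> 2 * B\<^sup>2" by simp
    finally have "k s * (sqrt_norm R (history full t s))\<^sup>2 \<le> k s * (2 * B\<^sup>2)" using ks by (rule mult_left_mono)
    then show ?thesis using q0 by (simp add: mult_ac)
   next
    case False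
    then have pm: "past (s - t) \<in> DR" using elim by simp
    have dm: "u t - f0 0 \<in> DR" using ut f0_DR by auto
    have "history full t s = (u t - f0 0) + past (s - t)" using history_full[OF t s] False by simp
    then have "sqrt_norm R (history full t s) \<le> B + norm (R (past (s - t)))"
     using DR.p_triangle[OF dm pm] P(1) by (simp add: sqrt_norm_def B_def)
    then have "(sqrt_norm R (history full t s))\<^sup>2 \<le> (B + norm (R (past (s - t))))\<^sup>2"
     by (intro power_mono) (auto simp: sqrt_norm_def)
    also have "\<dots> \<le> 2 * B\<^sup>2 + 2 * (norm (R (past (s - t))))\<^sup>2"
     using sum_squares_bound[of B "norm (R (past (s - t)))"] by (simp add: power2_sum)
    finally have "k s * (sqrt_norm R (history full t s))\<^sup>2 \<le> k s * (2 * B\<^sup>2 + 2 * (norm (R (past (s - t))))\<^sup>2)"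
     using ks by (rule mult_left_mono)
    also have "\<dots> = 2 * B\<^sup>2 * k s + 2 * (k s * (norm (R (past (s - t))))\<^sup>2)" by (simp add: algebra_simps)
    also have "k s * (norm (R (past (s - t))))\<^sup>2 \<le> k (s - t) * (norm (R (past (s - t))))\<^sup>2"
     using k_mono[of "s - t" s] False t by (intro mult_right_mono) auto
    also have "k (s - t) * (norm (R (past (s - t))))\<^sup>2 = qq (s - t)" using False by (simp add: qq_def)
    finally show ?thesis by simp
   qed
  qed
 qed
qed

text \<open>
\<open>R (full s) \<bullet> e\<close>, the past being expressed through \<open>past\<close>, whose values are in \<open>D(R)\<close> almost
everywhere; those of \<open>f0\<close> need not be in \<open>D(R)\<close>.
\<close>

definition probe :: "'a \<Rightarrow> real \<Rightarrow> real" where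
 "probe e s = (if s \<le> 0 then R (f0 0) \<bullet> e - R (past (- s)) \<bullet> e else R (u s) \<bullet> e)"

lemma probe_nonneg: "0 \<le> s \<Longrightarrow> probe e s = R (u s) \<bullet> e"
 using u_0 past_0 R_zero by (auto simp: probe_def)

lemma probe_cont: "continuous_on {0..} (probe e)"
proof -
 have "continuous_on {0..} (\<lambda>s. R (u s) \<bullet> e)"
  by (rule DR.continuous_on_functional[OF u_cont R_inner_functional])
 then show ?thesis by (rule continuous_on_cong[THEN iffD1, rotated 2]) (auto simp: probe_nonneg)
qed

lemma probe_integrable:
 assumes q: "0 \<le> q" "0 < k q" and T: "0 \<le> T"
 shows "probe e absolutely_integrable_on {-q..T}"
proof -
 have "(\<lambda>\<sigma>. R (past \<sigma>) \<bullet> e) absolutely_integrable_on {0..q}" by (rule pair_integrable_bound(1)[OF history_L2 q])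
 then have "(\<lambda>\<sigma>. R (past (- \<sigma>)) \<bullet> e) absolutely_integrable_on {-q..0}"
  using hk_integrable_reflect_real[where f = "\<lambda>\<sigma>. R (past \<sigma>) \<bullet> e" and a = 0 and b = q]
   hk_integrable_reflect_real[where f = "\<lambda>\<sigma>. \<bar>R (past \<sigma>) \<bullet> e\<bar>" and a = 0 and b = q]
  by (simp add: absolutely_integrable_on_def)
 then have "(\<lambda>\<sigma>. R (f0 0) \<bullet> e - R (past (- \<sigma>)) \<bullet> e) absolutely_integrable_on {-q..0}"
  by (rule set_integral_diff(1)[OF absolutely_integrable_continuous_real[OF continuous_on_const]])
 moreover have "probe e absolutely_integrable_on {-q..0} \<longleftrightarrow>
   (\<lambda>\<sigma>. R (f0 0) \<bullet> e - R (past (- \<sigma>)) \<bullet> e) absolutely_integrable_on {-q..0}"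
  by (rule set_integrable_cong[OF refl refl]) (simp add: probe_def)
 ultimately have 1: "probe e absolutely_integrable_on {-q..0}" by blast
 have 2: "probe e absolutely_integrable_on {0..T}"
  by (intro absolutely_integrable_continuous_real continuous_on_subset[OF probe_cont]) auto
 have "probe e absolutely_integrable_on ({-q..0} \<union> {0..T})"
  by (rule set_integrable_Un[OF 1 2]) auto
 also have "{-q..0} \<union> {0..T} = {-q..T}" using q T by auto
 finally show ?thesis .
qed

text \<open>
The primitive of the history is computed by the substitution \<open>\<sigma> \<mapsto> t - \<sigma>\<close>.
\<close>

lemma pair_history:
 assumes q: "0 \<le> q" "0 < k q" and s: "s \<in> {0..q}" and t: "0 \<le> t"
 shows "pair e s (history full t)
   = s * probe e t - (integral {-q..t} (probe e) - integral {-q..t - s} (probe e))"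
proof -
 have gi: "probe e integrable_on {-q..t}"
  using probe_integrable[OF q t] by (simp add: absolutely_integrable_on_def)
 have sk: "0 < k s" using k_positive_below[of s q] q s by auto
 have pastD: "AE \<sigma> in lebesgue. 0 < \<sigma> \<longrightarrow> past \<sigma> \<in> DR"
  using W.L2_D(3)[OF history_L2] by (simp add: AE_lebesgue_on_iff)
 have pD: "AE \<sigma> in lebesgue_on {0<..}. t < \<sigma> \<longrightarrow> past (- t + \<sigma>) \<in> DR"
  using AE_lebesgue_shift[OF pastD, of "- t"] by (simp add: AE_lebesgue_on_iff) (auto elim!: eventually_mono)
 have "pair e s (history full t) = integral {0..s} (\<lambda>\<sigma>. probe e t - probe e (t - \<sigma>))"
  unfolding pair_def
 proof (rule integral_eq_AE_positive)
  show "AE \<sigma> in lebesgue_on {0<..}. \<sigma> \<le> s \<longrightarrow> R (history full t \<sigma>) \<bullet> e = probe e t - probe e (t - \<sigma>)"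
   using pD AE_space
  proof eventually_elim
   case (elim \<sigma>)
   then have \<sigma>: "0 < \<sigma>" by simp
   have ut: "u t \<in> DR" using u_DR t by simp
   show ?case
   proof (cases "\<sigma> \<le> t")
    case True
    then show ?thesis
     using history_full[OF t \<sigma>] probe_nonneg[OF t] probe_nonneg[of "t - \<sigma>"] R_diff[OF ut u_DR[of "t - \<sigma>"]]
     by (simp add: inner_diff_left)
   next
    case False
    then have pm: "past (\<sigma> - t) \<in> DR" using elim by simp
    have "R (history full t \<sigma>) = R (u t) - R (f0 0) + R (past (\<sigma> - t))"
     using history_full[OF t \<sigma>] False ut f0_DR pm by (simp add: R_add R_diff)
    then show ?thesis
     using False probe_nonneg[OF t] by (simp add: probe_def[of e "t - \<sigma>"] inner_diff_left inner_add_left)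
   qed
  qed
 qed
 also have "\<dots> = s * probe e t - integral {0..s} (\<lambda>\<sigma>. probe e (t - \<sigma>))"
 proof -
  have "(\<lambda>\<sigma>. probe e (t - \<sigma>)) integrable_on {0..s}"
  proof -
   have "probe e integrable_on {t - s..t}" using s q by (intro integrable_on_subinterval[OF gi]) (use t in auto)
   then have "(\<lambda>\<sigma>. probe e (\<sigma> + t)) integrable_on {t - s - t..t - t}"
    using has_integral_shift_real_ivl[of "probe e" _ "t - s" t t] by (auto simp: integrable_on_def)
   then have "(\<lambda>\<sigma>. probe e (- \<sigma> + t)) integrable_on {- 0..- (- s)}"
    using hk_integrable_reflect_real[where f = "\<lambda>\<sigma>. probe e (\<sigma> + t)" and a = "- s" and b = 0] by simp
   then show ?thesis by (simp only: minus_zero minus_minus uminus_add_conv_diff)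
  qed
  from hk_integral_diff[OF integrable_const_ivl this, of "probe e t"]
  show ?thesis using s by simp
 qed
 also have "integral {0..s} (\<lambda>\<sigma>. probe e (t - \<sigma>)) = integral {-s..0} (\<lambda>\<sigma>. probe e (\<sigma> + t))"
  using Henstock_Kurzweil_Integration.integral_reflect_real[where f = "\<lambda>\<sigma>. probe e (\<sigma> + t)" and a = "- s" and b = 0]
  by (simp only: minus_zero minus_minus uminus_add_conv_diff)
 also have "\<dots> = integral {t - s..t} (probe e)"
  using integral_shift_real_ivl[of "t - s" t t "probe e"] by simp
 also have "integral {t - s..t} (probe e) = integral {-q..t} (probe e) - integral {-q..t - s} (probe e)"
  using hk_integral_combine[of "-q" "t - s" t "probe e"] gi s t by simp
 finally show ?thesis .
qed

lemma pair_w_joint_cont: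
 assumes q: "0 \<le> q" "0 < k q"
 shows "continuous_on ({0..T} \<times> {0..q}) (\<lambda>z. pair e (snd z) (w (fst z)))"
proof (rule continuous_on_by_control)
 fix z assume z: "z \<in> {0..T} \<times> {0..q}"
 let ?g = "\<lambda>z'. pair_const e q * E (U (fst z') - U (fst z)) + \<bar>pair e (snd z') (w (fst z)) - pair e (snd z) (w (fst z))\<bar>"
 have Uz: "U (fst z) \<in> X" "w (fst z) \<in> W.L2" using z H.cont_inD(1)[OF U_cont, of "fst z"] w_L2 by auto
 show "\<exists>g. continuous_on ({0..T} \<times> {0..q}) g \<and> g z = 0 \<and>
   (\<forall>z'\<in>{0..T} \<times> {0..q}. \<bar>pair e (snd z') (w (fst z')) - pair e (snd z) (w (fst z))\<bar> \<le> g z')"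
 proof (intro exI[of _ ?g] conjI ballI)
  show "continuous_on ({0..T} \<times> {0..q}) ?g"
   by (intro continuous_intros continuous_on_compose2[OF H.continuous_on_p_diff[OF U_cont Uz(1)]]
     continuous_on_compose2[OF pair_cont[OF Uz(2) q]]) auto
  show "?g z = 0" by simp
  fix z' assume z': "z' \<in> {0..T} \<times> {0..q}"
  then have w': "w (fst z') \<in> W.L2" and U': "U (fst z') \<in> X" using w_L2 H.cont_inD(1)[OF U_cont, of "fst z'"] by auto
  have sz: "0 \<le> snd z'" "0 < k (snd z')" "snd z' \<in> {0..q}" using z' q k_positive_below[of "snd z'" q] by auto
  have dL: "(\<lambda>\<sigma>. w (fst z') \<sigma> - w (fst z) \<sigma>) \<in> W.L2" using W.L2_diff[OF w' Uz(2)] .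
  have "pair e (snd z') (w (fst z')) - pair e (snd z') (w (fst z)) = pair e (snd z') (\<lambda>\<sigma>. w (fst z') \<sigma> - w (fst z) \<sigma>)"
   using pair_add[OF w' W.L2_scaleR[OF Uz(2), of "-1"] sz(1,2), of e] pair_scaleR[OF Uz(2), of e "snd z'" "-1"] by simp
  then have "\<bar>pair e (snd z') (w (fst z')) - pair e (snd z') (w (fst z))\<bar> \<le> pair_const e q * W.L2_norm (\<lambda>\<sigma>. w (fst z') \<sigma> - w (fst z) \<sigma>)"
   using pair_bound[OF dL q(2) sz(3)] by simp
  also have "\<dots> \<le> pair_const e q * E (U (fst z') - U (fst z))"
  proof -
   have eq: "U (fst z') - U (fst z) = (u (fst z') - u (fst z), v (fst z') - v (fst z), w (fst z') - w (fst z))"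
    by (simp add: U_eq)
   have "(u (fst z') - u (fst z), v (fst z') - v (fst z), w (fst z') - w (fst z)) \<in> X"
    using H.X_diff[OF U' Uz(1)] by (simp only: eq)
   from component_bounds(3)[OF this] show ?thesis
    unfolding eq using pair_const_nonneg[OF q] by (intro mult_left_mono) (auto simp: fun_diff_def)
  qed
  finally show "\<bar>pair e (snd z') (w (fst z')) - pair e (snd z) (w (fst z))\<bar> \<le> ?g z'" by linarith
 qed
qed

text \<open>
The weak form of \<open>w\<^sub>t = - w\<^sub>s + v\<close> after two integrations in \<open>s\<close>; \<open>v\<close> enters as \<open>u'\<close>.
\<close>

lemma history_equation:
 assumes e: "e \<in> DR" and s: "0 \<le> s" "0 < k s" and t: "0 \<le> t"
 shows "pair2 e s (w t) = pair2 e s (w 0) - integral {0..t} (\<lambda>r. pair e s (w r)) + s\<^sup>2 / 2 * (probe e t - probe e 0)"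
proof -
 have lin: "H.bounded_functional (\<lambda>U. (-1) * pair e s (snd (snd U)) + s\<^sup>2 / 2 * (fst (snd U) \<bullet> R e))
   (\<bar>-1\<bar> * pair_const e s + \<bar>s\<^sup>2 / 2\<bar> * norm (R e))"
  by (rule H.bounded_functional_combine[OF pair_functional[OF s] velocity_functional])
 have zero: "pair2 e s 0 = 0"
  unfolding pair2_def pair_def by (simp add: zero_fun_def R_zero)
 have "pair2 e s (w t) = pair2 e s (w 0) + integral {0..t} (\<lambda>r. (-1) * pair e s (w r) + s\<^sup>2 / 2 * (v r \<bullet> R e))"
  using weak_equation[OF pair2_functional[OF s] lin history_adjoint[OF e s] t] zero by (simp add: w_def v_def)
 also have "integral {0..t} (\<lambda>r. (-1) * pair e s (w r) + s\<^sup>2 / 2 * (v r \<bullet> R e))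
   = integral {0..t} (\<lambda>r. (-1) * pair e s (w r)) + integral {0..t} (\<lambda>r. s\<^sup>2 / 2 * (v r \<bullet> R e))"
 proof (rule hk_integral_add)
  have "continuous_on {0..t} (\<lambda>r. pair e s (w r))"
   using s by (intro continuous_on_compose2[OF pair_w_joint_cont[OF s, of t e], of _ "\<lambda>r. (r, s)", simplified] continuous_intros) auto
  then show "(\<lambda>r. (-1) * pair e s (w r)) integrable_on {0..t}"
   by (intro integrable_continuous_interval continuous_intros)
  show "(\<lambda>r. s\<^sup>2 / 2 * (v r \<bullet> R e)) integrable_on {0..t}"
   by (intro integrable_continuous_interval continuous_intros continuous_on_subset[OF v_cont]) auto
 qed
 also have "\<dots> = - integral {0..t} (\<lambda>r. pair e s (w r)) + s\<^sup>2 / 2 * integral {0..t} (\<lambda>r. v r \<bullet> R e)"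
  by simp
 also have "integral {0..t} (\<lambda>r. v r \<bullet> R e) = probe e t - probe e 0"
  using position_equation[OF e t] probe_nonneg t by simp
 finally show ?thesis by simp
qed

text \<open>
Let \<open>Z\<close> be the double primitive in \<open>s\<close> of the difference between \<open>w\<close> and the history of \<open>u\<close>, tested with
\<open>e\<close>, and \<open>D\<close> its derivative in \<open>s\<close>. The history satisfies the same equation as \<open>w\<close>, so that
\<open>Z\<^sub>t = - D\<close> by \<open>history_equation\<close>; both data of \<open>Z\<close> vanish, and \<open>transport_zero\<close> applies. The double
primitive is needed to have classical derivatives.
\<close>

lemma pair_w_eq_pair_history:
 assumes e: "e \<in> DR" and q: "0 < q" "0 < k q" and s: "s \<in> {0..q}" and t: "0 \<le> t"
 shows "pair e s (w t) = pair e s (history full t)"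
proof -
 define G where "G r = integral {-q..r} (probe e)" for r
 \<comment> \<open>the history of \<open>u\<close> is known on \<open>{0..q}\<close> through the values of \<open>u\<close> since time \<open>- q\<close>\<close>
 define GG where "GG r = integral {-q..r} G" for r
 have q0: "0 \<le> q" using q by simp
 have kq: "0 < k \<sigma>" if "\<sigma> \<in> {0..q}" for \<sigma> using that q k_positive_below[of \<sigma> q] by auto
 have gi: "probe e integrable_on {-q..t}"
  using probe_integrable[OF q0 q(2) t] by (simp add: absolutely_integrable_on_def)
 have Gc: "continuous_on {-q..t} G" unfolding G_def using indefinite_integral_continuous_1[OF gi] .
 have dGG: "(GG has_real_derivative G r) (at r within {-q..t})" if "r \<in> {-q..t}" for r
  unfolding GG_def using integral_has_real_derivative[OF Gc that] .
 have dG: "(G has_real_derivative probe e r) (at r within {0..t})" if r: "r \<in> {0..t}" for r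
 proof -
  have deriv: "((\<lambda>r. G 0 + integral {0..r} (probe e)) has_real_derivative 0 + probe e r) (at r within {0..t})"
   using r by (intro DERIV_add DERIV_const integral_has_real_derivative continuous_on_subset[OF probe_cont]) auto
  have eq: "G r' = G 0 + integral {0..r'} (probe e)" if "r' \<in> {0..t}" for r'
   unfolding G_def using hk_integral_combine[of "-q" 0 r' "probe e"] that q
    integrable_on_subinterval[OF gi, of "-q" r'] by auto
  show ?thesis using has_real_derivative_cong_on[OF deriv r eq] by simp
 qed
 define D where "D r \<sigma> = pair e \<sigma> (w r) - \<sigma> * probe e r + G r - G (r - \<sigma>)" for r \<sigma>
 define Z where "Z r \<sigma> = pair2 e \<sigma> (w r) - \<sigma>\<^sup>2 / 2 * probe e r + \<sigma> * G r - GG r + GG (r - \<sigma>)" for r \<sigma>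
 have Zs: "(Z r has_real_derivative D r \<sigma>) (at \<sigma> within {0..q})" if r: "r \<in> {0..t}" "\<sigma> \<in> {0..q}" for r \<sigma>
 proof -
  have 1: "((\<lambda>\<sigma>. pair2 e \<sigma> (w r)) has_real_derivative pair e \<sigma> (w r)) (at \<sigma> within {0..q})"
   unfolding pair2_def using r by (intro integral_has_real_derivative pair_cont w_L2 q q0) auto
  have "(GG has_real_derivative G (r - \<sigma>)) (at (r - \<sigma>) within (\<lambda>\<sigma>. r - \<sigma>) ` {0..q})"
   using r by (intro DERIV_subset[OF dGG]) auto
  moreover have "((\<lambda>\<sigma>. r - \<sigma>) has_real_derivative - 1) (at \<sigma> within {0..q})"
   by (auto intro!: derivative_eq_intros)
  ultimately have "(GG \<circ> (\<lambda>\<sigma>. r - \<sigma>) has_real_derivative G (r - \<sigma>) * - 1) (at \<sigma> within {0..q})"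
   by (rule DERIV_image_chain)
  then have 2: "((\<lambda>\<sigma>. GG (r - \<sigma>)) has_real_derivative - G (r - \<sigma>)) (at \<sigma> within {0..q})"
   by (simp add: o_def)
  have 3: "((\<lambda>\<sigma>. \<sigma>\<^sup>2 / 2 * probe e r) has_real_derivative \<sigma> * probe e r) (at \<sigma> within {0..q})"
   by (auto intro!: derivative_eq_intros)
  have 4: "((\<lambda>\<sigma>. \<sigma> * G r) has_real_derivative G r) (at \<sigma> within {0..q})"
   by (auto intro!: derivative_eq_intros)
  have "(Z r has_real_derivative pair e \<sigma> (w r) - \<sigma> * probe e r + G r - 0 + - G (r - \<sigma>)) (at \<sigma> within {0..q})"
   unfolding Z_def by (intro DERIV_add DERIV_diff DERIV_const 1 2 3 4)
  then show ?thesis by (simp add: D_def)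
 qed
 have Zt: "((\<lambda>r. Z r \<sigma>) has_real_derivative - D r \<sigma>) (at r within {0..t})" if r: "r \<in> {0..t}" "\<sigma> \<in> {0..q}" for r \<sigma>
 proof -
  have s': "0 \<le> \<sigma>" "0 < k \<sigma>" using r kq by auto
  have pc: "continuous_on {0..t} (\<lambda>r. pair e \<sigma> (w r))"
   using r by (intro continuous_on_compose2[OF pair_w_joint_cont[OF q0 q(2), of t e], of _ "\<lambda>r. (r, \<sigma>)", simplified] continuous_intros) auto
  have 1: "((\<lambda>r. integral {0..r} (\<lambda>r. pair e \<sigma> (w r))) has_real_derivative pair e \<sigma> (w r)) (at r within {0..t})"
   using r by (intro integral_has_real_derivative pc)
  have "(GG has_real_derivative G (r - \<sigma>)) (at (r - \<sigma>) within (\<lambda>r. r - \<sigma>) ` {0..t})"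
   using r by (intro DERIV_subset[OF dGG]) auto
  moreover have "((\<lambda>r. r - \<sigma>) has_real_derivative 1) (at r within {0..t})"
   by (auto intro!: derivative_eq_intros)
  ultimately have "(GG \<circ> (\<lambda>r. r - \<sigma>) has_real_derivative G (r - \<sigma>) * 1) (at r within {0..t})"
   by (rule DERIV_image_chain)
  then have 2: "((\<lambda>r. GG (r - \<sigma>)) has_real_derivative G (r - \<sigma>)) (at r within {0..t})"
   by (simp add: o_def)
  have 3: "(GG has_real_derivative G r) (at r within {0..t})"
   using r q by (intro DERIV_subset[OF dGG]) auto
  have deriv: "((\<lambda>r. (pair2 e \<sigma> (w 0) - \<sigma>\<^sup>2 / 2 * probe e 0) - integral {0..r} (\<lambda>r. pair e \<sigma> (w r)) + \<sigma> * G r - GG r + GG (r - \<sigma>))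
    has_real_derivative 0 - pair e \<sigma> (w r) + \<sigma> * probe e r - G r + G (r - \<sigma>)) (at r within {0..t})"
   by (intro DERIV_add DERIV_diff DERIV_const 1 2 3 DERIV_cmult dG r(1))
  have eq: "Z r' \<sigma> = (pair2 e \<sigma> (w 0) - \<sigma>\<^sup>2 / 2 * probe e 0) - integral {0..r'} (\<lambda>r. pair e \<sigma> (w r)) + \<sigma> * G r' - GG r' + GG (r' - \<sigma>)"
   if "r' \<in> {0..t}" for r'
   unfolding Z_def using history_equation[OF e s', of r'] that by (simp add: algebra_simps)
  have "((\<lambda>r. Z r \<sigma>) has_real_derivative 0 - pair e \<sigma> (w r) + \<sigma> * probe e r - G r + G (r - \<sigma>)) (at r within {0..t})"
   by (rule has_real_derivative_cong_on[OF deriv r(1) eq])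
  then show ?thesis by (simp add: D_def algebra_simps)
 qed
 have Dc: "continuous_on ({0..t} \<times> {0..q}) (\<lambda>z. D (fst z) (snd z))"
 proof -
  have "continuous_on ({0..t} \<times> {0..q}) (\<lambda>z. probe e (fst z))"
   by (rule continuous_on_compose2[OF probe_cont]) (auto intro!: continuous_intros)
  moreover have "continuous_on ({0..t} \<times> {0..q}) (\<lambda>z. G (fst z))"
   by (rule continuous_on_compose2[OF Gc]) (use q0 in \<open>auto intro!: continuous_intros\<close>)
  moreover have "continuous_on ({0..t} \<times> {0..q}) (\<lambda>z. G (fst z - snd z))"
   by (rule continuous_on_compose2[OF Gc]) (use q0 in \<open>auto intro!: continuous_intros\<close>)
  ultimately show ?thesis
   unfolding D_def by (intro continuous_on_add continuous_on_diff continuous_on_mult pair_w_joint_cont q0 q(2) continuous_on_snd continuous_on_id)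
 qed
 have D0: "D 0 \<sigma> = 0" if \<sigma>: "\<sigma> \<in> {0..q}" for \<sigma>
 proof -
  have "pair e \<sigma> (w 0) = pair e \<sigma> (history full 0)"
   unfolding pair_def
  proof (rule integral_eq_AE_positive, rule AE_I2, rule impI)
   fix x :: real assume "x \<in> space (lebesgue_on {0<..})"
   then have x: "0 < x" by simp
   show "R (w 0 x) \<bullet> e = R (history full 0 x) \<bullet> e"
    using history_full[of 0 x] x by (simp add: w_0 u_0)
  qed
  then show ?thesis using pair_history[OF q0 q(2) \<sigma>, of 0 e] by (simp add: D_def G_def)
 qed
 have Z00: "Z r 0 = 0" for r by (simp add: Z_def)
 have Z0: "Z 0 \<sigma> = 0" if \<sigma>: "\<sigma> \<in> {0..q}" for \<sigma>
 proof -
  have "(Z 0 has_derivative (\<lambda>h. 0)) (at x within {0..q})" if "x \<in> {0..q}" for x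
  proof -
   have "(*) 0 = (\<lambda>h::real. 0)" by auto
   then show ?thesis using Zs[of 0 x] D0[OF that] that t by (simp add: has_field_derivative_def)
  qed
  then have "Z 0 \<sigma> = Z 0 0" using \<sigma> q0 by (intro has_derivative_zero_unique[of "{0..q}"]) auto
  then show ?thesis using Z00 by simp
 qed
 have Z: "Z t \<sigma> = 0" if \<sigma>: "\<sigma> \<in> {0..q}" for \<sigma>
  by (rule transport_zero[OF Zs Zt Dc Z0 Z00]) (use t \<sigma> in auto)
 have "D t s = 0"
 proof (rule vector_derivative_unique_within)
  show "at s within {0..q} \<noteq> bot" using s q by (simp add: trivial_limit_within islimpt_Icc)
  show "(Z t has_vector_derivative D t s) (at s within {0..q})"
   using Zs[of t s] t s by (simp add: has_real_derivative_iff_has_vector_derivative)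
  show "(Z t has_vector_derivative 0) (at s within {0..q})"
   unfolding has_real_derivative_iff_has_vector_derivative[symmetric]
   by (rule has_real_derivative_cong_on[OF DERIV_const s Z])
 qed
 then show ?thesis using pair_history[OF q0 q(2) s t, of e] by (simp add: D_def G_def)
qed

text \<open>
By \<open>pair_w_eq_pair_history\<close>, all primitives of \<open>R d \<bullet> e\<close> vanish, where \<open>d\<close> is the difference; it remains to
choose one null set for all \<open>e\<close>. Countably many \<open>e\<close> suffice: the images under \<open>R\<close> of the values of simple
functions that approximate \<open>d\<close>, among whose limits is \<open>R (d \<sigma>)\<close> itself.
\<close>

lemma history_component: "AE \<sigma> in lebesgue_on {0<..}. 0 < k \<sigma> \<longrightarrow> R (w t \<sigma> - history full t \<sigma>) = 0"
 if t: "0 \<le> t"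
proof -
 define d where "d \<sigma> = w t \<sigma> - history full t \<sigma>" for \<sigma>
 have dL: "d \<in> W.L2" unfolding d_def by (rule W.L2_diff[OF w_L2[OF t] history_full_L2[OF t]])
 have pair_dense: "pair e s d = 0" if e: "e \<in> DR" and q: "0 < q" "0 < k q" and s: "s \<in> {0..q}" for e q s
 proof -
  have sk: "0 \<le> s" "0 < k s" using s q k_positive_below[of s q] by auto
  have "pair e s d = pair e s (w t) - pair e s (history full t)"
   unfolding d_def
   using pair_add[OF w_L2[OF t] W.L2_scaleR[OF history_full_L2[OF t], of "-1"] sk, of e]
    pair_scaleR[OF history_full_L2[OF t], of e s "-1"] by simp
  then show ?thesis using pair_w_eq_pair_history[OF e q s t] by simp
 qed
 have pair_all: "pair e s d = 0" if q: "0 < q" "0 < k q" and s: "s \<in> {0..q}" for e q s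
 proof -
  have sk: "0 \<le> s" "0 < k s" using s q k_positive_below[of s q] by auto
  define C where "C = (q + 1 / k q) * W.L2_norm d"
  have C: "0 \<le> C" unfolding C_def using q W.L2_norm_nonneg[OF dL] by simp
  have "\<bar>pair e s d\<bar> \<le> \<epsilon>" if \<epsilon>: "0 < \<epsilon>" for \<epsilon>
  proof -
   have "e \<in> closure DR" using DR_dense by simp
   then obtain e' where e': "e' \<in> DR" "dist e' e < \<epsilon> / (C + 1)"
    using \<epsilon> C by (metis closure_approachable add_nonneg_pos divide_pos_pos zero_less_one)
   have "pair (e - e') s d = pair e s d - pair e' s d"
    unfolding pair_def using pair_integrable_bound(1)[OF dL sk, of e] pair_integrable_bound(1)[OF dL sk, of e']
    by (simp add: inner_diff_right absolutely_integrable_on_def hk_integral_diff)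
   then have "\<bar>pair e s d\<bar> = \<bar>pair (e - e') s d\<bar>" using pair_dense[OF e'(1) q s] by simp
   also have "\<dots> \<le> norm (e - e') * C"
    using pair_bound[OF dL q(2) s, of "e - e'"] by (simp add: pair_const_def C_def mult.assoc)
   also have "\<dots> \<le> \<epsilon> / (C + 1) * (C + 1)"
    using e'(2) C \<epsilon> by (intro mult_mono) (auto simp: dist_norm norm_minus_commute)
   also have "\<dots> = \<epsilon>" using C by simp
   finally show ?thesis .
  qed
  then show ?thesis using field_le_epsilon[of "\<bar>pair e s d\<bar>" 0] by simp
 qed
 obtain g where g: "\<And>n. simple_function (lebesgue_on {0<..}) (g n)" "\<And>n. g n ` space (lebesgue_on {0<..}) \<subseteq> DR"
   "AE \<sigma> in lebesgue_on {0<..}. (\<lambda>n. sqrt_norm R (d \<sigma> - g n \<sigma>)) \<longlonglongrightarrow> 0" "AE \<sigma> in lebesgue_on {0<..}. d \<sigma> \<in> DR"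
  by (rule DR.strongly_measurableE[OF W.L2_D(1)[OF dL]]) (rule that)
 define C where "C = (\<Union>n. g n ` {0<..})"
 have "countable C" unfolding C_def using simple_functionD(1)[OF g(1)]
  by (intro countable_UN[OF countableI_type] countable_finite) simp
 moreover have countQ: "countable {q \<in> \<rat>. 0 < q \<and> 0 < k q}"
  using countable_rat by (rule countable_subset[rotated]) auto
 ultimately have cnt: "countable ({q \<in> \<rat>. 0 < q \<and> 0 < k q} \<times> C)" by auto
 have orth: "AE \<sigma> in lebesgue_on {0<..}. \<forall>(q, c) \<in> {q \<in> \<rat>. 0 < q \<and> 0 < k q} \<times> C. \<sigma> \<le> q \<longrightarrow> R (d \<sigma>) \<bullet> R c = 0"
 proof (rule AE_ball_countable[OF cnt, THEN iffD2], clarify)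
  fix q c assume q: "0 < q" "0 < k q"
  have "AE \<sigma> in lebesgue. \<sigma> \<in> {0..q} \<longrightarrow> R (d \<sigma>) \<bullet> R c = 0"
  proof (rule indefinite_integral_zero_imp_AE_zero)
   show "(\<lambda>\<sigma>. R (d \<sigma>) \<bullet> R c) absolutely_integrable_on {0..q}"
    using q by (intro pair_integrable_bound(1)[OF dL]) auto
   show "integral {0..s} (\<lambda>\<sigma>. R (d \<sigma>) \<bullet> R c) = 0" if "s \<in> {0..q}" for s
    using pair_all[OF q that, of "R c"] by (simp add: pair_def)
  qed (use q in simp)
  then show "AE \<sigma> in lebesgue_on {0<..}. \<sigma> \<le> q \<longrightarrow> R (d \<sigma>) \<bullet> R c = 0"
   by (simp add: AE_lebesgue_on_iff) (auto elim!: eventually_mono)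
 qed
 have "AE \<sigma> in lebesgue_on {0<..}. 0 < k \<sigma> \<longrightarrow> R (d \<sigma>) = 0"
  using orth g(3,4) AE_space
 proof eventually_elim
  case (elim \<sigma>)
  then have \<sigma>: "0 < \<sigma>" by simp
  show ?case
  proof
   assume k\<sigma>: "0 < k \<sigma>"
   have "isCont k \<sigma>" using continuous_on_interior[OF k_cont, of \<sigma>] \<sigma> by simp
   then have "(k \<longlongrightarrow> k \<sigma>) (at \<sigma>)" by (simp add: isCont_def)
   from order_tendstoD(1)[OF this k\<sigma>] obtain \<delta> where \<delta>: "0 < \<delta>" "\<And>x. \<lbrakk>x \<noteq> \<sigma>; dist x \<sigma> < \<delta>\<rbrakk> \<Longrightarrow> 0 < k x"
    unfolding eventually_at by auto
   obtain q where q: "q \<in> \<rat>" "\<sigma> < q" "q < \<sigma> + \<delta>" using Rats_dense_in_real[of \<sigma> "\<sigma> + \<delta>"] \<delta>(1) by auto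
   have kq: "0 < k q" using \<delta>(2)[of q] q by (simp add: dist_real_def)
   have z: "R (d \<sigma>) \<bullet> R (g n \<sigma>) = 0" for n
   proof -
    have "(q, g n \<sigma>) \<in> {q \<in> \<rat>. 0 < q \<and> 0 < k q} \<times> C" using q \<sigma> kq by (auto simp: C_def)
    then show ?thesis using bspec[OF elim(1), of "(q, g n \<sigma>)"] q(2) by simp
   qed
   have "(\<lambda>n. R (g n \<sigma>)) \<longlonglongrightarrow> R (d \<sigma>)"
   proof -
    have "g n \<sigma> \<in> DR" for n using g(2)[of n] \<sigma> by auto
    then have "sqrt_norm R (d \<sigma> - g n \<sigma>) = norm (R (g n \<sigma>) - R (d \<sigma>))" for n
     unfolding sqrt_norm_def by (subst R_diff[OF elim(3)]) (auto simp: norm_minus_commute)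
    then have "(\<lambda>n. norm (R (g n \<sigma>) - R (d \<sigma>))) \<longlonglongrightarrow> 0" using elim(2) by simp
    then show ?thesis by (rule LIM_zero_cancel[OF tendsto_norm_zero_cancel])
   qed
   then have "(\<lambda>n. R (d \<sigma>) \<bullet> R (g n \<sigma>)) \<longlonglongrightarrow> R (d \<sigma>) \<bullet> R (d \<sigma>)" by (intro tendsto_intros)
   then have "R (d \<sigma>) \<bullet> R (d \<sigma>) = 0" using z by (simp add: LIMSEQ_const_iff)
   then show "R (d \<sigma>) = 0" by simp
  qed
 qed
 then show ?thesis by (simp add: d_def)
qed

text \<open>
The components of a mild solution are those of a solution of the second-order problem.
\<close>

theorem mild_solution_structure:
 assumes t: "0 \<le> t"
 shows "(u t, v t, history full t) \<in> X" "E (U t - (u t, v t, history full t)) = 0"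
proof -
 show X': "(u t, v t, history full t) \<in> X"
  using u_DR[OF t] history_full_L2[OF t] by (simp add: energy_space_iff)
 have eq: "U t - (u t, v t, history full t) = (0, 0, w t - history full t)" by (simp add: U_eq)
 have dX: "(0, 0, w t - history full t) \<in> X"
  using H.X_diff[OF U_X[OF t] X'] by (simp add: U_eq)
 have dL: "w t - history full t \<in> W.L2" using dX by (simp add: energy_space_iff)
 have "AE s in lebesgue_on {0<..}. k s * (sqrt_norm R ((w t - history full t) s))\<^sup>2 = 0"
  using history_component[OF t] AE_space
 proof eventually_elim
  case (elim s)
  then show ?case using k_nonneg[of s] by (cases "k s = 0") (auto simp: sqrt_norm_def)
 qed
 then have "(W.L2_norm (w t - history full t))\<^sup>2 = 0"
  unfolding W.L2_norm_square[OF dL] by (rule integral_eq_zero_AE)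
 then have "(E (0, 0, w t - history full t))\<^sup>2 = 0"
  using energy_norm_square[OF dX] R_zero by simp
 then show "E (U t - (u t, v t, history full t)) = 0" unfolding eq by simp
qed

end

section \<open>Adjoints, radial retractions and monotonicity\<close>

text \<open>
 The representing vector minimises \<open>1/2 * \<parallel>x\<parallel>\<^sup>2 - f x\<close>: by the parallelogram law every minimising
 sequence is Cauchy, and the first variation at the minimum vanishes.
\<close>

theorem riesz_representation:
 fixes f :: "'h::{real_inner, banach} \<Rightarrow> real"
 assumes f: "bounded_linear f"
 shows "\<exists>z. \<forall>x. f x = x \<bullet> z"
proof -
 interpret f: bounded_linear f by (rule f)
 define J where "J x = (norm x)\<^sup>2 / 2 - f x" for x
 define K where "K = onorm f"
 have K: "0 \<le> K" unfolding K_def by (rule onorm_pos_le[OF f])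
 have fK: "f x \<le> K * norm x" for x using onorm[OF f, of x] by (simp add: K_def)
 have lower: "- (K\<^sup>2 / 2) \<le> J x" for x
 proof -
  have "2 * norm x * K \<le> (norm x)\<^sup>2 + K\<^sup>2" by (rule sum_squares_bound)
  moreover have "f x \<le> norm x * K" using fK[of x] by (simp only: mult.commute)
  ultimately show ?thesis unfolding J_def by argo
 qed
 define d where "d = (INF x. J x)"
 have bdd: "bdd_below (range J)" using lower by (intro bdd_belowI) auto
 have dJ: "d \<le> J x" for x unfolding d_def by (rule cINF_lower[OF bdd]) simp
 have "\<exists>x. J x < d + inverse (real (Suc n))" for n
  using cINF_less_iff[OF _ bdd, of "d + inverse (real (Suc n))"] by (auto simp: d_def)
 then obtain x where x: "\<And>n. J (x n) < d + inverse (real (Suc n))" by metis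
 have gap: "(norm (y - z))\<^sup>2 \<le> 4 * (J y + J z - 2 * d)" for y z
 proof -
  have "(norm (y - z))\<^sup>2 + (norm (y + z))\<^sup>2 = 2 * (norm y)\<^sup>2 + 2 * (norm z)\<^sup>2"
   unfolding power2_norm_eq_inner by (simp only: inner_diff_left inner_diff_right inner_add_left inner_add_right)
  moreover have "J ((1/2) *\<^sub>R (y + z)) = (norm (y + z))\<^sup>2 / 8 - f y / 2 - f z / 2"
   by (simp add: J_def f.scaleR f.add power_divide add_divide_distrib)
  ultimately show ?thesis using dJ[of "(1/2) *\<^sub>R (y + z)"] unfolding J_def[of y] J_def[of z] by argo
 qed
 have "Cauchy x"
 proof (rule metric_CauchyI)
  fix e :: real assume e: "0 < e"
  then obtain N where N: "inverse (real (Suc N)) < e\<^sup>2 / 8" using reals_Archimedean[of "e\<^sup>2 / 8"] by auto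
  show "\<exists>M. \<forall>m\<ge>M. \<forall>n\<ge>M. dist (x m) (x n) < e"
  proof (intro exI[of _ N] allI impI)
   fix m n assume mn: "m \<ge> N" "n \<ge> N"
   have "J (x j) < d + e\<^sup>2 / 8" if "j \<ge> N" for j
   proof -
    have "inverse (real (Suc j)) \<le> inverse (real (Suc N))" using that by (intro le_imp_inverse_le) auto
    then show ?thesis using x[of j] N by linarith
   qed
   from this[OF mn(1)] this[OF mn(2)] gap[of "x m" "x n"] have "(norm (x m - x n))\<^sup>2 < e\<^sup>2" by argo
   then show "dist (x m) (x n) < e" using e by (simp add: dist_norm power_less_imp_less_base)
  qed
 qed
 then obtain z where z: "x \<longlonglongrightarrow> z" using Cauchy_convergent convergent_def by blast
 have lim: "(\<lambda>n. J (x n)) \<longlonglongrightarrow> J z" unfolding J_def by (intro tendsto_intros z f.tendsto) auto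
 have "(\<lambda>n. d + inverse (real (Suc n))) \<longlonglongrightarrow> d + 0" by (intro tendsto_intros LIMSEQ_inverse_real_of_nat)
 from LIMSEQ_le[OF lim this] have "J z \<le> d + 0" using x less_imp_le by blast
 then have "J z \<le> d" by simp
 then have min: "J z \<le> J y" for y using dJ[of y] by (rule order_trans)
 have "f y = y \<bullet> z" for y
 proof (rule ccontr)
  assume ne: "f y \<noteq> y \<bullet> z"
  define D where "D = f y - y \<bullet> z"
  define c where "c = (norm y)\<^sup>2 + 1"
  have c: "0 < c" by (simp add: c_def add_nonneg_pos)
  \<comment> \<open>the variation of \<open>J\<close> in direction \<open>t *\<^sub>R y\<close> is \<open>t\<^sup>2 * \<parallel>y\<parallel>\<^sup>2 / 2 - t * D\<close>, negative for \<open>t = D / c\<close>\<close>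
  define t where "t = D / c"
  have sq: "(norm (z + t *\<^sub>R y))\<^sup>2 = (norm z)\<^sup>2 + 2 * t * (y \<bullet> z) + t\<^sup>2 * (norm y)\<^sup>2"
   unfolding power2_norm_eq_inner by (simp add: inner_add_left inner_add_right inner_commute power2_eq_square)
  have "t * f y = t * (y \<bullet> z) + t * D" by (simp add: D_def right_diff_distrib)
  then have "J (z + t *\<^sub>R y) = J z + t\<^sup>2 * (norm y)\<^sup>2 / 2 - t * D"
   unfolding J_def sq f.add f.scaleR real_scaleR_def by argo
  then have "t * D \<le> t\<^sup>2 * (norm y)\<^sup>2 / 2" using min[of "z + t *\<^sub>R y"] by linarith
  also have "\<dots> \<le> t\<^sup>2 * c / 2" by (intro divide_right_mono mult_left_mono) (auto simp: c_def)
  also have "t\<^sup>2 * c = t * D" using c by (simp add: power2_eq_square t_def)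
  finally have "t * D \<le> 0" by linarith
  moreover have "0 < t * D" using ne c by (simp add: t_def D_def flip: power2_eq_square)
  ultimately show False by linarith
 qed
 then show ?thesis by blast
qed

lemma hilbert_adjoint:
 fixes B :: "'h::{real_inner, banach} \<Rightarrow> 'h"
 assumes B: "bounded_linear B"
 shows "B x \<bullet> y = x \<bullet> adjoint B y" "bounded_linear (adjoint B)"
proof -
 have "\<exists>z. \<forall>x. B x \<bullet> y = x \<bullet> z" for y
  by (rule riesz_representation) (rule bounded_linear_compose[OF bounded_linear_inner_left B])
 then have "\<exists>B'. \<forall>x y. B x \<bullet> y = x \<bullet> B' y" by metis
 then have ad: "\<forall>x y. B x \<bullet> y = x \<bullet> adjoint B y" unfolding adjoint_def by (rule someI_ex)
 then show "B x \<bullet> y = x \<bullet> adjoint B y" by blast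
 show "bounded_linear (adjoint B)"
 proof (rule bounded_linear_intro)
  show "adjoint B (y + z) = adjoint B y + adjoint B z" for y z
   by (rule vector_eq_ldot[THEN iffD1]) (simp add: inner_add_right flip: ad[rule_format])
  show "adjoint B (c *\<^sub>R y) = c *\<^sub>R adjoint B y" for c y
   by (rule vector_eq_ldot[THEN iffD1]) (simp flip: ad[rule_format])
  fix y
  have "norm (adjoint B y) * norm (adjoint B y) = B (adjoint B y) \<bullet> y"
   by (simp add: ad power2_norm_eq_inner flip: power2_eq_square)
  also have "\<dots> \<le> norm (B (adjoint B y)) * norm y" by (rule norm_cauchy_schwarz)
  also have "\<dots> \<le> (onorm B * norm (adjoint B y)) * norm y" by (intro mult_right_mono onorm[OF B]) simp
  finally have "norm (adjoint B y) * norm (adjoint B y) \<le> norm (adjoint B y) * (norm y * onorm B)"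
   by (simp add: ac_simps)
  then show "norm (adjoint B y) \<le> norm y * onorm B"
   using onorm_pos_le[OF B] by (cases "adjoint B y = 0") auto
 qed
qed

definition retract_factor :: "real \<Rightarrow> real \<Rightarrow> real" where
 "retract_factor r t = (if t \<le> r then 1 else r / t)"

lemma retract_factor_bounds:
 assumes "0 \<le> r" "0 \<le> t"
 shows "0 \<le> retract_factor r t" "retract_factor r t \<le> 1" "retract_factor r t * t \<le> r"
 using assms by (auto simp: retract_factor_def divide_le_eq)

text \<open>
In any normed space the constant is \<open>2\<close>: the factors differ by at most \<open>\<parallel>x - y\<parallel> / \<parallel>y\<parallel>\<close>.
\<close>

lemma radial_retraction_lipschitz:
 fixes x y :: "'h::real_normed_vector"
 assumes r: "0 < r"
 shows "norm (retract_factor r (norm x) *\<^sub>R x - retract_factor r (norm y) *\<^sub>R y) \<le> 2 * norm (x - y)"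
proof -
 let ?c = "\<lambda>x. retract_factor r (norm x)"
 have d: "\<bar>?c x - ?c y\<bar> * norm y \<le> \<bar>norm x - norm y\<bar>"
 proof (cases "norm x \<le> r")
  case True
  show ?thesis
  proof (cases "norm y \<le> r")
   case False
   then have "(1 - r / norm y) * norm y = norm y - r" "0 \<le> 1 - r / norm y" using r by (auto simp: left_diff_distrib divide_le_eq)
   then show ?thesis using True False by (auto simp: retract_factor_def)
  qed (use True in \<open>simp add: retract_factor_def\<close>)
 next
  case x: False
  show ?thesis
  proof (cases "norm y \<le> r")
   case True
   have c: "0 \<le> 1 - r / norm x" using x r by (auto simp: divide_le_eq)
   then have "\<bar>?c x - ?c y\<bar> * norm y = (1 - r / norm x) * norm y" using x True by (simp add: retract_factor_def)
   also have "\<dots> \<le> (1 - r / norm x) * norm x" using c x True by (intro mult_left_mono) auto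
   also have "\<dots> = norm x - r" using x r by (auto simp: left_diff_distrib)
   finally show ?thesis using True by simp
  next
   case False
   have xy: "0 < norm x" "0 < norm y" using x False r by linarith+
   have "(r / norm x - r / norm y) * norm y = (r / norm x) * (norm y - norm x)"
    using xy by (simp add: left_diff_distrib right_diff_distrib)
   from arg_cong[OF this, of abs] have "\<bar>r / norm x - r / norm y\<bar> * norm y = (r / norm x) * \<bar>norm y - norm x\<bar>"
    using xy r unfolding abs_mult by simp
   also have "\<dots> \<le> 1 * \<bar>norm y - norm x\<bar>" using x r xy by (intro mult_right_mono) (auto simp: divide_le_eq)
   finally show ?thesis using x False by (simp add: retract_factor_def)
  qed
 qed
 have "?c x *\<^sub>R x - ?c y *\<^sub>R y = ?c x *\<^sub>R (x - y) + (?c x - ?c y) *\<^sub>R y" by (simp add: algebra_simps)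
 then have "norm (?c x *\<^sub>R x - ?c y *\<^sub>R y) \<le> norm (?c x *\<^sub>R (x - y)) + norm ((?c x - ?c y) *\<^sub>R y)"
  by (metis norm_triangle_ineq)
 also have "\<dots> \<le> norm (x - y) + norm (x - y)"
 proof (rule add_mono)
  show "norm (?c x *\<^sub>R (x - y)) \<le> norm (x - y)"
   using retract_factor_bounds[of r "norm x"] r by (simp add: mult_left_le_one_le)
  show "norm ((?c x - ?c y) *\<^sub>R y) \<le> norm (x - y)"
   using d norm_triangle_ineq3[of x y] by simp
 qed
 finally show ?thesis by simp
qed

text \<open>The mean value theorem on the segment from \<open>0\<close> to \<open>u\<close>.\<close>

text \<open>The mean value theorem on the segment from \<open>0\<close> to \<open>u\<close>.\<close>

lemma gradient_bound_on_segment: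
 assumes grad: "gradient_on D \<psi> D\<psi> G" and D: "subspace D" and u: "u \<in> D" and zero: "\<psi> 0 = 0"
  and bound: "\<And>\<theta>. \<lbrakk>0 \<le> \<theta>; \<theta> \<le> 1\<rbrakk> \<Longrightarrow> norm (G (\<theta> *\<^sub>R u)) \<le> K"
 shows "\<bar>\<psi> u\<bar> \<le> K * norm u"
proof -
 have uD: "\<theta> *\<^sub>R u \<in> D" for \<theta> using D u by (rule subspace_scale)
 have gateaux: "\<forall>u\<in>D. \<forall>v\<in>D. ((\<lambda>h. (\<psi> (u + h *\<^sub>R v) - \<psi> u) / h) \<longlongrightarrow> D\<psi> u v) (at 0)"
  and riesz: "\<forall>u\<in>D. \<forall>v\<in>D. G u \<bullet> v = D\<psi> u v"
  using grad unfolding gradient_on_def gateaux_derivative_on_def by (blast, blast)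
 have der: "((\<lambda>\<theta>. \<psi> (\<theta> *\<^sub>R u)) has_real_derivative G (\<theta> *\<^sub>R u) \<bullet> u) (at \<theta>)" for \<theta>
 proof -
  have "((\<lambda>h. (\<psi> (\<theta> *\<^sub>R u + h *\<^sub>R u) - \<psi> (\<theta> *\<^sub>R u)) / h) \<longlongrightarrow> D\<psi> (\<theta> *\<^sub>R u) u) (at 0)"
   using gateaux uD u by simp
  moreover have "D\<psi> (\<theta> *\<^sub>R u) u = G (\<theta> *\<^sub>R u) \<bullet> u"
   using riesz uD u by simp
  ultimately show ?thesis by (simp add: DERIV_def scaleR_add_left)
 qed
 have "\<exists>\<theta>::real. 0 < \<theta> \<and> \<theta> < 1 \<and> \<psi> (1 *\<^sub>R u) - \<psi> (0 *\<^sub>R u) = (1 - 0) * (G (\<theta> *\<^sub>R u) \<bullet> u)"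
  by (rule MVT2[OF zero_less_one]) (rule der)
 then obtain \<theta> where \<theta>: "0 < \<theta>" "\<theta> < 1" "\<psi> (1 *\<^sub>R u) - \<psi> (0 *\<^sub>R u) = (1 - 0) * (G (\<theta> *\<^sub>R u) \<bullet> u)"
  by blast
 have "\<bar>\<psi> u\<bar> = \<bar>G (\<theta> *\<^sub>R u) \<bullet> u\<bar>" using \<theta>(3) zero by simp
 also have "\<dots> \<le> norm (G (\<theta> *\<^sub>R u)) * norm u" by (rule Cauchy_Schwarz_ineq2)
 also have "\<dots> \<le> K * norm u" using bound[of \<theta>] \<theta> by (intro mult_right_mono) auto
 finally show ?thesis .
qed

lemma kernel_antimono:
 fixes k k' :: "real \<Rightarrow> real"
 assumes der: "\<And>t. t \<ge> 0 \<Longrightarrow> (k has_real_derivative k' t) (at t within {0..})"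
  and nonpos: "\<And>t. t \<ge> 0 \<Longrightarrow> k' t \<le> 0" and st: "0 \<le> s" "s \<le> t"
 shows "k t \<le> k s"
proof (rule DERIV_nonpos_imp_decreasing_open[OF st(2)])
 show "\<exists>y. DERIV k x :> y \<and> y \<le> 0" if "s < x" "x < t" for x
 proof -
  have "x \<in> interior {0..}" using that st by simp
  then have "at x within {0..} = at x" by (rule at_within_interior)
  then have "DERIV k x :> k' x" "k' x \<le> 0" using der[of x] nonpos[of x] that st by auto
  then show ?thesis by blast
 qed
 show "continuous_on {s..t} k"
  by (rule continuous_on_subset[OF DERIV_continuous_on[of "{0..}" k k']]) (use der st in auto)
qed

text \<open>
If \<open>f\<close> is not integrable, its integral is \<open>0\<close> and the bound still holds.
\<close>

lemma set_integral_le_mult: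
 fixes f g :: "real \<Rightarrow> real"
 assumes g: "set_integrable lebesgue S g" and g0: "\<And>s. s \<in> S \<Longrightarrow> 0 \<le> g s" and K: "0 \<le> K"
  and le: "\<And>s. s \<in> S \<Longrightarrow> f s \<le> K * g s"
 shows "(LINT s:S|lebesgue. f s) \<le> K * (LINT s:S|lebesgue. g s)"
proof -
 have "(LINT s:S|lebesgue. f s) \<le> (LINT s:S|lebesgue. K * g s)"
  unfolding set_lebesgue_integral_def
 proof (rule integral_mono')
  have "set_integrable lebesgue S (\<lambda>s. K * g s)" using g by simp
  then show "integrable lebesgue (\<lambda>x. indicator S x *\<^sub>R (K * g x))" by (simp add: set_integrable_def)
 qed (use le g0 K in \<open>auto simp: indicator_def\<close>)
 then show ?thesis by simp
qed

section \<open>Truncation and uniqueness for the delayed wave equation\<close>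

locale delayed_wave = wave_memory +
 fixes B :: "'a \<Rightarrow> 'a" and \<tau> :: real and \<alpha> L :: "real \<Rightarrow> real" and G1 G2 :: "'a \<Rightarrow> 'a"
 assumes B: "bounded_linear B" and tau: "0 < \<tau>"
  and alpha_int: "\<And>T. \<alpha> absolutely_integrable_on {0..T}"
  and L_pos: "\<And>r. 0 < r \<Longrightarrow> 0 < L r"
  and G1_lipschitz: "\<And>r u v. \<lbrakk>0 < r; u \<in> DR; v \<in> DR; norm (R u) \<le> r; norm (R v) \<le> r\<rbrakk>
    \<Longrightarrow> norm (G1 u - G1 v) \<le> L r * norm (R (u - v))"
  and G2_lipschitz: "\<And>r u v. \<lbrakk>0 < r; u \<in> DR; v \<in> DR; norm (R u) \<le> r; norm (R v) \<le> r\<rbrakk>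
    \<Longrightarrow> norm (G2 u - G2 v) \<le> L r * norm (R (u - v))"
  and G1_0: "G1 0 = 0" and G2_0: "G2 0 = 0"
begin

sublocale D: delayed_semigroup X "energy_inner R k" E S M \<omega> \<tau> \<alpha>
 by unfold_locales (auto intro: tau alpha_int)

text \<open>
The norm of the position in the energy space is \<open>c * \<parallel>R u\<parallel>\<close>.
\<close>

definition c where "c = sqrt (1 - kernel_mass k)"
definition b where "b = onorm (B \<circ> adjoint B)"

lemma c_pos: "0 < c" using k_mass by (simp add: c_def)

lemma BB_bounded: "bounded_linear (B \<circ> adjoint B)"
 unfolding o_def by (rule bounded_linear_compose[OF B hilbert_adjoint(2)[OF B]])

lemma b_nonneg: "0 \<le> b" unfolding b_def by (rule onorm_pos_le[OF BB_bounded])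

lemma velocity_state: "(0, z, 0) \<in> X" "E (0, z, 0) = norm z"
proof -
 show *: "(0, z, 0) \<in> X" using DR_zero W.L2_zero by (simp add: energy_space_iff zero_fun_def)
 have "W.L2_norm 0 = 0"
 proof -
  have "(0::'a, 0::'a, 0::real \<Rightarrow> 'a) \<in> X" using DR_zero W.L2_zero by (simp add: energy_space_iff zero_fun_def)
  moreover have "E (0::'a, 0::'a, 0::real \<Rightarrow> 'a) = 0" using H.p_zero by (simp add: zero_prod_def)
  ultimately show ?thesis using component_bounds(3)[of 0 0 0] W.L2_norm_nonneg[of 0] W.L2_zero
   by (simp add: zero_fun_def)
 qed
 then have "(E (0, z, 0))\<^sup>2 = (norm z)\<^sup>2" using energy_norm_square[OF *] R_zero by simp
 then show "E (0, z, 0) = norm z" using H.p_nonneg[OF *] by (simp add: power2_eq_iff_nonneg)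
qed

lemma state_bounds:
 assumes U: "U \<in> X"
 shows "fst U \<in> DR" "norm (R (fst U)) \<le> E U / c" "norm (fst (snd U)) \<le> E U"
proof -
 obtain u v w where eq: "U = (u, v, w)" by (rule prod_cases3)
 show "fst U \<in> DR" using U by (simp add: eq energy_space_iff)
 have X: "(u, v, w) \<in> X" using U by (simp add: eq)
 show "norm (R (fst U)) \<le> E U / c"
  using component_bounds(1)[OF X] c_pos by (simp add: eq c_def pos_le_divide_eq mult.commute)
 show "norm (fst (snd U)) \<le> E U" using component_bounds(2)[OF X] by (simp add: eq)
qed

lemma delay_op_eq: "delay_op B U = (0, - (B \<circ> adjoint B) (fst (snd U)), 0)"
 by (simp add: delay_op_def case_prod_beta)

lemma delay_op_X: "delay_op B U \<in> X"
 unfolding delay_op_eq by (rule velocity_state(1))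

lemma delay_op_lipschitz:
 assumes U: "U \<in> X" and V: "V \<in> X"
 shows "E (delay_op B U - delay_op B V) \<le> b * E (U - V)"
proof -
 interpret BB: bounded_linear "B \<circ> adjoint B" by (rule BB_bounded)
 have "delay_op B U - delay_op B V = (0, - (B \<circ> adjoint B) (fst (snd (U - V))), 0)"
  unfolding delay_op_eq by (simp only: snd_diff fst_diff BB.diff) simp
 then have "E (delay_op B U - delay_op B V) = norm ((B \<circ> adjoint B) (fst (snd (U - V))))"
  using velocity_state(2) by (simp only: norm_minus_cancel)
 also have "\<dots> \<le> b * norm (fst (snd (U - V)))" unfolding b_def by (rule onorm[OF BB_bounded])
 also have "\<dots> \<le> b * E (U - V)" by (rule mult_left_mono[OF state_bounds(3)[OF H.X_diff[OF U V]] b_nonneg])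
 finally show ?thesis .
qed

lemma source_X: "source_term g1 g2 U V \<in> X"
 unfolding source_term_def by (rule velocity_state(1))

lemma source_norm: "E (source_term g1 g2 U V) = norm (g1 (fst U) + g2 (fst V))"
 unfolding source_term_def by (rule velocity_state(2))

lemma source_lipschitz:
 assumes g1: "\<And>u v. \<lbrakk>u \<in> DR; v \<in> DR\<rbrakk> \<Longrightarrow> norm (g1 u - g1 v) \<le> K * norm (R (u - v))"
  and g2: "\<And>u v. \<lbrakk>u \<in> DR; v \<in> DR\<rbrakk> \<Longrightarrow> norm (g2 u - g2 v) \<le> K * norm (R (u - v))"
  and K: "0 \<le> K" and X: "U \<in> X" "V \<in> X" "U' \<in> X" "V' \<in> X"
 shows "E (source_term g1 g2 U V - source_term g1 g2 U' V') \<le> K / c * (E (U - U') + E (V - V'))"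
proof -
 have eq: "source_term g1 g2 U V - source_term g1 g2 U' V' =
   (0, (g1 (fst U) - g1 (fst U')) + (g2 (fst V) - g2 (fst V')), 0)"
  by (simp add: source_term_def)
 have le: "norm (g u - g v) \<le> K / c * E (W - W')" if "W \<in> X" "W' \<in> X" "u = fst W" "v = fst W'"
   "norm (g u - g v) \<le> K * norm (R (u - v))" for g :: "'a \<Rightarrow> 'a" and u v W W'
 proof -
  have "norm (R (u - v)) \<le> E (W - W') / c" using state_bounds(2)[OF H.X_diff[OF that(1,2)]] that by simp
  then have "K * norm (R (u - v)) \<le> K * (E (W - W') / c)" using K by (rule mult_left_mono)
  then show ?thesis using that(5) by simp
 qed
 have "E (source_term g1 g2 U V - source_term g1 g2 U' V')
   \<le> norm (g1 (fst U) - g1 (fst U')) + norm (g2 (fst V) - g2 (fst V'))"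
  unfolding eq velocity_state(2) by (rule norm_triangle_ineq)
 also have "\<dots> \<le> K / c * E (U - U') + K / c * E (V - V')"
  by (intro add_mono le g1 g2 refl state_bounds(1) X)
 finally show ?thesis by (simp only: distrib_left)
qed

text \<open>
The radial retraction of \<open>D(R)\<close>, normed by \<open>\<parallel>R u\<parallel>\<close>, onto the ball of radius \<open>r\<close>.
\<close>

definition cut :: "real \<Rightarrow> 'a \<Rightarrow> 'a" where
 "cut r u = retract_factor r (norm (R u)) *\<^sub>R u"

lemma cut:
 assumes r: "0 < r" and u: "u \<in> DR"
 shows "cut r u \<in> DR" "norm (R (cut r u)) \<le> r" "norm (R (cut r u)) \<le> norm (R u)"
  "norm (R u) \<le> r \<Longrightarrow> cut r u = u"
proof -
 note f = retract_factor_bounds[of r "norm (R u)"]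
 show "cut r u \<in> DR" unfolding cut_def by (rule subspace_scale[OF DR_subspace u])
 have eq: "norm (R (cut r u)) = retract_factor r (norm (R u)) * norm (R u)"
  unfolding cut_def R_scaleR[OF u] norm_scaleR using f r by simp
 show "norm (R (cut r u)) \<le> r" unfolding eq using f r by simp
 show "norm (R (cut r u)) \<le> norm (R u)" unfolding eq using f r by (simp add: mult_left_le_one_le)
 show "norm (R u) \<le> r \<Longrightarrow> cut r u = u" by (simp add: cut_def retract_factor_def)
qed

lemma cut_lipschitz:
 assumes r: "0 < r" and u: "u \<in> DR" and v: "v \<in> DR"
 shows "norm (R (cut r u - cut r v)) \<le> 2 * norm (R (u - v))"
proof -
 have "R (cut r u - cut r v) =
   retract_factor r (norm (R u)) *\<^sub>R R u - retract_factor r (norm (R v)) *\<^sub>R R v"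
  by (simp only: R_diff[OF cut(1)[OF r u] cut(1)[OF r v]]) (simp only: cut_def R_scaleR[OF u] R_scaleR[OF v])
 then show ?thesis using radial_retraction_lipschitz[OF r, of "R u" "R v"] by (simp only: R_diff[OF u v])
qed

text \<open>
Besides the global Lipschitz constant, the bound \<open>L r * \<parallel>R u\<parallel>\<close> is recorded: it governs the decay rate
and is better than the one that follows from the Lipschitz constant.
\<close>

lemma cut_nonlinearity:
 assumes r: "0 < r"
  and G: "\<And>u v. \<lbrakk>u \<in> DR; v \<in> DR; norm (R u) \<le> r; norm (R v) \<le> r\<rbrakk> \<Longrightarrow> norm (G u - G v) \<le> L r * norm (R (u - v))"
  and G0: "G 0 = 0"
 shows "\<lbrakk>u \<in> DR; v \<in> DR\<rbrakk> \<Longrightarrow> norm (G (cut r u) - G (cut r v)) \<le> (2 * L r) * norm (R (u - v))"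
  "u \<in> DR \<Longrightarrow> norm (G (cut r u)) \<le> L r * norm (R u)"
proof -
 note Lr = L_pos[OF r]
 show "norm (G (cut r u) - G (cut r v)) \<le> (2 * L r) * norm (R (u - v))" if uv: "u \<in> DR" "v \<in> DR"
 proof -
  have "norm (G (cut r u) - G (cut r v)) \<le> L r * norm (R (cut r u - cut r v))"
   by (intro G cut r uv)
  also have "\<dots> \<le> L r * (2 * norm (R (u - v)))" using Lr by (intro mult_left_mono cut_lipschitz r uv) simp
  finally show ?thesis by (simp only: mult.assoc mult.left_commute)
 qed
 show "norm (G (cut r u)) \<le> L r * norm (R u)" if u: "u \<in> DR"
 proof -
  have "norm (G (cut r u) - G 0) \<le> L r * norm (R (cut r u - 0))"
   using r R_zero by (intro G cut r u DR_zero) auto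
  also have "\<dots> \<le> L r * norm (R u)" using Lr cut(3)[OF r u] by (intro mult_left_mono) auto
  finally show ?thesis using G0 by simp
 qed
qed

abbreviation G1r where "G1r r \<equiv> \<lambda>u. G1 (cut r u)"
abbreviation G2r where "G2r r \<equiv> \<lambda>u. G2 (cut r u)"

lemmas G1r = cut_nonlinearity[OF _ G1_lipschitz G1_0]
lemmas G2r = cut_nonlinearity[OF _ G2_lipschitz G2_0]

lemma truncated_problem:
 assumes r: "0 < r" and \<Phi>: "continuous_on_in X E {-\<tau>..0} \<Phi>"
 shows "delayed_problem X (energy_inner R k) E S M \<omega> \<tau> \<alpha> (delay_op B)
  (source_term (G1r r) (G2r r)) b (2 * L r / c) \<Phi>"
proof unfold_locales
 show "0 \<le> 2 * L r / c" using L_pos[OF r] c_pos by simp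
 show "E (source_term (G1r r) (G2r r) U V - source_term (G1r r) (G2r r) U' V')
   \<le> 2 * L r / c * (E (U - U') + E (V - V'))" if "U \<in> X" "V \<in> X" "U' \<in> X" "V' \<in> X" for U V U' V'
  using L_pos[OF r] that by (intro source_lipschitz G1r(1) G2r(1)) (auto simp: r)
qed (auto intro: b_nonneg delay_op_X delay_op_lipschitz source_X \<Phi>)

lemma is_global_solution_iff:
 "is_global_solution DR R k S \<tau> \<alpha> B g1 g2 f0 g0 u \<longleftrightarrow>
  (\<forall>t\<le>0. u t = f0 t) \<and> (\<forall>t>0. u differentiable (at t)) \<and>
  continuous_on_in X E {-\<tau>..} (state_of f0 g0 u) \<and>
  D.mild_solution (\<lambda>s. delay_op B (state_of f0 g0 u (s - \<tau>)))
   (\<lambda>s. source_term g1 g2 (state_of f0 g0 u s) (state_of f0 g0 u (s - \<tau>))) (state_of f0 g0 u)"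
 unfolding is_global_solution_def D.mild_solution_def Let_def ..

lemma state_of_components:
 assumes "\<And>t. t \<le> 0 \<Longrightarrow> u t = f0 t"
 shows "fst (state_of f0 g0 u t) = u t" "fst (snd (state_of f0 g0 u t)) = velocity g0 u t"
 using assms by (auto simp: state_of_def initial_state_def velocity_def)

text \<open>
The truncation is invisible in the ball of radius \<open>r * c\<close> of the energy space.
\<close>

lemma source_cut_eq:
 assumes r: "0 < r" and X: "U \<in> X" "V \<in> X" and le: "E U \<le> r * c" "E V \<le> r * c"
 shows "source_term (G1r r) (G2r r) U V = source_term G1 G2 U V"
proof -
 have "cut r (fst W) = fst W" if "W \<in> X" "E W \<le> r * c" for W
 proof (rule cut(4)[OF r state_bounds(1)[OF that(1)]])
  have "E W / c \<le> r" using that(2) c_pos by (simp add: pos_divide_le_eq)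
  then show "norm (R (fst W)) \<le> r" using state_bounds(2)[OF that(1)] by (rule order_trans[rotated])
 qed
 then show ?thesis using X le by (simp add: source_term_def)
qed

text \<open>
Both solutions are bounded on \<open>{-\<tau>..t}\<close>. Truncating at a radius beyond this bound changes neither of
them there, and the truncated equation has a global Lipschitz constant.
\<close>

theorem global_solution_unique:
 assumes u: "is_global_solution DR R k S \<tau> \<alpha> B G1 G2 f0 g0 u"
  and u': "is_global_solution DR R k S \<tau> \<alpha> B G1 G2 f0 g0 u'"
 shows "u = u'"
proof
 fix t
 define V V' where "V = state_of f0 g0 u" and "V' = state_of f0 g0 u'"
 note uD = u[unfolded is_global_solution_iff, folded V_def]
 note uD' = u'[unfolded is_global_solution_iff, folded V'_def]
 show "u t = u' t"
 proof (cases "t \<le> 0")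
  case True
  then show ?thesis using uD uD' by simp
 next
  case False
  have cV: "continuous_on_in X E {-\<tau>..} V" and cV': "continuous_on_in X E {-\<tau>..} V'" using uD uD' by blast+
  have VX: "V s \<in> X" "V' s \<in> X" if "- \<tau> \<le> s" for s
   using H.cont_inD(1)[OF cV, of s] H.cont_inD(1)[OF cV', of s] that by auto
  have sub: "{- \<tau>..t} \<subseteq> {-\<tau>..}" "{-\<tau>..0} \<subseteq> {-\<tau>..}" "{0..t} \<subseteq> {0..}" by auto
  obtain P where P: "0 \<le> P" "\<forall>s\<in>{-\<tau>..t}. E (V s) \<le> P"
   using H.cont_in_bounded[OF H.cont_in_subset[OF cV sub(1)]] by blast
  obtain P' where P': "0 \<le> P'" "\<forall>s\<in>{-\<tau>..t}. E (V' s) \<le> P'"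
   using H.cont_in_bounded[OF H.cont_in_subset[OF cV' sub(1)]] by blast
  \<comment> \<open>large enough for the truncation to be the identity on both solutions\<close>
  define r where "r = (P + P' + 1) / c"
  have r: "0 < r" "r * c = P + P' + 1" unfolding r_def using c_pos P P' by auto
  have src: "source_term (G1r r) (G2r r) (V s) (V (s - \<tau>)) = source_term G1 G2 (V s) (V (s - \<tau>))"
   "source_term (G1r r) (G2r r) (V' s) (V' (s - \<tau>)) = source_term G1 G2 (V' s) (V' (s - \<tau>))"
   if "s \<in> {0..t}" for s
  proof -
   have s: "s \<in> {-\<tau>..t}" "s - \<tau> \<in> {-\<tau>..t}" "- \<tau> \<le> s" "- \<tau> \<le> s - \<tau>" using that tau by auto
   have "E (V s) \<le> r * c" "E (V (s - \<tau>)) \<le> r * c" "E (V' s) \<le> r * c" "E (V' (s - \<tau>)) \<le> r * c"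
    unfolding r(2) using bspec[OF P(2) s(1)] bspec[OF P(2) s(2)] bspec[OF P'(2) s(1)] bspec[OF P'(2) s(2)] P(1) P'(1)
    by linarith+
   then show "source_term (G1r r) (G2r r) (V s) (V (s - \<tau>)) = source_term G1 G2 (V s) (V (s - \<tau>))"
    "source_term (G1r r) (G2r r) (V' s) (V' (s - \<tau>)) = source_term G1 G2 (V' s) (V' (s - \<tau>))"
    using VX s by (intro source_cut_eq r(1); simp)+
  qed
  interpret P: delayed_problem X "energy_inner R k" E S M \<omega> \<tau> \<alpha> "delay_op B"
   "source_term (G1r r) (G2r r)" b "2 * L r / c" V
   by (rule truncated_problem[OF r(1) H.cont_in_subset[OF cV sub(2)]])
  have cy: "continuous_on_in X E {0..t} (\<lambda>s. source_term G1 G2 (W s) (W (s - \<tau>)))"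
   if cW: "continuous_on_in X E {-\<tau>..} W"
    and eq: "\<And>s. s \<in> {0..t} \<Longrightarrow> source_term (G1r r) (G2r r) (W s) (W (s - \<tau>)) = source_term G1 G2 (W s) (W (s - \<tau>))" for W
   by (rule H.cont_in_cong[OF H.cont_in_subset[OF P.terms_cont(2)[OF cW] sub(3)]])
    (use source_X eq H.p_zero in auto)
  have "E (V t - V' t) = 0"
  proof (rule D.mild_difference_vanishes[of t b "2 * L r / c" V V',
     OF _ b_nonneg P.K0 H.cont_in_subset[OF cV sub(1)] H.cont_in_subset[OF cV' sub(1)] _ _ _
     H.cont_in_subset[OF P.terms_cont(1)[OF cV] sub(3)] cy[OF cV src(1)]
     H.cont_in_subset[OF P.terms_cont(1)[OF cV'] sub(3)] cy[OF cV' src(2)]])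
   show "E (V s - V' s) = 0" if "s \<in> {-\<tau>..0}" for s
    using that by (simp add: V_def V'_def state_of_def H.p_zero)
   show "D.mild_solution (\<lambda>s. delay_op B (V (s - \<tau>))) (\<lambda>s. source_term G1 G2 (V s) (V (s - \<tau>))) V"
    "D.mild_solution (\<lambda>s. delay_op B (V' (s - \<tau>))) (\<lambda>s. source_term G1 G2 (V' s) (V' (s - \<tau>))) V'"
    using uD uD' by blast+
   fix s assume s: "s \<in> {0..t}"
   then have X: "V s \<in> X" "V (s - \<tau>) \<in> X" "V' s \<in> X" "V' (s - \<tau>) \<in> X" using VX tau by auto
   show "E (delay_op B (V (s - \<tau>)) - delay_op B (V' (s - \<tau>))) \<le> b * E (V (s - \<tau>) - V' (s - \<tau>))"
    by (intro delay_op_lipschitz X)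
   show "E (source_term G1 G2 (V s) (V (s - \<tau>)) - source_term G1 G2 (V' s) (V' (s - \<tau>)))
     \<le> 2 * L r / c * (E (V s - V' s) + E (V (s - \<tau>) - V' (s - \<tau>)))"
    using P.F_lipschitz[OF X] by (simp only: src[OF s])
  qed (use False in simp)
  then have "norm (R (u t - u' t)) \<le> 0"
   using state_bounds(2)[OF H.X_diff[OF VX], of t t] False tau uD uD'
   by (simp add: V_def V'_def state_of_components)
  moreover have "u t \<in> DR" "u' t \<in> DR"
   using state_bounds(1)[OF VX(1), of t] state_bounds(1)[OF VX(2), of t] False tau uD uD'
   by (simp_all add: V_def V'_def state_of_components)
  then have "u t - u' t \<in> DR" by (rule subspace_diff[OF DR_subspace])
  ultimately have "norm (u t - u' t) \<le> 0" using R_bounded_below by force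
  then show ?thesis by simp
 qed
qed

end

section \<open>Existence and decay for small data\<close>

lemma (in semi_hilbert) bochner_cong_value:
 assumes f: "has_bochner_integral_in X p M f I" and J: "J \<in> X" "p (I - J) = 0"
 shows "has_bochner_integral_in X p M f J"
proof (rule bochner_cong[OF f _ J])
 have "AE x in M. f x \<in> X" using f unfolding has_bochner_integral_in_def strongly_measurable_in_def by blast
 then show "AE x in M. f x \<in> X \<and> p (f x - f x) = 0" by (rule eventually_mono) simp
qed

context delayed_wave
begin

text \<open>
The first component of the abstract solution, extended by \<open>f0\<close>, is the solution: by
\<open>mild_solution_structure\<close> its state differs from the abstract one by a null vector only, and the
forcing depends on position and velocity alone, which are equal.
\<close>

theorem truncated_solution_exists:
 assumes r: "0 < r" and init: "continuous_on_in X E {-\<tau>..0} (initial_state f0 g0)"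
 shows "\<exists>u. is_global_solution DR R k S \<tau> \<alpha> B (G1r r) (G2r r) f0 g0 u"
proof -
 let ?F = "source_term (G1r r) (G2r r)"
 interpret P: delayed_problem X "energy_inner R k" E S M \<omega> \<tau> \<alpha> "delay_op B" ?F b "2 * L r / c" "initial_state f0 g0"
  by (rule truncated_problem[OF r init])
 obtain U where cU: "continuous_on_in X E {-\<tau>..} U" and U0: "\<forall>s\<le>0. U s = initial_state f0 g0 s"
  and mild: "D.mild_solution (\<lambda>s. delay_op B (U (s - \<tau>))) (\<lambda>s. ?F (U s) (U (s - \<tau>))) U"
  using P.mild_solution_exists by (elim exE conjE) (rule that)
 have cU0: "continuous_on_in X E {0..} U" by (rule H.cont_in_subset[OF cU]) (use tau in auto)
 interpret m: memory_mild A R DA DR k S M \<omega> \<alpha> "\<lambda>s. delay_op B (U (s - \<tau>))" "\<lambda>s. ?F (U s) (U (s - \<tau>))" U f0 "g0 0"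
 proof unfold_locales
  show "continuous_on_in X E {0..} (\<lambda>s. delay_op B (U (s - \<tau>)))" by (rule P.terms_cont(1)[OF cU])
  show "continuous_on_in X E {0..} (\<lambda>s. ?F (U s) (U (s - \<tau>)))" by (rule P.terms_cont(2)[OF cU])
  show "fst (delay_op B (U (s - \<tau>))) = 0 \<and> snd (snd (delay_op B (U (s - \<tau>)))) = 0" for s
   by (simp add: delay_op_eq)
  show "fst (?F (U s) (U (s - \<tau>))) = 0 \<and> snd (snd (?F (U s) (U (s - \<tau>)))) = 0" for s
   by (simp add: source_term_def)
  show "U 0 = (f0 0, g0 0, history f0 0)" using U0 by (simp add: initial_state_def)
  show "has_bochner_integral_in X E (lebesgue_on {0..t})
    (\<lambda>s. S (t - s) (\<alpha> s *\<^sub>R delay_op B (U (s - \<tau>)) + ?F (U s) (U (s - \<tau>)))) (U t - S t (U 0))" if "0 \<le> t" for t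
   using mild that unfolding D.mild_solution_def by blast
 qed (rule alpha_int cU0)+
 let ?u = m.full
 define V where "V = state_of f0 g0 ?u"
 have der: "(?u has_vector_derivative m.v t) (at t)" if t: "0 < t" for t
  by (rule has_vector_derivative_transform_within_open[OF m.u_derivative[OF t], of "{0<..}"])
   (use t m.full_nonneg in auto)
 have V_neg: "V t = U t" if "t \<le> 0" for t using U0 that by (simp add: V_def state_of_def)
 have V_pos: "V t = (m.u t, m.v t, history ?u t)" if "0 < t" for t
  using that vector_derivative_at[OF der[OF that]] m.full_nonneg[of t] by (simp add: V_def state_of_def velocity_def)
 have VX: "V t \<in> X" and null: "E (U t - V t) = 0" if "-\<tau> \<le> t" for t
  using m.mild_solution_structure[of t] V_pos[of t] V_neg[of t] H.cont_inD(1)[OF cU, of t] that H.p_zero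
  by (cases "t \<le> 0"; simp)+
 have comp: "fst (U t) = fst (V t)" "fst (snd (U t)) = fst (snd (V t))" for t
  using V_pos[of t] V_neg[of t] m.U_eq[of t] by (cases "t \<le> 0"; simp)+
 have same: "delay_op B (U s) = delay_op B (V s)" "?F (U s) (U s') = ?F (V s) (V s')" for s s'
  using comp by (simp_all add: delay_op_eq source_term_def)
 have "is_global_solution DR R k S \<tau> \<alpha> B (G1r r) (G2r r) f0 g0 ?u"
  unfolding is_global_solution_iff V_def[symmetric]
 proof (intro conjI allI impI)
  show "?u t = f0 t" if "t \<le> 0" for t using that by (simp add: m.full_def)
  show "?u differentiable (at t)" if "0 < t" for t
   using der[OF that] unfolding has_vector_derivative_def by (rule differentiableI)
  show "continuous_on_in X E {-\<tau>..} V" by (rule H.cont_in_cong[OF cU]) (use VX null in auto)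
  show "D.mild_solution (\<lambda>s. delay_op B (V (s - \<tau>))) (\<lambda>s. ?F (V s) (V (s - \<tau>))) V"
   unfolding D.mild_solution_def same[symmetric]
  proof (intro allI impI)
   fix t :: real assume t: "0 \<le> t"
   then have t': "- \<tau> \<le> t" "- \<tau> \<le> 0" using tau by auto
   have UX: "U t \<in> X" "U 0 \<in> X" using H.cont_inD(1)[OF cU] t' by auto
   then have SX: "S t (U 0) \<in> X" by (intro H.S_X t)
   show "has_bochner_integral_in X E (lebesgue_on {0..t})
     (\<lambda>s. S (t - s) (\<alpha> s *\<^sub>R delay_op B (U (s - \<tau>)) + ?F (U s) (U (s - \<tau>)))) (V t - S t (V 0))"
   proof (rule H.bochner_cong_value)
    show "has_bochner_integral_in X E (lebesgue_on {0..t})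
     (\<lambda>s. S (t - s) (\<alpha> s *\<^sub>R delay_op B (U (s - \<tau>)) + ?F (U s) (U (s - \<tau>)))) (U t - S t (U 0))"
     using mild t unfolding D.mild_solution_def by blast
    show "V t - S t (V 0) \<in> X" unfolding V_neg[OF order_refl] by (intro H.X_diff VX t' SX)
    have "U t - S t (U 0) - (V t - S t (V 0)) = U t - V t" unfolding V_neg[OF order_refl] by simp
    then show "E (U t - S t (U 0) - (V t - S t (V 0))) = 0" using null[OF t'(1)] by simp
   qed
  qed
 qed
 then show ?thesis by blast
qed

text \<open>
 As long as the state stays in the ball of radius \<open>r * c\<close> the truncation is invisible.  The
 nonlinearity then acts with the small constant \<open>L r / c\<close>, so that it costs at most half of the
 decay rate; a small initial state never leaves the ball.
\<close>

lemma small_solution: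
 assumes r: "0 < r" and rate: "M * (exp (\<omega> * \<tau>) + 1) * (L r / c) \<le> (\<omega> - \<omega>') / 2"
  and alpha_tau: "integral {0..\<tau>} (\<lambda>s. \<bar>\<alpha> s\<bar>) \<le> \<sigma>"
  and growth: "\<And>t. t > 0 \<Longrightarrow> M * b * exp (\<omega> * \<tau>) * integral {0..t} (\<lambda>s. \<bar>\<alpha> (s + \<tau>)\<bar>) \<le> \<gamma> + \<omega>' * t"
  and gamma: "0 \<le> \<gamma>" and omega': "\<omega>' < \<omega>" and \<rho>: "0 \<le> \<rho>"
  and K: "K = 1 + (M + M * exp (\<omega> * \<tau>) * (b * \<sigma> + L r / c * \<tau>)) * exp \<gamma>"
  and small: "\<rho> * K \<le> r * c"
  and init: "continuous_on_in X E {-\<tau>..0} (initial_state f0 g0)"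
  and init_le: "\<And>s. s \<in> {-\<tau>..0} \<Longrightarrow> E (initial_state f0 g0 s) \<le> \<rho>"
 shows "\<exists>u. is_global_solution DR R k S \<tau> \<alpha> B G1 G2 f0 g0 u \<and>
  (\<forall>t\<ge>-\<tau>. E (state_of f0 g0 u t) \<le> \<rho> * K * exp (- ((\<omega> - \<omega>') / 2) * t) \<and> E (state_of f0 g0 u t) \<le> r * c)"
proof -
 let ?F = "source_term (G1r r) (G2r r)" and ?d = "(\<omega> - \<omega>') / 2"
 obtain u where u: "is_global_solution DR R k S \<tau> \<alpha> B (G1r r) (G2r r) f0 g0 u"
  using truncated_solution_exists[OF r init] by blast
 define V where "V = state_of f0 g0 u"
 note uD = u[unfolded is_global_solution_iff, folded V_def]
 have cV: "continuous_on_in X E {-\<tau>..} V" using uD by blast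
 have VX: "V s \<in> X" if "- \<tau> \<le> s" for s using H.cont_inD(1)[OF cV, of s] that by auto
 interpret P: delayed_problem X "energy_inner R k" E S M \<omega> \<tau> \<alpha> "delay_op B" ?F b "2 * L r / c" "initial_state f0 g0"
  by (rule truncated_problem[OF r init])
 have l0: "0 \<le> L r / c" using L_pos[OF r] c_pos by simp
 have "0 \<le> integral {0..\<tau>} (\<lambda>s. \<bar>\<alpha> s\<bar>)" by (rule hk_integral_nonneg)
   (use set_integrable_abs[OF alpha_int] in \<open>auto simp: absolutely_integrable_on_def\<close>)
 then have sigma: "0 \<le> \<sigma>" using alpha_tau by linarith
 define K1 where "K1 = (M + M * exp (\<omega> * \<tau>) * (b * \<sigma> + L r / c * \<tau>)) * exp \<gamma>"
 have K1: "0 \<le> K1" "K = 1 + K1" unfolding K1_def K using M b_nonneg sigma l0 tau L_pos[OF r] c_pos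
  by (auto intro!: mult_nonneg_nonneg add_nonneg_nonneg)
 have V_init: "E (V s) \<le> \<rho>" if "s \<in> {-\<tau>..0}" for s using init_le[OF that] that by (simp add: V_def state_of_def)
 have decay: "E (V t) \<le> \<rho> * K1 * exp (- ?d * t)" if t: "0 \<le> t" for t
 proof -
  have "E (V t) \<le> \<rho> * (M + M * exp (\<omega> * \<tau>) * (b * \<sigma> + L r / c * \<tau>)) * exp \<gamma>
   * exp (- (\<omega> - \<omega>' - M * (exp (\<omega> * \<tau>) + 1) * (L r / c)) * t)"
  proof (rule D.mild_decay[OF b_nonneg l0 \<rho> cV V_init _ P.terms_cont(1)[OF cV] P.terms_cont(2)[OF cV]
     _ _ alpha_tau growth gamma t])
   show "D.mild_solution (\<lambda>s. delay_op B (V (s - \<tau>))) (\<lambda>s. ?F (V s) (V (s - \<tau>))) V" using uD by blast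
   fix s :: real assume s: "0 \<le> s"
   then have X: "V s \<in> X" "V (s - \<tau>) \<in> X" using VX tau by auto
   have "delay_op B 0 = 0" using bounded_linear.linear[OF BB_bounded] linear_0
    by (simp only: delay_op_eq fst_zero snd_zero) (simp add: zero_prod_def linear_0 del: o_apply)
   then show "E (delay_op B (V (s - \<tau>))) \<le> b * E (V (s - \<tau>))"
    using delay_op_lipschitz[OF X(2) H.X_zero] by simp
   have le: "norm (g (fst W)) \<le> L r / c * E W" if "W \<in> X" "norm (g (fst W)) \<le> L r * norm (R (fst W))" for g :: "'a \<Rightarrow> 'a" and W
   proof -
    have "L r * norm (R (fst W)) \<le> L r * (E W / c)"
     using L_pos[OF r] state_bounds(2)[OF that(1)] by (intro mult_left_mono) auto
    then show ?thesis using that(2) by simp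
   qed
   have "E (?F (V s) (V (s - \<tau>))) \<le> norm (G1r r (fst (V s))) + norm (G2r r (fst (V (s - \<tau>))))"
    unfolding source_norm by (rule norm_triangle_ineq)
   also have "\<dots> \<le> L r / c * E (V s) + L r / c * E (V (s - \<tau>))"
    using X by (intro add_mono le G1r(2) G2r(2) r state_bounds(1))
   finally show "E (?F (V s) (V (s - \<tau>))) \<le> L r / c * (E (V s) + E (V (s - \<tau>)))" by (simp only: distrib_left)
  qed
  also have "\<dots> = \<rho> * K1 * exp (- (\<omega> - \<omega>' - M * (exp (\<omega> * \<tau>) + 1) * (L r / c)) * t)"
   by (simp only: K1_def mult.assoc)
  also have "\<dots> \<le> \<rho> * K1 * exp (- ?d * t)"
  proof (rule mult_left_mono)
   have "?d * t \<le> (\<omega> - \<omega>' - M * (exp (\<omega> * \<tau>) + 1) * (L r / c)) * t"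
    using rate t by (intro mult_right_mono) auto
   then show "exp (- (\<omega> - \<omega>' - M * (exp (\<omega> * \<tau>) + 1) * (L r / c)) * t) \<le> exp (- ?d * t)"
    by (simp only: exp_le_cancel_iff mult_minus_left neg_le_iff_le)
   show "0 \<le> \<rho> * K1" using \<rho> K1 by simp
  qed
  finally show ?thesis .
 qed
 have bounds: "E (V t) \<le> \<rho> * K * exp (- ?d * t)" "E (V t) \<le> \<rho> * K" if t: "- \<tau> \<le> t" for t
 proof -
  have d: "0 \<le> ?d" using omega' by simp
  have "E (V t) \<le> \<rho> * K * exp (- ?d * t) \<and> E (V t) \<le> \<rho> * K"
  proof (cases "t \<le> 0")
   case True
   then have 1: "E (V t) \<le> \<rho>" using V_init t by simp
   have 2: "\<rho> \<le> \<rho> * K" using \<rho> K1 by (simp add: distrib_left)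
   have "0 \<le> - ?d * t" using d True by (simp add: mult_nonneg_nonpos)
   then have "\<rho> * K * 1 \<le> \<rho> * K * exp (- ?d * t)" using \<rho> K1 by (intro mult_left_mono) auto
   then show ?thesis using 1 2 by simp
  next
   case False
   have "\<rho> * K1 \<le> \<rho> * K" using \<rho> K1 by (simp add: distrib_left)
   then have 1: "\<rho> * K1 * exp (- ?d * t) \<le> \<rho> * K * exp (- ?d * t)" by (rule mult_right_mono) simp
   have "0 \<le> ?d * t" using d False by simp
   then have "\<rho> * K * exp (- ?d * t) \<le> \<rho> * K * 1" using \<rho> K1 by (intro mult_left_mono) auto
   then show ?thesis using decay[of t] 1 False by simp
  qed
  then show "E (V t) \<le> \<rho> * K * exp (- ?d * t)" "E (V t) \<le> \<rho> * K" by auto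
 qed
 have src: "?F (V s) (V (s - \<tau>)) = source_term G1 G2 (V s) (V (s - \<tau>))" if s: "0 \<le> s" for s
 proof -
  have s': "- \<tau> \<le> s" "- \<tau> \<le> s - \<tau>" using s tau by auto
  show ?thesis using bounds(2)[OF s'(1)] bounds(2)[OF s'(2)] small
   by (intro source_cut_eq r VX s') auto
 qed
 have "D.mild_solution (\<lambda>s. delay_op B (V (s - \<tau>))) (\<lambda>s. source_term G1 G2 (V s) (V (s - \<tau>))) V"
  unfolding D.mild_solution_def
 proof (intro allI impI)
  fix t :: real assume t: "0 \<le> t"
  have VXt: "V t - S t (V 0) \<in> X" using t tau by (intro H.X_diff H.S_X VX) auto
  have m: "has_bochner_integral_in X E (lebesgue_on {0..t})
   (\<lambda>s. S (t - s) (\<alpha> s *\<^sub>R delay_op B (V (s - \<tau>)) + ?F (V s) (V (s - \<tau>)))) (V t - S t (V 0))"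
   using uD t unfolding D.mild_solution_def by blast
  show "has_bochner_integral_in X E (lebesgue_on {0..t})
   (\<lambda>s. S (t - s) (\<alpha> s *\<^sub>R delay_op B (V (s - \<tau>)) + source_term G1 G2 (V s) (V (s - \<tau>)))) (V t - S t (V 0))"
  proof (rule H.bochner_cong[OF m _ VXt])
   show "AE s in lebesgue_on {0..t}.
    S (t - s) (\<alpha> s *\<^sub>R delay_op B (V (s - \<tau>)) + source_term G1 G2 (V s) (V (s - \<tau>))) \<in> X \<and>
    E (S (t - s) (\<alpha> s *\<^sub>R delay_op B (V (s - \<tau>)) + ?F (V s) (V (s - \<tau>))) -
      S (t - s) (\<alpha> s *\<^sub>R delay_op B (V (s - \<tau>)) + source_term G1 G2 (V s) (V (s - \<tau>)))) = 0"
    using AE_space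
   proof (rule eventually_mono)
    fix s assume "s \<in> space (lebesgue_on {0..t})"
    then have s: "0 \<le> s" "0 \<le> t - s" by (auto simp: space_restrict_space)
    have "S (t - s) (\<alpha> s *\<^sub>R delay_op B (V (s - \<tau>)) + source_term G1 G2 (V s) (V (s - \<tau>))) \<in> X"
     by (intro H.S_X s H.X_add H.X_scaleR delay_op_X source_X)
    then show "S (t - s) (\<alpha> s *\<^sub>R delay_op B (V (s - \<tau>)) + source_term G1 G2 (V s) (V (s - \<tau>))) \<in> X \<and>
     E (S (t - s) (\<alpha> s *\<^sub>R delay_op B (V (s - \<tau>)) + ?F (V s) (V (s - \<tau>))) -
       S (t - s) (\<alpha> s *\<^sub>R delay_op B (V (s - \<tau>)) + source_term G1 G2 (V s) (V (s - \<tau>)))) = 0"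
     unfolding src[OF s(1)] by (simp add: H.p_zero)
   qed
  qed (simp add: H.p_zero)
 qed
 then have "is_global_solution DR R k S \<tau> \<alpha> B G1 G2 f0 g0 u"
  unfolding is_global_solution_iff V_def[symmetric] using uD by blast
 moreover have "\<forall>t\<ge>-\<tau>. E (V t) \<le> \<rho> * K * exp (- ?d * t) \<and> E (V t) \<le> r * c"
  using bounds small by (meson order_trans)
 ultimately show ?thesis unfolding V_def by blast
qed

end

text \<open>
The growth condition and the energy involve \<open>\<alpha> (s + \<tau>)\<close>, the bound \<open>\<sigma>\<close> concerns \<open>\<alpha>\<close> itself.
\<close>

lemma absolutely_integrable_shift_nonneg:
 fixes f :: "real \<Rightarrow> real"
 assumes f: "f absolutely_integrable_on {a + d..b + d}" and f0: "\<And>s. 0 \<le> f s"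
 shows "(\<lambda>s. f (s + d)) absolutely_integrable_on {a..b}"
  "(LINT s:{a..b}|lebesgue. f (s + d)) = (LINT s:{a + d..b + d}|lebesgue. f s)"
proof -
 have "(f has_integral integral {a + d..b + d} f) {a + d..b + d}"
  using f by (simp add: absolutely_integrable_on_def integrable_integral)
 from has_integral_shift_real_ivl[OF this, of d]
 have sh: "((\<lambda>s. f (s + d)) has_integral integral {a + d..b + d} f) {a..b}" by simp
 show ai: "(\<lambda>s. f (s + d)) absolutely_integrable_on {a..b}"
  using sh f0 by (intro nonnegative_absolutely_integrable_1) (auto simp: integrable_on_def)
 show "(LINT s:{a..b}|lebesgue. f (s + d)) = (LINT s:{a + d..b + d}|lebesgue. f s)"
  unfolding set_lebesgue_integral_eq_integral(2)[OF ai] set_lebesgue_integral_eq_integral(2)[OF f]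
  by (rule integral_unique[OF sh])
qed

context delayed_wave
begin

text \<open>
Every term of the energy is at most a constant times the largest square of the norm of the state on
\<open>[t - \<tau>, t]\<close>; squaring doubles the rate. For \<open>\<psi>1\<close> this is \<open>gradient_bound_on_segment\<close>, since
\<open>\<parallel>G1 w\<parallel> \<le> L r * \<parallel>R w\<parallel>\<close> on the ball.
\<close>

lemma wave_energy_decay:
 assumes r: "0 < r" and psi: "gradient_on DR \<psi>1 D\<psi>1 G1" and psi_0: "\<psi>1 0 = 0"
  and u: "is_global_solution DR R k S \<tau> \<alpha> B G1 G2 f0 g0 u"
  and d: "0 \<le> d" and Q: "0 \<le> Q"
  and bound: "\<And>t. -\<tau> \<le> t \<Longrightarrow> E (state_of f0 g0 u t) \<le> Q * exp (- d * t) \<and> E (state_of f0 g0 u t) \<le> r * c"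
  and alpha_shift: "\<And>t. 0 \<le> t \<Longrightarrow> set_integrable lebesgue {t-\<tau>..t} (\<lambda>s. \<bar>\<alpha> (s + \<tau>)\<bar>)"
  and alpha_sigma: "\<And>t. 0 \<le> t \<Longrightarrow> (LINT s:{t-\<tau>..t}|lebesgue. \<bar>\<alpha> (s + \<tau>)\<bar>) \<le> \<sigma>"
 shows "\<exists>C. \<forall>t\<ge>0. wave_energy R k \<tau> \<alpha> B \<psi>1 G2 g0 u t \<le> C * exp (- (2 * d) * t)"
proof -
 define V where "V = state_of f0 g0 u"
 note uD = u[unfolded is_global_solution_iff, folded V_def]
 have VX: "V s \<in> X" if "- \<tau> \<le> s" for s using H.cont_inD(1)[of "{-\<tau>..}" V s] uD that by simp
 have comp: "fst (V t) = u t" "fst (snd (V t)) = velocity g0 u t" for t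
  using uD unfolding V_def by (intro state_of_components; blast)+
 obtain c1 where c1: "0 < c1" "\<forall>u\<in>DR. norm u \<le> c1 * norm (R u)" using R_bounded_below by blast
 have Lr: "0 < L r" by (rule L_pos[OF r])
 define \<beta> where "\<beta> = onorm (adjoint B)"
 define W where "W = Q\<^sup>2 * exp (2 * d * \<tau>)"
 define N where "N t = W * exp (- (2 * d) * t)" for t
 have N0: "0 \<le> N t" for t by (simp add: N_def W_def)
 \<comment> \<open>the delay costs the factor \<open>exp (2 * d * \<tau>)\<close>\<close>
 have E_le: "(E (V s))\<^sup>2 \<le> N t" if s: "s \<in> {t - \<tau>..t}" and t: "0 \<le> t" for s t
 proof -
  have s': "- \<tau> \<le> s" using s t by simp
  have "(E (V s))\<^sup>2 \<le> (Q * exp (- d * s))\<^sup>2"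
   using bound[OF s'] H.p_nonneg[OF VX[OF s']] unfolding V_def by (intro power_mono) auto
  also have "\<dots> = Q\<^sup>2 * exp (- (2 * d * s))" by (simp add: power_mult_distrib flip: exp_double)
  also have "\<dots> \<le> Q\<^sup>2 * exp (2 * d * \<tau> + - (2 * d) * t)"
  proof (intro mult_left_mono)
   have "2 * d * (t - \<tau>) \<le> 2 * d * s" using s d by (intro mult_left_mono) auto
   then show "exp (- (2 * d * s)) \<le> exp (2 * d * \<tau> + - (2 * d) * t)" by (simp add: right_diff_distrib)
  qed simp
  also have "\<dots> = N t" unfolding N_def W_def by (simp only: exp_add mult.assoc)
  finally show ?thesis .
 qed
 have pos_le: "(norm (R (u s)))\<^sup>2 \<le> N t / c\<^sup>2" and vel_le: "(norm (velocity g0 u s))\<^sup>2 \<le> N t"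
  and u_DR: "u s \<in> DR" and R_le: "norm (R (u s)) \<le> r"
  if s: "s \<in> {t - \<tau>..t}" and t: "0 \<le> t" for s t
 proof -
  have s': "- \<tau> \<le> s" using s t by simp
  note b = state_bounds[OF VX[OF s'], unfolded comp]
  show "u s \<in> DR" by (rule b(1))
  have "(norm (R (u s)))\<^sup>2 \<le> (E (V s) / c)\<^sup>2" using b(2) by (intro power_mono) auto
  also have "\<dots> \<le> N t / c\<^sup>2" unfolding power_divide using E_le[OF s t] by (intro divide_right_mono) auto
  finally show "(norm (R (u s)))\<^sup>2 \<le> N t / c\<^sup>2" .
  have "(norm (velocity g0 u s))\<^sup>2 \<le> (E (V s))\<^sup>2" using b(3) by (intro power_mono) auto
  then show "(norm (velocity g0 u s))\<^sup>2 \<le> N t" using E_le[OF s t] by linarith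
  have "E (V s) / c \<le> r" using bound[OF s'] c_pos unfolding V_def by (simp add: pos_divide_le_eq)
  then show "norm (R (u s)) \<le> r" using b(2) by linarith
 qed
 have G_le: "norm (g w) \<le> L r * norm (R w)"
  if w: "w \<in> DR" "norm (R w) \<le> r" and g: "g 0 = 0"
   "norm (g w - g 0) \<le> L r * norm (R (w - 0))" for g :: "'a \<Rightarrow> 'a" and w
  using g by simp
 have G1_le: "norm (G1 w) \<le> L r * norm (R w)" and G2_le: "norm (G2 w) \<le> L r * norm (R w)"
  if w: "w \<in> DR" "norm (R w) \<le> r" for w
  using r R_zero by (intro G_le[OF w] G1_0 G2_0 G1_lipschitz G2_lipschitz w DR_zero; simp)+
 define C where "C = 1/2 + 1/2 + L r * c1 / c\<^sup>2 + 1/2 * ((L r)\<^sup>2 / c\<^sup>2 * \<tau>) + 1/2 * (\<beta>\<^sup>2 * \<sigma>) + 1/2"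
 have "wave_energy R k \<tau> \<alpha> B \<psi>1 G2 g0 u t \<le> C * N t" if t: "0 \<le> t" for t
 proof -
  have tt: "t \<in> {t - \<tau>..t}" using tau by simp
  have 1: "(norm (velocity g0 u t))\<^sup>2 \<le> N t" by (rule vel_le[OF tt t])
  have 2: "(1 - kernel_mass k) * (norm (R (u t)))\<^sup>2 \<le> N t"
  proof -
   have "c\<^sup>2 * (norm (R (u t)))\<^sup>2 \<le> c\<^sup>2 * (N t / c\<^sup>2)" by (intro mult_left_mono pos_le[OF tt t]) simp
   then show ?thesis using c_pos k_mass by (simp add: c_def)
  qed
  have 3: "- \<psi>1 (u t) \<le> L r * c1 / c\<^sup>2 * N t"
  proof -
   note ut = u_DR[OF tt t] and Rt = R_le[OF tt t]
   have "\<bar>\<psi>1 (u t)\<bar> \<le> (L r * norm (R (u t))) * norm (u t)"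
   proof (rule gradient_bound_on_segment[where G=G1, OF psi DR_subspace ut psi_0])
    fix \<theta> :: real assume \<theta>: "0 \<le> \<theta>" "\<theta> \<le> 1"
    have \<theta>u: "\<theta> *\<^sub>R u t \<in> DR" by (rule subspace_scale[OF DR_subspace ut])
    have le: "norm (R (\<theta> *\<^sub>R u t)) \<le> norm (R (u t))"
     unfolding R_scaleR[OF ut] using \<theta> by (simp add: mult_left_le_one_le)
    have "norm (G1 (\<theta> *\<^sub>R u t)) \<le> L r * norm (R (\<theta> *\<^sub>R u t))" using le Rt by (intro G1_le \<theta>u) linarith
    also have "\<dots> \<le> L r * norm (R (u t))" using le Lr by (intro mult_left_mono) auto
    finally show "norm (G1 (\<theta> *\<^sub>R u t)) \<le> L r * norm (R (u t))" .
   qed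
   also have "\<dots> \<le> (L r * norm (R (u t))) * (c1 * norm (R (u t)))"
    using Lr bspec[OF c1(2) ut] by (intro mult_left_mono) auto
   also have "\<dots> = L r * c1 * (norm (R (u t)))\<^sup>2" by (simp add: power2_eq_square)
   also have "\<dots> \<le> L r * c1 * (N t / c\<^sup>2)" using Lr c1 by (intro mult_left_mono pos_le[OF tt t]) auto
   finally show ?thesis by simp
  qed
  have 4: "(LINT s:{t-\<tau>..t}|lebesgue. (norm (G2 (u s)))\<^sup>2) \<le> (L r)\<^sup>2 / c\<^sup>2 * \<tau> * N t"
  proof -
   have one: "(\<lambda>s. 1::real) absolutely_integrable_on {t-\<tau>..t}"
    by (rule absolutely_integrable_continuous_real) (rule continuous_on_const)
   have "(LINT s:{t-\<tau>..t}|lebesgue. (norm (G2 (u s)))\<^sup>2)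
     \<le> ((L r)\<^sup>2 * (N t / c\<^sup>2)) * (LINT s:{t-\<tau>..t}|lebesgue. 1)"
   proof (rule set_integral_le_mult)
    show "set_integrable lebesgue {t-\<tau>..t} (\<lambda>s. 1::real)" by (rule one)
    fix s assume s: "s \<in> {t - \<tau>..t}"
    have "(norm (G2 (u s)))\<^sup>2 \<le> (L r * norm (R (u s)))\<^sup>2"
     by (intro power_mono G2_le u_DR[OF s t] R_le[OF s t]) simp
    also have "\<dots> = (L r)\<^sup>2 * (norm (R (u s)))\<^sup>2" by (rule power_mult_distrib)
    also have "\<dots> \<le> (L r)\<^sup>2 * (N t / c\<^sup>2)" by (intro mult_left_mono pos_le[OF s t]) simp
    finally show "(norm (G2 (u s)))\<^sup>2 \<le> ((L r)\<^sup>2 * (N t / c\<^sup>2)) * 1" by simp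
   qed (use N0 in auto)
   also have "(LINT s:{t-\<tau>..t}|lebesgue. (1::real)) = \<tau>"
    using tau set_lebesgue_integral_eq_integral(2)[OF one] by simp
   finally show ?thesis by (simp add: ac_simps)
  qed
  have 5: "(LINT s:{t-\<tau>..t}|lebesgue. \<bar>\<alpha> (s + \<tau>)\<bar> * (norm (adjoint B (velocity g0 u s)))\<^sup>2) \<le> \<beta>\<^sup>2 * \<sigma> * N t"
  proof -
   have "(LINT s:{t-\<tau>..t}|lebesgue. \<bar>\<alpha> (s + \<tau>)\<bar> * (norm (adjoint B (velocity g0 u s)))\<^sup>2)
     \<le> (\<beta>\<^sup>2 * N t) * (LINT s:{t-\<tau>..t}|lebesgue. \<bar>\<alpha> (s + \<tau>)\<bar>)"
   proof (rule set_integral_le_mult[OF alpha_shift[OF t]])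
    fix s assume s: "s \<in> {t - \<tau>..t}"
    have "(norm (adjoint B (velocity g0 u s)))\<^sup>2 \<le> (\<beta> * norm (velocity g0 u s))\<^sup>2"
     unfolding \<beta>_def by (intro power_mono onorm hilbert_adjoint(2) B) simp
    also have "\<dots> = \<beta>\<^sup>2 * (norm (velocity g0 u s))\<^sup>2" by (rule power_mult_distrib)
    also have "\<dots> \<le> \<beta>\<^sup>2 * N t" by (intro mult_left_mono vel_le[OF s t]) simp
    finally show "\<bar>\<alpha> (s + \<tau>)\<bar> * (norm (adjoint B (velocity g0 u s)))\<^sup>2 \<le> (\<beta>\<^sup>2 * N t) * \<bar>\<alpha> (s + \<tau>)\<bar>"
     by (simp add: mult_left_mono mult.commute[of "\<beta>\<^sup>2 * N t"])
   qed (use N0 in auto)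
   also have "\<dots> \<le> (\<beta>\<^sup>2 * N t) * \<sigma>" using N0 by (intro mult_left_mono alpha_sigma t) auto
   finally show ?thesis by (simp only: ac_simps)
  qed
  have 6: "(LINT s:{0<..}|lebesgue. k s * (norm (R (history u t s)))\<^sup>2) \<le> N t"
  proof -
   obtain x y z where V: "V t = (x, y, z)" by (rule prod_cases3)
   have Xt: "(x, y, z) \<in> X" using VX[of t] t tau by (simp add: V)
   then have z: "z \<in> W.L2" by (simp add: energy_space_iff)
   have hz: "history u t s = z s" if "0 < s" for s
   proof (cases "t = 0")
    case True
    then show ?thesis using V uD that by (auto simp: V_def state_of_def initial_state_def history_def)
   next
    case False
    then show ?thesis using V t by (auto simp: V_def state_of_def)
   qed
   have "(LINT s:{0<..}|lebesgue. k s * (norm (R (history u t s)))\<^sup>2) = (LINT s:{0<..}|lebesgue. k s * (sqrt_norm R (z s))\<^sup>2)"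
    by (rule set_lebesgue_integral_cong) (auto simp: hz sqrt_norm_def)
   also have "\<dots> = (W.L2_norm z)\<^sup>2"
    unfolding W.L2_norm_square[OF z] by (simp add: set_lebesgue_integral_def integral_restrict_space)
   also have "\<dots> \<le> (E (V t))\<^sup>2"
    using component_bounds(3)[OF Xt] W.L2_norm_nonneg[OF z] unfolding V by (intro power_mono)
   also have "\<dots> \<le> N t" by (rule E_le[OF tt t])
   finally show ?thesis .
  qed
  have "wave_energy R k \<tau> \<alpha> B \<psi>1 G2 g0 u t \<le> 1/2 * N t + 1/2 * N t + L r * c1 / c\<^sup>2 * N t
    + 1/2 * ((L r)\<^sup>2 / c\<^sup>2 * \<tau> * N t) + 1/2 * (\<beta>\<^sup>2 * \<sigma> * N t) + 1/2 * N t"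
   unfolding wave_energy_def using 1 2 3 4 5 6 by argo
  also have "\<dots> = C * N t" unfolding C_def by (simp only: distrib_right mult.assoc)
  finally show ?thesis .
 qed
 then have "\<forall>t\<ge>0. wave_energy R k \<tau> \<alpha> B \<psi>1 G2 g0 u t \<le> (C * W) * exp (- (2 * d) * t)"
  unfolding N_def by (simp only: mult.assoc) blast
 then show ?thesis by blast
qed

end

theorem theorem3p7:
 fixes A R B :: "'h::{real_inner, banach} \<Rightarrow> 'h"
  and DA DR :: "'h set"
  and k k' \<alpha> L h1 :: "real \<Rightarrow> real"
  and \<tau> \<sigma> \<zeta> M \<omega> \<omega>' \<gamma> :: real
  and \<psi>1 \<psi>2 :: "'h \<Rightarrow> real"
  and D\<psi>1 D\<psi>2 :: "'h \<Rightarrow> 'h \<Rightarrow> real"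
  and G1 G2 :: "'h \<Rightarrow> 'h"
  and S :: "real \<Rightarrow> 'h state \<Rightarrow> 'h state"
 assumes A: "positive_self_adjoint_on DA A"
  and sqrt_A: "is_sqrt_op DA A DR R"
  and B: "bounded_linear B"
  and tau: "\<tau> > 0"
  and alpha_neg: "\<And>s. s < 0 \<Longrightarrow> \<alpha> s = 0"
  and alpha_L1: "\<And>T. T \<ge> 0 \<Longrightarrow> set_integrable lebesgue {0..T} \<alpha>"
  and sigma: "\<sigma> > 0"
  and alpha_sigma: "\<And>t. t \<ge> 0 \<Longrightarrow> (LINT s:{t-\<tau>..t}|lebesgue. \<bar>\<alpha> s\<bar>) \<le> \<sigma>"
  and k_nonneg: "\<And>t. t \<ge> 0 \<Longrightarrow> k t \<ge> 0"
  and k_deriv: "\<And>t. t \<ge> 0 \<Longrightarrow> (k has_real_derivative k' t) (at t within {0..})"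
  and k_C1: "continuous_on {0..} k'"
  and k_L1: "set_integrable lebesgue {0<..} k"
  and k_0: "k 0 > 0"
  and k_mass: "kernel_mass k < 1"
  and zeta: "\<zeta> > 0"
  and k_decay: "\<And>t. t \<ge> 0 \<Longrightarrow> k' t \<le> - \<zeta> * k t"
  and psi1: "gradient_on DR \<psi>1 D\<psi>1 G1"
  and psi2: "gradient_on DR \<psi>2 D\<psi>2 G2"
  and L_pos: "\<And>r. r > 0 \<Longrightarrow> L r > 0"
  and L_lim: "(L \<longlongrightarrow> 0) (at_right 0)"
  and G1_lipschitz: "\<And>r u v. \<lbrakk>r > 0; u \<in> DR; v \<in> DR; norm (R u) \<le> r; norm (R v) \<le> r\<rbrakk>
    \<Longrightarrow> norm (G1 u - G1 v) \<le> L r * norm (R (u - v))"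
  and G2_lipschitz: "\<And>r u v. \<lbrakk>r > 0; u \<in> DR; v \<in> DR; norm (R u) \<le> r; norm (R v) \<le> r\<rbrakk>
    \<Longrightarrow> norm (G2 u - G2 v) \<le> L r * norm (R (u - v))"
  and psi_0: "\<psi>1 0 = 0" "\<psi>2 0 = 0"
  and G_0: "G1 0 = 0" "G2 0 = 0"
  and h1: "strict_mono_on {0..} h1" "continuous_on {0..} h1"
  and G1_h1: "\<And>u. u \<in> DR \<Longrightarrow> \<bar>G1 u \<bullet> u\<bar> \<le> h1 (norm (R u)) * (norm (R u))\<^sup>2"
  and S_gen: "generates_in (energy_space DR R k) (energy_norm R k)
    (wave_memory_op DA A DR R k) S"
  and M: "M > 0"
  and omega: "\<omega> > 0"
  and S_stable: "\<And>t U. \<lbrakk>t \<ge> 0; U \<in> energy_space DR R k\<rbrakk>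
    \<Longrightarrow> energy_norm R k (S t U) \<le> M * exp (- \<omega> * t) * energy_norm R k U"
  and gamma: "\<gamma> \<ge> 0"
  and omega': "0 \<le> \<omega>'" "\<omega>' < \<omega>"
  and alpha_growth: "\<And>t. t > 0 \<Longrightarrow>
    M * onorm (B \<circ> adjoint B) * exp (\<omega> * \<tau>) * (LINT s:{0..t}|lebesgue. \<bar>\<alpha> (s + \<tau>)\<bar>)
     \<le> \<gamma> + \<omega>' * t"
 shows "\<exists>\<rho>>0. \<forall>f0 g0.
   continuous_on_in (energy_space DR R k) (energy_norm R k) {-\<tau>..0} (initial_state f0 g0) \<longrightarrow>
   (norm (g0 0))\<^sup>2 + (1 - kernel_mass k) * (norm (R (f0 0)))\<^sup>2
    + (LINT s:{-\<tau>..0}|lebesgue. (norm (G2 (f0 s)))\<^sup>2)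
    + (LINT s:{0<..}|lebesgue. k s * (norm (R (history f0 0 s)))\<^sup>2)
    + (LINT s:{-\<tau>..0}|lebesgue. \<bar>\<alpha> (s + \<tau>)\<bar> * (norm (adjoint B (g0 s)))\<^sup>2) < \<rho>\<^sup>2 \<longrightarrow>
   (SUP s\<in>{-\<tau>..0}. energy_norm R k (initial_state f0 g0 s)) < \<rho> \<longrightarrow>
   (\<exists>u. is_global_solution DR R k S \<tau> \<alpha> B G1 G2 f0 g0 u \<and>
     (\<forall>u'. is_global_solution DR R k S \<tau> \<alpha> B G1 G2 f0 g0 u' \<longrightarrow> u' = u) \<and>
     (\<exists>C. \<forall>t\<ge>0. wave_energy R k \<tau> \<alpha> B \<psi>1 G2 g0 u t \<le> C * exp (- (\<omega> - \<omega>') * t)))"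
proof -
 interpret wave_memory A R DA DR k S M \<omega>
 proof unfold_locales
  show "continuous_on {0..} k" by (rule DERIV_continuous_on) (use k_deriv in auto)
  show "k t \<le> k s" if "0 \<le> s" "s \<le> t" for s t
  proof (rule kernel_antimono[OF k_deriv _ that])
   show "k' t \<le> 0" if "0 \<le> t" for t
    using k_decay[OF that] mult_nonneg_nonneg[of \<zeta> "k t"] k_nonneg[OF that] zeta by linarith
  qed
 qed (use sqrt_A k_nonneg k_L1 k_mass S_gen M omega S_stable in auto)
 have alpha_int: "\<alpha> absolutely_integrable_on {0..T}" for T
 proof (cases "0 \<le> T")
  case False
  then show ?thesis by (simp add: set_integrable_def)
 qed (rule alpha_L1)
 interpret delayed_wave A R DA DR k S M \<omega> B \<tau> \<alpha> L G1 G2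
  by (rule delayed_wave.intro[OF wave_memory_axioms], rule delayed_wave_axioms.intro) (fact B tau alpha_int L_pos G1_lipschitz G2_lipschitz G_0)+
 have abs_int: "(\<lambda>s. \<bar>\<alpha> s\<bar>) absolutely_integrable_on {s..t}" if "0 \<le> s" for s t
  by (rule set_integrable_subset[OF set_integrable_abs[OF alpha_int[of t]]]) (use that in auto)
 have shift_int: "(\<lambda>s. \<bar>\<alpha> (s + \<tau>)\<bar>) absolutely_integrable_on {s..t}" if "0 \<le> s + \<tau>" for s t
  by (rule absolutely_integrable_shift_nonneg(1)[OF abs_int[OF that]]) simp
 have shift_sigma: "(LINT s:{t-\<tau>..t}|lebesgue. \<bar>\<alpha> (s + \<tau>)\<bar>) \<le> \<sigma>" if "0 \<le> t" for t
 proof -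
  have "0 \<le> t - \<tau> + \<tau>" using that by simp
  from absolutely_integrable_shift_nonneg(2)[OF abs_int[OF this, of "t + \<tau>"]]
  show ?thesis using alpha_sigma[of "t + \<tau>"] that tau by simp
 qed
 have alpha_tau: "integral {0..\<tau>} (\<lambda>s. \<bar>\<alpha> s\<bar>) \<le> \<sigma>"
  using alpha_sigma[of \<tau>] tau set_lebesgue_integral_eq_integral(2)[OF abs_int[of 0 \<tau>]] by simp
 have growth: "M * b * exp (\<omega> * \<tau>) * integral {0..t} (\<lambda>s. \<bar>\<alpha> (s + \<tau>)\<bar>) \<le> \<gamma> + \<omega>' * t" if "0 < t" for t
  using alpha_growth[OF that] set_lebesgue_integral_eq_integral(2)[OF shift_int[of 0 t]] tau by (simp add: b_def)
 define D where "D = M * (exp (\<omega> * \<tau>) + 1)"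
 have D: "0 < D" using M by (simp add: D_def add_pos_pos)
 \<comment> \<open>half of the gap is left to the nonlinearity, whose cost per unit of \<open>L r / c\<close> is \<open>D\<close>\<close>
 define d where "d = (\<omega> - \<omega>') / 2"
 have d: "0 < d" using omega' by (simp add: d_def)
 have "0 < d * c / D" using d c_pos D by simp
 then have "eventually (\<lambda>r. L r < d * c / D) (at_right 0)" by (rule order_tendstoD(2)[OF L_lim])
 then have "eventually (\<lambda>r. L r < d * c / D \<and> 0 < r) (at_right 0)"
  by (rule eventually_conj) (simp add: eventually_at_right_less)
 then obtain r where r: "L r < d * c / D" "0 < r"
  using eventually_happens'[OF trivial_limit_at_right_real] by blast
 have rate: "M * (exp (\<omega> * \<tau>) + 1) * (L r / c) \<le> (\<omega> - \<omega>') / 2"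
 proof -
  have "L r / c \<le> d / D" using r(1) c_pos D by (simp add: field_simps)
  then have "D * (L r / c) \<le> D * (d / D)" using D by (intro mult_left_mono) auto
  then show ?thesis using D unfolding D_def[symmetric] d_def[symmetric] by simp
 qed
 define K where "K = 1 + (M + M * exp (\<omega> * \<tau>) * (b * \<sigma> + L r / c * \<tau>)) * exp \<gamma>"
 have K: "1 \<le> K" unfolding K_def using M b_nonneg sigma L_pos[OF r(2)] c_pos tau
  by (auto intro!: mult_nonneg_nonneg add_nonneg_nonneg)
 \<comment> \<open>initial states of norm below \<open>\<rho>\<close> stay in the ball of radius \<open>r * c\<close>, as \<open>K\<close> bounds the amplification\<close>
 define \<rho> where "\<rho> = r * c / K"
 have \<rho>: "0 < \<rho>" "\<rho> * K = r * c" using r c_pos K by (auto simp: \<rho>_def)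
 show ?thesis
 proof (intro exI[of _ \<rho>] conjI allI impI \<rho>(1))
  fix f0 g0 :: "real \<Rightarrow> 'h"
  assume init: "continuous_on_in X E {-\<tau>..0} (initial_state f0 g0)"
   and small: "(SUP s\<in>{-\<tau>..0}. E (initial_state f0 g0 s)) < \<rho>"
  have init_le: "E (initial_state f0 g0 s) \<le> \<rho>" if s: "s \<in> {-\<tau>..0}" for s
  proof -
   obtain P where "\<forall>s\<in>{-\<tau>..0}. E (initial_state f0 g0 s) \<le> P" using H.cont_in_bounded[OF init] by blast
   then have "bdd_above ((\<lambda>s. E (initial_state f0 g0 s)) ` {-\<tau>..0})" by (intro bdd_aboveI2[where M=P]) auto
   from cSUP_upper[OF s this] show ?thesis using small by linarith
  qed
  obtain u where u: "is_global_solution DR R k S \<tau> \<alpha> B G1 G2 f0 g0 u"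
   and le: "\<forall>t\<ge>-\<tau>. E (state_of f0 g0 u t) \<le> \<rho> * K * exp (- ((\<omega> - \<omega>') / 2) * t) \<and> E (state_of f0 g0 u t) \<le> r * c"
   using small_solution[OF r(2) rate alpha_tau growth gamma omega'(2) less_imp_le[OF \<rho>(1)] K_def
     eq_refl[OF \<rho>(2)] init init_le] by blast
  have "\<exists>C. \<forall>t\<ge>0. wave_energy R k \<tau> \<alpha> B \<psi>1 G2 g0 u t \<le> C * exp (- (2 * d) * t)"
  proof (rule wave_energy_decay[OF r(2) psi1 psi_0(1) u less_imp_le[OF d], of "\<rho> * K" \<sigma>])
   show "0 \<le> \<rho> * K" using \<rho>(1) K by (intro mult_nonneg_nonneg) auto
   show "E (state_of f0 g0 u t) \<le> \<rho> * K * exp (- d * t) \<and> E (state_of f0 g0 u t) \<le> r * c" if "- \<tau> \<le> t" for t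
    using le that unfolding d_def by blast
  qed (use shift_int shift_sigma in auto)
  moreover have "2 * d = \<omega> - \<omega>'" by (simp add: d_def)
  ultimately have "\<exists>C. \<forall>t\<ge>0. wave_energy R k \<tau> \<alpha> B \<psi>1 G2 g0 u t \<le> C * exp (- (\<omega> - \<omega>') * t)" by simp
  then show "\<exists>u. is_global_solution DR R k S \<tau> \<alpha> B G1 G2 f0 g0 u \<and>
    (\<forall>u'. is_global_solution DR R k S \<tau> \<alpha> B G1 G2 f0 g0 u' \<longrightarrow> u' = u) \<and>
    (\<exists>C. \<forall>t\<ge>0. wave_energy R k \<tau> \<alpha> B \<psi>1 G2 g0 u t \<le> C * exp (- (\<omega> - \<omega>') * t))"
   using u global_solution_unique by blast
 qed
qed

end
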